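(* Let $L,\ell>0$ and let $f\colon \mathbb{T}\to\mathbb{C}$ be an $(L,\ell)$-bi-Lipschitz embedding. Then $f$ can be extended to an $(L',\ell')$-bi-Lipschitz automorphism $F\colon\mathbb{C}\to\mathbb{C}$ (that is, $F|_{\mathbb{T}}=f$) with $L'=10^{28}L$ and $\ell'=10^{-25}\ell^2/L$.
   Context: $\mathbb{T}=\{z\in\mathbb{C}:|z|=1\}$ is the unit circle. For a subset $X\subset\mathbb{C}$ and constants $L,\ell>0$, a map $f\colon X\to\mathbb{C}$ is an $(L,\ell)$-bi-Lipschitz embedding if $\ell|a-b|\le|f(a)-f(b)|\le L|a-b|$ for all $a,b\in X$. An $(L',\ell')$-bi-Lipschitz automorphism of $\mathbb{C}$ is a bijection $F\colon\mathbb{C}\to\mathbb{C}$ that is $(L',\ell')$-bi-Lipschitz. *)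

theory Defs
  imports "HOL-Analysis.Analysis"
begin

text \<open>A map on a subset \<open>X\<close> of the plane is represented by a total function of which only
  the values on \<open>X\<close> matter. The first constant is the upper one, the second the lower one.\<close>

definition bilipschitz_embedding ::
    "real \<Rightarrow> real \<Rightarrow> complex set \<Rightarrow> (complex \<Rightarrow> complex) \<Rightarrow> bool" where
  "bilipschitz_embedding L l X f \<longleftrightarrow>
     L > 0 \<and> l > 0 \<and>
     (\<forall>a\<in>X. \<forall>b\<in>X. l * norm (a - b) \<le> norm (f a - f b) \<and> norm (f a - f b) \<le> L * norm (a - b))"

definition bilipschitz_automorphism ::
    "real \<Rightarrow> real \<Rightarrow> (complex \<Rightarrow> complex) \<Rightarrow> bool" where
  "bilipschitz_automorphism L l F \<longleftrightarrow> bij F \<and> bilipschitz_embedding L l UNIV F"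

end

theory Submission
 imports Defs "HOL-Complex_Analysis.Complex_Analysis" "HOL-Real_Asymp.Real_Asymp"
begin

text \<open>After division by \<open>l\<close> the lower constant is 1. The Riemann map \<open>phi\<close> of the inside of the curve
 extends to a homeomorphism of the closed disc (Caratheodory), and \<open>phi (cis x) = f (cis (\<plusminus> g x))\<close> for
 an increasing \<open>g\<close> that commutes with the translation by \<open>2 \<pi>\<close>. The extension to the disc is
 \<open>phi \<circ> Psi\<inverse>\<close>, where \<open>Psi\<close> extends \<open>g\<close> explicitly: \<open>Psi (e^(i w)) = e^(i G(w))\<close>, with \<open>G(u + i v)\<close> equal to
 the mean plus \<open>i \<surd>7\<close> times the standard deviation of \<open>g\<close> on \<open>[u - v, u + v]\<close> for the density
 \<open>15/16 (1 - s^2)^2\<close>. The derivative of \<open>G\<close> is comparable to increments of \<open>g\<close> divided by \<open>v\<close>. These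
 increments and \<open>phi'\<close> are compared with the distance to the curve by harmonic measure estimates,
 obtained from products of rotated bounded holomorphic functions, and by the Schwarz lemma. The
 outside is treated in the same way after the inversion \<open>q0 + 1 / x\<close>. The resulting pointwise bounds
 are integrated along segments; for the inverse map the part of a segment between its first and last
 point on the curve is estimated directly by the lower bound for \<open>f\<close>.\<close>

section \<open>Harmonic measure and conformal charts of the disc\<close>

text \<open>Both constants must be linear in \<open>kap\<close> = L / l. The conformal estimates are
  therefore cross-ratio inequalities with absolute constants, valid for every Jordan curve; being
  invariant under inversion, they serve both sides. The ratio \<open>kap\<close> enters once in each
  direction, when distances on the curve are compared with increments of \<open>g\<close>. With d
  the distance to the curve, |Phi'| v is of order d near the curve; subwindows of \<open>g\<close>
  have increments of at least order d / \<open>kap\<close>, which yields the Lipschitz constant of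
  the extension, and the whole window has an increment of at most order \<open>kap\<close> d, which
  yields that of the inverse. Mean and standard deviation are chosen because \<open>G\<close> is
  injective for every increasing \<open>g\<close>: it fixes the integrals of 1, g and g^2 against a
  kernel, and a combination of these three functions separates any two kernels. The factor sqrt 7
  offsets the variance 1/7 of the density, so that \<open>G\<close> is the identity for g = id. The
  density vanishes to second order at the ends, which makes \<open>G\<close> differentiable for
  merely continuous \<open>g\<close>.\<close>

lemma norm_le_of_limsup_sphere:
 fixes h :: "complex => complex"
 assumes hol: "h holomorphic_on ball 0 1"
  and lim: "!!ze e. ze \<in> sphere 0 1 ==> e > 0 ==>
        eventually (%z. norm (h z) < B + e) (at ze within ball 0 1)"
 shows "norm (h 0) <= B"
proof (rule field_le_epsilon)
 fix e :: real assume e: "e > 0"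
 have "\<exists>d>0. \<forall>z\<in>ball 0 1. dist z ze < d --> norm (h z) < B + e" if z0: "ze \<in> sphere 0 1" for ze
 proof -
  obtain d where "d > 0" and d: "!!z. z \<in> ball 0 1 ==> z ~= ze ==> dist z ze < d ==> norm (h z) < B + e"
   using lim[OF z0 e] unfolding eventually_at by (auto simp: dist_commute)
  moreover have "z ~= ze" if "z \<in> ball 0 1" for z using that \<open>ze \<in> sphere 0 1\<close> by auto
  ultimately show ?thesis by metis
 qed
 then obtain d where d0: "!!ze. ze \<in> sphere 0 1 ==> d ze > 0"
  and d: "!!ze z. ze \<in> sphere 0 1 ==> z \<in> ball 0 1 ==> dist z ze < d ze ==> norm (h z) < B + e"
  by metis
 \<comment> \<open>A Lebesgue number of this cover makes the boundary bound uniform, so that it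
   holds on a whole circle of radius \<open>r\<close> < 1, where the maximum principle
   applies.\<close>
 have "sphere 0 1 \<subseteq> (\<Union>ze\<in>sphere 0 1. ball ze (d ze))" using d0 by auto
 moreover have "compact (sphere (0::complex) 1)" by simp
 ultimately obtain ep where ep: "ep > 0" 
  and leb: "!!x. x \<in> sphere 0 1 ==> \<exists>G\<in>(%ze. ball ze (d ze)) ` sphere 0 1. ball x ep \<subseteq> G"
  using Heine_Borel_lemma[of "sphere (0::complex) 1" "(%ze. ball ze (d ze)) ` sphere 0 1"] by (metis (no_types, lifting) imageE open_ball)
 define r where "r = max (1/2) (1 - ep/2)"
 have r: "0 < r" "r < 1" using ep by (auto simp: r_def)
 have bd: "norm (h z) <= B + e" if "norm z = r" for z
 proof -
  have z: "z ~= 0" "z \<in> ball 0 1" using that r by auto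
  define x where "x = z / of_real r"
  have x: "x \<in> sphere 0 1" using that r by (simp add: x_def norm_divide)
  have "dist x z = norm (z * (1 / of_real r - 1))" by (simp add: x_def dist_norm algebra_simps)
  also have "... = r * (1/r - 1)"
  proof -
   have "1 / complex_of_real r - 1 = of_real (1/r - 1)" by simp
   thus ?thesis using r that by (simp only: norm_mult norm_of_real) (simp add: field_simps)
  qed
  also have "... = 1 - r" using r by (simp add: field_simps)
  also have "... < ep" using ep by (auto simp: r_def max_def)
  finally have "z \<in> ball x ep" by simp
  with leb[OF x] obtain ze where "ze \<in> sphere 0 1" "z \<in> ball ze (d ze)" by auto
  thus ?thesis using d[of ze z] z by (auto simp: dist_commute less_imp_le)
 qed
 show "norm (h 0) <= B + e"
 proof (rule maximum_modulus_frontier[of h "cball 0 r"])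
  show "h holomorphic_on interior (cball 0 r)"
   using hol r by (auto intro: holomorphic_on_subset)
  show "continuous_on (closure (cball 0 r)) h"
   using holomorphic_on_imp_continuous_on[OF hol] r by (auto intro: continuous_on_subset)
 qed (use bd r in auto)
qed

text \<open>Substitute for the two-constants theorem of harmonic measure. The product of the
  \<open>n\<close> rotated copies of \<open>h\<close> equals \<open>h 0 ^ n\<close> at 0. Since the
  arc has length at least 2 pi / n, near each boundary point some copy is evaluated near the arc and
  is small there, while the other \<open>n - 1\<close> copies are at most \<open>M\<close>.\<close>

lemma norm_power_le_of_small_on_arc:
 fixes h :: "complex => complex"
 assumes hol: "h holomorphic_on ball 0 1" and M: "!!z. z \<in> ball 0 1 ==> norm (h z) <= M"
  and n: "n > 0" and arc: "be - al >= 2 * pi / real n" and dl: "dl >= 0"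
  and small: "!!t e. t \<in> {al..be} ==> e > 0 ==>
         eventually (%z. norm (h z) < dl + e) (at (cis t) within ball 0 1)"
 shows "norm (h 0) ^ n <= dl * M ^ (n - 1)"
proof -
 define c where "c k = cis (2 * pi * real k / real n)" for k :: nat
 define P where "P z = (\<Prod>k<n. h (c k * z))" for z
 have cn: "norm (c k) = 1" for k by (simp add: c_def)
 have cb: "c k * z \<in> ball 0 1" if "z \<in> ball 0 1" for k z using that by (simp add: norm_mult cn)
 have M0: "M >= 0" using M[of 0] by (meson centre_in_ball norm_ge_zero order_trans zero_less_one)
 have "P holomorphic_on ball 0 1" unfolding P_def
 proof (intro holomorphic_intros)
  fix k assume "k \<in> {..<n}"
  have "(h \<circ> (%z. c k * z)) holomorphic_on ball 0 1"
   by (rule holomorphic_on_compose_gen[OF _ hol]) (auto intro!: holomorphic_intros simp: norm_mult cn)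
  thus "(%z. h (c k * z)) holomorphic_on ball 0 1" by (simp add: o_def)
 qed
 moreover have "eventually (%z. norm (P z) < dl * M ^ (n - 1) + e) (at ze within ball 0 1)"
  if ze: "ze \<in> sphere 0 1" and e: "e > 0" for ze e
 proof -
  obtain t0 where t0: "ze = cis t0" 
   using ze by (metis cis_Arg complex_sgn_def mem_sphere_0 norm_zero scale_one zero_neq_one inverse_1 sgn_eq)
  \<comment> \<open>\<open>j\<close> rotations by 2 pi / n carry the angle \<open>t0\<close> into
    the arc; below, \<open>k\<close> is \<open>j\<close> reduced modulo \<open>n\<close>.\<close>
  define j where "j = \<lceil>(al - t0) * real n / (2 * pi)\<rceil>"
  define t where "t = t0 + 2 * pi * real_of_int j / real n"
  have pin: "2 * pi / real n > 0" using n by simp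
  have "(al - t0) * real n / (2 * pi) <= j" "j < (al - t0) * real n / (2 * pi) + 1"
   unfolding j_def by linarith+
  hence "(al - t0) <= j * (2 * pi / n)" "j * (2*pi/n) < (al - t0) + 2*pi/n"
   using n by (simp_all add: field_simps)
  hence t: "t \<in> {al..be}" using arc by (auto simp: t_def algebra_simps)
  define k where "k = nat (j mod int n)"
  have k: "k < n" using n by (simp add: k_def nat_less_iff)
  have kj: "real k = real_of_int j - real_of_int (j div int n) * real n"
  proof -
   have "int k = j - (j div int n) * int n" using n by (simp add: k_def minus_div_mult_eq_mod)
   thus ?thesis by (metis of_int_diff of_int_mult of_int_of_nat_eq)
  qed
  have "c k * ze = cis t"
  proof -
   have "2 * pi * real k / real n = 2 * pi * real_of_int j / real n - 2 * pi * real_of_int (j div int n)"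
    using n unfolding kj by (simp add: field_simps)
   hence "c k * ze = cis (t - 2 * pi * real_of_int (j div int n))"
    unfolding c_def t0 cis_mult t_def by (intro arg_cong[of _ _ cis]) linarith
   also have "... = cis t / cis (2 * pi * real_of_int (j div int n))" by (simp only: cis_divide)
   also have "cis (2 * pi * real_of_int (j div int n)) = 1"
    by (rule cis_multiple_2pi) auto
   finally show ?thesis by simp
  qed
  define e' where "e' = e / (M ^ (n - 1) + 1)"
  have Mp: "M ^ (n - 1) >= 0" using M0 by simp
  have e': "e' > 0" "e' * M ^ (n - 1) < e" using e Mp by (auto simp: e'_def field_simps)
  have ev: "eventually (%z. norm (h z) < dl + e') (at (cis t) within ball 0 1)"
   by (rule small[OF t e'(1)])
  have "filterlim (%z. c k * z) (at (cis t) within ball 0 1) (at ze within ball 0 1)"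
   unfolding filterlim_at
  proof (intro conjI)
   show "((%z. c k * z) \<longlongrightarrow> cis t) (at ze within ball 0 1)"
    unfolding \<open>c k * ze = cis t\<close>[symmetric] by (intro tendsto_intros)
   show "eventually (%x. c k * x \<in> ball 0 1 & c k * x ~= cis t) (at ze within ball 0 1)"
    unfolding eventually_at_filter
   proof (rule always_eventually, intro allI impI conjI)
    fix x assume "x ~= ze" "x \<in> ball 0 1"
    thus "c k * x \<in> ball 0 1" using cb by blast
    have "norm (c k * x) < 1" using cb[OF \<open>x \<in> ball 0 1\<close>] by simp
    thus "c k * x ~= cis t" by auto
   qed
  qed
  from filterlim_iff[THEN iffD1, OF this, rule_format, OF ev]
  have "eventually (%z. norm (h (c k * z)) < dl + e') (at ze within ball 0 1)" .
  moreover have "eventually (%z. z \<in> ball 0 1) (at ze within ball 0 1)"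
   by (simp add: eventually_at_filter)
  ultimately show ?thesis
  proof eventually_elim
   case (elim z)
   have "norm (P z) = norm (h (c k * z)) * (\<Prod>i\<in>{..<n}-{k}. norm (h (c i * z)))"
    unfolding P_def using k by (simp add: prod.remove[of "{..<n}" k] norm_mult prod_norm)
   also have "... <= norm (h (c k * z)) * (\<Prod>i\<in>{..<n}-{k}. M)"
    by (intro mult_left_mono prod_mono) (use M cb elim in auto)
   also have "... = norm (h (c k * z)) * M ^ (n - 1)" using k by simp
   also have "... <= (dl + e') * M ^ (n - 1)" using elim Mp by (intro mult_right_mono) auto
   also have "... < dl * M ^ (n - 1) + e" using e' by (simp add: algebra_simps)
   finally show ?case .
  qed
 qed
 ultimately have "norm (P 0) <= dl * M ^ (n - 1)" by (rule norm_le_of_limsup_sphere)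
 thus ?thesis by (simp add: P_def norm_power)
qed

section \<open>Conformal charts of Jordan domains: cross-ratio estimates at the centre\<close>

definition disc_chart :: "(complex => complex) => bool" where
 "disc_chart phi \<longleftrightarrow> continuous_on (cball 0 1) phi & phi holomorphic_on ball 0 1 & inj_on phi (cball 0 1)"

lemma disc_chart_facts:
 assumes "disc_chart phi"
 shows disc_chart_open: "open (phi ` ball 0 1)" and disc_chart_compact: "compact (phi ` cball 0 1)"
  and disc_chart_connected: "connected (phi ` ball 0 1)"
  and disc_chart_frontier: "frontier (phi ` ball 0 1) = phi ` sphere 0 1"
  and disc_chart_disjoint: "phi ` ball 0 1 \<inter> phi ` sphere 0 1 = {}"
  and disc_chart_bounded: "bounded (phi ` ball 0 1)"
  and disc_chart_closure: "closure (phi ` ball 0 1) = phi ` cball 0 1"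
proof -
 have c: "continuous_on (cball 0 1) phi" and h: "phi holomorphic_on ball 0 1" and i: "inj_on phi (cball 0 1)"
  using assms by (auto simp: disc_chart_def)
 show o: "open (phi ` ball 0 1)"
  by (rule open_mapping_thm3[OF h]) (use i inj_on_subset ball_subset_cball in blast)+
 show k: "compact (phi ` cball 0 1)" using c by (simp add: compact_continuous_image)
 show "connected (phi ` ball 0 1)"
  using c by (intro connected_continuous_image continuous_on_subset[OF c]) auto
 show d: "phi ` ball 0 1 \<inter> phi ` sphere 0 1 = {}"
 proof (rule ccontr)
  assume "phi ` ball 0 1 \<inter> phi ` sphere 0 1 ~= {}"
  then obtain x y where "x \<in> ball 0 1" "y \<in> sphere 0 1" "phi x = phi y" by auto
  thus False using inj_onD[OF i, of x y] by auto
 qed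
 show cl: "closure (phi ` ball 0 1) = phi ` cball 0 1"
 proof
  show "closure (phi ` ball 0 1) \<subseteq> phi ` cball 0 1"
   by (rule closure_minimal) (use k compact_imp_closed ball_subset_cball in blast)+
  have "phi ` closure (ball 0 1) \<subseteq> closure (phi ` ball 0 1)"
   by (rule image_closure_subset) (use c closure_subset[of "phi ` ball 0 1"] in auto)
  thus "phi ` cball 0 1 \<subseteq> closure (phi ` ball 0 1)" by simp
 qed
 have "cball (0::complex) 1 = ball 0 1 \<union> sphere 0 1" by auto
 hence "phi ` cball 0 1 = phi ` ball 0 1 \<union> phi ` sphere 0 1" by (metis image_Un)
 with d show "frontier (phi ` ball 0 1) = phi ` sphere 0 1"
  unfolding frontier_def cl interior_open[OF o] by auto
 show "bounded (phi ` ball 0 1)" using k cl by (metis bounded_closure_image compact_imp_bounded bounded_subset closure_subset)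
qed

text \<open>Let p = \<open>phi 0\<close>. In the proof \<open>R\<close> is the Moebius map with zero
  \<open>a\<close>, pole \<open>b\<close> and value 1 at p, and \<open>g\<close> is a branch of its
  square root along \<open>phi\<close>. Maximality of |x - b| / |x - p| at \<open>a\<close> means
  that \<open>R\<close> maps no point of the curve into the open unit disc around 1. That disc is
  therefore covered by the image of the domain, and over it the branch with \<open>g 0 = 1\<close>
  has positive real part, which keeps \<open>g\<close> away from -1. Thus \<open>1 / (g + 1)\<close>
  is bounded whatever the shape of the curve.\<close>

lemma disc_chart_sqrt:
 assumes ch: "disc_chart phi" and b: "b \<in> phi ` sphere 0 1"
 obtains a g where "a \<in> phi ` sphere 0 1" "a ~= b" "g holomorphic_on ball 0 1" "g 0 = 1"
  "!!s. s \<in> ball 0 1 ==> (g s)^2 = (phi s - a) * (phi 0 - b) / ((phi s - b) * (phi 0 - a))"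
  "!!s. s \<in> ball 0 1 ==> norm (g s + 1) >= 2/5"
  "!!x. x \<in> phi ` sphere 0 1 ==> norm (x - b) * norm (a - phi 0) <= norm (a - b) * norm (x - phi 0)"
proof -
 note F = disc_chart_facts[OF ch]
 have c: "continuous_on (cball 0 1) phi" and hol: "phi holomorphic_on ball 0 1" and inj: "inj_on phi (cball 0 1)"
  using ch by (auto simp: disc_chart_def)
 define G where "G = phi ` sphere 0 1"
 define p where "p = phi 0"
 have pO: "p \<in> phi ` ball 0 1" by (auto simp: p_def)
 have pG: "p \<notin> G" using F(5) pO by (auto simp: G_def)
 have cG: "compact G" unfolding G_def
  by (intro compact_continuous_image continuous_on_subset[OF c]) auto
 have "continuous_on G (%x. norm (x - b) / norm (x - p))"
  using pG by (intro continuous_intros) auto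
 from continuous_attains_sup[OF cG _ this] b obtain a where a: "a \<in> G"
  and amax: "!!x. x \<in> G ==> norm (x - b) / norm (x - p) <= norm (a - b) / norm (a - p)"
  unfolding G_def by blast
 have ap: "a ~= p" and bp: "b ~= p" using a b pG by (auto simp: G_def)
 have npos: "norm (x - p) > 0" if "x \<in> G" for x using that pG by auto
 have cross: "norm (x - b) * norm (a - p) <= norm (a - b) * norm (x - p)" if "x \<in> G" for x
  using amax[OF that] npos[OF that] npos[OF a] by (simp add: field_simps)
 \<comment> \<open>The ray from \<open>p\<close> away from \<open>b\<close> must leave the bounded
   domain, and all its points are nearer to \<open>p\<close> than to \<open>b\<close>. This gives
   |cc| < 1 below, which keeps infinity out of the preimage of the unit disc around 1.\<close>
 obtain x1 where x1: "x1 \<in> G" "norm (x1 - b) > norm (x1 - p)"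
 proof -
  have "\<not> bounded ((%t. p + of_real t * (p - b)) ` {0..})"
  proof
   assume "bounded ((%t. p + of_real t * (p - b)) ` {0..})"
   then obtain B where B: "!!t. t >= 0 ==> norm (p + of_real t * (p - b)) <= B"
    by (auto simp: bounded_iff)
   define t where "t = (\<bar>B\<bar> + norm p + 1) / norm (p - b)"
   have "t >= 0" by (auto simp: t_def)
   have "norm (of_real t * (p - b)) = \<bar>B\<bar> + norm p + 1"
    using bp \<open>t >= 0\<close> by (simp add: norm_mult) (simp add: t_def)
   moreover have "norm (of_real t * (p - b)) <= norm (p + of_real t * (p - b)) + norm p"
    by (metis add_diff_cancel_left' norm_triangle_ineq4)
   ultimately show False using B[OF \<open>t >= 0\<close>] by linarith
  qed
  hence "\<not> (%t. p + of_real t * (p - b)) ` {0..} \<subseteq> phi ` ball 0 1"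
   using F(6) bounded_subset by blast
  moreover have "connected ((%t. p + of_real t * (p - b)) ` {0..})"
   by (intro connected_continuous_image continuous_intros) auto
  moreover have "p \<in> (%t. p + of_real t * (p - b)) ` {0..}" by (auto intro!: image_eqI[of _ _ 0])
  ultimately have "(%t. p + of_real t * (p - b)) ` {0..} \<inter> G ~= {}"
   using connected_Int_frontier[of "(%t. p + of_real t * (p - b)) ` {0..}" "phi ` ball 0 1"] pO F(4)
   unfolding G_def by blast
  then obtain t where t: "t >= 0" "p + of_real t * (p - b) \<in> G" by auto
  have "norm (p + of_real t * (p - b) - b) = (1 + t) * norm (p - b)"
  proof -
   have "p + of_real t * (p - b) - b = of_real (1 + t) * (p - b)" by (simp add: algebra_simps)
   thus ?thesis using t by (simp only: norm_mult norm_of_real)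
  qed
  moreover have "norm (p + of_real t * (p - b) - p) = t * norm (p - b)" using t by (simp add: norm_mult)
  ultimately show ?thesis using that[OF t(2)] bp by (simp add: algebra_simps)
 qed
 have ab: "norm (a - p) < norm (a - b)"
 proof -
  have "1 < norm (x1 - b) / norm (x1 - p)" using x1 npos[OF x1(1)] by simp
  hence "1 < norm (a - b) / norm (a - p)" using amax[OF x1(1)] by linarith
  thus ?thesis using npos[OF a] by simp
 qed
 hence anb: "a ~= b" by auto
 define R where "R x = (x - a) * (p - b) / ((x - b) * (p - a))" for x
 define cc where "cc = (p - a) / (a - b)"
 have cc: "norm cc < 1" "cc ~= 0" using ab anb ap by (auto simp: cc_def norm_divide norm_minus_commute divide_simps)
 have R1: "R x - 1 = (x - p) / (cc * (x - b))" if "x ~= b" for x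
  using that ap anb unfolding R_def cc_def by (simp add: divide_simps) (simp add: algebra_simps)
 have RG: "norm (R x - 1) >= 1" if "x \<in> G" "x ~= b" for x
 proof -
  have "norm (R x - 1) = (norm (x - p) * norm (a - b)) / (norm (p - a) * norm (x - b))"
   using that anb by (simp add: R1 cc_def norm_divide norm_mult)
  moreover have "0 < norm (p - a) * norm (x - b)" using that ap by simp
  moreover have "norm (p - a) * norm (x - b) <= norm (x - p) * norm (a - b)"
   using cross[OF that(1)] by (simp add: norm_minus_commute mult.commute)
  ultimately show ?thesis by (simp add: le_divide_eq)
 qed
 have nb: "phi s ~= b" "phi s ~= a" if "s \<in> ball 0 1" for s
  proof -
  have "phi s \<in> phi ` ball 0 1" using that by blast
  thus "phi s ~= b" "phi s ~= a" using F(5) a b unfolding G_def by blast+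
 qed
 have holR: "(%s. R (phi s)) holomorphic_on ball 0 1"
  unfolding R_def using nb ap by (intro holomorphic_intros hol) auto
 have Rnz: "R (phi s) ~= 0" if "s \<in> ball 0 1" for s using nb[OF that] ap bp by (auto simp: R_def)
 obtain g0 where g0: "g0 holomorphic_on ball 0 1" "!!s. s \<in> ball 0 1 ==> R (phi s) = (g0 s)^2"
  using contractible_imp_holomorphic_sqrt[OF holR _ Rnz] convex_imp_contractible[OF convex_ball] by blast
 have R0: "R (phi 0) = 1" using ap bp by (auto simp: R_def p_def[symmetric])
 have "(g0 0)^2 = 1" using g0(2)[of 0] R0 by simp
 hence g00: "g0 0 * g0 0 = 1" by (simp add: power2_eq_square)
 define g where "g s = g0 0 * g0 s" for s
 have g: "g holomorphic_on ball 0 1" "g 0 = 1" unfolding g_def by (intro holomorphic_intros g0) (simp add: g00)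
 have gsq: "(g s)^2 = R (phi s)" if "s \<in> ball 0 1" for s
  using g0(2)[OF that] \<open>(g0 0)^2 = 1\<close> by (simp add: g_def power_mult_distrib)
 obtain psi where psi: "psi holomorphic_on phi ` ball 0 1" "!!s. s \<in> ball 0 1 ==> psi (phi s) = s"
  using holomorphic_has_inverse[OF hol open_ball inj_on_subset[OF inj ball_subset_cball]] by metis
 have glow: "norm (g s + 1) >= 2/5" if s: "s \<in> ball 0 1" for s
 proof (rule ccontr)
  assume "\<not> norm (g s + 1) >= 2/5"
  hence lt: "norm (g s + 1) < 2/5" by simp
  define e where "e = (g s)^2 - 1"
  have "norm (g s - 1) <= norm (g s + 1) + norm (2::complex)"
   using norm_triangle_ineq4[of "g s + 1" 2] by (simp add: algebra_simps)
  hence "norm (g s - 1) < 12/5" using lt by simp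
  moreover have "norm e = norm (g s - 1) * norm (g s + 1)"
   by (simp add: e_def norm_mult[symmetric] power2_eq_square algebra_simps)
  ultimately have "norm e <= (12/5) * (2/5)" using lt by (metis mult_mono less_imp_le norm_ge_zero zero_le_numeral zero_le_divide_iff)
  hence e1: "norm e < 1" by simp
  \<comment> \<open>With |g s + 1| < 2/5 one has |g s - 1| < 12/5, hence |e| <= 24/25, and the
    segment from 1 to (g s)^2 stays in the disc. \<open>x t\<close> is its preimage under
    \<open>R\<close>.\<close>
  define x where "x t = b + (p - b) / (1 - of_real t * cc * e)" for t :: real
  have nt: "norm (of_real t * e) < 1" if "t \<in> {0..1}" for t
  proof -
   have "norm (of_real t * e) <= 1 * norm e" using that by (simp add: norm_mult mult_left_le_one_le)
   thus ?thesis using e1 by simp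
  qed
  have den: "1 - of_real t * cc * e ~= 0" if "t \<in> {0..1}" for t
  proof
   assume "1 - of_real t * cc * e = 0"
   hence "norm (cc * (of_real t * e)) = 1" by (metis eq_iff_diff_eq_0 mult.assoc mult.commute norm_one)
   moreover have "norm (cc * (of_real t * e)) <= norm (of_real t * e)" using cc by (simp add: norm_mult mult_left_le_one_le)
   ultimately show False using nt[OF that] by linarith
  qed
  have contx: "continuous_on {0..1} x" unfolding x_def using den by (intro continuous_intros) auto
  have xb: "x t ~= b" if "t \<in> {0..1}" for t using den[OF that] bp by (auto simp: x_def)
  have Rx: "R (x t) = 1 + of_real t * e" if t: "t \<in> {0..1}" for t
  proof -
   define D where "D = 1 - of_real t * cc * e"
   have D: "D ~= 0" "of_real t * cc * e = 1 - D" using den[OF t] by (auto simp: D_def)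
   have xm: "x t - b = (p - b) / D" by (simp add: x_def D_def)
   have "p - b = (x t - b) * D" using D xm by simp
   moreover have "x t - p = (x t - b) - (p - b)" by simp
   ultimately have "x t - p = (x t - b) * (1 - D)" by (metis mult.right_neutral right_diff_distrib')
   hence "(x t - p) / (cc * (x t - b)) = (1 - D) / cc" using xb[OF t] cc by simp
   also have "1 - D = cc * (of_real t * e)" using D(2) by (simp only: mult_ac)
   also have "cc * (of_real t * e) / cc = of_real t * e" using cc(2) by simp
   finally have "(x t - p) / (cc * (x t - b)) = of_real t * e" .
   with R1[OF xb[OF t]] show ?thesis by (simp add: algebra_simps)
  qed
  have xG: "x t \<notin> G" if "t \<in> {0..1}" for t
   using RG[of "x t"] xb[OF that] Rx[OF that] nt[OF that] by auto
  have x0: "x 0 = p" by (simp add: x_def)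
  have "x ` {0..1} \<subseteq> phi ` ball 0 1"
  proof (rule ccontr)
   assume "\<not> x ` {0..1} \<subseteq> phi ` ball 0 1"
   moreover have "connected (x ` {0..1})" using contx by (intro connected_continuous_image) auto
   moreover have "p \<in> x ` {0..1}" using x0 by force
   ultimately have "x ` {0..1} \<inter> G ~= {}"
    using connected_Int_frontier[of "x ` {0..1}" "phi ` ball 0 1"] pO F(4) unfolding G_def by blast
   thus False using xG by auto
  qed
  hence xO: "x t \<in> phi ` ball 0 1" if "t \<in> {0..1}" for t using that by blast
  define si where "si t = psi (x t)" for t
  have si: "si t \<in> ball 0 1" "phi (si t) = x t" if "t \<in> {0..1}" for t
   using xO[OF that] psi(2) by (auto simp: si_def)
  have contsi: "continuous_on {0..1} si" unfolding si_def
   by (rule continuous_on_compose2[OF holomorphic_on_imp_continuous_on[OF psi(1)] contx]) (use xO in auto)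
  have contg: "continuous_on {0..1} (%t. Re (g (si t)))"
   by (intro continuous_intros continuous_on_compose2[OF holomorphic_on_imp_continuous_on[OF g(1)] contsi]) (use si in auto)
  \<comment> \<open>The square of \<open>g\<close> stays in the right half-plane along the path, so
    \<open>g\<close> cannot cross the imaginary axis.\<close>
  have nz: "Re (g (si t)) ~= 0" if t: "t \<in> {0..1}" for t
  proof
   assume "Re (g (si t)) = 0"
   hence "Re ((g (si t))^2) <= 0" by (simp add: power2_eq_square)
   moreover have "(g (si t))^2 = 1 + of_real t * e" using gsq[OF si(1)[OF t]] si(2)[OF t] Rx[OF t] by simp
   moreover have "Re (1 + of_real t * e) > 0" using nt[OF t] abs_Re_le_cmod[of "of_real t * e"] by simp
   ultimately show False by simp
  qed
  have s0: "si 0 = 0" using psi(2)[of 0] x0 by (simp add: si_def p_def)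
  have s1: "si 1 = s"
  proof -
   have "R (x 1) = R (phi s)" using Rx[of 1] gsq[OF s] by (simp add: e_def)
   hence "(x 1 - p) / (cc * (x 1 - b)) = (phi s - p) / (cc * (phi s - b))"
    using R1[OF xb[of 1]] R1[OF nb(1)[OF s]] by simp
   hence "(x 1 - p) * (phi s - b) = (phi s - p) * (x 1 - b)"
    using xb[of 1] nb(1)[OF s] cc by (simp add: divide_simps)
   hence "(x 1 - phi s) * (p - b) = 0" by (simp add: algebra_simps)
   hence "x 1 = phi s" using bp by simp
   thus ?thesis using psi(2)[OF s] by (simp add: si_def)
  qed
  have "Re (g (si 1)) > 0"
  proof (rule ccontr)
   assume "\<not> Re (g (si 1)) > 0"
   moreover have "Re (g (si 0)) = 1" using s0 g(2) by simp
   ultimately obtain t where "0 <= t" "t <= 1" "Re (g (si t)) = 0"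
    using IVT2'[of "%t. Re (g (si t))" 1 0 0] contg by auto
   thus False using nz[of t] by auto
  qed
  hence "norm (g s + 1) >= 1" using s1 abs_Re_le_cmod[of "g s + 1"] by simp
  with lt show False by simp
 qed
 show ?thesis
  by (rule that[of a g]) (use a anb g gsq glow cross in \<open>auto simp: G_def p_def R_def\<close>)
qed

text \<open>An arc through \<open>b\<close> that fills a fixed part of the circle cannot cling to
  \<open>b\<close>. Otherwise \<open>Y = 1 / (g + 1)\<close> would be at most 2 / 5^n along it,
  while |Y| <= 5/2 everywhere and Y 0 = 1/2; the product of rotations then gives (1/2)^n <= 4/5
  (1/2)^n. The cross-ratio form is what survives the inversion used for the outside.\<close>

lemma disc_chart_arc_far:
 assumes ch: "disc_chart phi" and n: "n > 0" and arc: "be - al >= 2 * pi / real n"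
  and tb: "tb \<in> {al..be}" and bdef: "b = phi (cis tb)" and q: "q \<in> phi ` sphere 0 1" "q ~= b"
 shows "\<exists>t\<in>{al..be}. norm (phi (cis t) - phi 0) * norm (q - b)
      < ((3 + 5 ^ n) / 2)^2 * norm (phi (cis t) - b) * norm (phi 0 - q)"
proof (rule ccontr)
 assume neg0: "\<not> ?thesis"
 define p where "p = phi 0"
 define Rn where "Rn = ((3 + 5 ^ n) / 2 :: real)^2"
 have neg: "norm (phi (cis t) - p) * norm (q - b) >= Rn * norm (phi (cis t) - b) * norm (p - q)"
  if "t \<in> {al..be}" for t using neg0 that by (auto simp: p_def Rn_def not_less)
 have b: "b \<in> phi ` sphere 0 1" by (auto simp: bdef)
 obtain a g where a: "a \<in> phi ` sphere 0 1" "a ~= b" and g: "g holomorphic_on ball 0 1" "g 0 = 1"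
  and gsq: "!!s. s \<in> ball 0 1 ==> (g s)^2 = (phi s - a) * (p - b) / ((phi s - b) * (p - a))"
  and glow: "!!s. s \<in> ball 0 1 ==> norm (g s + 1) >= 2/5"
  and cross: "!!x. x \<in> phi ` sphere 0 1 ==> norm (x - b) * norm (a - p) <= norm (a - b) * norm (x - p)"
  using disc_chart_sqrt[OF ch b] unfolding p_def by metis
 have cont: "continuous_on (cball 0 1) phi" using ch by (simp add: disc_chart_def)
 have notin: "phi s ~= x" if "s \<in> ball 0 1" "x \<in> phi ` sphere 0 1" for s x
  using disc_chart_disjoint[OF ch] that by blast
 have pb: "p ~= b" and pa: "p ~= a" and pq: "p ~= q"
  using notin[of 0] a b q by (auto simp: p_def)
 have gnz: "g s + 1 ~= 0" if "s \<in> ball 0 1" for s using glow[OF that] by auto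
 define Y where "Y s = 1 / (g s + 1)" for s
 have Yhol: "Y holomorphic_on ball 0 1" unfolding Y_def using gnz by (intro holomorphic_intros g) auto
 have Ybd: "norm (Y s) <= 5/2" if "s \<in> ball 0 1" for s
  using glow[OF that] by (simp add: Y_def norm_divide divide_simps split: if_splits)
 define x where "x = (5 ^ n / 2 :: real)"
 have x: "x > 0" by (simp add: x_def)
 have Rnx: "Rn - 1 >= (1 + x)^2 + 1/4"
  using x by (simp add: Rn_def x_def power2_eq_square field_simps)
 have small: "eventually (%z. norm (Y z) < 1/x + e) (at (cis t) within ball 0 1)"
  if t: "t \<in> {al..be}" and e: "e > 0" for t e
 proof -
  define x' where "x' = 1 / (1/x + e)"
  have x'eq: "x' = x / (1 + e * x)" using x by (simp add: x'_def field_simps)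
  have ex: "0 < e * x" using x e by simp
  have x': "0 < x'" "x' < x" using x ex unfolding x'eq by (auto simp: divide_less_eq intro!: divide_pos_pos)
  define H where "H s = norm (phi s - a) * norm (p - b) - (1 + x')^2 * (norm (phi s - b) * norm (p - a))" for s
  have Hpos: "H (cis t) > 0"
  proof (cases "phi (cis t) = b")
   case True
   thus ?thesis using a pb by (simp add: H_def)
  next
   case False
   define ze where "ze = phi (cis t)"
   have "Rn * norm (ze - b) * norm (p - q) * norm (a - p) <= norm (ze - p) * (norm (q - b) * norm (a - p))"
    using mult_right_mono[OF neg[OF t], of "norm (a - p)"] by (simp add: ze_def mult.assoc)
   also have "... <= norm (ze - p) * (norm (a - b) * norm (q - p))"
    by (intro mult_left_mono cross q) auto
   finally have "norm (p - q) * (Rn * norm (ze - b) * norm (a - p)) <= norm (p - q) * (norm (ze - p) * norm (a - b))"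
    by (simp add: norm_minus_commute mult_ac)
   hence "Rn * norm (ze - b) * norm (a - p) <= norm (ze - p) * norm (a - b)" using pq by simp
   also have "... = norm ((ze - a) * (p - b) - (ze - b) * (p - a))"
    unfolding norm_mult[symmetric] by (rule arg_cong[of _ _ norm]) (simp add: algebra_simps)
   also have "... <= norm (ze - a) * norm (p - b) + norm (ze - b) * norm (p - a)"
    using norm_triangle_ineq4[of "(ze - a) * (p - b)" "(ze - b) * (p - a)"] by (simp add: norm_mult)
   finally have "(Rn - 1) * (norm (ze - b) * norm (p - a)) <= norm (ze - a) * norm (p - b)"
    by (simp add: algebra_simps norm_minus_commute)
   moreover have "(1 + x')^2 * (norm (ze - b) * norm (p - a)) < (Rn - 1) * (norm (ze - b) * norm (p - a))"
   proof (rule mult_strict_right_mono)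
    have "(1 + x')^2 <= (1 + x)^2" using x' by (intro power_mono) auto
    thus "(1 + x')^2 < Rn - 1" using Rnx by linarith
    show "0 < norm (ze - b) * norm (p - a)" using False pa by (simp add: ze_def)
   qed
   ultimately show ?thesis by (simp add: H_def ze_def)
  qed
  have "continuous_on (cball 0 1) H" unfolding H_def by (intro continuous_intros cont)
  hence "(H \<longlongrightarrow> H (cis t)) (at (cis t) within cball 0 1)" by (simp add: continuous_on)
  hence "(H \<longlongrightarrow> H (cis t)) (at (cis t) within ball 0 1)"
   by (rule tendsto_within_subset) auto
  hence "eventually (%s. H s > 0) (at (cis t) within ball 0 1)" using Hpos by (rule order_tendstoD)
  moreover have "eventually (%z. z \<in> ball 0 1) (at (cis t) within ball 0 1)"
   by (simp add: eventually_at_filter)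
  ultimately show ?thesis
  proof eventually_elim
   case (elim s)
   have nz: "norm (phi s - b) * norm (p - a) > 0" using notin[OF elim(2)] b pa by simp
   have "(norm (g s))^2 = norm (phi s - a) * norm (p - b) / (norm (phi s - b) * norm (p - a))"
    using gsq[OF elim(2)] by (metis norm_divide norm_mult norm_power)
   also have "... > (1 + x')^2" using elim(1) nz unfolding H_def by (simp only: less_divide_eq) simp
   finally have "norm (g s) > 1 + x'" by (rule power_less_imp_less_base) simp
   moreover have "norm (g s) <= norm (g s + 1) + 1"
    using norm_triangle_ineq4[of "g s + 1" 1] by simp
   ultimately have "norm (g s + 1) > x'" by linarith
   hence "norm (Y s) < 1 / x'" using x' by (simp add: Y_def norm_divide divide_simps)
   also have "1 / x' = 1/x + e" by (simp add: x'_def)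
   finally show ?case .
  qed
 qed
 have "norm (Y 0) ^ n <= (1/x) * (5/2) ^ (n - 1)"
  by (rule norm_power_le_of_small_on_arc[OF Yhol Ybd n arc _ small]) (use x in auto)
 hence "(1/2) ^ n <= (2 / 5 ^ n) * (5/2 :: real) ^ (n - 1)" by (simp add: Y_def g x_def)
 moreover have "(5/2 :: real) ^ (n - 1) = (2/5) * (5/2) ^ n" using n by (cases n) auto
 ultimately have "(1/2) ^ n <= (2 / 5 ^ n) * ((2/5) * (5/2 :: real) ^ n)" by (simp only:)
 hence "(1/2) ^ n <= (4 / 5) * ((1 / 5 ^ n) * (5/2 :: real) ^ n)" by simp
 also have "(1 / 5 ^ n) * (5/2 :: real) ^ n = (1/2) ^ n" by (simp add: power_divide)
 finally have "(1/2 :: real) ^ n <= (4/5) * (1/2) ^ n" .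
 thus False by simp
qed

text \<open>An arc that fills a fixed part of the circle cannot cling to any point \<open>q\<close>,
  wherever it lies. The function \<open>X\<close> in the proof is the cross-ratio (z - q) (p - b) /
  ((z - b) (q - p)) along \<open>phi\<close>, divided by (g + 1)^2, which cancels the pole at
  \<open>b\<close>. It is bounded by 25 and equals -1/4 at 0, so it cannot be too small on the whole
  arc.\<close>

lemma disc_chart_arc_spread:
 assumes ch: "disc_chart phi" and n: "n > 0" and arc: "be - al >= 2 * pi / real n"
  and b: "b \<in> phi ` sphere 0 1" and q: "q \<in> phi ` sphere 0 1" "q ~= b"
 shows "\<exists>t\<in>{al..be}. norm (phi (cis t) - q) * norm (phi 0 - b)
      > (3 / 100 ^ n) * norm (phi (cis t) - b) * norm (q - phi 0)"
proof (rule ccontr)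
 assume neg0: "\<not> ?thesis"
 define p where "p = phi 0"
 define c where "c = (3 / 100 ^ n :: real)"
 have c: "c > 0" by (simp add: c_def)
 have neg: "norm (phi (cis t) - q) * norm (p - b) <= c * norm (phi (cis t) - b) * norm (q - p)"
  if "t \<in> {al..be}" for t using neg0 that by (auto simp: p_def c_def not_less)
 obtain a g where a: "a \<in> phi ` sphere 0 1" "a ~= b" and g: "g holomorphic_on ball 0 1" "g 0 = 1"
  and gsq: "!!s. s \<in> ball 0 1 ==> (g s)^2 = (phi s - a) * (p - b) / ((phi s - b) * (p - a))"
  and glow: "!!s. s \<in> ball 0 1 ==> norm (g s + 1) >= 2/5"
  and cross: "!!x. x \<in> phi ` sphere 0 1 ==> norm (x - b) * norm (a - p) <= norm (a - b) * norm (x - p)"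
  using disc_chart_sqrt[OF ch b] unfolding p_def by metis
 have cont: "continuous_on (cball 0 1) phi" using ch by (simp add: disc_chart_def)
 have notin: "phi s ~= x" if "s \<in> ball 0 1" "x \<in> phi ` sphere 0 1" for s x
  using disc_chart_disjoint[OF ch] that by blast
 have pb: "p ~= b" and pa: "p ~= a" and pq: "p ~= q"
  using notin[of 0] a b q by (auto simp: p_def)
 have gnz: "g s + 1 ~= 0" if "s \<in> ball 0 1" for s using glow[OF that] by auto
 define Rq where "Rq = (q - a) * (p - b) / ((q - b) * (p - a))"
 have Rq1: "Rq - 1 = (q - p) * (a - b) / ((q - b) * (p - a))"
  using q pa unfolding Rq_def by (simp add: divide_simps) (simp add: algebra_simps)
 have nRq1: "norm (Rq - 1) >= 1"
 proof -
  have "norm (Rq - 1) = norm (q - p) * norm (a - b) / (norm (q - b) * norm (p - a))"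
   by (simp add: Rq1 norm_divide norm_mult)
  moreover have "norm (q - b) * norm (p - a) > 0" using q pa by simp
  ultimately show ?thesis using cross[OF q(1)] by (simp add: le_divide_eq norm_minus_commute mult.commute)
 qed
 define X where "X s = ((g s)^2 - Rq) / ((g s + 1)^2 * (Rq - 1))" for s
 have Xhol: "X holomorphic_on ball 0 1" unfolding X_def using gnz nRq1 by (intro holomorphic_intros g) auto
 have Xbd: "norm (X s) <= 25" if s: "s \<in> ball 0 1" for s
 proof -
  define u where "u = norm (g s + 1)"
  define r where "r = norm (Rq - 1)"
  have u: "u >= 2/5" and r: "r >= 1" using glow[OF s] nRq1 by (auto simp: u_def r_def)
  have "norm (g s) <= u + 1" using norm_triangle_ineq4[of "g s + 1" 1] by (simp add: u_def)
  hence "(norm (g s))^2 <= (u + 1)^2" by (intro power_mono) auto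
  moreover have "norm Rq <= r + 1" using norm_triangle_ineq[of "Rq - 1" 1] by (simp add: r_def)
  moreover have "norm ((g s)^2 - Rq) <= (norm (g s))^2 + norm Rq"
   using norm_triangle_ineq4[of "(g s)^2" Rq] by (simp add: norm_power)
  ultimately have num: "norm ((g s)^2 - Rq) <= (u + 1)^2 + (r + 1)" by linarith
  have "u * u >= (2/5) * (2/5)" using u by (intro mult_mono) auto
  hence uu: "u^2 >= 4/25" by (simp add: power2_eq_square)
  have "(u + 1)^2 <= 49/4 * u^2"
  proof -
   have "u + 1 <= 7/2 * u" using u by simp
   hence "(u + 1)^2 <= (7/2 * u)^2" using u by (intro power_mono) auto
   thus ?thesis by (simp add: power2_eq_square)
  qed
  hence "(u + 1)^2 + (r + 1) <= 49/4 * u^2 * r + 2 * r * (25/4 * u^2)"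
  proof -
   have "49/4 * u^2 * 1 <= 49/4 * u^2 * r" using r by (intro mult_left_mono) auto
   moreover have "2 * r * 1 <= 2 * r * (25/4 * u^2)" using r uu by (intro mult_left_mono) auto
   ultimately show ?thesis using r \<open>(u + 1)^2 <= 49/4 * u^2\<close> by linarith
  qed
  also have "... <= 25 * (u^2 * r)" using r by (simp add: algebra_simps)
  finally have "norm ((g s)^2 - Rq) <= 25 * (u^2 * r)" using num by linarith
  moreover have "u^2 * r > 0" using u r by simp
  ultimately show ?thesis
   by (simp add: X_def norm_divide norm_mult norm_power u_def[symmetric] r_def[symmetric] divide_le_eq)
 qed
 have small: "eventually (%z. norm (X z) < 25/4 * c + e) (at (cis t) within ball 0 1)"
  if t: "t \<in> {al..be}" and e: "e > 0" for t e
 proof -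
  define c' where "c' = c + e / 10"
  have c': "c' > c" "c' > 0" "25/4 * c' < 25/4 * c + e" using c e by (auto simp: c'_def)
  define H where "H s = c' * norm (phi s - b) * norm (q - p) - norm (phi s - q) * norm (p - b)" for s
  have nb: "phi (cis t) ~= b"
  proof
   assume "phi (cis t) = b"
   hence "norm (b - q) * norm (p - b) <= 0" using neg[OF t] by simp
   moreover have "norm (b - q) * norm (p - b) > 0" using q pb by simp
   ultimately show False by linarith
  qed
  have "c * (norm (phi (cis t) - b) * norm (q - p)) < c' * (norm (phi (cis t) - b) * norm (q - p))"
   using c' nb pq by (intro mult_strict_right_mono) auto
  hence Hpos: "H (cis t) > 0" using neg[OF t] by (simp add: H_def)
  have "continuous_on (cball 0 1) H" unfolding H_def by (intro continuous_intros cont)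
  hence "(H \<longlongrightarrow> H (cis t)) (at (cis t) within cball 0 1)" by (simp add: continuous_on)
  hence "(H \<longlongrightarrow> H (cis t)) (at (cis t) within ball 0 1)"
   by (rule tendsto_within_subset) auto
  hence "eventually (%s. H s > 0) (at (cis t) within ball 0 1)" using Hpos by (rule order_tendstoD)
  moreover have "eventually (%z. z \<in> ball 0 1) (at (cis t) within ball 0 1)"
   by (simp add: eventually_at_filter)
  ultimately show ?thesis
  proof eventually_elim
   case (elim s)
   define ze where "ze = phi s"
   have zeb: "ze ~= b" using notin[OF elim(2)] b by (simp add: ze_def)
   have "(g s)^2 - Rq = (ze - q) * (p - b) * (a - b) / ((ze - b) * (q - b) * (p - a))"
    using zeb q pa unfolding gsq[OF elim(2)] Rq_def ze_def[symmetric]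
    by (simp add: divide_simps) (simp add: algebra_simps)
   also have "... = (ze - q) * (p - b) / ((ze - b) * (q - p)) * (Rq - 1)"
    using zeb q pa pq unfolding Rq1 by (simp add: divide_simps)
   finally have eq: "((g s)^2 - Rq) / (Rq - 1) = (ze - q) * (p - b) / ((ze - b) * (q - p))"
    using nRq1 by auto
   have "norm (((g s)^2 - Rq) / (Rq - 1)) < c'"
    using elim(1) zeb pq unfolding eq by (simp add: norm_divide norm_mult H_def ze_def divide_less_eq mult_ac)
   moreover have "norm (X s) = norm (((g s)^2 - Rq) / (Rq - 1)) / (norm (g s + 1))^2"
    by (simp add: X_def norm_divide norm_mult norm_power)
   moreover have "... <= norm (((g s)^2 - Rq) / (Rq - 1)) / (4/25)"
   proof (rule divide_left_mono)
    have "(2/5)^2 <= (norm (g s + 1))^2" using glow[OF elim(2)] by (intro power_mono) auto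
    thus "4/25 <= (norm (g s + 1))^2" by (simp add: power2_eq_square)
    hence "0 < (norm (g s + 1))^2" by linarith
    thus "0 < (norm (g s + 1))^2 * (4/25)" by linarith
   qed auto
   moreover have "norm (((g s)^2 - Rq) / (Rq - 1)) / (4/25) < c' / (4/25)"
    using calculation(1) by (rule divide_strict_right_mono) simp
   ultimately have "norm (X s) < c' / (4/25)" by (metis le_less_trans)
   also have "c' / (4/25) = 25/4 * c'" by simp
   finally show ?case using c'(3) by linarith
  qed
 qed
 have "norm (X 0) ^ n <= (25/4 * c) * 25 ^ (n - 1)"
  by (rule norm_power_le_of_small_on_arc[OF Xhol Xbd n arc _ small]) (use c in auto)
 moreover have "norm (X 0) = 1/4"
 proof -
  have "X 0 = - 1 / 4" using nRq1 by (auto simp: X_def g divide_simps)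
  thus ?thesis by simp
 qed
 moreover have "(25 :: real) ^ n = 25 ^ (n - 1) * 25" using n by (metis Suc_diff_1 power_Suc2)
 ultimately have "(1/4) ^ n <= (1/4) * c * 25 ^ n" by simp
 hence "(1/4 :: real) ^ n <= (3/4) * (25 ^ n / 100 ^ n)" by (simp add: c_def)
 also have "(25 ^ n / 100 ^ n) = (1/4 :: real) ^ n" by (simp add: power_divide[symmetric])
 finally show False by simp
qed

text \<open>Since g^2 - 1 = (1 - 2 Y) / Y^2 for the bounded function \<open>Y = 1 / (g + 1)\<close>,
  Schwarz-type estimates for \<open>Y\<close> control how far \<open>phi s\<close> moves from
  \<open>phi 0\<close>.\<close>

lemma disc_chart_growth_aux:
 assumes ch: "disc_chart phi" and b: "b \<in> phi ` sphere 0 1"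
 obtains Y where "Y holomorphic_on ball 0 1" "Y 0 = 1/2" "!!s. s \<in> ball 0 1 ==> norm (Y s) <= 5/2"
  "!!s. s \<in> ball 0 1 ==> Y s ~= 0"
  "!!s q. s \<in> ball (0::complex) 1 ==> q \<in> phi ` sphere 0 1 ==>
   norm (phi s - phi 0) * norm (q - b) <= norm (1 - 2 * Y s) / (norm (Y s))^2 * norm (phi s - b) * norm (phi 0 - q)"
proof -
 define p where "p = phi 0"
 obtain a g where a: "a \<in> phi ` sphere 0 1" "a ~= b" and g: "g holomorphic_on ball 0 1" "g 0 = 1"
  and gsq: "!!s. s \<in> ball 0 1 ==> (g s)^2 = (phi s - a) * (p - b) / ((phi s - b) * (p - a))"
  and glow: "!!s. s \<in> ball 0 1 ==> norm (g s + 1) >= 2/5"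
  and cross: "!!x. x \<in> phi ` sphere 0 1 ==> norm (x - b) * norm (a - p) <= norm (a - b) * norm (x - p)"
  using disc_chart_sqrt[OF ch b] unfolding p_def by metis
 have notin: "phi s ~= x" if "s \<in> ball 0 1" "x \<in> phi ` sphere 0 1" for s x
  using disc_chart_disjoint[OF ch] that by blast
 have pb: "p ~= b" and pa: "p ~= a"
  using notin[of 0] a b by (auto simp: p_def)
 have gnz: "g s + 1 ~= 0" if "s \<in> ball 0 1" for s using glow[OF that] by auto
 define Y where "Y s = 1 / (g s + 1)" for s
 show ?thesis
 proof (rule that[of Y])
  show "Y holomorphic_on ball 0 1" unfolding Y_def using gnz by (intro holomorphic_intros g) auto
  show "Y 0 = 1/2" by (simp add: Y_def g)
  show "norm (Y s) <= 5/2" if "s \<in> ball 0 1" for s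
   using glow[OF that] by (simp add: Y_def norm_divide divide_simps split: if_splits)
  show "Y s ~= 0" if "s \<in> ball 0 1" for s using gnz[OF that] by (simp add: Y_def)
  fix s q :: complex assume s: "s \<in> ball 0 1" and q: "q \<in> phi ` sphere 0 1"
  have zeb: "phi s ~= b" using notin[OF s b] .
  have pq: "p ~= q" using notin[of 0 q] q by (auto simp: p_def)
  have "(g s)^2 - 1 = (phi s - p) * (a - b) / ((phi s - b) * (p - a))"
   using zeb pa unfolding gsq[OF s] by (simp add: divide_simps) (simp add: algebra_simps)
  moreover have "(g s)^2 - 1 = (1 - 2 * Y s) / (Y s)^2"
   using gnz[OF s] by (simp add: Y_def power2_eq_square field_simps)
  ultimately have "norm (1 - 2 * Y s) / (norm (Y s))^2 = norm (phi s - p) * norm (a - b) / (norm (phi s - b) * norm (p - a))"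
   by (metis norm_divide norm_mult norm_power)
  hence "norm (1 - 2 * Y s) / (norm (Y s))^2 * norm (phi s - b) * norm (p - q)
    = norm (phi s - p) * (norm (a - b) * norm (q - p)) / norm (p - a)"
   using zeb by (simp add: norm_minus_commute)
  moreover have "... >= norm (phi s - p) * (norm (q - b) * norm (a - p)) / norm (p - a)"
   by (intro divide_right_mono mult_left_mono cross q) auto
  moreover have "norm (phi s - p) * (norm (q - b) * norm (a - p)) / norm (p - a) = norm (phi s - p) * norm (q - b)"
   using pa by (simp add: norm_minus_commute)
  ultimately show "norm (phi s - phi 0) * norm (q - b) <= norm (1 - 2 * Y s) / (norm (Y s))^2 * norm (phi s - b) * norm (phi 0 - q)"
   by (simp add: p_def)
 qed
qed

text \<open>The Schwarz lemma for (Y - 1/2) / 4 gives |Y s - 1/2| <= 4 |s|. For |s| <= 1/100 this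
  keeps |Y s| above 46/100, and 8 / 0.46^2 < 38.\<close>

lemma disc_chart_growth_small:
 assumes ch: "disc_chart phi" and b: "b \<in> phi ` sphere 0 1" and q: "q \<in> phi ` sphere 0 1"
  and s: "norm (s :: complex) <= 1/100"
 shows "norm (phi s - phi 0) * norm (q - b) <= 38 * norm s * norm (phi s - b) * norm (phi 0 - q)"
proof -
 obtain Y where Y: "Y holomorphic_on ball 0 1" "Y 0 = 1/2" "!!s. s \<in> ball 0 1 ==> norm (Y s) <= 5/2"
  and est: "!!s q. s \<in> ball (0::complex) 1 ==> q \<in> phi ` sphere 0 1 ==>
   norm (phi s - phi 0) * norm (q - b) <= norm (1 - 2 * Y s) / (norm (Y s))^2 * norm (phi s - b) * norm (phi 0 - q)"
  using disc_chart_growth_aux[OF ch b] by metis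
 have sb: "s \<in> ball 0 1" using s by simp
 have "norm ((Y s - 1/2) / 4) <= norm s"
 proof (rule Schwarz_Lemma(1))
  show "(%s. (Y s - 1/2) / 4) holomorphic_on ball 0 1" by (intro holomorphic_intros Y) auto
  show "norm ((Y z - 1/2) / 4) < 1" if "norm z < 1" for z
  proof -
   have "norm (Y z - 1/2) <= 5/2 + 1/2"
    using norm_triangle_ineq4[of "Y z" "1/2"] Y(3)[of z] that by simp
   thus ?thesis by (simp add: norm_divide)
  qed
 qed (use Y s in auto)
 hence d: "norm (Y s - 1/2) <= 4 * norm s" by (simp add: norm_divide)
 have "norm (1 - 2 * Y s) = 2 * norm (Y s - 1/2)"
 proof -
  have "1 - 2 * Y s = - 2 * (Y s - 1/2)" by (simp add: algebra_simps)
  thus ?thesis by (simp only: norm_mult) simp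
 qed
 hence 1: "norm (1 - 2 * Y s) <= 8 * norm s" using d by simp
 have "1/2 <= norm (Y s) + norm (Y s - 1/2)"
  using norm_triangle_ineq4[of "Y s" "Y s - 1/2"] by simp
 hence "norm (Y s) >= 46/100" using d s by simp
 hence "(norm (Y s))^2 >= (46/100)^2" by (intro power_mono) auto
 hence "norm (1 - 2 * Y s) / (norm (Y s))^2 <= (8 * norm s) / (46/100)^2"
  using 1 by (intro frac_le) auto
 also have "... <= 38 * norm s" by (simp add: power2_eq_square divide_simps)
 finally have "norm (1 - 2 * Y s) / (norm (Y s))^2 <= 38 * norm s" .
 hence "norm (1 - 2 * Y s) / (norm (Y s))^2 * (norm (phi s - b) * norm (phi 0 - q))
   <= 38 * norm s * (norm (phi s - b) * norm (phi 0 - q))"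
  by (intro mult_right_mono) auto
 with est[OF sb q] show ?thesis by (simp add: mult.assoc)
qed

text \<open>Cross-ratio form of the classical bound of |phi' 0| by a multiple of the distance from
  \<open>phi 0\<close> to the boundary, which is the case of \<open>b\<close> tending to
  infinity.\<close>

lemma disc_chart_deriv_le:
 assumes ch: "disc_chart phi" and b: "b \<in> phi ` sphere 0 1" and q: "q \<in> phi ` sphere 0 1"
 shows "norm (deriv phi 0) * norm (q - b) <= 38 * norm (phi 0 - b) * norm (phi 0 - q)"
proof -
 have hol: "phi holomorphic_on ball 0 1" using ch by (simp add: disc_chart_def)
 have D: "(phi has_field_derivative deriv phi 0) (at 0)"
  using holomorphic_derivI[OF hol] by simp
 hence l1: "((%s. (phi s - phi 0) / s) \<longlongrightarrow> deriv phi 0) (at 0)"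
  by (simp add: has_field_derivative_iff)
 have "isCont phi 0" using D DERIV_isCont by blast
 hence l2: "(phi \<longlongrightarrow> phi 0) (at 0)" by (simp add: isCont_def)
 show ?thesis
 proof (rule tendsto_le[of "at 0"])
  show "((%s. norm ((phi s - phi 0) / s) * norm (q - b)) \<longlongrightarrow> norm (deriv phi 0) * norm (q - b)) (at 0)"
   by (intro tendsto_intros l1)
  show "((%s. 38 * norm (phi s - b) * norm (phi 0 - q)) \<longlongrightarrow> 38 * norm (phi 0 - b) * norm (phi 0 - q)) (at 0)"
   by (intro tendsto_intros l2)
  have "eventually (%s. s \<in> ball 0 (1/100) - {0}) (at (0::complex))"
   using eventually_at_in_open[of "ball 0 (1/100)" "0::complex"] by simp
  thus "eventually (%s. norm ((phi s - phi 0) / s) * norm (q - b) <= 38 * norm (phi s - b) * norm (phi 0 - q)) (at 0)"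
  proof eventually_elim
   case (elim s)
   thus ?case
    using disc_chart_growth_small[OF ch b q, of s] by (simp add: norm_divide divide_simps mult_ac)
  qed
 qed auto
qed

text \<open>\<open>Y\<close> has no zeros, so Harnack's inequality for the positive harmonic
  function ln 2.51 - ln |Y| bounds |Y| from below; it is obtained from the Schwarz lemma for (L - A)
  / (L + A). The radius 0.6704 exceeds exp (-0.4), so the estimate covers all points exp (i w) with
  Im w >= 4/10.\<close>

lemma disc_chart_growth_large:
 assumes ch: "disc_chart phi" and b: "b \<in> phi ` sphere 0 1" and q: "q \<in> phi ` sphere 0 1"
  and s: "norm (s :: complex) <= 6704/10000"
 shows "norm (phi s - phi 0) * norm (q - b) <= 3 * 10 ^ 6 * norm (phi s - b) * norm (phi 0 - q)"
proof -
 obtain Y where Y: "Y holomorphic_on ball 0 1" "Y 0 = 1/2" "!!s. s \<in> ball 0 1 ==> norm (Y s) <= 5/2"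
   "!!s. s \<in> ball 0 1 ==> Y s ~= 0"
  and est: "!!s q. s \<in> ball (0::complex) 1 ==> q \<in> phi ` sphere 0 1 ==>
   norm (phi s - phi 0) * norm (q - b) <= norm (1 - 2 * Y s) / (norm (Y s))^2 * norm (phi s - b) * norm (phi 0 - q)"
  using disc_chart_growth_aux[OF ch b] by metis
 have sb: "s \<in> ball 0 1" using s by simp
 obtain h0 where h0: "h0 holomorphic_on ball 0 1" "!!s. s \<in> ball 0 1 ==> Y s = exp (h0 s)"
  using contractible_imp_holomorphic_log[OF Y(1) _ Y(4)] convex_imp_contractible[OF convex_ball] by blast
 define h where "h s = h0 s - h0 0 - of_real (ln 2)" for s
 have expl: "exp (complex_of_real (ln 2)) = 2" by (simp add: exp_of_real)
 have h: "h holomorphic_on ball 0 1" "h 0 = - of_real (ln 2)"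
  unfolding h_def by (intro holomorphic_intros h0) simp
 have hY: "exp (h s) = Y s" if "s \<in> ball 0 1" for s
  using h0(2)[OF that] h0(2)[of 0] Y(2) by (simp add: h_def exp_diff expl)
 define A where "A = ln (502/100 :: real)"
 have A: "A > 0" by (simp add: A_def)
 \<comment> \<open>The value 2.51, slightly above the bound 5/2 of |Y|, makes
   \<open>Re (L s)\<close> strictly positive.\<close>
 define L where "L s = of_real (ln (251/100)) - h s" for s
 have L0: "L 0 = of_real A"
 proof -
  have "ln (251/100) + ln 2 = ln (502/100 :: real)" by (subst ln_mult_pos[symmetric]) auto
  thus ?thesis by (simp add: L_def h A_def flip: of_real_add)
 qed
 have reL: "Re (L s) > 0" if "s \<in> ball 0 1" for s
 proof -
  have "norm (Y s) = exp (Re (h s))" using hY[OF that] by (metis norm_exp_eq_Re)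
  hence "exp (Re (h s)) < 251/100" using Y(3)[OF that] by simp
  hence "Re (h s) < ln (251/100)" by (metis exp_less_cancel_iff exp_ln zero_less_divide_iff zero_less_numeral)
  thus ?thesis by (simp add: L_def)
 qed
 define T where "T s = (L s - A) / (L s + A)" for s
 have dn: "L s + A ~= 0" if "s \<in> ball 0 1" for s
  using reL[OF that] A by (metis add_pos_pos Re_complex_of_real less_irrefl plus_complex.simps(1) zero_complex.simps(1))
 have Lhol: "L holomorphic_on ball 0 1" unfolding L_def by (intro holomorphic_intros h)
 have "norm (T s) <= norm s"
 proof (rule Schwarz_Lemma(1))
  show "T holomorphic_on ball 0 1" unfolding T_def by (intro holomorphic_intros Lhol) (use dn in auto)
  show "norm (T z) < 1" if "norm z < 1" for z
  proof -
   have z: "z \<in> ball 0 1" using that by simp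
   have "(norm (L z - A))^2 < (norm (L z + A))^2"
    using mult_pos_pos[OF reL[OF z] A] by (simp only: cmod_power2) (auto simp: power2_eq_square algebra_simps)
   hence "norm (L z - A) < norm (L z + A)" by (rule power_less_imp_less_base) simp
   thus ?thesis using dn[OF z] by (simp add: T_def norm_divide)
  qed
  show "T 0 = 0" by (simp add: T_def L0)
 qed (use s in auto)
 hence T: "norm (T s) <= 6704/10000" using s by simp
 have "L s * (1 - T s) = A * (1 + T s)" using dn[OF sb] by (simp add: T_def divide_simps)
 hence "norm (L s) * norm (1 - T s) = A * norm (1 + T s)"
  using A by (metis abs_of_pos norm_mult norm_of_real)
 moreover have "norm (1 - T s) >= 3296/10000" using norm_triangle_ineq2[of 1 "T s"] T by simp
 moreover have "norm (1 + T s) <= 16704/10000" using norm_triangle_ineq[of 1 "T s"] T by simp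
 moreover have "norm (L s) * (3296/10000) <= norm (L s) * norm (1 - T s)"
  by (rule mult_left_mono) (use calculation in auto)
 moreover have "A * norm (1 + T s) <= A * (16704/10000)"
  by (rule mult_left_mono) (use A calculation in auto)
 ultimately have "norm (L s) * (3296/10000) <= A * (16704/10000)" by linarith
 hence "norm (L s) <= 507/100 * A" using A by simp
 hence "Re (L s) <= 507/100 * A" using complex_Re_le_cmod order_trans by blast
 hence reh: "Re (h s) >= ln (251/100) - 507/100 * A" by (simp add: L_def)
 \<comment> \<open>5.07 exceeds (1 + r) / (1 - r) for r = 0.6704. The factor
   \<open>(502/100) powr (7/100)\<close> is at most 9/8 because 5.02 <= (9/8)^14 and 14 * 7/100 <
   1.\<close>
 have "exp (507/100 * A) = (502/100) powr (5 + 7/100)" by (simp add: powr_def A_def)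
 also have "... = (502/100) ^ 5 * (502/100) powr (7/100)" by (subst powr_add) (simp add: powr_realpow[symmetric] flip: powr_numeral)
 also have "... <= (502/100) ^ 5 * (9/8)"
 proof (rule mult_left_mono)
  have "(502/100 :: real) <= (9/8) ^ 14" by (simp add: power_divide)
  hence "(502/100 :: real) powr (7/100) <= ((9/8) ^ 14) powr (7/100)" by (intro powr_mono2) auto
  also have "((9/8 :: real) ^ 14) powr (7/100) = (9/8) powr (14 * (7/100))" by (simp add: powr_powr flip: powr_numeral)
  also have "... <= (9/8) powr 1" by (intro powr_mono) auto
  finally show "(502/100 :: real) powr (7/100) <= 9/8" by simp
 qed auto
 also have "... <= 3590" by (simp add: power_divide)
 finally have e1: "exp (507/100 * A) <= 3590" .
 have "norm (Y s) = exp (Re (h s))" using hY[OF sb] by (metis norm_exp_eq_Re)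
 also have "... >= exp (ln (251/100) - 507/100 * A)" using reh by simp
 also have "exp (ln (251/100) - 507/100 * A) = (251/100) / exp (507/100 * A)" by (simp add: exp_diff)
 also have "(251/100) / exp (507/100 * A) >= (251/100) / 3590" using e1 by (intro divide_left_mono) auto
 finally have Ylow: "norm (Y s) >= 251/359000" by simp
 define u where "u = norm (Y s)"
 have u: "u >= 251/359000" using Ylow by (simp add: u_def)
 have "norm (1 - 2 * Y s) <= 1 + 2 * u" using norm_triangle_ineq4[of 1 "2 * Y s"] by (simp add: u_def norm_mult)
 hence "norm (1 - 2 * Y s) / u^2 <= (1 + 2 * u) / u^2" by (intro divide_right_mono) auto
 also have "... = 1 / u^2 + 2 / u" using u by (simp add: field_simps power2_eq_square)
 also have "... <= 1 / (251/359000)^2 + 2 / (251/359000)"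
  using u by (intro add_mono divide_left_mono power_mono) auto
 also have "... <= 3 * 10 ^ 6" by (simp add: power_divide)
 finally have "norm (1 - 2 * Y s) / (norm (Y s))^2 <= 3 * 10 ^ 6" by (simp add: u_def)
 hence "norm (1 - 2 * Y s) / (norm (Y s))^2 * (norm (phi s - b) * norm (phi 0 - q))
   <= 3 * 10 ^ 6 * (norm (phi s - b) * norm (phi 0 - q))"
  by (intro mult_right_mono) auto
 with est[OF sb q] show ?thesis by (simp only: mult.assoc)
qed

section \<open>Automorphisms of the disc: moving the estimates from the centre to any point\<close>

definition disc_shift :: "complex => complex => complex" where
 "disc_shift a s = (s + a) / (1 + cnj a * s)"

lemma disc_shift_denom:
 assumes "norm a < 1" "norm s <= 1"
 shows "1 + cnj a * s ~= 0"
proof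
 assume "1 + cnj a * s = 0"
 hence "norm (cnj a * s) = 1" by (metis add_eq_0_iff norm_minus_cancel norm_one)
 moreover have "norm (cnj a * s) <= norm a" using assms(2) by (simp add: norm_mult mult_left_le)
 ultimately show False using assms(1) by simp
qed

lemma disc_shift_norm:
 assumes "norm a < 1" "norm s <= 1"
 shows "1 - (norm (disc_shift a s))^2 = (1 - (norm a)^2) * (1 - (norm s)^2) / (norm (1 + cnj a * s))^2"
proof -
 have nz: "norm (1 + cnj a * s) ~= 0" using disc_shift_denom[OF assms] by simp
 have "(norm (1 + cnj a * s))^2 - (norm (s + a))^2 = (1 - (norm a)^2) * (1 - (norm s)^2)"
  by (simp only: cmod_power2) (simp add: power2_eq_square algebra_simps)
 thus ?thesis using nz by (simp add: disc_shift_def norm_divide power_divide divide_simps)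
qed

lemma disc_shift_inverse:
 assumes "norm a < 1" "norm s <= 1"
 shows "disc_shift (- a) (disc_shift a s) = s"
proof -
 have d: "1 + cnj a * s ~= 0" using disc_shift_denom[OF assms] .
 have na: "1 - cnj a * a ~= 0"
  using disc_shift_denom[OF assms(1), of "- a"] assms(1) by simp
 have "1 + cnj (- a) * ((s + a) / (1 + cnj a * s)) = (1 - cnj a * a) / (1 + cnj a * s)"
  using d by (simp add: divide_simps) (simp add: algebra_simps)
 moreover have "(s + a) / (1 + cnj a * s) + - a = s * (1 - cnj a * a) / (1 + cnj a * s)"
  using d by (simp add: divide_simps) (simp add: algebra_simps)
 ultimately show ?thesis using d na by (simp add: disc_shift_def)
qed

lemma disc_shift_bij:
 assumes a: "norm a < 1"
 shows "disc_shift a ` ball 0 1 = ball 0 1" "disc_shift a ` sphere 0 1 = sphere 0 1"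
  "disc_shift a ` cball 0 1 = cball 0 1" "inj_on (disc_shift a) (cball 0 1)"
proof -
 have in1: "norm (disc_shift a s) < 1 \<longleftrightarrow> norm s < 1" "norm (disc_shift a s) = 1 \<longleftrightarrow> norm s = 1" 
  if a: "norm a < 1" and s: "norm s <= 1" for s a
 proof -
  have a2: "1 - (norm a)^2 > 0" using a by (simp add: abs_square_less_1)
  have d2: "(norm (1 + cnj a * s))^2 > 0" using disc_shift_denom[OF a s] by simp
  have "norm (disc_shift a s) < 1 \<longleftrightarrow> 1 - (norm (disc_shift a s))^2 > 0" by (simp add: abs_square_less_1)
  also have "... \<longleftrightarrow> 1 - (norm s)^2 > 0"
   unfolding disc_shift_norm[OF a s] using a2 d2 by (simp add: zero_less_divide_iff zero_less_mult_iff)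
  also have "... \<longleftrightarrow> norm s < 1" by (simp add: abs_square_less_1)
  finally show "norm (disc_shift a s) < 1 \<longleftrightarrow> norm s < 1" .
  have "norm (disc_shift a s) = 1 \<longleftrightarrow> 1 - (norm (disc_shift a s))^2 = 0" by (simp add: abs_square_eq_1)
  also have "... \<longleftrightarrow> 1 - (norm s)^2 = 0"
   unfolding disc_shift_norm[OF a s] using a2 d2 by simp
  also have "... \<longleftrightarrow> norm s = 1" by (simp add: abs_square_eq_1)
  finally show "norm (disc_shift a s) = 1 \<longleftrightarrow> norm s = 1" .
 qed
 have inv: "disc_shift a (disc_shift (- a) s) = s" if "norm s <= 1" for s
  using disc_shift_inverse[of "- a" s] a that by simp
 have ma: "norm (- a) < 1" using a by simp
 show "disc_shift a ` ball 0 1 = ball 0 1"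
 proof (intro equalityI subsetI)
  fix x assume "x \<in> disc_shift a ` ball 0 1" thus "x \<in> ball 0 1" using in1(1)[OF a] by auto
 next
  fix x :: complex assume "x \<in> ball 0 1"
  thus "x \<in> disc_shift a ` ball 0 1"
   using in1(1)[OF ma, of x] inv[of x] by (intro image_eqI[of _ _ "disc_shift (- a) x"]) auto
 qed
 moreover show "disc_shift a ` sphere 0 1 = sphere 0 1"
 proof (intro equalityI subsetI)
  fix x assume "x \<in> disc_shift a ` sphere 0 1" thus "x \<in> sphere 0 1" using in1(2)[OF a] by auto
 next
  fix x :: complex assume "x \<in> sphere 0 1"
  thus "x \<in> disc_shift a ` sphere 0 1"
   using in1(2)[OF ma, of x] inv[of x] by (intro image_eqI[of _ _ "disc_shift (- a) x"]) auto
 qed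
 moreover have "cball 0 1 = ball 0 1 \<union> sphere (0::complex) 1" by auto
 ultimately show "disc_shift a ` cball 0 1 = cball 0 1" by (simp add: image_Un)
 show "inj_on (disc_shift a) (cball 0 1)"
  by (rule inj_on_inverseI[of _ "disc_shift (- a)"]) (use disc_shift_inverse[OF a] in auto)
qed

lemma disc_shift_holomorphic:
 assumes "norm a < 1"
 shows "disc_shift a holomorphic_on ball 0 1" "continuous_on (cball 0 1) (disc_shift a)"
proof -
 show "disc_shift a holomorphic_on ball 0 1"
  unfolding disc_shift_def using disc_shift_denom[OF assms] by (intro holomorphic_intros) auto
 show "continuous_on (cball 0 1) (disc_shift a)"
  unfolding disc_shift_def using disc_shift_denom[OF assms] by (intro continuous_intros) auto
qed

lemma disc_chart_shift:
 assumes ch: "disc_chart phi" and a: "norm a < 1"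
 shows "disc_chart (phi \<circ> disc_shift a)"
  "(phi \<circ> disc_shift a) ` sphere 0 1 = phi ` sphere 0 1"
  "(phi \<circ> disc_shift a) 0 = phi a"
  "deriv (phi \<circ> disc_shift a) 0 = deriv phi a * of_real (1 - (norm a)^2)"
proof -
 have c: "continuous_on (cball 0 1) phi" and h: "phi holomorphic_on ball 0 1" and i: "inj_on phi (cball 0 1)"
  using ch by (auto simp: disc_chart_def)
 note b = disc_shift_bij[OF a]
 show "disc_chart (phi \<circ> disc_shift a)"
  unfolding disc_chart_def
 proof (intro conjI)
  show "continuous_on (cball 0 1) (phi \<circ> disc_shift a)"
   by (rule continuous_on_compose) (use disc_shift_holomorphic[OF a] b c in auto)
  show "(phi \<circ> disc_shift a) holomorphic_on ball 0 1"
   by (rule holomorphic_on_compose) (use disc_shift_holomorphic[OF a] b h in auto)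
  show "inj_on (phi \<circ> disc_shift a) (cball 0 1)"
   by (rule comp_inj_on) (use b i in auto)
 qed
 show "(phi \<circ> disc_shift a) ` sphere 0 1 = phi ` sphere 0 1" by (metis image_comp b(2))
 show "(phi \<circ> disc_shift a) 0 = phi a" by (simp add: disc_shift_def)
 have "(disc_shift a has_field_derivative (1 - cnj a * a)) (at 0)"
  unfolding disc_shift_def by (auto intro!: derivative_eq_intros simp: algebra_simps)
 moreover have "(phi has_field_derivative deriv phi a) (at (disc_shift a 0))"
  using holomorphic_derivI[OF h open_ball, of a] a by (simp add: disc_shift_def)
 ultimately have "((phi \<circ> disc_shift a) has_field_derivative (deriv phi a * (1 - cnj a * a))) (at 0)"
  by (metis DERIV_chain)
 moreover have "1 - cnj a * a = of_real (1 - (norm a)^2)"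
  by (metis complex_norm_square mult.commute of_real_1 of_real_diff)
 ultimately show "deriv (phi \<circ> disc_shift a) 0 = deriv phi a * of_real (1 - (norm a)^2)"
  using DERIV_imp_deriv by metis
qed

section \<open>The boundary as seen from a point of the half-plane\<close>

lemma sinh_ge_self: "sinh x >= x" if "x >= 0" for x :: real
proof -
 have "sinh 0 - 0 <= sinh x - x"
  by (rule DERIV_nonneg_imp_nondecreasing[OF that])
    (rule exI, rule conjI, (rule derivative_eq_intros refl)+, simp add: cosh_real_ge_1)
 thus ?thesis by simp
qed

lemma mult_sinh_ge: "v * sinh v >= 2 * (cosh v - 1)" if "v >= 0" for v :: real
proof -
 have "0 * sinh 0 - 2 * (cosh 0 - 1) <= v * sinh v - 2 * (cosh v - 1)"
 proof (rule DERIV_nonneg_imp_nondecreasing[OF that])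
  fix x :: real assume x: "0 <= x" "x <= v"
  have "0 * cosh 0 - sinh 0 <= x * cosh x - sinh x"
   by (rule DERIV_nonneg_imp_nondecreasing[OF x(1)])
     (rule exI, rule conjI, (rule derivative_eq_intros refl)+, simp)
  thus "\<exists>y. ((%v. v * sinh v - 2 * (cosh v - 1)) has_real_derivative y) (at x) & 0 <= y"
   by (intro exI[of _ "x * cosh x - sinh x"]) (auto intro!: derivative_eq_intros)
 qed
 thus ?thesis by simp
qed

lemma cos_ge_quadratic: "cos x >= 1 - x^2 / 2" for x :: real
proof -
 have "cos x = 1 - 2 * (sin (x/2))^2" using cos_double_sin[of "x/2"] by simp
 moreover have "(sin (x/2))^2 <= (x/2)^2" using abs_sin_x_le_abs_x[of "x/2"] by (metis abs_le_square_iff)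
 ultimately show ?thesis by (simp add: power_divide)
qed

text \<open>\<open>th\<close> is the angular coordinate of a boundary point as seen from \<open>exp (\<i> w)\<close>; its derivative is
 the Poisson kernel, which dominates that of the upper half-plane.\<close>

lemma disc_view:
 assumes v: "Im w > 0"
 obtains th :: "real => real" where "continuous_on UNIV th" "strict_mono th"
  "!!xi. disc_shift (exp (\<i> * w)) (cis (th xi)) = cis xi"
  "!!s t. s <= t ==> th (Re w + Im w * t) - th (Re w + Im w * s) >= 2 * (arctan t - arctan s)"
proof -
 define a where "a = exp (\<i> * w)"
 define u v where "u = Re w" and "v = Im w"
 have v0: "v > 0" using v by (simp add: v_def)
 have na: "norm a = exp (- v)" by (simp add: a_def v_def)
 have a1: "norm a < 1" using v0 by (simp add: na)
 have aeq: "a = of_real (exp (- v)) * cis u"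
  by (simp add: a_def complex_eq_iff Re_exp Im_exp u_def v_def)
 define U where "U xi = 1 - a * cis (- xi)" for xi
 have ReU: "Re (U xi) > 0" for xi
 proof -
  have "norm (a * cis (- xi)) < 1" using a1 by (simp add: norm_mult)
  thus ?thesis using abs_Re_le_cmod[of "a * cis (- xi)"] by (simp add: U_def)
 qed
 have U0: "U xi ~= 0" "U xi \<notin> \<real>\<^sub>\<le>\<^sub>0" for xi using ReU[of xi] by (auto simp: complex_nonpos_Reals_iff)
 \<comment> \<open>An argument of (cis xi - a) / (1 - cnj a cis xi), which equals cis xi times U xi
   / cnj (U xi). Since \<open>Re (U xi) > 0\<close>, the principal logarithm gives a continuous
   choice.\<close>
 define th where "th xi = xi + 2 * Im (Ln (U xi))" for xi
 define P where "P xi = sinh v / (cosh v - cos (xi - u))" for xi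
 have dcis: "((%x. cis (- x)) has_vector_derivative (- \<i> * cis (- xi))) (at xi)" for xi
 proof -
  have "((%z. exp (- (\<i> * z))) has_field_derivative (- \<i> * exp (- (\<i> * of_real xi)))) (at (of_real xi))"
   by (auto intro!: derivative_eq_intros)
  from has_vector_derivative_real_field[OF this] show ?thesis by (simp add: cis_conv_exp)
 qed
 have den: "cosh v - cos (xi - u) > 0" for xi
 proof -
  have "cosh v > 1" using v0 cosh_real_strict_mono[of 0 v] by simp
  thus ?thesis using cos_le_one[of "xi - u"] by linarith
 qed
 have D: "(th has_real_derivative P xi) (at xi)" for xi
 proof -
  have dU: "(U has_vector_derivative (\<i> * a * cis (- xi))) (at xi)"
   unfolding U_def by (rule derivative_eq_intros dcis refl | simp add: algebra_simps)+
  have "((%x. Ln (U x)) has_vector_derivative (\<i> * a * cis (- xi)) * inverse (U xi)) (at xi)"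
   using field_vector_diff_chain_at[OF dU has_field_derivative_Ln[OF U0(2)]] by (simp add: o_def)
  hence "((%x. Im (Ln (U x))) has_vector_derivative Im ((\<i> * a * cis (- xi)) * inverse (U xi))) (at xi)"
   by (rule bounded_linear.has_vector_derivative[OF bounded_linear_Im])
  hence "((%x. Im (Ln (U x))) has_real_derivative Im ((\<i> * a * cis (- xi)) * inverse (U xi))) (at xi)"
   by (simp add: has_real_derivative_iff_has_vector_derivative)
  hence "(th has_real_derivative 1 + 2 * Im ((\<i> * a * cis (- xi)) * inverse (U xi))) (at xi)"
   unfolding th_def
   by (intro DERIV_add DERIV_ident DERIV_cmult)
  moreover have "1 + 2 * Im ((\<i> * a * cis (- xi)) * inverse (U xi)) = P xi"
  proof -
   define ta where "ta = a * cis (- xi)"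
   have ta: "U xi = 1 - ta" by (simp add: U_def ta_def)
   have n: "(norm (1 - ta))^2 > 0" using U0(1)[of xi] by (simp add: ta)
   have "Im (\<i> * ta * inverse (1 - ta)) = Re (ta / (1 - ta))" by (simp add: divide_inverse mult.assoc)
   also have "ta / (1 - ta) = ta * cnj (1 - ta) / of_real ((norm (1 - ta))^2)"
    using complex_div_cnj by blast
   also have "Re ... = (Re ta - (norm ta)^2) / (norm (1 - ta))^2"
    unfolding Re_divide_of_real cmod_power2[of ta] by (simp add: power2_eq_square algebra_simps)
   finally have e1: "1 + 2 * Im ((\<i> * a * cis (- xi)) * inverse (U xi)) = 1 + 2 * (Re ta - (norm ta)^2) / (norm (1 - ta))^2"
    by (simp add: ta_def[symmetric] ta mult.assoc)
   have e2: "(norm (1 - ta))^2 = 1 - 2 * Re ta + (norm ta)^2"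
    unfolding cmod_power2 by (simp add: power2_eq_square algebra_simps)
   have nt: "norm ta = exp (- v)" by (simp add: ta_def norm_mult na)
   have "Re ta = exp (- v) * cos (xi - u)"
    by (simp add: ta_def aeq cis_mult mult.assoc) (metis cos_minus minus_diff_eq)
   hence e3: "1 - 2 * Re ta + (norm ta)^2 = 2 * exp (- v) * (cosh v - cos (xi - u))"
    by (simp add: nt cosh_field_def exp_minus field_simps power2_eq_square)
   have e4: "1 - (norm ta)^2 = 2 * exp (- v) * sinh v"
    by (simp add: nt sinh_field_def exp_minus field_simps power2_eq_square)
   have "1 + 2 * (Re ta - (norm ta)^2) / (norm (1 - ta))^2 = (1 - (norm ta)^2) / (norm (1 - ta))^2"
   proof -
    have *: "1 + 2 * (x - y) / N = (1 - y) / N" if "N > 0" "N = 1 - 2 * x + y" for x y N :: real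
     using that by (simp add: divide_simps)
    show ?thesis by (rule *[OF n e2])
   qed
   also have "... = P xi" unfolding e2 e3 e4 P_def by simp
   finally show ?thesis using e1 by simp
  qed
  ultimately show ?thesis by simp
 qed
 have Ppos: "P xi > 0" for xi using den v0 by (simp add: P_def)
 have sm: "strict_mono th"
  by (rule strict_monoI, rule DERIV_pos_imp_increasing) (use D Ppos in auto)
 have ct: "continuous_on UNIV th"
  by (intro DERIV_continuous_on[where D = P]) (use D in \<open>auto intro: has_field_derivative_at_within\<close>)
 \<comment> \<open>Comparison with the Poisson kernel of the half-plane, from cosh v - 1 <= (v sinh
   v) / 2 and v <= sinh v.\<close>
 have low: "P (u + v * s) * v >= 2 / (1 + s^2)" for s
 proof -
  have "cosh v - cos (v * s) <= cosh v - 1 + v^2 * s^2 / 2"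
   using cos_ge_quadratic[of "v * s"] by (simp add: power_mult_distrib)
  also have "... <= v * sinh v / 2 + v * sinh v * s^2 / 2"
  proof -
   have "v * v <= v * sinh v" using sinh_ge_self[of v] v0 by (intro mult_left_mono) auto
   hence "v^2 * s^2 / 2 <= v * sinh v * s^2 / 2" by (simp add: power2_eq_square mult_right_mono)
   thus ?thesis using mult_sinh_ge[of v] v0 by simp
  qed
  also have "... = v * sinh v * (1 + s^2) / 2" by (simp add: algebra_simps)
  finally have "2 * (cosh v - cos (v * s)) <= v * sinh v * (1 + s^2)" by simp
  moreover have "1 + s^2 > 0" by (simp add: add_pos_nonneg)
  ultimately show ?thesis using den[of "u + v * s"] by (simp add: P_def divide_simps mult_ac)
 qed
 show ?thesis
 proof (rule that[OF ct sm])
  fix xi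
  have "cis (th xi) = cis xi * exp (\<i> * of_real (2 * Im (Ln (U xi))))"
   by (simp add: th_def cis_conv_exp exp_add[symmetric] algebra_simps)
  also have "\<i> * of_real (2 * Im (Ln (U xi))) = Ln (U xi) - cnj (Ln (U xi))"
   by (simp add: complex_eq_iff)
  also have "exp ... = U xi / cnj (U xi)" using U0(1) by (simp add: exp_diff exp_cnj[symmetric])
  finally have 1: "cis (th xi) = cis xi * (U xi / cnj (U xi))" .
  have cU: "cnj (U xi) = 1 - cnj a * cis xi" by (simp add: U_def cis_cnj)
  have cU0: "1 - cnj a * cis xi ~= 0" using U0(1)[of xi] cU by (metis complex_cnj_zero_iff)
  have "cis xi * U xi = cis xi - a" by (simp add: U_def algebra_simps cis_mult)
  hence 2: "cis (th xi) = (cis xi - a) / (1 - cnj a * cis xi)" using 1 cU by simp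
  hence "cis (th xi) = disc_shift (- a) (cis xi)" by (simp add: disc_shift_def)
  thus "disc_shift (exp (\<i> * w)) (cis (th xi)) = cis xi"
   using disc_shift_inverse[of "- a" "cis xi"] a1 by (simp add: a_def)
 next
  fix s t :: real assume st: "s <= t"
  have "(th (u + v * s) - 2 * arctan s) <= (th (u + v * t) - 2 * arctan t)"
  proof (rule DERIV_nonneg_imp_nondecreasing[OF st])
   fix x
   have "((%x. th (u + v * x)) has_real_derivative P (u + v * x) * v) (at x)"
    by (rule DERIV_chain2[OF D]) (auto intro!: derivative_eq_intros)
   hence "((%x. th (u + v * x) - 2 * arctan x) has_real_derivative P (u + v * x) * v - 2 * inverse (1 + x^2)) (at x)"
    by (rule DERIV_diff) (rule DERIV_cmult[OF DERIV_arctan])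
   moreover have "0 <= P (u + v * x) * v - 2 * inverse (1 + x^2)" using low[of x] by (simp add: divide_inverse)
   ultimately show "\<exists>y. ((%x. th (u + v * x) - 2 * arctan x) has_real_derivative y) (at x) & 0 <= y" by blast
  qed
  thus "th (Re w + Im w * t) - th (Re w + Im w * s) >= 2 * (arctan t - arctan s)"
   by (simp add: u_def v_def)
 qed
qed

text \<open>Turns an angle of view in the half-plane into an arc of the recentred chart. The arc is
  at least twice the difference of the arctangents, because a full view is pi in the half-plane and
  2 pi in the disc.\<close>

lemma disc_chart_view:
 assumes ch: "disc_chart phi" and v: "Im w > 0" and n: "n > 0" and st: "arctan t - arctan s >= pi / real n"
 obtains al be th where "be - al >= 2 * pi / real n"
  "!!x. x \<in> {al..be} ==> \<exists>xi\<in>{Re w + Im w * s..Re w + Im w * t}. (phi \<circ> disc_shift (exp (\<i> * w))) (cis x) = phi (cis xi)"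
  "!!xi. xi \<in> {Re w + Im w * s..Re w + Im w * t} ==> th xi \<in> {al..be} & (phi \<circ> disc_shift (exp (\<i> * w))) (cis (th xi)) = phi (cis xi)"
proof -
 obtain th where th: "continuous_on UNIV th" "strict_mono th"
  "!!xi. disc_shift (exp (\<i> * w)) (cis (th xi)) = cis xi"
  "!!s t. s <= t ==> th (Re w + Im w * t) - th (Re w + Im w * s) >= 2 * (arctan t - arctan s)"
  using disc_view[OF v] by metis
 have "0 < pi / real n" using n by simp
 hence "arctan s < arctan t" using st by linarith
 hence st': "s <= t" by (simp add: arctan_less_iff less_imp_le)
 have le: "Re w + Im w * s <= Re w + Im w * t" using st' v by simp
 show ?thesis
 proof (rule that[of "th (Re w + Im w * t)" "th (Re w + Im w * s)" th])
  show "th (Re w + Im w * t) - th (Re w + Im w * s) >= 2 * pi / real n"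
   using th(4)[OF st'] st by simp
  fix x assume "x \<in> {th (Re w + Im w * s)..th (Re w + Im w * t)}"
  then obtain xi where "xi \<in> {Re w + Im w * s..Re w + Im w * t}" "th xi = x"
   using IVT'[of th "Re w + Im w * s" x "Re w + Im w * t"] le continuous_on_subset[OF th(1)] by auto
  thus "\<exists>xi\<in>{Re w + Im w * s..Re w + Im w * t}. (phi \<circ> disc_shift (exp (\<i> * w))) (cis x) = phi (cis xi)"
   using th(3)[of xi] by auto
 next
  fix xi assume "xi \<in> {Re w + Im w * s..Re w + Im w * t}"
  thus "th xi \<in> {th (Re w + Im w * s)..th (Re w + Im w * t)} & (phi \<circ> disc_shift (exp (\<i> * w))) (cis (th xi)) = phi (cis xi)"
   using th(3)[of xi] strict_mono_less_eq[OF th(2)] by auto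
 qed
qed

lemma disc_chart_arc_far_at:
 assumes ch: "disc_chart phi" and v: "Im w > 0" and n: "n > 0" and st: "arctan t - arctan s >= pi / real n"
  and xib: "xib \<in> {Re w + Im w * s..Re w + Im w * t}" and q: "q \<in> phi ` sphere 0 1" "q ~= phi (cis xib)"
 shows "\<exists>xi\<in>{Re w + Im w * s..Re w + Im w * t}. norm (phi (cis xi) - phi (exp (\<i> * w))) * norm (q - phi (cis xib))
      < ((3 + 5 ^ n) / 2)^2 * norm (phi (cis xi) - phi (cis xib)) * norm (phi (exp (\<i> * w)) - q)"
proof -
 have a: "norm (exp (\<i> * w)) < 1" using v by simp
 note S = disc_chart_shift[OF ch a]
 obtain al be th where V: "be - al >= 2 * pi / real n"
  "!!x. x \<in> {al..be} ==> \<exists>xi\<in>{Re w + Im w * s..Re w + Im w * t}. (phi \<circ> disc_shift (exp (\<i> * w))) (cis x) = phi (cis xi)"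
  "!!xi. xi \<in> {Re w + Im w * s..Re w + Im w * t} ==> th xi \<in> {al..be} & (phi \<circ> disc_shift (exp (\<i> * w))) (cis (th xi)) = phi (cis xi)"
  using disc_chart_view[OF ch v n st] by metis
 have "\<exists>x\<in>{al..be}. norm ((phi \<circ> disc_shift (exp (\<i> * w))) (cis x) - (phi \<circ> disc_shift (exp (\<i> * w))) 0) * norm (q - phi (cis xib))
      < ((3 + 5 ^ n) / 2)^2 * norm ((phi \<circ> disc_shift (exp (\<i> * w))) (cis x) - phi (cis xib)) * norm ((phi \<circ> disc_shift (exp (\<i> * w))) 0 - q)"
  by (rule disc_chart_arc_far[OF S(1) n V(1), of "th xib"]) (use V(3)[OF xib] S(2) q in auto)
 then obtain x where "x \<in> {al..be}" and x: "norm ((phi \<circ> disc_shift (exp (\<i> * w))) (cis x) - phi (exp (\<i> * w))) * norm (q - phi (cis xib))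
      < ((3 + 5 ^ n) / 2)^2 * norm ((phi \<circ> disc_shift (exp (\<i> * w))) (cis x) - phi (cis xib)) * norm (phi (exp (\<i> * w)) - q)"
  unfolding S(3) by blast
 thus ?thesis using V(2)[of x] by metis
qed

lemma disc_chart_arc_spread_at:
 assumes ch: "disc_chart phi" and v: "Im w > 0" and n: "n > 0" and st: "arctan t - arctan s >= pi / real n"
  and b: "b \<in> phi ` sphere 0 1" and q: "q \<in> phi ` sphere 0 1" "q ~= b"
 shows "\<exists>xi\<in>{Re w + Im w * s..Re w + Im w * t}. norm (phi (cis xi) - q) * norm (phi (exp (\<i> * w)) - b)
      > (3 / 100 ^ n) * norm (phi (cis xi) - b) * norm (q - phi (exp (\<i> * w)))"
proof -
 have a: "norm (exp (\<i> * w)) < 1" using v by simp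
 note S = disc_chart_shift[OF ch a]
 obtain al be th where V: "be - al >= 2 * pi / real n"
  "!!x. x \<in> {al..be} ==> \<exists>xi\<in>{Re w + Im w * s..Re w + Im w * t}. (phi \<circ> disc_shift (exp (\<i> * w))) (cis x) = phi (cis xi)"
  using disc_chart_view[OF ch v n st] by metis
 have "\<exists>x\<in>{al..be}. norm ((phi \<circ> disc_shift (exp (\<i> * w))) (cis x) - q) * norm ((phi \<circ> disc_shift (exp (\<i> * w))) 0 - b)
      > (3 / 100 ^ n) * norm ((phi \<circ> disc_shift (exp (\<i> * w))) (cis x) - b) * norm (q - (phi \<circ> disc_shift (exp (\<i> * w))) 0)"
  by (rule disc_chart_arc_spread[OF S(1) n V(1)]) (use S(2) q b in auto)
 then obtain x where "x \<in> {al..be}" and x: "norm ((phi \<circ> disc_shift (exp (\<i> * w))) (cis x) - q) * norm (phi (exp (\<i> * w)) - b)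
      > (3 / 100 ^ n) * norm ((phi \<circ> disc_shift (exp (\<i> * w))) (cis x) - b) * norm (q - phi (exp (\<i> * w)))"
  unfolding S(3) by blast
 thus ?thesis using V(2)[of x] by metis
qed

lemma disc_chart_deriv_le_at:
 assumes ch: "disc_chart phi" and a: "norm a < 1" and b: "b \<in> phi ` sphere 0 1" and q: "q \<in> phi ` sphere 0 1"
 shows "norm (deriv phi a) * (1 - (norm a)^2) * norm (q - b) <= 38 * norm (phi a - b) * norm (phi a - q)"
proof -
 note S = disc_chart_shift[OF ch a]
 have "(norm a)^2 <= 1" using a by (simp add: abs_square_le_1)
 hence "norm (complex_of_real (1 - (norm a)^2)) = 1 - (norm a)^2"
  by (metis abs_of_nonneg diff_ge_0_iff_ge norm_of_real)
 hence "norm (deriv phi a * of_real (1 - (norm a)^2)) = norm (deriv phi a) * (1 - (norm a)^2)"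
  by (metis norm_mult)
 thus ?thesis
  using disc_chart_deriv_le[OF S(1), of b q] b q unfolding S by simp
qed

text \<open>The chart recentred at \<open>a\<close> is evaluated at \<open>- a\<close>, which
  exchanges the roles of \<open>phi 0\<close> and \<open>phi a\<close>.\<close>

lemma disc_chart_growth_large_at:
 assumes ch: "disc_chart phi" and a: "norm a <= 6704/10000" and b: "b \<in> phi ` sphere 0 1" and q: "q \<in> phi ` sphere 0 1"
 shows "norm (phi 0 - phi a) * norm (q - b) <= 3 * 10 ^ 6 * norm (phi 0 - b) * norm (phi a - q)"
proof -
 have a1: "norm a < 1" using a by simp
 note S = disc_chart_shift[OF ch a1]
 have "(phi \<circ> disc_shift a) (- a) = phi 0" by (simp add: disc_shift_def)
 thus ?thesis
  using disc_chart_growth_large[OF S(1), of b q "- a"] a b q unfolding S by simp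
qed

section \<open>Boundary extension of conformal maps\<close>

lemma sum_square_radii_le:
 fixes c :: "'i => complex"
 assumes fin: "finite I" and r0: "!!i. i \<in> I ==> r i >= 0" and M: "M >= 0"
  and sub: "!!i. i \<in> I ==> ball (c i) (r i) \<subseteq> ball 0 M"
  and disj: "disjoint_family_on (%i. ball (c i) (r i)) I"
 shows "(\<Sum>i\<in>I. (r i)^2) <= M^2"
proof -
 have "(\<Sum>i\<in>I. measure lborel (ball (c i) (r i))) = measure lborel (\<Union>i\<in>I. ball (c i) (r i))"
  by (rule measure_finite_Union[symmetric]) (use fin disj emeasure_lborel_ball_finite in \<open>auto simp: less_top\<close>)
 also have "... <= measure lborel (ball (0::complex) M)"
  by (intro measure_mono_fmeasurable) (use sub fin emeasure_lborel_ball_finite[of "0::complex" M] in \<open>auto intro!: borel_open fmeasurableI\<close>)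
 finally have "(\<Sum>i\<in>I. pi * (r i)^2) <= pi * M^2"
  using r0 M by (simp add: content_ball unit_ball_vol_2 cong: sum.cong)
 thus ?thesis by (simp add: sum_distrib_left[symmetric])
qed

text \<open>The length-area principle. Bloch's theorem replaces the change of variables formula: small discs
 in the strip have images containing disjoint discs of comparable derivative size.\<close>

lemma strip_crosscut_aux:
 fixes Phi :: "complex => complex"
 assumes hol: "Phi holomorphic_on {z. 0 < Im z & Im z < pi}" and inj: "inj_on Phi {z. 0 < Im z & Im z < pi}"
  and bd: "!!z. 0 < Im z ==> Im z < pi ==> norm (Phi z) < M" and ab: "a < b" and ep: "0 < ep" "ep < 1"
 shows "\<exists>x\<in>{a..b}. \<forall>y\<in>{ep..pi - ep}. \<forall>y'\<in>{ep..pi - ep}. norm (Phi (Complex x y) - Phi (Complex x y')) <= 100 * M / sqrt (b - a)"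
proof -
 define S where "S = {z. 0 < Im z & Im z < pi}"
 have oS: "open S" unfolding S_def by (intro open_Collect_conj open_halfspace_Im_gt open_halfspace_Im_lt)
 have pi3: "pi > 3" "pi < 4" using pi_gt3 pi_less_4 by auto
 have M: "M > 0" using bd[of "\<i>"] pi3 by (auto intro: le_less_trans[OF norm_ge_zero])
 define ba where "ba = b - a"
 have ba: "ba > 0" using ab by (simp add: ba_def)
 \<comment> \<open>Admissible error when \<open>deriv Phi\<close> is replaced by its value at the
   centre of a cell: over a height below 4 it costs at most M / sqrt ba.\<close>
 define e where "e = M / (4 * sqrt ba)"
 have e: "e > 0" using M ba by (simp add: e_def)
 define K where "K = cbox (Complex a (ep/2)) (Complex b (pi - ep/2))"
 have KS: "K \<subseteq> S" unfolding K_def S_def in_cbox_complex_iff using ep by (auto simp: in_cbox_complex_iff)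
 have "continuous_on K (deriv Phi)"
  by (rule continuous_on_subset[OF holomorphic_on_imp_continuous_on[OF holomorphic_deriv[OF hol]] KS[unfolded S_def]])
    (use oS in \<open>simp add: S_def\<close>)
 hence "uniformly_continuous_on K (deriv Phi)" by (intro compact_uniformly_continuous) (auto simp: K_def)
 then obtain d0 where d0: "d0 > 0" and uc: "!!z z'. z \<in> K ==> z' \<in> K ==> dist z' z < d0 ==> dist (deriv Phi z') (deriv Phi z) < e"
  unfolding uniformly_continuous_on_def using e by metis
 obtain N :: nat where N: "N > 0" "ba / real N < min d0 (ep / 2)"
 proof -
  have "0 < min d0 (ep / 2) / ba" using d0 ep ba by simp
  from ex_inverse_of_nat_less[OF this] obtain n where n: "n > 0" "inverse (real n) < min d0 (ep/2) / ba" by blast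
  hence "ba / real n < min d0 (ep/2)" using ba by (simp add: field_simps)
  thus ?thesis using that n(1) by blast
 qed
 define de where "de = ba / real N"
 have de: "de > 0" "de < d0" "de < ep / 2" "real N * de = ba" using N ba by (auto simp: de_def)
 define m where "m = nat \<lceil>(pi - 2 * ep) / de\<rceil>"
 have m1: "real m * de >= pi - 2 * ep" "real m * de < pi - 2 * ep + de"
 proof -
  have "(pi - 2 * ep) / de > 0" using ep de pi3 by simp
  hence "real m = of_int \<lceil>(pi - 2 * ep) / de\<rceil>" unfolding m_def by simp
  hence "real m >= (pi - 2 * ep) / de" "real m < (pi - 2 * ep) / de + 1" by linarith+
  thus "real m * de >= pi - 2 * ep" "real m * de < pi - 2 * ep + de" using de by (simp_all add: field_simps)
 qed
 define xx where "xx i = a + (real i + 1/2) * de" for i :: nat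
 define yy where "yy j = ep + (real j + 1/2) * de" for j :: nat
 define cc where "cc p = Complex (xx (fst p)) (yy (snd p))" for p
 define I where "I = {..<N} \<times> {..<m}"
 have fI: "finite I" by (simp add: I_def)
 have xx: "a <= xx i" "xx i <= b" if "i < N" for i
 proof -
  have "0 <= (real i + 1/2) * de" using de by simp
  thus "a <= xx i" by (simp add: xx_def)
  have "(real i + 1/2) * de <= real N * de" using that de by (intro mult_right_mono) auto
  thus "xx i <= b" using de(4) by (simp add: xx_def ba_def)
 qed
 have row: "real j * de + de <= pi - 2 * ep + de" if "j < m" for j
 proof -
  have "(real j + 1) * de <= real m * de" using that de by (intro mult_right_mono) auto
  thus ?thesis using m1(2) by (simp add: algebra_simps)
 qed
 have KI: "Complex (xx i) y \<in> K" if "i < N" "y \<in> {ep..ep + real m * de}" for i y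
  using xx[OF that(1)] that(2) m1(2) de(3) ep by (simp add: K_def in_cbox_complex_iff)
 have disc: "ball (cc p) (de/2) \<subseteq> S" if p: "p \<in> I" for p
 proof
  fix z assume "z \<in> ball (cc p) (de/2)"
  hence "\<bar>Im z - yy (snd p)\<bar> < de/2"
   using abs_Im_le_cmod[of "z - cc p"] by (simp add: dist_norm norm_minus_commute cc_def)
  moreover have "snd p < m" using p by (auto simp: I_def)
  moreover have "0 <= real (snd p) * de" using de by simp
  moreover have "yy (snd p) = ep + real (snd p) * de + de / 2" by (simp add: yy_def algebra_simps)
  ultimately have "0 < Im z & Im z < pi" using row[of "snd p"] de(1,3) ep unfolding abs_less_iff by linarith
  thus "z \<in> S" by (simp add: S_def)
 qed
 \<comment> \<open>Bloch's theorem with constant 1/12 on a disc of radius de / 2.\<close>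
 define r where "r p = de / 24 * norm (deriv Phi (cc p))" for p
 have "\<exists>w. ball w (r p) \<subseteq> Phi ` ball (cc p) (de/2)" if p: "p \<in> I" for p
 proof -
  have "Phi holomorphic_on ball (cc p) (de/2)" using hol disc[OF p] by (auto simp: S_def intro: holomorphic_on_subset)
  moreover have "r p <= (de/2) * norm (deriv Phi (cc p)) / 12" by (simp add: r_def)
  ultimately show ?thesis using Bloch[of Phi "cc p" "de/2" "r p"] de by (metis half_gt_zero)
 qed
 then obtain w where w: "!!p. p \<in> I ==> ball (w p) (r p) \<subseteq> Phi ` ball (cc p) (de/2)" by metis
 have sep: "ball (cc p) (de/2) \<inter> ball (cc p') (de/2) = {}" if "p ~= p'" for p p'
 proof (rule disjoint_ballI)
  have far: "\<bar>real i - real i'\<bar> * de >= de" if "i ~= i'" for i i' :: nat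
  proof -
   have "1 <= \<bar>real i - real i'\<bar>" using that by linarith
   thus ?thesis using de by (simp add: mult_le_cancel_right1)
  qed
  have "de <= norm (cc p - cc p')"
  proof (cases "fst p = fst p'")
   case False
   have "Re (cc p - cc p') = (real (fst p) - real (fst p')) * de" by (simp add: cc_def xx_def algebra_simps)
   hence "\<bar>Re (cc p - cc p')\<bar> = \<bar>real (fst p) - real (fst p')\<bar> * de" using de by (simp add: abs_mult)
   thus ?thesis using far[OF False] abs_Re_le_cmod[of "cc p - cc p'"] by linarith
  next
   case True
   hence F: "snd p ~= snd p'" using that by (auto simp: prod_eq_iff)
   have "Im (cc p - cc p') = (real (snd p) - real (snd p')) * de" by (simp add: cc_def yy_def algebra_simps)
   hence "\<bar>Im (cc p - cc p')\<bar> = \<bar>real (snd p) - real (snd p')\<bar> * de" using de by (simp add: abs_mult)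
   thus ?thesis using far[OF F] abs_Im_le_cmod[of "cc p - cc p'"] by linarith
  qed
  thus "dist (cc p) (cc p') >= de/2 + de/2" by (simp add: dist_norm)
 qed
 have "(\<Sum>p\<in>I. (r p)^2) <= M^2"
 proof (rule sum_square_radii_le[OF fI, of r M w])
  show "ball (w p) (r p) \<subseteq> ball 0 M" if pI: "p \<in> I" for p
  proof
   fix z assume "z \<in> ball (w p) (r p)"
   then obtain s where "s \<in> ball (cc p) (de/2)" "z = Phi s" using w[OF pI] by auto
   thus "z \<in> ball 0 M" using disc[OF pI] bd[of s] by (auto simp: S_def)
  qed
  show "disjoint_family_on (%p. ball (w p) (r p)) I"
   unfolding disjoint_family_on_def
  proof (intro ballI impI)
   fix p p' assume pp: "p \<in> I" "p' \<in> I" "p ~= p'"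
   have "Phi ` ball (cc p) (de/2) \<inter> Phi ` ball (cc p') (de/2) = Phi ` (ball (cc p) (de/2) \<inter> ball (cc p') (de/2))"
    by (rule inj_on_image_Int[symmetric, OF inj]) (use disc[OF pp(1)] disc[OF pp(2)] in \<open>auto simp: S_def\<close>)
   hence "Phi ` ball (cc p) (de/2) \<inter> Phi ` ball (cc p') (de/2) = {}" using sep[OF pp(3)] by simp
   thus "ball (w p) (r p) \<inter> ball (w p') (r p') = {}" using w[OF pp(1)] w[OF pp(2)] by blast
  qed
 qed (use M de in \<open>auto simp: r_def\<close>)
 hence tot: "(\<Sum>i<N. \<Sum>j<m. (r (i, j))^2) <= M^2" by (simp add: I_def sum.cartesian_product)
 \<comment> \<open>Pigeonhole over the columns; then Cauchy-Schwarz over the rows of the column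
   found bounds the sum of its radii by 2 M / sqrt ba.\<close>
 have "\<exists>i<N. (\<Sum>j<m. (r (i, j))^2) <= M^2 / real N"
 proof (rule ccontr)
  assume "\<not> ?thesis"
  hence "(\<Sum>i<N. M^2 / real N) < (\<Sum>i<N. \<Sum>j<m. (r (i, j))^2)"
   using N by (intro sum_strict_mono) (auto simp: not_le)
  thus False using tot N by simp
 qed
 then obtain i where i: "i < N" "(\<Sum>j<m. (r (i, j))^2) <= M^2 / real N" by blast
 have "(\<Sum>j<m. r (i, j))^2 <= (\<Sum>j<m. (r (i, j))^2) * real (card {..<m})"
  by (rule sum_squared_le_sum_of_squares)
 also have "... <= M^2 / real N * real m" using mult_right_mono[OF i(2), of "real m"] by simp
 also have "... = M^2 * (real m * de) / ba" using de(4) ba N by (simp add: de_def)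
 also have "... <= M^2 * 4 / ba"
  using m1(2) de(3) ep pi3 ba by (intro divide_right_mono mult_left_mono) auto
 also have "... = (2 * M / sqrt ba)^2" using ba by (simp add: power_divide power_mult_distrib)
 finally have sq: "(\<Sum>j<m. r (i, j))^2 <= (2 * M / sqrt ba)^2" .
 have "0 <= 2 * M / sqrt ba" using M ba by simp
 hence rs: "(\<Sum>j<m. r (i, j)) <= 2 * M / sqrt ba" by (rule power2_le_imp_le[OF sq])
 define B where "B j = norm (deriv Phi (cc (i, j))) + e" for j
 have Bsum: "(\<Sum>j<m. B j * de) <= 50 * M / sqrt ba"
 proof -
  have "(\<Sum>j<m. B j * de) = 24 * (\<Sum>j<m. r (i, j)) + real m * de * e"
   by (simp add: B_def r_def sum.distrib sum_distrib_left algebra_simps)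
  also have "... <= 24 * (2 * M / sqrt ba) + 4 * e"
  proof -
   have "real m * de * e <= 4 * e" using m1(2) de(3) ep pi3 e by (intro mult_right_mono) auto
   thus ?thesis using rs by simp
  qed
  also have "... = 49 * M / sqrt ba" by (simp add: e_def field_simps)
  also have "... <= 50 * M / sqrt ba" using M ba by (intro divide_right_mono) auto
  finally show ?thesis .
 qed
 have Bpos: "B j * de >= 0" for j using e de by (simp add: B_def)
 have piece: "norm (Phi (Complex (xx i) y) - Phi (Complex (xx i) (ep + real k * de))) <= B k * de"
  if k: "k < m" and y: "y \<in> {ep + real k * de..ep + (real k + 1) * de}" for k y
 proof -
  define L where "L = closed_segment (Complex (xx i) (ep + real k * de)) (Complex (xx i) (ep + (real k + 1) * de))"
  have Leq: "L = {z. Re z = xx i & Im z \<in> {ep + real k * de..ep + (real k + 1) * de}}"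
  proof -
   have le: "ep + real k * de <= ep + (real k + 1) * de" using de by (simp add: algebra_simps)
   have "L = {z. Re z = xx i & Im z \<in> closed_segment (ep + real k * de) (ep + (real k + 1) * de)}"
    unfolding L_def by (subst closed_segment_same_Re) auto
   thus ?thesis unfolding closed_segment_eq_real_ivl1[OF le] .
  qed
  have top: "(real k + 1) * de <= real m * de" using k de by (intro mult_right_mono) auto
  have bot: "0 <= real k * de" using de by simp
  have LK: "z \<in> K" if "z \<in> L" for z
  proof -
   have "z = Complex (xx i) (Im z)" using that by (simp add: Leq complex_eq_iff)
   thus ?thesis using KI[OF i(1), of "Im z"] that top bot unfolding Leq by auto
  qed
  have cL: "cc (i, k) \<in> K" using KI[OF i(1), of "yy k"] top bot de by (simp add: cc_def yy_def algebra_simps)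
  show ?thesis
  proof (rule order_trans[OF field_differentiable_bound[of L Phi "deriv Phi" "B k"]])
   show "convex L" by (simp add: L_def)
   show "(Phi has_field_derivative deriv Phi z) (at z within L)" if "z \<in> L" for z
    using holomorphic_derivI[OF hol oS[unfolded S_def]] LK[OF that] KS has_field_derivative_at_within
    unfolding S_def by blast
   show "norm (deriv Phi z) <= B k" if z: "z \<in> L" for z
   proof -
    have "z - cc (i, k) = of_real (Im z - yy k) * \<i>"
     using z by (simp add: Leq cc_def complex_eq_iff)
    hence "dist z (cc (i,k)) = \<bar>Im z - yy k\<bar>" by (simp only: dist_norm norm_mult norm_of_real) simp
    also have "... < d0" using z de by (auto simp: Leq yy_def algebra_simps abs_if)
    finally have "dist (deriv Phi z) (deriv Phi (cc (i,k))) < e" using uc[OF cL LK[OF z]] by simp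
    thus ?thesis using norm_triangle_ineq2[of "deriv Phi z" "deriv Phi (cc (i,k))"]
     by (simp add: B_def dist_norm)
   qed
   show "Complex (xx i) y \<in> L" "Complex (xx i) (ep + real k * de) \<in> L"
    using y de by (auto simp: Leq algebra_simps)
   have "norm (Complex (xx i) y - Complex (xx i) (ep + real k * de)) = \<bar>y - (ep + real k * de)\<bar>"
    by (simp add: cmod_def)
   also have "... <= de" using y by (auto simp: algebra_simps)
   finally show "B k * norm (Complex (xx i) y - Complex (xx i) (ep + real k * de)) <= B k * de"
    using e by (intro mult_left_mono) (auto simp: B_def)
  qed
 qed
 have chain: "norm (Phi (Complex (xx i) y) - Phi (Complex (xx i) ep)) <= (\<Sum>j<k. B j * de)"
  if "k <= m" "y \<in> {ep..ep + real k * de}" for k y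
  using that
 proof (induction k arbitrary: y)
  case 0
  thus ?case by simp
 next
  case (Suc k)
  show ?case
  proof (cases "y <= ep + real k * de")
   case True
   hence "norm (Phi (Complex (xx i) y) - Phi (Complex (xx i) ep)) <= (\<Sum>j<k. B j * de)"
    using Suc.IH[of y] Suc.prems by auto
   thus ?thesis using Bpos[of k] by simp
  next
   case False
   have "norm (Phi (Complex (xx i) (ep + real k * de)) - Phi (Complex (xx i) ep)) <= (\<Sum>j<k. B j * de)"
    using Suc.IH[of "ep + real k * de"] Suc.prems de by simp
   moreover have "norm (Phi (Complex (xx i) y) - Phi (Complex (xx i) (ep + real k * de))) <= B k * de"
    using False Suc.prems by (intro piece) (auto simp: algebra_simps)
   ultimately show ?thesis
    using norm_triangle_ineq[of "Phi (Complex (xx i) y) - Phi (Complex (xx i) (ep + real k * de))"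
      "Phi (Complex (xx i) (ep + real k * de)) - Phi (Complex (xx i) ep)"] by simp
  qed
 qed
 show ?thesis
 proof (intro bexI ballI)
  show "xx i \<in> {a..b}" using xx[OF i(1)] by simp
  fix y y' assume y: "y \<in> {ep..pi - ep}" "y' \<in> {ep..pi - ep}"
  have "norm (Phi (Complex (xx i) y) - Phi (Complex (xx i) ep)) <= 50 * M / sqrt ba"
   "norm (Phi (Complex (xx i) y') - Phi (Complex (xx i) ep)) <= 50 * M / sqrt ba"
   using chain[of m y] chain[of m y'] y m1(1) Bsum by auto
  thus "norm (Phi (Complex (xx i) y) - Phi (Complex (xx i) y')) <= 100 * M / sqrt (b - a)"
   using norm_triangle_ineq4[of "Phi (Complex (xx i) y) - Phi (Complex (xx i) ep)" "Phi (Complex (xx i) y') - Phi (Complex (xx i) ep)"]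
   by (simp add: ba_def)
 qed
qed

text \<open>The abscissa found for a truncated strip depends on the truncation; a limit point of
  these abscissae serves all heights at once.\<close>

lemma strip_crosscut:
 fixes Phi :: "complex => complex"
 assumes hol: "Phi holomorphic_on {z. 0 < Im z & Im z < pi}" and inj: "inj_on Phi {z. 0 < Im z & Im z < pi}"
  and bd: "!!z. 0 < Im z ==> Im z < pi ==> norm (Phi z) < M" and ab: "a < b"
 obtains x where "x \<in> {a..b}"
  "!!y y'. y \<in> {0<..<pi} ==> y' \<in> {0<..<pi} ==> norm (Phi (Complex x y) - Phi (Complex x y')) <= 100 * M / sqrt (b - a)"
proof -
 have "\<exists>x\<in>{a..b}. \<forall>y\<in>{1 / (real n + 2)..pi - 1 / (real n + 2)}. \<forall>y'\<in>{1 / (real n + 2)..pi - 1 / (real n + 2)}.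
   norm (Phi (Complex x y) - Phi (Complex x y')) <= 100 * M / sqrt (b - a)" for n :: nat
  by (rule strip_crosscut_aux[OF hol inj bd ab]) auto
 then obtain X where X: "!!n. X n \<in> {a..b}"
  "!!n y y'. y \<in> {1 / (real n + 2)..pi - 1 / (real n + 2)} ==> y' \<in> {1 / (real n + 2)..pi - 1 / (real n + 2)} ==>
   norm (Phi (Complex (X n) y) - Phi (Complex (X n) y')) <= 100 * M / sqrt (b - a)"
  by metis
 obtain x rho where x: "x \<in> {a..b}" "strict_mono rho" "(X \<circ> rho) \<longlonglongrightarrow> x"
  using compact_Icc[of a b] X(1) unfolding compact_def by metis
 show ?thesis
 proof (rule that[OF x(1)])
  fix y y' :: real assume y: "y \<in> {0<..<pi}" "y' \<in> {0<..<pi}"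
  have cont: "(%n. Phi (Complex (X (rho n)) t)) \<longlonglongrightarrow> Phi (Complex x t)" if "t \<in> {0<..<pi}" for t
  proof (rule continuous_on_tendsto_compose[OF holomorphic_on_imp_continuous_on[OF hol]])
   show "(%n. Complex (X (rho n)) t) \<longlonglongrightarrow> Complex x t"
    using x(3) by (intro tendsto_Complex) (auto simp: o_def)
  qed (use that in auto)
  define ep where "ep = min (min y y') (min (pi - y) (pi - y'))"
  have ep: "ep > 0" using y by (auto simp: ep_def)
  have "eventually (%n. 1 / (real n + 2) < ep) sequentially" using ep by real_asymp
  hence ev: "eventually (%n. norm (Phi (Complex (X (rho n)) y) - Phi (Complex (X (rho n)) y')) <= 100 * M / sqrt (b - a)) sequentially"
  proof eventually_elim
   case (elim n)
   have "1 / (real (rho n) + 2) <= 1 / (real n + 2)"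
    using strict_mono_imp_increasing[OF x(2), of n] by (intro divide_left_mono) auto
   thus ?case using elim by (intro X(2)) (auto simp: ep_def)
  qed
  show "norm (Phi (Complex x y) - Phi (Complex x y')) <= 100 * M / sqrt (b - a)"
   by (rule tendsto_upperbound[OF tendsto_norm[OF tendsto_diff[OF cont[OF y(1)] cont[OF y(2)]]] ev]) simp
 qed
qed

text \<open>Uniform local connectedness: small subsets of the curve lie in small subcontinua. For an
  empty \<open>K\<close> the empty set is a possible \<open>si\<close>.\<close>

definition locally_arcwise_small :: "complex set => bool" where
 "locally_arcwise_small Gam \<longleftrightarrow> (\<forall>e>0. \<exists>d>0. \<forall>K\<subseteq>Gam. (\<forall>x\<in>K. \<forall>y\<in>K. dist x y <= d) -->
   (\<exists>si. K \<subseteq> si & si \<subseteq> Gam & compact si & connected si & (\<forall>x\<in>si. \<forall>y\<in>si. dist x y <= e)))"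

lemma connected_avoiding_frontier_subset:
 assumes "connected U" "U \<inter> Gam = {}" "frontier Om \<subseteq> Gam" "U \<inter> Om ~= {}"
 shows "U \<subseteq> Om"
 using connected_Int_frontier[of U Om] assms by blast

text \<open>Crosscut argument. Near a boundary point \<open>ze\<close> the circular arcs T = |ze -
  w| / |ze + w| = const are images of vertical lines of a strip, so one of them has an image of
  small diameter. The closure of this image, completed by a small continuum of the curve, lies in a
  small disc, and by Janiszewski's theorem it cannot separate two points of the domain outside this
  disc. One of \<open>phi 0\<close>, \<open>phi (1/2)\<close> is such a point and lies beyond the
  crosscut; hence everything cut off by the crosscut is mapped into the small disc.\<close>

lemma disc_map_boundary_oscillation:
 fixes phi :: "complex => complex"
 assumes hol: "phi holomorphic_on ball 0 1" and inj: "inj_on phi (ball 0 1)"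
  and bd: "bounded (phi ` ball 0 1)" and fr: "frontier (phi ` ball 0 1) \<subseteq> Gam"
  and Gam: "compact Gam" "phi ` ball 0 1 \<inter> Gam = {}" and lc: "locally_arcwise_small Gam" and e: "e > 0"
 obtains r where "r > 0" 
  "!!ze omg omg'. ze \<in> sphere 0 1 ==> omg \<in> ball 0 1 ==> omg' \<in> ball 0 1 ==> dist omg ze < r ==> dist omg' ze < r ==> dist (phi omg) (phi omg') <= e"
proof -
 define Om where "Om = phi ` ball 0 1"
 have oOm: "open Om" unfolding Om_def by (rule open_mapping_thm3[OF hol open_ball inj])
 have cOm: "connected Om" unfolding Om_def
  by (intro connected_continuous_image holomorphic_on_imp_continuous_on hol) auto
 obtain psi where psi: "psi holomorphic_on Om" "!!s. s \<in> ball 0 1 ==> psi (phi s) = s"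
  using holomorphic_has_inverse[OF hol open_ball inj] unfolding Om_def by metis
 have psic: "continuous_on Om psi" using psi(1) by (rule holomorphic_on_imp_continuous_on)
 obtain M where M: "M > 0" "!!s. s \<in> ball 0 1 ==> norm (phi s) < M"
 proof -
  obtain M0 where "!!x. x \<in> phi ` ball 0 1 ==> norm x <= M0" using bd unfolding bounded_iff by blast
  thus ?thesis by (intro that[of "\<bar>M0\<bar> + 1"]) (force simp: abs_if)+
 qed
 define D0 where "D0 = dist (phi 0) (phi (1/2))"
 have D0: "D0 > 0" using inj_onD[OF inj, of 0 "1/2"] by (auto simp: D0_def)
 define e1 where "e1 = min e D0 / 10"
 have e1: "e1 > 0" "10 * e1 <= e" "10 * e1 <= D0" using e D0 by (auto simp: e1_def)
 from lc e1(1) have "\<exists>d>0. \<forall>K\<subseteq>Gam. (\<forall>x\<in>K. \<forall>y\<in>K. dist x y <= d) -->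
   (\<exists>si. K \<subseteq> si & si \<subseteq> Gam & compact si & connected si & (\<forall>x\<in>si. \<forall>y\<in>si. dist x y <= e1))"
  unfolding locally_arcwise_small_def by simp
 then obtain d where d: "d > 0" and sm: "\<forall>K\<subseteq>Gam. (\<forall>x\<in>K. \<forall>y\<in>K. dist x y <= d) -->
   (\<exists>si. K \<subseteq> si & si \<subseteq> Gam & compact si & connected si & (\<forall>x\<in>si. \<forall>y\<in>si. dist x y <= e1))"
  by (elim exE conjE)
 define l where "l = min d e1"
 have l: "l > 0" "l <= d" "l <= e1" using d e1 by (auto simp: l_def)
 \<comment> \<open>The interval from \<open>a\<close> to -2 is just long enough for the crosscut to
   have diameter at most \<open>l\<close>. The end -2 gives T = exp x < 1/3 on the crosscut, whereas
   T >= 1/3 on the disc of radius 1/2.\<close>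
 define a where "a = -2 - (100 * M / l)^2"
 have a: "a < -2" using M l by (simp add: a_def)
 have lval: "100 * M / sqrt (-2 - a) <= l" using M l by (simp add: a_def real_sqrt_power)
 define r where "r = min 1 (exp a)"
 show ?thesis
 proof (rule that[of r])
  show "r > 0" by (simp add: r_def)
  fix ze omg omg' :: complex assume ze: "ze \<in> sphere 0 1"
   and om: "omg \<in> ball 0 1" "omg' \<in> ball 0 1" "dist omg ze < r" "dist omg' ze < r"
  have z1: "norm ze = 1" "ze ~= 0" using ze by auto
  \<comment> \<open>Cayley transform of the upper half-plane onto the disc with 0 going to
    \<open>ze\<close> and the imaginary unit going to 0. It satisfies T (m ta) = |ta|, so after
    \<open>exp\<close> the level lines of \<open>T\<close> are vertical.\<close>
  define m where "m ta = ze * (\<i> - ta) / (\<i> + ta)" for ta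
  define T where "T w = norm (ze - w) / norm (ze + w)" for w
  have den: "ze + w ~= 0" if "w \<in> ball 0 1" for w
  proof
   assume "ze + w = 0" hence "norm w = norm ze" by (metis add_eq_0_iff norm_minus_cancel)
   thus False using that z1 by simp
  qed
  have hden: "\<i> + ta ~= 0" if "Im ta > 0" for ta using that by (auto simp: complex_eq_iff)
  have mball: "m ta \<in> ball 0 1" if "Im ta > 0" for ta
  proof -
   have "(norm (\<i> - ta))^2 < (norm (\<i> + ta))^2" using that
    by (simp only: cmod_power2) (simp add: power2_eq_square algebra_simps)
   hence "norm (\<i> - ta) < norm (\<i> + ta)" by (rule power_less_imp_less_base) simp
   thus ?thesis using hden[OF that] z1 by (simp add: m_def norm_mult norm_divide)
  qed
  have Tm: "T (m ta) = norm ta" if "Im ta > 0" for ta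
  proof -
   have "ze - m ta = 2 * ze * ta / (\<i> + ta)" "ze + m ta = 2 * ze * \<i> / (\<i> + ta)"
    using hden[OF that] by (simp_all add: m_def field_simps)
   thus ?thesis using hden[OF that] z1 by (simp add: T_def norm_mult norm_divide)
  qed
  have msurj: "\<exists>ta. Im ta > 0 & m ta = w" if w: "w \<in> ball 0 1" for w
  proof -
   define ta where "ta = \<i> * (ze - w) / (ze + w)"
   have "ta = \<i> * ((ze - w) * cnj (ze + w)) / of_real ((norm (ze + w))^2)"
    unfolding ta_def by (subst complex_div_cnj) (simp add: mult.assoc)
   hence "Im ta = Re ((ze - w) * cnj (ze + w)) / (norm (ze + w))^2"
    by (simp add: Im_divide_of_real flip: of_real_power)
   also have "Re ((ze - w) * cnj (ze + w)) = (norm ze)^2 - (norm w)^2"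
    unfolding cmod_power2 by (simp add: power2_eq_square algebra_simps)
   finally have Imta: "Im ta > 0" using w z1 den[OF w] by (simp add: abs_square_less_1)
   have t1: "\<i> - ta = 2 * \<i> * w / (ze + w)" using den[OF w] by (simp add: ta_def field_simps)
   have t2: "\<i> + ta = 2 * \<i> * ze / (ze + w)" using den[OF w] by (simp add: ta_def field_simps)
   have "m ta = w" unfolding m_def t1 t2 using den[OF w] z1 by simp
   with Imta show ?thesis by blast
  qed
  have minj: "ta = ta'" if "Im ta > 0" "Im ta' > 0" "m ta = m ta'" for ta ta'
  proof -
   have "ze * (\<i> - ta) * (\<i> + ta') = ze * (\<i> - ta') * (\<i> + ta)"
    using that(3) hden[OF that(1)] hden[OF that(2)] frac_eq_eq unfolding m_def by blast
   hence "ze * (ta - ta') = 0" by (auto simp: algebra_simps)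
   thus ?thesis using z1 by simp
  qed
  define Str where "Str = {z. 0 < Im z & Im z < pi}"
  have Imexp: "Im (exp z) > 0" if "z \<in> Str" for z using that by (auto simp: Str_def Im_exp sin_gt_zero)
  define Phi where "Phi z = phi (m (exp z))" for z
  have holm: "(%z. m (exp z)) holomorphic_on Str"
   unfolding m_def using hden Imexp by (intro holomorphic_intros) auto
  have h1: "Phi holomorphic_on Str" unfolding Phi_def
   using holomorphic_on_compose_gen[OF holm hol] mball Imexp by (force simp: o_def)
  have h2: "inj_on Phi Str"
  proof (rule inj_onI)
   fix z z' assume zz: "z \<in> Str" "z' \<in> Str" "Phi z = Phi z'"
   hence "m (exp z) = m (exp z')" using inj_onD[OF inj] mball Imexp by (auto simp: Phi_def)
   hence "exp z = exp z'" using minj Imexp zz by blast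
   moreover have "\<bar>Im z - Im z'\<bar> < 2 * pi"
    using zz(1,2) unfolding Str_def mem_Collect_eq abs_less_iff by linarith
   ultimately show "z = z'" by (metis exp_complex_eqI)
  qed
  have h3: "norm (Phi z) < M" if "0 < Im z" "Im z < pi" for z
   using M(2) mball Imexp that by (auto simp: Phi_def Str_def)
  obtain x where x: "x \<in> {a..-2}" and xs: "!!y y'. y \<in> {0<..<pi} ==> y' \<in> {0<..<pi} ==> 
    norm (Phi (Complex x y) - Phi (Complex x y')) <= 100 * M / sqrt (-2 - a)"
   using strip_crosscut[OF h1[unfolded Str_def] h2[unfolded Str_def] h3 a] by metis
  define C where "C = {w \<in> ball 0 1. T w = exp x}"
  define V where "V = phi ` C"
  have Vd: "dist p p' <= l" if "p \<in> V" "p' \<in> V" for p p'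
  proof -
   have *: "\<exists>y. y \<in> {0<..<pi} & p = Phi (Complex x y)" if p: "p \<in> V" for p
   proof -
    obtain w where w: "w \<in> ball 0 1" "T w = exp x" "p = phi w" using p by (auto simp: V_def C_def)
    obtain ta where ta: "Im ta > 0" "m ta = w" using msurj[OF w(1)] by blast
    have n: "norm ta = exp x" using Tm[OF ta(1)] ta(2) w(2) by simp
    have "exp (Complex x (Arg ta)) = rcis (exp x) (Arg ta)" by (simp add: exp_eq_polar rcis_def)
    hence "ta = exp (Complex x (Arg ta))" using rcis_cmod_Arg[of ta] n by simp
    moreover have "Arg ta \<in> {0<..<pi}" using Arg_lt_pi[of ta] ta(1) by auto
    ultimately show ?thesis using ta(2) w(3) by (auto simp: Phi_def)
   qed
   show ?thesis using *[OF that(1)] *[OF that(2)] xs lval by (force simp: dist_norm)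
  qed
  have contT: "continuous_on (ball 0 1) T" unfolding T_def using den by (intro continuous_intros) auto
  have "\<i> * of_real (exp x) \<in> {ta. Im ta > 0}" by simp
  hence "m (\<i> * of_real (exp x)) \<in> C" using mball Tm by (auto simp: C_def norm_mult)
  then obtain v0 where v0: "v0 \<in> V" by (auto simp: V_def)
  have VOm: "V \<subseteq> Om" by (auto simp: V_def C_def Om_def)
  define S where "S = closure V"
  have Scb: "S \<subseteq> cball v0 l" unfolding S_def by (rule closure_minimal) (use Vd v0 in auto)
  have SV: "S \<subseteq> V \<union> Gam"
  proof
   fix p assume p: "p \<in> S"
   show "p \<in> V \<union> Gam"
   proof (cases "p \<in> Om")
    case False
    have "p \<in> closure Om" using p closure_mono[OF VOm] by (auto simp: S_def)
    hence "p \<in> frontier Om" using False oOm by (simp add: frontier_def interior_open)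
    thus ?thesis using fr by (auto simp: Om_def)
   next
    case True
    then obtain w where w: "w \<in> ball 0 1" "p = phi w" by (auto simp: Om_def)
    obtain X where X: "!!n. X n \<in> V" "X \<longlonglongrightarrow> p" using p unfolding S_def closure_sequential by blast
    have XO: "X n \<in> Om" for n using X(1) VOm by blast
    have "(%n. psi (X n)) \<longlonglongrightarrow> psi p"
     by (rule continuous_on_tendsto_compose[OF psic X(2) True]) (simp add: XO)
    hence l0: "(%n. psi (X n)) \<longlonglongrightarrow> w" using w psi(2) by simp
    have XB: "psi (X n) \<in> ball 0 1" for n using XO[of n] psi(2) by (auto simp: Om_def)
    have l1: "(%n. T (psi (X n))) \<longlonglongrightarrow> T w"
     by (rule continuous_on_tendsto_compose[OF contT l0 w(1)]) (use XB in simp)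
    have "T (psi (X n)) = exp x" for n using X(1)[of n] psi(2) by (auto simp: V_def C_def)
    hence "(%n. exp x) \<longlonglongrightarrow> T w" using l1 by simp
    hence "T w = exp x" by (simp add: LIMSEQ_const_iff)
    thus ?thesis using w by (auto simp: V_def C_def)
   qed
  qed
  define K where "K = S \<inter> Gam"
  have "\<exists>si. K \<subseteq> si & si \<subseteq> Gam & compact si & connected si & si \<subseteq> cball v0 (2 * e1)"
  proof (cases "K = {}")
   case True
   thus ?thesis by (intro exI[of _ "{}"]) auto
  next
   case False
   have "dist x y <= l" if "x \<in> S" "y \<in> S" for x y
   proof -
    have "closure V \<subseteq> cball z l" if "z \<in> V" for z by (rule closure_minimal) (use Vd that in auto)
    hence "y \<in> cball z l" if "z \<in> V" for z using that \<open>y \<in> S\<close> unfolding S_def by blast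
    hence "V \<subseteq> cball y l" by (auto simp: dist_commute)
    hence "closure V \<subseteq> cball y l" by (rule closure_minimal) auto
    thus ?thesis using that(1) by (auto simp: S_def dist_commute)
   qed
   hence "\<forall>x\<in>K. \<forall>y\<in>K. dist x y <= d" using l(2) by (force simp: K_def)
   then obtain si where si: "K \<subseteq> si" "si \<subseteq> Gam" "compact si" "connected si" "!!x y. x \<in> si ==> y \<in> si ==> dist x y <= e1"
    using sm[rule_format, of K] by (auto simp: K_def)
   obtain k where k: "k \<in> K" using False by blast
   have "dist v0 y <= 2 * e1" if "y \<in> si" for y
   proof -
    have "dist v0 k <= e1" using k Scb l(3) by (auto simp: K_def)
    moreover have "dist k y <= e1" using si(1,5) k that by blast
    ultimately show ?thesis using dist_triangle[of v0 y k] by linarith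
   qed
   thus ?thesis using si by (intro exI[of _ si]) auto
  qed
  then obtain si where si: "K \<subseteq> si" "si \<subseteq> Gam" "compact si" "connected si" "si \<subseteq> cball v0 (2 * e1)" by blast
  define S' where "S' = S \<union> si"
  have cS: "compact S" unfolding S_def
   by (metis S_def Scb bounded_cball bounded_subset closed_closure compact_eq_bounded_closed)
  have cS': "compact S'" using cS si(3) by (simp add: S'_def compact_Un)
  have S'b: "S' \<subseteq> cball v0 (2 * e1)"
  proof -
   have "cball v0 l \<subseteq> cball v0 (2 * e1)" using l(3) e1(1) by auto
   thus ?thesis using Scb si(5) by (auto simp: S'_def)
  qed
  have S'Gam: "S' \<inter> Gam = si" using si(1,2) by (auto simp: S'_def K_def)
  \<comment> \<open>Neither S' nor \<open>Gam\<close> separates the two image points, and their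
    intersection \<open>si\<close> is connected; hence their union does not separate them, and a
    connected set joining them inside \<open>Om\<close> avoids the crosscut.\<close>
  have same: "T w1 < exp x \<longleftrightarrow> T w2 < exp x"
   if w: "w1 \<in> ball 0 1" "w2 \<in> ball 0 1" "dist v0 (phi w1) > 2 * e1" "dist v0 (phi w2) > 2 * e1" for w1 w2
  proof -
   have "connected_component (- S') (phi w1) (phi w2)"
    unfolding connected_component_def
   proof (intro exI conjI)
    show "connected (- cball v0 (2 * e1))"
     by (rule connected_complement_bounded_convex) auto
   qed (use S'b w in auto)
   moreover have "connected_component (- Gam) (phi w1) (phi w2)"
    unfolding connected_component_def using cOm Gam(2) w by (intro exI[of _ Om]) (auto simp: Om_def)
   ultimately have "connected_component (- (S' \<union> Gam)) (phi w1) (phi w2)"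
    using Janiszewski[OF cS' compact_imp_closed[OF Gam(1)]] S'Gam si(4) by metis
   then obtain U where U: "connected U" "U \<subseteq> - (S' \<union> Gam)" "phi w1 \<in> U" "phi w2 \<in> U"
    unfolding connected_component_def by blast
   have UOm: "U \<subseteq> Om"
    by (rule connected_avoiding_frontier_subset[OF U(1) _ fr[folded Om_def]]) (use U w in \<open>auto simp: Om_def\<close>)
   have cont: "continuous_on U (%u. T (psi u))"
    by (rule continuous_on_compose2[OF contT continuous_on_subset[OF psic UOm]]) (use UOm psi(2) in \<open>force simp: Om_def\<close>)
   have conn: "connected ((%u. T (psi u)) ` U)" by (rule connected_continuous_image[OF cont U(1)])
   have avoid: "exp x \<notin> (%u. T (psi u)) ` U"
   proof
    assume "exp x \<in> (%u. T (psi u)) ` U"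
    then obtain u where u: "u \<in> U" "T (psi u) = exp x" by auto
    then obtain w where "w \<in> ball 0 1" "u = phi w" using UOm by (auto simp: Om_def)
    hence "u \<in> V" using u psi(2) by (auto simp: V_def C_def)
    hence "u \<in> S'" using closure_subset by (auto simp: S'_def S_def)
    thus False using U(2) u(1) by auto
   qed
   have in12: "T w1 \<in> (%u. T (psi u)) ` U" "T w2 \<in> (%u. T (psi u)) ` U"
    using U(3,4) psi(2) w by (force intro!: image_eqI)+
   show ?thesis
    using connectedD_interval[OF conn in12(1) in12(2), of "exp x"] connectedD_interval[OF conn in12(2) in12(1), of "exp x"] avoid in12
    by (metis leI less_eq_real_def)
  qed
  have far: "T w >= 1/3" if "norm w <= 1/2" for w
  proof -
   have "norm (ze - w) >= 1/2" using norm_triangle_ineq2[of ze w] that z1 by simp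
   moreover have "norm (ze + w) <= 3/2" using norm_triangle_ineq[of ze w] that z1 by simp
   moreover have "ze + w ~= 0" using den[of w] that by simp
   ultimately show ?thesis by (simp add: T_def le_divide_eq)
  qed
  have ex3: "exp x < 1/3"
  proof -
   have "exp x <= exp (-2)" using x by simp
   also have "exp (-2) < (1/3 :: real)"
   proof -
    have "(1 + 2) < exp (2::real)" using exp_lower_Taylor_quadratic[of 2] by simp
    thus ?thesis by (simp add: exp_minus field_simps)
   qed
   finally show ?thesis .
  qed
  obtain w2 where w2: "w2 \<in> ball 0 1" "norm w2 <= 1/2" "dist v0 (phi w2) > 2 * e1"
  proof -
   have "dist (phi 0) (phi (1/2)) <= dist v0 (phi 0) + dist v0 (phi (1/2))" by (metis dist_commute dist_triangle)
   hence "dist v0 (phi 0) > 2 * e1 | dist v0 (phi (1/2)) > 2 * e1" using e1 by (auto simp: D0_def)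
   thus ?thesis using that[of 0] that[of "1/2"] by auto
  qed
  have near: "dist v0 (phi w) <= 2 * e1" if w: "w \<in> ball 0 1" "dist w ze < r" for w
  proof (rule ccontr)
   assume "\<not> dist v0 (phi w) <= 2 * e1"
   hence "T w < exp x \<longleftrightarrow> T w2 < exp x" using same[of w w2] w w2 by simp
   moreover have "\<not> T w2 < exp x" using far[OF w2(2)] ex3 by simp
   moreover have "T w < exp x"
   proof -
    have n: "norm (ze - w) < r" using w(2) by (simp add: dist_norm norm_minus_commute)
    have "norm (ze + w) >= 1"
    proof -
     have "ze + w = 2 * ze - (ze - w)" by simp
     hence "norm (ze + w) >= norm (2 * ze) - norm (ze - w)" by (metis norm_triangle_ineq2)
     thus ?thesis using n z1 by (simp add: norm_mult r_def)
    qed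
    hence "norm (ze - w) * 1 <= norm (ze - w) * norm (ze + w)" "norm (ze + w) > 0"
     using mult_left_mono[of 1 "norm (ze + w)" "norm (ze - w)"] by (auto simp del: zero_less_norm_iff)
    hence "T w <= norm (ze - w)" by (simp add: T_def divide_le_eq)
    also have "... < exp a" using n by (simp add: r_def)
    also have "... <= exp x" using x by simp
    finally show ?thesis .
   qed
   ultimately show False by simp
  qed
  have "dist (phi omg) (phi omg') <= dist v0 (phi omg) + dist v0 (phi omg')" by (metis dist_commute dist_triangle)
  thus "dist (phi omg) (phi omg') <= e" using near[of omg] near[of omg'] om e1 by linarith
 qed
qed

section \<open>Chords, arcs and sectors of the circle\<close>

lemma norm_cis_diff: "norm (cis s - cis t) = 2 * \<bar>sin ((s - t) / 2)\<bar>"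
proof -
 have "cis s - cis t = cis t * (exp (\<i> * of_real (s - t)) - 1)"
  by (simp add: cis_conv_exp algebra_simps flip: exp_add)
 thus ?thesis by (simp only: norm_mult dist_exp_i_1) simp
qed

lemma norm_cis_diff_le: "norm (cis s - cis t) <= \<bar>s - t\<bar>"
 using abs_sin_x_le_abs_x[of "(s - t) / 2"] by (simp add: norm_cis_diff)

lemma norm_cis_diff_ge:
 assumes "\<bar>s - t\<bar> <= pi"
 shows "norm (cis s - cis t) >= \<bar>s - t\<bar> / 2"
proof -
 have *: "sin x >= x / 2" if x: "0 <= x" "x <= pi/2" for x :: real
 proof (cases "x <= pi/3")
  case True
  have "sin 0 - 0/2 <= sin x - x/2"
  proof (rule DERIV_nonneg_imp_nondecreasing[OF x(1)])
   fix y assume y: "0 <= y" "y <= x"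
   have "cos (pi/3) <= cos y" using y True by (intro cos_monotone_0_pi_le) auto
   thus "\<exists>d. ((%x. sin x - x/2) has_real_derivative d) (at y) & 0 <= d"
    by (intro exI[of _ "cos y - 1/2"]) (auto intro!: derivative_eq_intros simp: cos_60)
  qed
  thus ?thesis by simp
 next
  case False
  have "sin (pi/3) <= sin x" using False x by (intro sin_monotone_2pi_le) auto
  moreover have "sqrt 3 / 2 >= (4/5 :: real)" using real_le_rsqrt[of "8/5" 3] by (simp add: power2_eq_square)
  moreover have "x / 2 <= 4/5" using x pi_less_4 pi_approx by simp
  ultimately show ?thesis by (simp add: sin_60)
 qed
 have "\<bar>sin ((s - t) / 2)\<bar> = \<bar>sin (\<bar>s - t\<bar> / 2)\<bar>"
 proof (cases "s >= t")
  case False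
  hence "(s - t) / 2 = - (\<bar>s - t\<bar> / 2)" by linarith
  thus ?thesis by (simp only: sin_minus abs_minus_cancel)
 qed simp
 moreover have "\<bar>s - t\<bar> / 2 / 2 <= sin (\<bar>s - t\<bar> / 2)" using assms by (intro *) auto
 ultimately show ?thesis unfolding norm_cis_diff by linarith
qed

lemma cis_image_UNIV: "range cis = sphere 0 1" "cis ` {a..a + 2 * pi} = sphere 0 1"
proof -
 have *: "\<exists>t\<in>{a..a + 2 * pi}. z = cis t" if "z \<in> sphere 0 1" for z
 proof -
  have "z ~= 0" using that by auto
  have "z / cis a = exp (\<i> * of_real (Arg2pi (z / cis a)))"
   using Arg2pi_eq[of "z / cis a"] that by (simp add: norm_divide)
  hence "z = cis (a + Arg2pi (z / cis a))" by (simp add: cis_conv_exp exp_add field_simps)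
  thus ?thesis using Arg2pi_ge_0 Arg2pi_lt_2pi by (intro bexI[of _ "a + Arg2pi (z / cis a)"]) (auto simp: less_imp_le)
 qed
 show "range cis = sphere 0 1" "cis ` {a..a + 2 * pi} = sphere 0 1" using * by force+
qed

lemma cis_inj_on: "inj_on cis {a..<a + 2 * pi}"
proof (rule inj_onI)
 fix s t assume st: "s \<in> {a..<a + 2 * pi}" "t \<in> {a..<a + 2 * pi}" "cis s = cis t"
 hence "exp (\<i> * of_real s) = exp (\<i> * of_real t)" by (simp add: cis_conv_exp)
 hence "\<i> * of_real s = \<i> * of_real t" by (rule exp_complex_eqI[rotated]) (use st in auto)
 thus "s = t" by simp
qed

lemma continuous_on_cis' [continuous_intros]: "continuous_on A cis"
 by (auto intro!: continuous_on_cis continuous_intros)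

lemma connected_sphere_minus:
 assumes "ze \<in> sphere (0::complex) 1"
 shows "connected (sphere 0 1 - {ze})"
proof -
 obtain a where a: "ze = cis a" using cis_image_UNIV(1) assms by (metis image_iff)
 have "sphere 0 1 - {ze} = cis ` {a<..<a + 2 * pi}"
 proof
  show "sphere 0 1 - {ze} \<subseteq> cis ` {a<..<a + 2 * pi}"
  proof
   fix z assume z: "z \<in> sphere 0 1 - {ze}"
   then obtain t where t: "t \<in> {a..a + 2 * pi}" "z = cis t" using cis_image_UNIV(2)[of a] by (metis (no_types) Diff_iff imageE)
   have "t ~= a" using z t a by auto
   moreover have "t ~= a + 2 * pi" using z t a by (auto simp: cis_mult[symmetric])
   ultimately show "z \<in> cis ` {a<..<a + 2 * pi}" using t by auto
  qed
  show "cis ` {a<..<a + 2 * pi} \<subseteq> sphere 0 1 - {ze}"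
   using inj_onD[OF cis_inj_on[of a], of _ a] a by force
 qed
 thus ?thesis by (simp add: connected_continuous_image continuous_on_cis')
qed

text \<open>The continua are images of parameter arcs; uniform continuity of the inverse of
  \<open>h\<close> keeps the parameters of a small set together, and that of \<open>h\<close> keeps
  the image of the arc small.\<close>

lemma locally_arcwise_small_curve:
 fixes h :: "complex => complex"
 assumes cont: "continuous_on (sphere 0 1) h" and inj: "inj_on h (sphere 0 1)"
 shows "locally_arcwise_small (h ` sphere 0 1)"
 unfolding locally_arcwise_small_def
proof (intro allI impI)
 fix e :: real assume e: "e > 0"
 define k where "k = inv_into (sphere 0 1) h"
 have k: "k (h z) = z" if "z \<in> sphere 0 1" for z using that inj by (simp add: k_def)
 have kc: "continuous_on (h ` sphere 0 1) k"
  using cont k by (intro continuous_on_inv) auto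
 have "uniformly_continuous_on (sphere 0 1) h" using cont by (intro compact_uniformly_continuous compact_sphere)
 then obtain eta where eta: "eta > 0" "!!z z'. z \<in> sphere 0 1 ==> z' \<in> sphere 0 1 ==> dist z' z < eta ==> dist (h z') (h z) < e"
  unfolding uniformly_continuous_on_def using e by metis
 define ta where "ta = min (eta / 4) (pi / 2)"
 have ta: "ta > 0" "ta <= eta / 4" "ta <= pi / 2" using eta(1) by (auto simp: ta_def)
 have "uniformly_continuous_on (h ` sphere 0 1) k"
  using kc cont by (intro compact_uniformly_continuous compact_continuous_image compact_sphere)
 then obtain d where d: "d > 0" "!!z z'. z \<in> h ` sphere 0 1 ==> z' \<in> h ` sphere 0 1 ==> dist z' z < d ==> dist (k z') (k z) < ta / 2"
  unfolding uniformly_continuous_on_def using ta(1) by (metis half_gt_zero)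
 show "\<exists>d>0. \<forall>K\<subseteq>h ` sphere 0 1. (\<forall>x\<in>K. \<forall>y\<in>K. dist x y <= d) -->
   (\<exists>si. K \<subseteq> si & si \<subseteq> h ` sphere 0 1 & compact si & connected si & (\<forall>x\<in>si. \<forall>y\<in>si. dist x y <= e))"
 proof (intro exI[of _ "d/2"] conjI allI impI)
  show "d / 2 > 0" using d by simp
  fix K assume K: "K \<subseteq> h ` sphere 0 1" and small: "\<forall>x\<in>K. \<forall>y\<in>K. dist x y <= d / 2"
  show "\<exists>si. K \<subseteq> si & si \<subseteq> h ` sphere 0 1 & compact si & connected si & (\<forall>x\<in>si. \<forall>y\<in>si. dist x y <= e)"
  proof (cases "K = {}")
   case True
   thus ?thesis by (intro exI[of _ "{}"]) auto
  next
   case False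
   then obtain x0 where x0: "x0 \<in> K" by blast
   then obtain z0 where z0: "z0 \<in> sphere 0 1" "x0 = h z0" using K by auto
   obtain t0 where t0: "z0 = cis t0" using cis_image_UNIV(1) z0 by (metis image_iff)
   define A where "A = cis ` {t0 - ta..t0 + ta}"
   have As: "A \<subseteq> sphere 0 1" by (auto simp: A_def)
   show ?thesis
   proof (intro exI[of _ "h ` A"] conjI ballI)
    show "h ` A \<subseteq> h ` sphere 0 1" using As by blast
    show "compact (h ` A)" unfolding A_def
     by (intro compact_continuous_image continuous_on_cis' compact_Icc continuous_on_subset[OF cont]) auto
    show "connected (h ` A)" unfolding A_def
     by (intro connected_continuous_image continuous_on_cis' connected_Icc continuous_on_subset[OF cont]) auto
    show "K \<subseteq> h ` A"
    proof
     fix x assume x: "x \<in> K"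
     then obtain z where z: "z \<in> sphere 0 1" "x = h z" using K by auto
     have "dist x x0 <= d / 2" using small x x0 by blast
     hence "dist x x0 < d" using d(1) by linarith
     hence "dist z z0 < ta / 2" using d(2)[of x0 x] z z0 k by auto
     obtain t where t: "t \<in> {t0 - pi..t0 - pi + 2 * pi}" "z = cis t" using cis_image_UNIV(2)[of "t0 - pi"] z by (metis image_iff)
     have "\<bar>t - t0\<bar> <= pi" using t(1) unfolding atLeastAtMost_iff abs_le_iff by linarith
     hence "\<bar>t - t0\<bar> / 2 <= norm (cis t - cis t0)" by (rule norm_cis_diff_ge)
     hence "\<bar>t - t0\<bar> < ta" using \<open>dist z z0 < ta / 2\<close> by (simp add: dist_norm t t0)
     thus "x \<in> h ` A" using z t by (auto simp: A_def abs_less_iff)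
    qed
    fix x y assume "x \<in> h ` A" "y \<in> h ` A"
    then obtain s t where st: "s \<in> {t0 - ta..t0 + ta}" "t \<in> {t0 - ta..t0 + ta}" "x = h (cis s)" "y = h (cis t)"
     by (auto simp: A_def)
    have "dist (cis s) (cis t) <= \<bar>s - t\<bar>" using norm_cis_diff_le by (simp add: dist_norm)
    also have "... <= 2 * ta" using st by (auto simp: abs_le_iff)
    also have "... < eta" using ta eta by linarith
    finally show "dist x y <= e" using eta(2)[of "cis t" "cis s"] st by (simp add: less_imp_le)
   qed
  qed
 qed
qed

text \<open>The two open sectors between the radii are written as images under \<open>exp\<close>,
  so that they are open by the open mapping theorem.\<close>

lemma ball_sector_cases:
 assumes "w \<in> ball (0::complex) 1" "al < be" "be < al + 2 * pi"
 shows "w \<in> exp ` {z. Re z < 0 & al < Im z & Im z < be} | w \<in> exp ` {z. Re z < 0 & be < Im z & Im z < al + 2 * pi}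
  | w \<in> closed_segment 0 (cis al) | w \<in> closed_segment 0 (cis be)"
proof (cases "w = 0")
 case False
 have "sgn w \<in> sphere 0 1" using False by (simp add: norm_sgn)
 then obtain t where t: "t \<in> {al..al + 2 * pi}" "sgn w = cis t" using cis_image_UNIV(2)[of al] by (metis image_iff)
 have w: "w = of_real (norm w) * cis t" using t(2) False by (simp add: sgn_eq field_simps)
 have e: "w = exp (Complex (ln (norm w)) t)" using False by (subst w) (simp add: exp_eq_polar)
 have l: "ln (norm w) < 0" using assms(1) False by simp
 have seg: "w \<in> closed_segment 0 (cis s)" if "cis t = cis s" for s
  unfolding closed_segment_def using w that assms(1) by (auto intro!: exI[of _ "norm w"] simp: scaleR_conv_of_real)
 consider "al < t & t < be" | "be < t & t < al + 2 * pi" | "t = al | t = be | t = al + 2 * pi" using t by fastforce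
 thus ?thesis
 proof cases
  case 1 thus ?thesis using e l by (intro disjI1) (auto intro!: image_eqI)
 next
  case 2 thus ?thesis using e l by (intro disjI2 disjI1) (auto intro!: image_eqI)
 next
  case 3 thus ?thesis using seg[of al] seg[of be] by (auto simp: cis_mult[symmetric])
 qed
qed auto

text \<open>Caratheodory's theorem. The extension comes from uniform continuity, which is the
  oscillation bound near the circle and compactness elsewhere; injectivity on the circle is a
  separation argument with two radii.\<close>

lemma disc_map_extends:
 fixes phi h :: "complex => complex"
 assumes hol: "phi holomorphic_on ball 0 1" and inj: "inj_on phi (ball 0 1)"
  and bd: "bounded (phi ` ball 0 1)" and fr: "frontier (phi ` ball 0 1) = h ` sphere 0 1"
  and h: "continuous_on (sphere 0 1) h" "inj_on h (sphere 0 1)"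
 obtains Phi where "disc_chart Phi" "!!w. w \<in> ball 0 1 ==> Phi w = phi w" "Phi ` sphere 0 1 = h ` sphere 0 1"
proof -
 define Om where "Om = phi ` ball 0 1"
 define Gam where "Gam = h ` sphere 0 1"
 have oOm: "open Om" unfolding Om_def by (rule open_mapping_thm3[OF hol open_ball inj])
 have cont: "continuous_on (ball 0 1) phi" by (rule holomorphic_on_imp_continuous_on[OF hol])
 have cOm: "connected Om" unfolding Om_def by (intro connected_continuous_image cont) auto
 have fr': "frontier Om = Gam" using fr by (simp add: Om_def Gam_def)
 have cGam: "compact Gam" unfolding Gam_def by (intro compact_continuous_image h(1) compact_sphere)
 have disj: "Om \<inter> Gam = {}" using oOm fr' frontier_disjoint_eq by blast
 have lc: "locally_arcwise_small Gam" unfolding Gam_def by (rule locally_arcwise_small_curve[OF h])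
 obtain psi where psi: "psi holomorphic_on Om" "!!s. s \<in> ball 0 1 ==> psi (phi s) = s"
  using holomorphic_has_inverse[OF hol open_ball inj] unfolding Om_def by metis
 have psic: "continuous_on Om psi" using psi(1) by (rule holomorphic_on_imp_continuous_on)
 have "uniformly_continuous_on (ball 0 1) phi"
  unfolding uniformly_continuous_on_def
 proof (intro allI impI)
  fix e :: real assume e: "e > 0"
  obtain r where r: "r > 0" 
   "!!ze omg omg'. ze \<in> sphere 0 1 ==> omg \<in> ball 0 1 ==> omg' \<in> ball 0 1 ==> dist omg ze < r ==> dist omg' ze < r ==> dist (phi omg) (phi omg') <= e/2"
   using disc_map_boundary_oscillation[OF hol inj bd _ cGam _ lc, of "e/2"] e fr' disj unfolding Om_def by (metis half_gt_zero order_refl)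
  \<comment> \<open>Within \<open>q\<close> of the circle the oscillation bound is applied at the
    nearest boundary point \<open>sgn z\<close>.\<close>
  define q where "q = min (1/2) (r/4)"
  have q: "0 < q" "q <= 1/2" "q <= r/4" using r by (auto simp: q_def)
  have "uniformly_continuous_on (cball 0 (1 - q)) phi"
   by (intro compact_uniformly_continuous continuous_on_subset[OF cont]) (use q in auto)
  then obtain d where d: "d > 0" "!!z z'. z \<in> cball 0 (1 - q) ==> z' \<in> cball 0 (1 - q) ==> dist z' z < d ==> dist (phi z') (phi z) < e"
   unfolding uniformly_continuous_on_def using e by metis
  have main: "dist (phi z') (phi z) < e" if z: "z \<in> ball 0 1" "z' \<in> ball 0 1" "dist z' z < r/4" "norm z > 1 - q" for z z'
  proof -
   have "z ~= 0" using z q by auto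
   hence "dist (sgn z) z = 1 - norm z"
   proof -
    have "sgn z - z = of_real (1 / norm z - 1) * z" using \<open>z ~= 0\<close> by (simp add: sgn_eq algebra_simps)
    hence "norm (sgn z - z) = \<bar>1 / norm z - 1\<bar> * norm z" by (simp only: norm_mult norm_of_real)
    thus ?thesis using \<open>z ~= 0\<close> z by (simp add: dist_norm field_simps)
   qed
   hence d1: "dist z (sgn z) < r/4 + r/4" using z(4) q r(1) by (simp add: dist_commute)
   have "dist z' (sgn z) < r" using d1 z(3) dist_triangle[of z' "sgn z" z] r(1)
    using \<open>dist (sgn z) z = 1 - norm z\<close> z(4) q by (simp add: dist_commute)
   hence "dist (phi z') (phi z) <= e/2" using d1 r(1) z \<open>z ~= 0\<close> by (intro r(2)[of "sgn z"]) (auto simp: norm_sgn)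
   thus ?thesis using e by simp
  qed
  show "\<exists>d>0. \<forall>x\<in>ball 0 1. \<forall>x'\<in>ball 0 1. dist x' x < d --> dist (phi x') (phi x) < e"
  proof (intro exI[of _ "min d (r/4)"] conjI ballI impI)
   fix x x' :: complex assume x: "x \<in> ball 0 1" "x' \<in> ball 0 1" "dist x' x < min d (r/4)"
   show "dist (phi x') (phi x) < e"
   proof (cases "norm x > 1 - q")
    case True
    thus ?thesis using main x by simp
   next
    case F: False
    show ?thesis
    proof (cases "norm x' > 1 - q")
     case True
     thus ?thesis using main[of x' x] x by (simp add: dist_commute)
    next
     case False
     thus ?thesis using d(2)[of x x'] F x by simp
    qed
   qed
  qed (use d r in auto)
 qed
 from uniformly_continuous_on_extension_on_closure[OF this] obtain Phi where
  Phiu: "uniformly_continuous_on (closure (ball 0 1)) Phi" and Phie: "!!x. x \<in> ball 0 1 ==> phi x = Phi x" by metis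
 have Phic: "continuous_on (cball 0 1) Phi" using uniformly_continuous_imp_continuous[OF Phiu] by simp
 have Phihol: "Phi holomorphic_on ball 0 1" using hol Phie by (metis holomorphic_transform)
 have PhiOm: "Phi ` ball 0 1 = Om" using Phie by (auto simp: Om_def)
 have cb: "cball (0::complex) 1 = ball 0 1 \<union> sphere 0 1" by auto
 have cl: "Phi ` cball 0 1 = closure Om"
 proof
  have "Phi ` closure (ball 0 1) \<subseteq> closure Om"
   by (rule image_closure_subset) (use Phic PhiOm closure_subset[of Om] in auto)
  thus "Phi ` cball 0 1 \<subseteq> closure Om" by simp
  show "closure Om \<subseteq> Phi ` cball 0 1"
  proof (rule closure_minimal)
   show "Om \<subseteq> Phi ` cball 0 1" using PhiOm ball_subset_cball by blast
   show "closed (Phi ` cball 0 1)" using Phic by (simp add: compact_continuous_image compact_imp_closed)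
  qed
 qed
 \<comment> \<open>A boundary value inside \<open>Om\<close> would be the image of an interior
   point, and the continuous inverse would carry the images of a sequence tending to
   \<open>ze\<close> to that point.\<close>
 have bnd: "Phi ze \<in> Gam" if ze: "ze \<in> sphere 0 1" for ze
 proof (rule ccontr)
  assume "Phi ze \<notin> Gam"
  moreover have "Phi ze \<in> closure Om" using cl ze cb by blast
  ultimately have inOm: "Phi ze \<in> Om" using fr' oOm by (auto simp: frontier_def interior_open)
  define X where "X n = of_real (1 - 1 / (real n + 1)) * ze" for n :: nat
  have Xb: "X n \<in> ball 0 1" for n
  proof -
   have "norm (X n) = 1 - 1 / (real n + 1)" using ze by (simp only: X_def norm_mult norm_of_real) simp
   thus ?thesis by simp
  qed
  have "(%n. 1 - 1 / (real n + 1)) \<longlonglongrightarrow> 1" by real_asymp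
  hence "(%n. complex_of_real (1 - 1 / (real n + 1))) \<longlonglongrightarrow> of_real 1" by (rule tendsto_of_real)
  hence Xl: "X \<longlonglongrightarrow> ze" unfolding X_def using tendsto_mult_right[of _ 1 sequentially ze] by simp
  have "(%n. Phi (X n)) \<longlonglongrightarrow> Phi ze"
   by (rule continuous_on_tendsto_compose[OF Phic Xl]) (use ze Xb in \<open>auto intro!: always_eventually simp: less_imp_le\<close>)
  moreover have "Phi (X n) \<in> Om" for n using Xb PhiOm by blast
  ultimately have "(%n. psi (Phi (X n))) \<longlonglongrightarrow> psi (Phi ze)"
   by (intro continuous_on_tendsto_compose[OF psic _ inOm]) auto
  moreover have "psi (Phi (X n)) = X n" for n using psi(2) Phie Xb by metis
  ultimately have "psi (Phi ze) = ze" using Xl LIMSEQ_unique by fastforce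
  moreover have "psi (Phi ze) \<in> ball 0 1" using inOm psi(2) by (auto simp: Om_def)
  ultimately show False using ze by simp
 qed
 have surj: "Phi ` sphere 0 1 = Gam"
 proof
  show "Phi ` sphere 0 1 \<subseteq> Gam" using bnd by blast
  show "Gam \<subseteq> Phi ` sphere 0 1"
  proof
   fix x assume x: "x \<in> Gam"
   hence "x \<in> closure Om" using fr' by (auto simp: frontier_def)
   then obtain w where "w \<in> cball 0 1" "x = Phi w" using cl by (metis imageE)
   moreover have "w \<notin> ball 0 1" using calculation x disj PhiOm by blast
   ultimately show "x \<in> Phi ` sphere 0 1" using cb by blast
  qed
 qed
 \<comment> \<open>If two boundary points had the same image \<open>q\<close>, the image
   \<open>S\<close> of the two radii would meet the curve only in \<open>q\<close>. By Janiszewski's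
   theorem \<open>S\<close> separates the images of the two sectors. But the connected set Gam - {q}
   avoids \<open>S\<close> and touches both images, because \<open>Phi\<close> is not constantly
   \<open>q\<close> on either boundary arc.\<close>
 have key: False if ab: "al < be" "be < al + 2 * pi" and eq: "Phi (cis al) = Phi (cis be)" for al be
 proof -
  define q where "q = Phi (cis al)"
  have qGam: "q \<in> Gam" using bnd by (simp add: q_def)
  define A where "A = exp ` {z. Re z < 0 & al < Im z & Im z < be}"
  define B where "B = exp ` {z. Re z < 0 & be < Im z & Im z < al + 2 * pi}"
  have opn: "open (exp ` {z. Re z < 0 & s < Im z & Im z < t})" if "t <= s + 2 * pi" for s t
  proof (rule open_mapping_thm3)
   show "open {z. Re z < 0 & s < Im z & Im z < t}"
    by (intro open_Collect_conj open_halfspace_Im_gt open_halfspace_Im_lt open_halfspace_Re_lt)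
   show "inj_on exp {z. Re z < 0 & s < Im z & Im z < t}"
   proof (rule inj_onI)
    fix z z' :: complex assume z: "z \<in> {z. Re z < 0 & s < Im z & Im z < t}" "z' \<in> {z. Re z < 0 & s < Im z & Im z < t}" "exp z = exp z'"
    hence "\<bar>Im z - Im z'\<bar> < 2 * pi" using that unfolding mem_Collect_eq by linarith
    thus "z = z'" using z(3) by (rule exp_complex_eqI)
   qed
  qed (intro holomorphic_intros)
  have oA: "open A" and oB: "open B" unfolding A_def B_def using ab by (auto intro!: opn)
  have AB: "A \<inter> B = {}"
  proof (rule ccontr)
   assume "A \<inter> B ~= {}"
   then obtain x where "x \<in> A" "x \<in> B" by blast
   obtain z where "x = exp z" "al < Im z" "Im z < be" using \<open>x \<in> A\<close> unfolding A_def by blast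
   moreover obtain z' where "x = exp z'" "be < Im z'" "Im z' < al + 2 * pi" using \<open>x \<in> B\<close> unfolding B_def by blast
   ultimately have z: "al < Im z" "Im z < be" "be < Im z'" "Im z' < al + 2 * pi" "exp z = exp z'" by simp_all
   have "\<bar>Im z - Im z'\<bar> < 2 * pi" using z by linarith
   hence "z = z'" using z(5) by (rule exp_complex_eqI)
   thus False using z by simp
  qed
  define L where "L = closed_segment 0 (cis al) \<union> closed_segment 0 (cis be)"
  have Lc: "L \<subseteq> cball 0 1" unfolding L_def
   by (intro Un_least closed_segment_subset) auto
  have Ls: "w = cis al | w = cis be" if "w \<in> L" "w \<in> sphere 0 1" for w
   using that by (auto simp: L_def closed_segment_def norm_mult)
  define S where "S = Phi ` L"
  have cS: "compact S" unfolding S_def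
   by (intro compact_continuous_image continuous_on_subset[OF Phic Lc]) (auto simp: L_def)
  have SGam: "S \<inter> Gam = {q}"
  proof
   show "{q} \<subseteq> S \<inter> Gam" using qGam by (auto simp: S_def q_def L_def)
   show "S \<inter> Gam \<subseteq> {q}"
   proof
    fix x assume "x \<in> S \<inter> Gam"
    then obtain w where w: "w \<in> L" "x = Phi w" "x \<in> Gam" by (auto simp: S_def)
    have "w \<notin> ball 0 1" using w disj PhiOm by blast
    hence "w \<in> sphere 0 1" using w(1) Lc cb by blast
    thus "x \<in> {q}" using Ls[OF w(1)] w(2) eq by (auto simp: q_def)
   qed
  qed
  have ball_sub: "A \<subseteq> ball 0 1" "B \<subseteq> ball 0 1" by (auto simp: A_def B_def)
  have notconn: "\<not> connected_component (- S) (Phi a) (Phi b)" if aA: "a \<in> A" and bB: "b \<in> B" for a b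
  proof
   assume "connected_component (- S) (Phi a) (Phi b)"
   moreover have "connected_component (- Gam) (Phi a) (Phi b)"
    unfolding connected_component_def using cOm disj aA bB ball_sub PhiOm by (intro exI[of _ Om]) blast
   ultimately have "connected_component (- (S \<union> Gam)) (Phi a) (Phi b)"
    using Janiszewski[OF cS compact_imp_closed[OF cGam]] SGam by simp
   then obtain U where U: "connected U" "U \<subseteq> - (S \<union> Gam)" "Phi a \<in> U" "Phi b \<in> U"
    unfolding connected_component_def by blast
   have UOm: "U \<subseteq> Om"
    by (rule connected_avoiding_frontier_subset[OF U(1), of Gam]) (use U fr' aA ball_sub PhiOm in blast)+
   have conn: "connected (psi ` U)" by (rule connected_continuous_image[OF continuous_on_subset[OF psic UOm] U(1)])
   have "psi ` U \<subseteq> A \<union> B"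
   proof
    fix w assume "w \<in> psi ` U"
    then obtain u where u: "u \<in> U" "w = psi u" by auto
    then obtain w' where w': "w' \<in> ball 0 1" "u = phi w'" using UOm by (auto simp: Om_def)
    hence "w = w'" using u(2) psi(2) by simp
    hence w: "w \<in> ball 0 1" "u = Phi w" using w' Phie by simp_all
    have "w \<notin> L" using u(1) w(2) U(2) unfolding S_def by blast
    thus "w \<in> A \<union> B" using ball_sector_cases[OF w(1) ab] unfolding A_def B_def L_def by blast
   qed
   moreover have "psi (Phi a) = a" "psi (Phi b) = b" using psi(2) Phie aA bB ball_sub by auto
   hence "a \<in> psi ` U" "b \<in> psi ` U" using U by (metis imageI)+
   ultimately show False using connectedD[OF conn oA oB] AB aA bB by blast
  qed
  have near: "\<exists>a\<in>exp ` {z. Re z < 0 & s0 < Im z & Im z < t0}. connected_component (- S) (Phi (cis t)) (Phi a)"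
   if t: "s0 < t" "t < t0" "Phi (cis t) ~= q" for s0 t0 t
  proof -
   have x: "Phi (cis t) \<in> - S" using t SGam bnd[of "cis t"] by auto
   obtain e where e: "e > 0" "ball (Phi (cis t)) e \<subseteq> - S"
    using compact_imp_closed[OF cS] x open_contains_ball[of "- S"] by (auto simp: open_Compl)
   have lim: "((%r. exp (Complex r t)) \<longlongrightarrow> cis t) (at_left 0)"
   proof -
    have "((%r. exp (Complex r t)) \<longlongrightarrow> exp (Complex 0 t)) (at_left 0)"
     by (intro tendsto_intros tendsto_Complex)
    thus ?thesis by (simp add: exp_eq_polar)
   qed
   have ev0: "eventually (%r::real. r < 0) (at_left 0)" by (simp add: eventually_at_filter)
   have "((%r. Phi (exp (Complex r t))) \<longlongrightarrow> Phi (cis t)) (at_left 0)"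
    by (rule continuous_on_tendsto_compose[OF Phic lim])
      (use ev0 in \<open>auto elim!: eventually_mono simp: exp_eq_polar norm_mult\<close>)
   hence "eventually (%r. dist (Phi (exp (Complex r t))) (Phi (cis t)) < e) (at_left 0)"
    using e(1) by (rule tendstoD)
   with ev0 have "eventually (%r. r < 0 & dist (Phi (exp (Complex r t))) (Phi (cis t)) < e) (at_left 0)"
    by eventually_elim auto
   then obtain r where r: "r < 0" "dist (Phi (exp (Complex r t))) (Phi (cis t)) < e"
    using eventually_happens'[OF trivial_limit_at_left_real] by blast
   show ?thesis
   proof (intro bexI)
    show "connected_component (- S) (Phi (cis t)) (Phi (exp (Complex r t)))"
     unfolding connected_component_def using e r
     by (intro exI[of _ "ball (Phi (cis t)) e"]) (auto simp: dist_commute)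
    show "exp (Complex r t) \<in> exp ` {z. Re z < 0 & s0 < Im z & Im z < t0}" using r t by auto
   qed
  qed
  \<comment> \<open>On an arc with constant value \<open>q\<close> the rotation estimate holds with
    bound 0, which forces \<open>phi 0 = q\<close>.\<close>
  have const: False if st: "s < t" and cq: "!!x. s < x ==> x < t ==> Phi (cis x) = q" for s t
  proof -
   obtain n :: nat where n: "n > 0" "2 * pi / real n < (t - s) / 2"
   proof -
    have "0 < (t - s) / 2 / (2 * pi)" using st by simp
    from ex_inverse_of_nat_less[OF this] obtain n where n: "n > 0" "inverse (real n) < (t - s) / 2 / (2 * pi)" by blast
    hence "2 * pi / real n < (t - s) / 2" by (simp add: field_simps)
    thus ?thesis using that n(1) by blast
   qed
   obtain M where M: "!!x. x \<in> Om ==> norm x <= M" using bd unfolding bounded_iff Om_def by blast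
   have "norm (phi 0 - q) ^ n <= 0 * (M + norm q) ^ (n - 1)"
   proof (rule norm_power_le_of_small_on_arc[where al = "s + (t - s)/4" and be = "t - (t - s)/4"])
    show "(%w. phi w - q) holomorphic_on ball 0 1" by (intro holomorphic_intros hol)
    show "norm (phi z - q) <= M + norm q" if "z \<in> ball 0 1" for z
     using M[of "phi z"] that norm_triangle_ineq4[of "phi z" q] by (auto simp: Om_def)
    show "t - (t - s) / 4 - (s + (t - s) / 4) >= 2 * pi / real n" using n by (simp add: field_simps)
    fix x e :: real assume x: "x \<in> {s + (t - s) / 4..t - (t - s) / 4}" and e: "e > 0"
    have "((%w. Phi w) \<longlongrightarrow> Phi (cis x)) (at (cis x) within cball 0 1)" using Phic by (simp add: continuous_on)
    hence "((%w. Phi w) \<longlongrightarrow> Phi (cis x)) (at (cis x) within ball 0 1)" by (rule tendsto_within_subset) auto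
    moreover have "Phi (cis x) = q" using x st by (intro cq) (auto simp: field_simps)
    ultimately have "eventually (%w. dist (Phi w) q < e) (at (cis x) within ball 0 1)" using e by (metis tendstoD)
    moreover have "eventually (%w. w \<in> ball 0 1) (at (cis x) within ball 0 1)" by (simp add: eventually_at_filter)
    ultimately show "eventually (%w. norm (phi w - q) < 0 + e) (at (cis x) within ball 0 1)"
     by eventually_elim (use Phie in \<open>auto simp: dist_norm\<close>)
   qed (use n in auto)
   hence "norm (phi 0 - q) ^ n = 0" using zero_le_power[OF norm_ge_zero, of "phi 0 - q" n] by linarith
   hence "phi 0 = q" using n by simp
   moreover have "phi 0 \<in> Om" by (simp add: Om_def)
   ultimately show False using qGam disj by blast
  qed
  obtain t1 where t1: "al < t1" "t1 < be" "Phi (cis t1) ~= q" using const[OF ab(1)] by blast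
  obtain t2 where t2: "be < t2" "t2 < al + 2 * pi" "Phi (cis t2) ~= q" using const[OF ab(2)] by blast
  obtain a b where a: "a \<in> A" "connected_component (- S) (Phi (cis t1)) (Phi a)"
   and b: "b \<in> B" "connected_component (- S) (Phi (cis t2)) (Phi b)"
   using near[OF t1] near[OF t2] by (auto simp: A_def B_def)
  obtain zq where zq: "zq \<in> sphere 0 1" "q = h zq" using qGam by (auto simp: Gam_def)
  have "Gam - {q} = h ` (sphere 0 1 - {zq})" using zq h(2) by (auto simp: Gam_def inj_on_def)
  moreover have "connected (h ` (sphere 0 1 - {zq}))"
   by (intro connected_continuous_image connected_sphere_minus zq(1) continuous_on_subset[OF h(1)]) auto
  ultimately have "connected (Gam - {q})" by simp
  hence "connected_component (- S) (Phi (cis t1)) (Phi (cis t2))"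
   unfolding connected_component_def
   by (intro exI[of _ "Gam - {q}"]) (use SGam bnd t1 t2 in auto)
  hence "connected_component (- S) (Phi a) (Phi b)"
   using a b by (meson connected_component_sym connected_component_trans)
  thus False using notconn a b by blast
 qed
 have "inj_on Phi (cball 0 1)"
 proof (rule inj_onI)
  fix w w' assume w: "w \<in> cball 0 1" "w' \<in> cball 0 1" "Phi w = Phi w'"
  consider "w \<in> ball 0 1" "w' \<in> ball 0 1" | "w \<in> sphere 0 1" "w' \<in> sphere 0 1"
   | "w \<in> ball 0 1" "w' \<in> sphere 0 1" | "w \<in> sphere 0 1" "w' \<in> ball 0 1" using w cb by blast
  thus "w = w'"
  proof cases
   case 1 thus ?thesis using w(3) Phie inj_onD[OF inj, of w w'] by simp
  next
   case 2
   obtain s where s: "w = cis s" using 2 cis_image_UNIV(1) by (metis image_iff)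
   obtain t where t: "t \<in> {s..s + 2 * pi}" "w' = cis t" using 2 cis_image_UNIV(2)[of s] by (metis image_iff)
   show ?thesis
   proof (rule ccontr)
    assume ne: "w ~= w'"
    have "cis (s + 2 * pi) = cis s" by (simp add: cis_mult[symmetric])
    hence "t ~= s" "t ~= s + 2 * pi" using ne s t(2) by metis+
    hence "s < t" "t < s + 2 * pi" using t(1) by auto
    thus False using key[of s t] w(3) s t(2) by simp
   qed
  next
   case 3
   hence "Phi w \<in> Om" "Phi w \<in> Gam" using w(3) bnd[of w'] PhiOm by (metis imageI)+
   thus ?thesis using disj by blast
  next
   case 4
   hence "Phi w' \<in> Om" "Phi w' \<in> Gam" using w(3) bnd[of w] PhiOm by (metis imageI)+
   thus ?thesis using disj by blast
  qed
 qed
 hence "disc_chart Phi" using Phic Phihol by (simp add: disc_chart_def)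
 thus ?thesis by (rule that[of Phi]) (use Phie surj in \<open>simp_all add: Gam_def\<close>)
qed

lemma jordan_disc_chart:
 fixes h :: "complex => complex"
 assumes h: "continuous_on (sphere 0 1) h" "inj_on h (sphere 0 1)" and p: "p \<in> inside (h ` sphere 0 1)"
 obtains phi where "disc_chart phi" "phi ` ball 0 1 = inside (h ` sphere 0 1)" "phi ` sphere 0 1 = h ` sphere 0 1" "phi 0 = p"
proof -
 define c where "c = h \<circ> circlepath 0 1"
 have img: "path_image c = h ` sphere 0 1"
  unfolding c_def path_image_compose by (simp add: path_image_circlepath)
 have sp: "simple_path c" unfolding c_def
  by (rule simple_path_continuous_image) (use h in \<open>simp_all add: path_image_circlepath simple_path_circlepath\<close>)
 have cl: "pathfinish c = pathstart c" by (simp add: c_def pathfinish_compose pathstart_compose)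
 define S where "S = inside (h ` sphere 0 1)"
 have S: "open S" "bounded S" "frontier S = h ` sphere 0 1" "simply_connected S"
  using Jordan_inside_outside[OF sp cl] simply_connected_inside_simple_path[OF sp] by (simp_all add: img S_def)
 have "S ~= UNIV" using S(2) not_bounded_UNIV by metis
 have pS: "p \<in> S" using p by (simp add: S_def)
 obtain f g where "f holomorphic_on S" "g holomorphic_on ball 0 1"
   "\<forall>z\<in>S. f z \<in> ball 0 1 & g (f z) = z" "\<forall>z\<in>ball 0 1. g z \<in> S & f (g z) = z"
  using iffD1[OF Riemann_mapping_theorem conjI[OF S(1,4)]] pS \<open>S ~= UNIV\<close> by blast
 note fg = this(1,2) bspec[OF this(3)] bspec[OF this(4)]
 define a where "a = f p"
 have a: "norm a < 1" using fg(3)[OF pS] by (simp add: a_def)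
 note D = disc_shift_bij[OF a]
 have gi: "inj_on g (ball 0 1)" using fg(4) by (metis inj_onI)
 have gim: "g ` ball 0 1 = S" using fg(3,4) by (metis (no_types, lifting) image_eqI image_subsetI subsetI subset_antisym)
 define k where "k = g \<circ> disc_shift a"
 have k1: "k holomorphic_on ball 0 1" unfolding k_def
  by (rule holomorphic_on_compose_gen[OF disc_shift_holomorphic(1)[OF a] fg(2)]) (simp add: D)
 have k2: "inj_on k (ball 0 1)" unfolding k_def
  by (rule comp_inj_on) (use D(4) gi in \<open>auto simp: D(1) intro: inj_on_subset\<close>)
 have k3: "k ` ball 0 1 = S" unfolding k_def image_comp[symmetric] D(1) gim ..
 have k4: "k 0 = p" using fg(3)[OF pS] by (simp add: k_def disc_shift_def a_def)
 obtain Phi where Phi: "disc_chart Phi" "!!w. w \<in> ball 0 1 ==> Phi w = k w" "Phi ` sphere 0 1 = h ` sphere 0 1"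
  by (rule disc_map_extends[OF k1 k2 _ _ h]) (simp_all add: k3 S)
 have "Phi ` ball 0 1 = S" using Phi(2) k3 by (metis image_cong)
 moreover have "Phi 0 = p" using Phi(2) k4 by simp
 ultimately show ?thesis using that Phi by (simp add: S_def)
qed

section \<open>Lifts of circle homeomorphisms to the line\<close>

lemma cis_eq_iff_int: "cis s = cis t \<longleftrightarrow> (\<exists>n::int. s = t + 2 * pi * of_int n)"
proof -
 have "s *\<^sub>R \<i> = t *\<^sub>R \<i> + (of_int (2 * n) * pi) * \<i> \<longleftrightarrow> s = t + 2 * pi * of_int n" for n
  by (simp add: complex_eq_iff algebra_simps)
 thus ?thesis unfolding cis_conv_exp exp_eq scaleR_conv_of_real by (simp add: mult.commute)
qed

lemma shift_2pi_iterate: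
 fixes g :: "real => real"
 assumes "!!x. g (x + 2 * pi) = g x + 2 * pi"
 shows "g (x + 2 * pi * of_int n) = g x + 2 * pi * of_int n"
proof -
 have *: "g (x + 2 * pi * real m) = g x + 2 * pi * real m" for x and m :: nat
 proof (induction m)
  case (Suc m)
  thus ?case using assms[of "x + 2 * pi * real m"] by (simp add: algebra_simps)
 qed simp
 show ?thesis
 proof (cases "n >= 0")
  case True
  thus ?thesis using *[of x "nat n"] by simp
 next
  case False
  thus ?thesis using *[of "x + 2 * pi * of_int n" "nat (- n)"] by (simp add: algebra_simps)
 qed
qed

text \<open>\<open>D\<close> in the proof is the degree of the lift: continuous and integer valued,
  hence constant. Monotonicity on one period makes it positive, and injectivity of \<open>k\<close>
  excludes values above 1. The sign \<open>si\<close> allows an increasing lift for both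
  orientations.\<close>

lemma circle_lift_mono:
 fixes k :: "real => complex" and g :: "real => real"
 assumes per: "!!x. k (x + 2 * pi) = k x" and inj: "!!a. inj_on k {a..<a + 2 * pi}"
  and g: "continuous_on UNIV g" "!!x. k x = cis (si * g x)" and si: "si = 1 | si = - 1"
  and mono: "strict_mono_on {0..<2 * pi} g"
 shows "strict_mono g" "g (x + 2 * pi) = g x + 2 * pi"
proof -
 have sii: "(\<exists>n::int. si * s = si * t + 2 * pi * of_int n) \<longleftrightarrow> (\<exists>n::int. s = t + 2 * pi * of_int n)" for s t
  using si
 proof
  assume s: "si = - 1"
  show ?thesis
  proof
   assume "\<exists>n::int. si * s = si * t + 2 * pi * of_int n"
   then obtain n :: int where "si * s = si * t + 2 * pi * of_int n" by blast
   thus "\<exists>n::int. s = t + 2 * pi * of_int n" using s by (intro exI[of _ "- n"]) simp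
  next
   assume "\<exists>n::int. s = t + 2 * pi * of_int n"
   then obtain n :: int where "s = t + 2 * pi * of_int n" by blast
   thus "\<exists>n::int. si * s = si * t + 2 * pi * of_int n" using s by (intro exI[of _ "- n"]) simp
  qed
 qed simp
 have kk: "k x = k y \<longleftrightarrow> (\<exists>n::int. g x = g y + 2 * pi * of_int n)" for x y
  unfolding g(2) cis_eq_iff_int sii ..
 define D where "D x = (g (x + 2 * pi) - g x) / (2 * pi)" for x
 have Di: "\<exists>n::int. D x = of_int n" for x
 proof -
  obtain n :: int where "g (x + 2 * pi) = g x + 2 * pi * of_int n" using kk[of "x + 2 * pi" x] per by auto
  thus ?thesis by (intro exI[of _ n]) (simp add: D_def)
 qed
 have gsh: "continuous_on UNIV (%x. g (x + 2 * pi))"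
  by (rule continuous_on_compose2[OF g(1)]) (auto intro!: continuous_intros)
 have "D constant_on UNIV"
 proof (rule continuous_discrete_range_constant)
  show "continuous_on UNIV D" unfolding D_def by (intro continuous_intros g(1) gsh) auto
  show "\<exists>e>0. \<forall>y. y \<in> UNIV & D y ~= D x --> e <= norm (D y - D x)" for x
  proof (intro exI[of _ 1] conjI allI impI)
   fix y assume y: "y \<in> UNIV & D y ~= D x"
   obtain m n :: int where mn: "D y = of_int m" "D x = of_int n" using Di by metis
   hence "m ~= n" using y by auto
   hence "\<bar>m - n\<bar> >= 1" by simp
   hence "\<bar>real_of_int m - real_of_int n\<bar> >= 1" by linarith
   thus "1 <= norm (D y - D x)" using mn by simp
  qed simp
 qed auto
 then obtain c where c: "!!x. D x = c" unfolding constant_on_def by blast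
 have gc: "g (x + 2 * pi) = g x + 2 * pi * c" for x using c[of x] by (simp add: D_def field_simps)
 obtain m :: int where m: "c = of_int m" using Di[of 0] c by metis
 have mono': "g s < g t" if "0 <= s" "s < t" "t < 2 * pi" for s t
  using strict_mono_onD[OF mono] that by auto
 have "g pi <= g (2 * pi)"
 proof (rule tendsto_lowerbound)
  show "(g \<longlongrightarrow> g (2 * pi)) (at_left (2 * pi))"
   using g(1) by (simp add: continuous_on_def tendsto_within_subset[of g _ _ UNIV])
  have "eventually (%x. x \<in> {pi<..<2 * pi}) (at_left (2 * pi))" by (rule eventually_at_left_real) simp
  thus "\<forall>\<^sub>F x in at_left (2 * pi). g pi <= g x"
   by eventually_elim (use mono'[of pi] in \<open>auto intro: less_imp_le\<close>)
 qed simp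
 moreover have "g 0 < g pi" by (rule mono') auto
 ultimately have "2 * pi * c > 0" using gc[of 0] by simp
 hence "c > 0" by (simp add: zero_less_mult_iff)
 hence m1: "m >= 1" using m by simp
 have "m = 1"
 proof (rule ccontr)
  assume "m ~= 1"
  hence "real_of_int m >= 2" using m1 by linarith
  hence g2: "g (2 * pi) >= g 0 + 4 * pi" using gc[of 0] m by simp
  have "\<exists>x\<ge>0. x <= 2 * pi & g x = g 0 + 2 * pi"
  proof (rule IVT')
   show "g 0 + 2 * pi <= g (2 * pi)" using g2 pi_gt_zero by linarith
  qed (use g(1) in \<open>auto intro: continuous_on_subset\<close>)
  then obtain x where x: "0 <= x" "x <= 2 * pi" "g x = g 0 + 2 * pi" by blast
  have "x ~= 2 * pi" "x ~= 0" using x(3) g2 by auto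
  moreover have "k x = k 0" using kk[of x 0] x(3) by (metis mult.right_neutral of_int_1)
  ultimately show False using inj_onD[OF inj[of 0], of x 0] x by auto
 qed
 hence eqv: "g (x + 2 * pi) = g x + 2 * pi" for x using gc m by simp
 thus "g (x + 2 * pi) = g x + 2 * pi" .
 have loc: "strict_mono_on {a..<a + 2 * pi} g" for a
 proof -
  have "inj_on g {a..<a + 2 * pi}" using inj[of a] g(2) by (metis inj_onI inj_onD)
  hence "strict_mono_on {a..<a + 2 * pi} g | strict_antimono_on {a..<a + 2 * pi} g"
   using injective_eq_monotone_map[of "{a..<a + 2 * pi}" g] g(1) by (auto intro: continuous_on_subset simp: is_interval_co)
  moreover have "\<not> strict_antimono_on {a..<a + 2 * pi} g"
  proof
   assume anti: "strict_antimono_on {a..<a + 2 * pi} g"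
   have "g (a + 2 * pi) <= g a"
   proof (rule tendsto_upperbound)
    show "(g \<longlongrightarrow> g (a + 2 * pi)) (at_left (a + 2 * pi))"
     using g(1) by (simp add: continuous_on_def tendsto_within_subset[of g _ _ UNIV])
    have "eventually (%x. x \<in> {a<..<a + 2 * pi}) (at_left (a + 2 * pi))" by (rule eventually_at_left_real) simp
    thus "\<forall>\<^sub>F x in at_left (a + 2 * pi). g x <= g a"
     by eventually_elim (use anti in \<open>auto simp: monotone_on_def intro: less_imp_le\<close>)
   qed simp
   thus False using eqv[of a] pi_gt_zero by simp
  qed
  ultimately show ?thesis by blast
 qed
 show "strict_mono g"
 proof (rule strict_monoI)
  fix x y :: real assume xy: "x < y"
  define n where "n = \<lfloor>(y - x) / (2 * pi)\<rfloor>"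
  define r where "r = y - x - 2 * pi * of_int n"
  have n0: "n >= 0" using xy by (simp add: n_def)
  have "of_int n <= (y - x) / (2 * pi)" "(y - x) / (2 * pi) < of_int n + 1" unfolding n_def by linarith+
  hence r: "0 <= r" "r < 2 * pi" by (simp_all add: r_def field_simps)
  have gy: "g y = g (x + r) + 2 * pi * of_int n"
   using shift_2pi_iterate[of g "x + r" n] eqv by (simp add: r_def)
  show "g x < g y"
  proof (cases "r = 0")
   case True
   hence "n ~= 0" using xy by (auto simp: r_def)
   hence "2 * pi * of_int n > 0" using n0 by simp
   thus ?thesis using gy True by simp
  next
   case False
   hence "g x < g (x + r)" using strict_mono_onD[OF loc[of x], of x "x + r"] r by auto
   moreover have "2 * pi * of_int n >= 0" using n0 by simp
   ultimately show ?thesis using gy by linarith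
  qed
 qed
qed

lemma circle_lift:
 fixes k :: "real => complex"
 assumes cont: "continuous_on UNIV k" and per: "!!x. k (x + 2 * pi) = k x"
  and nrm: "!!x. norm (k x) = 1" and inj: "!!a. inj_on k {a..<a + 2 * pi}"
 obtains si :: real and g where "si = 1 | si = - 1" "continuous_on UNIV g" "strict_mono g"
  "!!x. g (x + 2 * pi) = g x + 2 * pi" "!!x. k x = cis (si * g x)"
proof -
 have "contractible (UNIV :: real set)" by (simp add: convex_imp_contractible)
 moreover have "k x ~= 0" for x using nrm[of x] by auto
 ultimately obtain g0 where g0: "continuous_on UNIV g0" "!!x. k x = exp (g0 x)"
  using continuous_logarithm_on_contractible[OF cont] by (metis UNIV_I)
 have R0: "Re (g0 x) = 0" for x using nrm[of x] g0(2)[of x] by simp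
 define g where "g x = Im (g0 x)" for x
 have g: "continuous_on UNIV g" unfolding g_def by (intro continuous_intros g0)
 have kg: "k x = cis (g x)" for x
  unfolding g0(2) cis_conv_exp using R0[of x] by (intro arg_cong[where f = exp]) (simp add: complex_eq_iff g_def)
 have "inj_on g {0..<0 + 2 * pi}" using inj[of 0] kg by (metis inj_onI inj_onD)
 then consider "strict_mono_on {0..<2 * pi} g" | "strict_antimono_on {0..<2 * pi} g"
  using injective_eq_monotone_map[of "{0..<2 * pi}" g] g by (auto intro: continuous_on_subset simp: is_interval_co)
 thus ?thesis
 proof cases
  case 1
  have "k x = cis (1 * g x)" for x by (simp add: kg)
  from circle_lift_mono[OF per inj g this _ 1] show ?thesis using that[of 1 g] g kg by simp
 next
  case 2
  define g' where "g' x = - g x" for x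
  have c: "continuous_on UNIV g'" unfolding g'_def by (intro continuous_intros g)
  have "k x = cis (- 1 * g' x)" for x by (simp add: kg g'_def)
  moreover have "strict_mono_on {0..<2 * pi} g'" using 2 by (auto simp: monotone_on_def g'_def)
  ultimately show ?thesis using circle_lift_mono[OF per inj c, of "- 1"] that[of "- 1" g'] c by blast
 qed
qed

lemma disc_chart_lift:
 fixes h :: "complex => complex"
 assumes h: "continuous_on (sphere 0 1) h" "inj_on h (sphere 0 1)"
  and phi: "disc_chart phi" "phi ` sphere 0 1 = h ` sphere 0 1"
 obtains si :: real and g where "si = 1 | si = - 1" "continuous_on UNIV g" "strict_mono g"
  "!!x. g (x + 2 * pi) = g x + 2 * pi" "!!x. phi (cis x) = h (cis (si * g x))"
proof -
 define hi where "hi = inv_into (sphere 0 1) h"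
 have hi: "hi (h z) = z" if "z \<in> sphere 0 1" for z using that h(2) by (simp add: hi_def)
 have hc: "continuous_on (h ` sphere 0 1) hi"
  using h(1) compact_sphere hi by (intro continuous_on_inv) auto
 define k where "k x = hi (phi (cis x))" for x
 have phis: "phi (cis x) \<in> h ` sphere 0 1" for x using phi(2) by (metis imageI mem_sphere_0 norm_cis)
 have hk: "h (k x) = phi (cis x)" "norm (k x) = 1" for x
  using phis[of x] hi by (auto simp: k_def)
 have "continuous_on (range cis) phi" using phi(1) by (auto simp: disc_chart_def intro: continuous_on_subset)
 hence "continuous_on UNIV (%x. phi (cis x))" by (intro continuous_on_compose2[OF _ continuous_on_cis']) auto
 hence "continuous_on UNIV k" unfolding k_def
  by (intro continuous_on_compose2[OF hc]) (use phis in auto)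
 moreover have "k (x + 2 * pi) = k x" for x by (simp add: k_def cis_mult[symmetric])
 moreover have "inj_on k {a..<a + 2 * pi}" for a
 proof (rule inj_onI)
  fix x y assume xy: "x \<in> {a..<a + 2 * pi}" "y \<in> {a..<a + 2 * pi}" "k x = k y"
  hence "phi (cis x) = phi (cis y)" using hk(1) by metis
  hence "cis x = cis y" using phi(1) unfolding disc_chart_def inj_on_def by simp
  thus "x = y" using inj_onD[OF cis_inj_on] xy by metis
 qed
 ultimately obtain si :: real and g where g: "si = 1 | si = - 1" "continuous_on UNIV g" "strict_mono g"
  "!!x. g (x + 2 * pi) = g x + 2 * pi" "!!x. k x = cis (si * g x)"
  by (rule circle_lift[OF _ _ hk(2)]) blast
 thus ?thesis using that[of si g] hk(1) by metis
qed

section \<open>Mean and standard deviation of an increasing function\<close>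

lemma integral_antiderivative:
 fixes f :: "real => real"
 assumes "a <= b" "!!x. (P has_real_derivative f x) (at x)"
 shows "integral {a..b} f = P b - P a" "f integrable_on {a..b}"
proof -
 have "(f has_integral (P b - P a)) {a..b}"
  by (rule fundamental_theorem_of_calculus[OF assms(1)])
    (use assms(2) in \<open>auto simp: has_real_derivative_iff_has_vector_derivative[symmetric] intro: DERIV_subset\<close>)
 thus "integral {a..b} f = P b - P a" "f integrable_on {a..b}" by (auto simp: integral_unique)
qed

text \<open>Used on [-1, 1] only, where it is a probability density with mean 0 and variance 1/7.
  Its double zeros at the ends make its extension by 0 continuously differentiable.\<close>

definition bump :: "real => real" where "bump s = 15/16 * (1 - s^2)^2"

text \<open>The derivative of -(a + b s) \<open>bump s\<close>. By integration by parts, its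
  integral against g (u + v s), divided by v, is the derivative of the average of \<open>g\<close>
  in the direction a + i b; no derivative of \<open>g\<close> occurs.\<close>

definition bump_slope :: "real => real => real => real" where
 "bump_slope a b s = 15/16 * (1 - s^2) * (4 * a * s + b * (5 * s^2 - 1))"

lemma continuous_on_bump [continuous_intros]: "continuous_on A bump"
 unfolding bump_def[abs_def] by (intro continuous_intros)

lemma continuous_on_bump_slope [continuous_intros]: "continuous_on A (bump_slope a b)"
 unfolding bump_slope_def[abs_def] by (intro continuous_intros)

lemma bump_slope_antiderivative: "((%s. - (a + b * s) * bump s) has_real_derivative bump_slope a b s) (at s)"
 unfolding bump_def bump_slope_def
 by (rule derivative_eq_intros refl | simp add: field_simps power2_eq_square power3_eq_cube)+

lemma bump_ends [simp]: "bump 1 = 0" "bump (- 1) = 0" by (simp_all add: bump_def)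

lemma bump_nonneg [simp]: "bump s >= 0" by (simp add: bump_def)

lemma integral_bump_slope:
 "c <= d ==> integral {c..d} (bump_slope a b) = (a + b * c) * bump c - (a + b * d) * bump d"
 using integral_antiderivative(1)[of c d _ "bump_slope a b", OF _ bump_slope_antiderivative] by (simp add: algebra_simps)

lemma bump_moments:
 "integral {-1..1} bump = 1" "integral {-1..1} (%s. s * bump s) = 0" "integral {-1..1} (%s. s^2 * bump s) = 1/7"
proof -
 have 1: "((%s. 15/16 * (s - 2 * s^3 / 3 + s^5 / 5)) has_real_derivative bump s) (at s)" for s
  unfolding bump_def by (rule derivative_eq_intros refl | simp add: field_simps power2_eq_square eval_nat_numeral)+
 have 2: "((%s. 15/16 * (s^2 / 2 - 2 * s^4 / 4 + s^6 / 6)) has_real_derivative s * bump s) (at s)" for s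
  unfolding bump_def by (rule derivative_eq_intros refl | simp add: field_simps power2_eq_square eval_nat_numeral)+
 have 3: "((%s. 15/16 * (s^3 / 3 - 2 * s^5 / 5 + s^7 / 7)) has_real_derivative s^2 * bump s) (at s)" for s
  unfolding bump_def by (rule derivative_eq_intros refl | simp add: field_simps power2_eq_square eval_nat_numeral)+
 show "integral {-1..1} bump = 1" by (subst integral_antiderivative(1)[OF _ 1]) auto
 show "integral {-1..1} (%s. s * bump s) = 0" by (subst integral_antiderivative(1)[OF _ 2]) auto
 show "integral {-1..1} (%s. s^2 * bump s) = 1/7" by (subst integral_antiderivative(1)[OF _ 3]) auto
qed

lemma integral_slope_poly:
 fixes a b :: real
 shows "integral {-1..1} (%s. (4 * a * s + b * (5 * s^2 - 1))^2) = 32/3 * a^2 + 16/3 * b^2"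
proof -
 have 1: "((%s. 16 * a^2 * s^3 / 3 + 8 * a * b * (5 * s^4 / 4 - s^2 / 2) + b^2 * (25 * s^5 / 5 - 10 * s^3 / 3 + s))
   has_real_derivative (4 * a * s + b * (5 * s^2 - 1))^2) (at s)" for s
  by (rule derivative_eq_intros refl | simp add: field_simps power2_eq_square eval_nat_numeral)+
 show ?thesis by (subst integral_antiderivative(1)[OF _ 1]) (auto simp: field_simps)
qed

text \<open>Integration by parts against the increments of \<open>X\<close>. The second mean value
  theorem replaces the Stieltjes integral of \<open>P\<close> by its value at one point.\<close>

lemma mono_weighted_integral_ge:
 fixes X :: "real => real"
 assumes "al <= be" "!!x. (P has_real_derivative f x) (at x)" and c: "!!x. x \<in> {al..be} ==> P x <= - c"
  and X: "mono_on {al..be} X"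
 shows "integral {al..be} (%s. X s * f s) >= X be * P be - X al * P al + c * (X be - X al)"
proof -
 note I = integral_antiderivative[OF _ assms(2)]
 obtain xi where xi: "xi \<in> {al..be}"
  "integral {al..be} (%s. X s * f s) = X al * integral {al..xi} f + X be * integral {xi..be} f"
  by (rule second_mean_value_theorem[OF I(2)[OF assms(1)] assms(1), of X]) (use X in \<open>auto simp: mono_on_def\<close>)
 have "integral {al..be} (%s. X s * f s) = X be * P be - X al * P al - P xi * (X be - X al)"
  using xi I(1)[of al xi] I(1)[of xi be] by (simp add: algebra_simps)
 moreover have "(c + P xi) * (X be - X al) <= 0"
  using c[OF xi(1)] monotone_onD[OF X, of al be] assms(1) by (intro mult_nonpos_nonneg) auto
 ultimately show ?thesis by (simp add: algebra_simps)
qed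

text \<open>The quadratic is the last factor of \<open>bump_slope a 1\<close>. At a root s one has 4
  s (a + s) = 1 - s^2, which gives the two final bounds.\<close>

lemma slope_roots:
 assumes a: "\<bar>a\<bar> < (1::real)"
 obtains s1 s2 where "- 1 < s1" "s1 < 0" "0 < s2" "s2 < 1" "!!s. 4 * a * s + (5 * s^2 - 1) = 5 * (s - s1) * (s - s2)"
  "a + s2 >= (1 - s2) / 2" "- (a + s1) >= (1 + s1) / 2"
proof -
 define r where "r = sqrt (4 * a^2 + 5)"
 have r2: "r^2 = 4 * a^2 + 5" and r0: "r >= 0" by (simp_all add: r_def)
 define s1 where "s1 = (- 2 * a - r) / 5"
 define s2 where "s2 = (- 2 * a + r) / 5"
 have r: "2 * \<bar>a\<bar> < r" by (rule power2_less_imp_less) (use r2 r0 in \<open>simp_all add: power_mult_distrib\<close>)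
 have *: "r < 5 + 2 * x" if "\<bar>x\<bar> = \<bar>a\<bar>" for x
 proof (rule power2_less_imp_less)
  have "x^2 = a^2" using that by (metis power2_abs)
  moreover have "x > - 1" using that a by linarith
  ultimately show "r^2 < (5 + 2 * x)^2" unfolding r2 by (simp add: power2_eq_square algebra_simps)
 qed (use that a in linarith)
 have s: "- 1 < s1" "s1 < 0" "0 < s2" "s2 < 1" using r *[of a] *[of "- a"] by (auto simp: s1_def s2_def)
 have q: "4 * a * s + (5 * s^2 - 1) = 5 * (s - s1) * (s - s2)" for s
 proof -
  have "5 * (s - s1) * (s - s2) = 5 * s^2 + 4 * a * s + (4 * a^2 - r^2) / 5"
   by (simp add: s1_def s2_def field_simps power2_eq_square)
  thus ?thesis using r2 by simp
 qed
 have "4 * s2 * (a + s2) = (1 - s2) * (1 + s2)" using q[of s2] by (simp add: algebra_simps power2_eq_square)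
 also have "... >= (1 - s2) * (2 * s2)" using s by (intro mult_left_mono) auto
 finally have "4 * s2 * ((1 - s2) / 2) <= 4 * s2 * (a + s2)" by (simp add: algebra_simps)
 hence 2: "a + s2 >= (1 - s2) / 2" using s by (subst (asm) mult_le_cancel_left_pos) auto
 have "4 * (- s1) * (- (a + s1)) = (1 + s1) * (1 - s1)" using q[of s1] by (simp add: algebra_simps power2_eq_square)
 also have "... >= (1 + s1) * (2 * (- s1))" using s by (intro mult_left_mono) auto
 finally have "4 * (- s1) * ((1 + s1) / 2) <= 4 * (- s1) * (- (a + s1))" by (simp add: algebra_simps)
 hence 1: "- (a + s1) >= (1 + s1) / 2" using s by (subst (asm) mult_le_cancel_left_pos) auto
 show ?thesis by (rule that[OF s q 2 1])
qed

lemma bump_anti: "\<bar>s\<bar> <= \<bar>t\<bar> ==> \<bar>t\<bar> <= 1 ==> bump t <= bump s"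
 unfolding bump_def by (intro mult_left_mono power_mono) (auto simp: abs_le_square_iff abs_square_le_1)

lemma integral_bump_tail:
 "0 <= c ==> c <= 1 ==> integral {c..1} bump <= bump c * (1 - c)"
 "c <= 0 ==> - 1 <= c ==> integral {-1..c} bump <= bump c * (1 + c)"
proof -
 assume c: "0 <= c" "c <= 1"
 have "integral {c..1} bump <= integral {c..1} (%s. bump c)"
  by (intro integral_le integrable_continuous_real continuous_intros bump_anti) (use c in auto)
 thus "integral {c..1} bump <= bump c * (1 - c)" using c by (simp add: mult.commute)
next
 assume c: "c <= 0" "- 1 <= c"
 have "integral {-1..c} bump <= integral {-1..c} (%s. bump c)"
  by (intro integral_le integrable_continuous_real continuous_intros bump_anti) (use c in auto)
 thus "integral {-1..c} bump <= bump c * (1 + c)" using c by (simp add: mult.commute algebra_simps)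
qed

lemma integral_subinterval_le:
 fixes f g :: "real => real"
 assumes "continuous_on {-1..1} g" "!!s. s \<in> {-1..1} ==> g s >= 0" "{c..d} \<subseteq> {-1..1}"
  "continuous_on {c..d} f" "!!s. s \<in> {c..d} ==> f s <= g s"
 shows "integral {c..d} f <= integral {-1..1} g"
proof -
 have "integral {c..d} f <= integral {c..d} g"
  using assms by (intro integral_le integrable_continuous_real) (auto intro: continuous_on_subset)
 also have "... <= integral {-1..1} g"
  using assms by (intro integral_subset_le integrable_continuous_real) (auto intro: continuous_on_subset)
 finally show ?thesis .
qed

lemma bump_ge: "bump s >= 9/10" if "s \<in> {-1/10..1/10}" 
proof -
 have "s^2 <= (1/10)^2" using that by (intro power2_le_iff_abs_le[THEN iffD2]) (auto simp: abs_le_iff)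
 hence "(99/100)^2 <= (1 - s^2)^2" by (intro power_mono) (auto simp: power2_eq_square)
 thus ?thesis by (simp add: bump_def power2_eq_square)
qed

text \<open>Young's inequality for (1 - s^2) |q s| with weight t = M / V. As 32/3 bounds the
  integral of q^2, the result is t/2 V^2 + 5 M^2 / t = 55/10 M V.\<close>

lemma weighted_slope_le:
 assumes g: "continuous_on {-1..1} g" "!!s. s \<in> {-1..1} ==> \<bar>g s\<bar> <= M" and ab: "a^2 + b^2 = 1"
  and c: "integral {-1..1} (%s. (g s)^2 * bump s) <= V^2" "V > 0" and M: "M > 0"
 shows "\<bar>integral {-1..1} (%s. (g s)^2 * bump_slope a b s)\<bar> <= 55/10 * M * V"
proof -
 define q where "q s = 4 * a * s + b * (5 * s^2 - 1)" for s
 define t where "t = M / V"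
 have t: "t > 0" using c M by (simp add: t_def)
 have qc: "continuous_on {-1..1} q" unfolding q_def[abs_def] by (intro continuous_intros)
 have pw: "norm ((g s)^2 * bump_slope a b s) <= t/2 * ((g s)^2 * bump s) + 15/32 * M^2 / t * (q s)^2"
  if s: "s \<in> {-1..1}" for s
 proof -
  have s2: "s^2 <= 1" using s by (simp add: abs_square_le_1 abs_le_iff)
  have gm: "(g s)^2 <= M^2" using g(2)[OF s] M by (intro power2_le_iff_abs_le[THEN iffD2]) auto
  have "2 * t * ((1 - s^2) * \<bar>q s\<bar>) <= t^2 * (1 - s^2)^2 + (q s)^2"
   using sum_squares_bound[of "t * (1 - s^2)" "\<bar>q s\<bar>"] by (simp only: power_mult_distrib power2_abs mult.assoc)
  hence "(1 - s^2) * \<bar>q s\<bar> <= t/2 * (1 - s^2)^2 + (q s)^2 / (2 * t)"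
   using t by (simp add: field_simps power2_eq_square)
  hence "15/16 * (g s)^2 * ((1 - s^2) * \<bar>q s\<bar>) <= 15/16 * (g s)^2 * (t/2 * (1 - s^2)^2 + (q s)^2 / (2 * t))"
   by (intro mult_left_mono) auto
  also have "... = t/2 * ((g s)^2 * bump s) + 15/32 * (g s)^2 * ((q s)^2 / t)"
   using t by (simp add: bump_def field_simps)
  also have "15/32 * (g s)^2 * ((q s)^2 / t) <= 15/32 * M^2 * ((q s)^2 / t)"
   using gm t by (intro mult_right_mono) auto
  finally have "15/16 * (g s)^2 * ((1 - s^2) * \<bar>q s\<bar>) <= t/2 * ((g s)^2 * bump s) + 15/32 * M^2 / t * (q s)^2" by simp
  moreover have "norm ((g s)^2 * bump_slope a b s) = 15/16 * (g s)^2 * ((1 - s^2) * \<bar>q s\<bar>)"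
   using s2 by (simp add: bump_slope_def q_def[symmetric] abs_mult)
  ultimately show ?thesis by linarith
 qed
 have "norm (integral {-1..1} (%s. (g s)^2 * bump_slope a b s))
   <= integral {-1..1} (%s. t/2 * ((g s)^2 * bump s) + 15/32 * M^2 / t * (q s)^2)"
  by (rule integral_norm_bound_integral) (use pw t in \<open>auto intro!: integrable_continuous_real continuous_intros g(1) qc\<close>)
 also have "... = t/2 * integral {-1..1} (%s. (g s)^2 * bump s) + 15/32 * M^2 / t * integral {-1..1} (%s. (q s)^2)"
  using t by (subst integral_add) (auto intro!: integrable_continuous_real continuous_intros g(1) qc)
 also have "integral {-1..1} (%s. (q s)^2) = 32/3 * a^2 + 16/3 * b^2" unfolding q_def by (rule integral_slope_poly)
 also have "t/2 * integral {-1..1} (%s. (g s)^2 * bump s) <= t/2 * V^2" using c t by (intro mult_left_mono) auto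
 also have "15/32 * M^2 / t * (32/3 * a^2 + 16/3 * b^2) <= 15/32 * M^2 / t * (32/3)"
  by (rule mult_left_mono) (use ab t in \<open>auto simp: zero_le_power2 algebra_simps\<close>, smt (verit) zero_le_power2)
 also have "t/2 * V^2 + 15/32 * M^2 / t * (32/3) = 55/10 * M * V"
  using c M by (simp add: t_def field_simps power2_eq_square)
 finally show ?thesis by simp
qed

section \<open>Two-sided bounds for the derivative form of mean and standard deviation\<close>

context
 fixes X :: "real => real"
begin

definition smean :: real where "smean = integral {-1..1} (%s. X s * bump s)"

definition svar :: real where "svar = integral {-1..1} (%s. (X s - smean)^2 * bump s)"

text \<open>With X the window function at w, this is the square of Im w times the length of the
  derivative of \<open>Gmap\<close> in the direction a + i b. The second summand comes from sqrt (7
  \<open>svar\<close>). The variation of the mean does not contribute to it, since X -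
  \<open>smean\<close> has mean 0.\<close>

definition slope_norm :: "real => real => real" where
 "slope_norm a b = (integral {-1..1} (%s. X s * bump_slope a b s))^2
   + 7 * (integral {-1..1} (%s. (X s - smean)^2 * bump_slope a b s))^2 / (4 * svar)"

lemma slope_scale:
 "integral {-1..1} (%s. X s * bump_slope (r * a) (r * b) s) = r * integral {-1..1} (%s. X s * bump_slope a b s)"
 "integral {-1..1} (%s. (X s - c)^2 * bump_slope (r * a) (r * b) s) = r * integral {-1..1} (%s. (X s - c)^2 * bump_slope a b s)"
proof -
 have k: "bump_slope (r * a) (r * b) s = r * bump_slope a b s" for s
 proof -
  have "4 * (r * a) * s + r * b * (5 * s^2 - 1) = r * (4 * a * s + b * (5 * s^2 - 1))" by (simp add: algebra_simps)
  thus ?thesis unfolding bump_slope_def by (simp only: mult.left_commute)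
 qed
 show "integral {-1..1} (%s. X s * bump_slope (r * a) (r * b) s) = r * integral {-1..1} (%s. X s * bump_slope a b s)"
  unfolding k by (simp add: mult.left_commute)
 show "integral {-1..1} (%s. (X s - c)^2 * bump_slope (r * a) (r * b) s) = r * integral {-1..1} (%s. (X s - c)^2 * bump_slope a b s)"
  unfolding k by (simp add: mult.left_commute)
qed

lemma slope_norm_scale: "slope_norm (r * a) (r * b) = r^2 * slope_norm a b"
 unfolding slope_norm_def slope_scale by (simp add: power_mult_distrib algebra_simps add_divide_distrib)

context
 assumes Xc: "continuous_on {-1..1} X"
begin

lemma sampled_integrable [simp, intro]:
 "continuous_on {-1..1} g ==> (%s. X s * g s) integrable_on {-1..1}"
 "continuous_on {-1..1} g ==> (%s. (X s - c)^2 * g s) integrable_on {-1..1}"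
 "continuous_on {-1..1} g ==> (%s. (X s)^2 * g s) integrable_on {-1..1}"
 by (intro integrable_continuous_real continuous_intros Xc; assumption)+

lemma integral_quadratic:
 assumes g: "continuous_on {-1..1} g"
 shows "integral {-1..1} (%s. ((X s)^2 + p * X s + q) * g s)
  = integral {-1..1} (%s. (X s)^2 * g s) + p * integral {-1..1} (%s. X s * g s) + q * integral {-1..1} g"
proof -
 have "(%s. ((X s)^2 + p * X s + q) * g s) = (%s. ((X s)^2 * g s + p * (X s * g s)) + q * g s)"
  by (simp add: algebra_simps)
 thus ?thesis
  using g by (simp only:) (subst integral_add, (auto intro!: integrable_add integrable_continuous_real continuous_intros Xc)[2],
   subst integral_add, auto intro!: integrable_continuous_real continuous_intros Xc)
qed

lemma smean_lin:
 assumes g: "continuous_on {-1..1} g"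
 shows "integral {-1..1} (%s. (X s - c)^2 * g s)
  = integral {-1..1} (%s. (X s)^2 * g s) - 2 * c * integral {-1..1} (%s. X s * g s) + c^2 * integral {-1..1} g"
 using integral_quadratic[OF g, of "- 2 * c" "c^2"] by (simp add: power2_diff algebra_simps)

lemma svar_eq: "svar = integral {-1..1} (%s. (X s)^2 * bump s) - smean^2"
 unfolding svar_def by (subst smean_lin) (auto simp: bump_moments smean_def[symmetric] power2_eq_square intro!: continuous_intros)

context
 assumes Xm: "mono_on {-1..1} X"
begin

text \<open>For |b| <= a the antiderivative -(a + b s) \<open>bump s\<close> is nowhere positive on
  [-1, 1]. On [1/10, 8/10] it is at most -0.024 a, since there a + b s >= a / 5 and
  \<open>bump s\<close> >= 0.1215.\<close>

lemma bump_slope_pairing_ge: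
 assumes ab: "\<bar>b\<bar> <= a" and eta: "X (8/10) - X (1/10) >= eta"
 shows "integral {-1..1} (%s. X s * bump_slope a b s) >= 24/1000 * a * eta"
proof -
 have c: "- (a + b * s) * bump s <= 0" if "s \<in> {-1..1}" for s
 proof -
  have "\<bar>b * s\<bar> <= \<bar>b\<bar>" unfolding abs_mult using that by (intro mult_left_le) auto
  hence "a + b * s >= 0" using ab by linarith
  thus ?thesis by (intro mult_nonpos_nonneg) auto
 qed
 have c': "- (a + b * s) * bump s <= - (24/1000 * a)" if s: "s \<in> {1/10..8/10}" for s
 proof -
  have "\<bar>b * s\<bar> <= a * (8/10)" unfolding abs_mult by (rule mult_mono) (use s ab in auto)
  hence 1: "a + b * s >= 2/10 * a" by linarith
  have "s^2 <= (8/10)^2" using s by (intro power_mono) auto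
  hence "(36/100)^2 <= (1 - s^2)^2" by (intro power_mono) (auto simp: power2_eq_square)
  hence 2: "bump s >= 1215/10000" by (simp add: bump_def power2_eq_square)
  have "2/10 * a * (1215/10000) <= (a + b * s) * bump s" by (rule mult_mono[OF 1 2]) (use 1 ab in auto)
  hence "24/1000 * a <= (a + b * s) * bump s" using ab by linarith
  thus ?thesis unfolding mult_minus_left by simp
 qed
 define P where "P s = - (a + b * s) * bump s" for s
 have i: "integral {al..be} (%s. X s * bump_slope a b s) >= X be * P be - X al * P al + k * (X be - X al)"
  if "!!x. x \<in> {al..be} ==> - (a + b * x) * bump x <= - k" "{al..be} \<subseteq> {-1..1}" "al <= be" for al be k
  unfolding P_def by (rule mono_weighted_integral_ge[OF that(3) bump_slope_antiderivative that(1)])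
    (use Xm that(2) in \<open>auto intro: mono_on_subset\<close>)
 have I: "(%s. X s * bump_slope a b s) integrable_on {al..1}" if "al >= -1" for al
  by (rule integrable_on_subinterval[OF sampled_integrable(1)[OF continuous_on_bump_slope]]) (use that in auto)
 have "integral {-1..1} (%s. X s * bump_slope a b s) = integral {-1..1/10} (%s. X s * bump_slope a b s)
   + (integral {1/10..8/10} (%s. X s * bump_slope a b s) + integral {8/10..1} (%s. X s * bump_slope a b s))"
  using Henstock_Kurzweil_Integration.integral_combine[of "-1" "1/10" 1, OF _ _ I]
   Henstock_Kurzweil_Integration.integral_combine[of "1/10" "8/10" 1, OF _ _ I] by simp
 moreover have "24/1000 * a * eta <= 24/1000 * a * (X (8/10) - X (1/10))" using eta ab by (intro mult_left_mono) auto
 moreover have "X (1/10) * P (1/10) - X (- 1) * P (- 1) + 0 * (X (1/10) - X (- 1)) <= integral {-1..1/10} (%s. X s * bump_slope a b s)"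
  by (rule i) (use c in auto)
 moreover have "X (8/10) * P (8/10) - X (1/10) * P (1/10) + (24/1000 * a) * (X (8/10) - X (1/10)) <= integral {1/10..8/10} (%s. X s * bump_slope a b s)"
  by (rule i[OF c']) auto
 moreover have "X 1 * P 1 - X (8/10) * P (8/10) + 0 * (X 1 - X (8/10)) <= integral {8/10..1} (%s. X s * bump_slope a b s)"
  by (rule i) (use c in auto)
 moreover have "P 1 = 0" "P (- 1) = 0" by (simp_all add: P_def)
 ultimately show ?thesis by (simp only: mult_zero_left mult_zero_right)
qed

text \<open>Either X (8/10) exceeds the mean by eta / 2 or X (1/10) is below it by eta / 2;
  monotonicity extends this to an interval on the outer side.\<close>

lemma svar_pos:
 assumes eta: "X (8/10) - X (1/10) >= eta" "eta > 0"
 shows "svar > 0"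
proof -
 define e where "e = (eta/2)^2"
 have e0: "e > 0" using eta(2) by (simp add: e_def)
 have c: "continuous_on {-1..1} (%s. (X s - smean)^2 * bump s)" by (intro continuous_intros Xc)
 consider "X (8/10) - smean >= eta/2" | "smean - X (1/10) >= eta/2" using eta by linarith
 thus ?thesis
 proof cases
  case 1
  have "integral {8/10..9/10} (%s::real. e * (33/1000)) <= svar" unfolding svar_def
  proof (rule integral_subinterval_le[OF c])
   fix s :: real assume s: "s \<in> {8/10..9/10}"
   have "X (8/10) <= X s" using s by (intro monotone_onD[OF Xm]) auto
   hence 2: "e <= (X s - smean)^2" unfolding e_def using 1 eta(2) by (intro power_mono) auto
   have "s^2 <= (9/10)^2" using s by (intro power_mono) auto
   hence "(19/100)^2 <= (1 - s^2)^2" by (intro power_mono) (auto simp: power2_eq_square)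
   hence "bump s >= 33/1000" by (simp add: bump_def power2_eq_square)
   thus "e * (33/1000) <= (X s - smean)^2 * bump s" using e0 by (intro mult_mono 2) auto
  qed auto
  thus ?thesis using e0 by simp
 next
  case 2
  have "integral {0..1/10} (%s::real. e * (33/1000)) <= svar" unfolding svar_def
  proof (rule integral_subinterval_le[OF c])
   fix s :: real assume s: "s \<in> {0..1/10}"
   have "X s <= X (1/10)" using s by (intro monotone_onD[OF Xm]) auto
   hence "e <= (smean - X s)^2" unfolding e_def using 2 eta(2) by (intro power_mono) auto
   hence 3: "e <= (X s - smean)^2" by (simp add: power2_commute)
   have "bump s >= 33/1000" using bump_ge[of s] s by simp
   thus "e * (33/1000) <= (X s - smean)^2 * bump s" using e0 by (intro mult_mono 3) auto
  qed auto
  thus ?thesis using e0 by simp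
 qed
qed

text \<open>The weight \<open>kap\<close> changes sign at the roots s1, s2, and so does H = (X - X
  s1) (X - X s2); hence N, the integral of H kap, is a sum of nonnegative parts. Expanding H gives N
  = P2 + t P1, and Cauchy-Schwarz gives N^2 <= S (t^2 + 4 svar / 7), where S is the form to be
  bounded below. The bracket is at most D^2 + 8 N, because the integral of H (2 kap - bump) is
  nonnegative. Together with N >= 15/10000 eta (D + eta) this bounds S, whether D^2 or 8 N is the
  larger term.\<close>

lemma variance_slope_ge:
 assumes a: "\<bar>a\<bar> < 1" and eta: "eta > 0"
  and R: "X (8/10) - X (1/10) >= eta" and L: "X (- 1/10) - X (- 8/10) >= eta"
 shows "11/10^7 * eta^2 <= (integral {-1..1} (%s. X s * bump_slope a 1 s))^2
   + 7 * (integral {-1..1} (%s. (X s - smean)^2 * bump_slope a 1 s))^2 / (4 * svar)"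
proof -
 define kap where "kap = bump_slope a 1"
 define P1 where "P1 = integral {-1..1} (%s. X s * kap s)"
 define P2 where "P2 = integral {-1..1} (%s. (X s - smean)^2 * kap s)"
 obtain s1 s2 where s: "- 1 < s1" "s1 < 0" "0 < s2" "s2 < 1"
  and q: "!!s. 4 * a * s + (5 * s^2 - 1) = 5 * (s - s1) * (s - s2)"
  and as2: "a + s2 >= (1 - s2) / 2" and as1: "- (a + s1) >= (1 + s1) / 2"
  using slope_roots[OF a] by metis
 define al where "al = X s1"
 define be where "be = X s2"
 define D where "D = be - al"
 define t where "t = 2 * smean - al - be"
 define H where "H s = (X s - al) * (X s - be)" for s
 define N where "N = integral {-1..1} (%s. H s * kap s)"
 have kapc: "continuous_on A kap" for A unfolding kap_def by (rule continuous_on_bump_slope)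
 have Hc: "continuous_on {-1..1} H" unfolding H_def[abs_def] by (intro continuous_intros Xc)
 have X: "X x <= X y" if "- 1 <= x" "x <= y" "y <= 1" for x y
  using that by (intro monotone_onD[OF Xm]) auto
 have D0: "D >= 0" unfolding D_def al_def be_def using X[of s1 s2] s by simp
 have k: "kap s = 15/16 * (1 - s^2) * (5 * (s - s1) * (s - s2))" for s
  unfolding kap_def bump_slope_def using q[of s] by simp
 have sq: "s^2 <= 1" if "s \<in> {-1..1}" for s :: real using that by (simp add: abs_square_le_1 abs_le_iff)
 have kp: "kap s >= 0" if "s \<in> {-1..1}" "s >= s2 | s <= s1" for s
 proof -
  have "0 <= (s - s1) * (s - s2)" using that s by (auto simp: zero_le_mult_iff)
  hence "0 <= 5 * (s - s1) * (s - s2)" unfolding mult.assoc by simp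
  thus ?thesis unfolding k using sq[OF that(1)] by (intro mult_nonneg_nonneg[of "15/16 * _"]) auto
 qed
 have Hp: "H s >= 0" if hs: "s \<in> {-1..1}" "s >= s2 | s <= s1" for s
  using hs(2)
 proof
  assume "s2 <= s"
  thus ?thesis unfolding H_def al_def be_def using X[of s2 s] X[of s1 s] hs(1) s by (intro mult_nonneg_nonneg) auto
 next
  assume "s <= s1"
  thus ?thesis unfolding H_def al_def be_def using X[of s s1] X[of s s2] hs(1) s by (intro mult_nonpos_nonpos) auto
 qed
 have Hn: "H s <= 0" if "s1 <= s" "s <= s2" for s
  unfolding H_def al_def be_def using X[of s1 s] X[of s s2] that s by (intro mult_nonneg_nonpos) auto
 have kn: "kap s <= 0" if "s1 <= s" "s <= s2" for s
 proof -
  have "(s - s1) * (s - s2) <= 0" using that by (intro mult_nonneg_nonpos) auto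
  hence "5 * (s - s1) * (s - s2) <= 0" unfolding mult.assoc by simp
  thus ?thesis unfolding k using sq[of s] that s by (intro mult_nonneg_nonpos) auto
 qed
 have Hk: "H s * kap s >= 0" if "s \<in> {-1..1}" for s
  using Hp[OF that] kp[OF that] Hn[of s] kn[of s] by (cases "s >= s2 | s <= s1") (auto intro!: mult_nonneg_nonneg mult_nonpos_nonpos)
 have Hkc: "continuous_on {-1..1} (%s. H s * kap s)" by (intro continuous_intros Hc kapc)
 have N_ge: "integral {c..d} f <= N" if "{c..d} \<subseteq> {-1..1}" "continuous_on {c..d} f" "!!s. s \<in> {c..d} ==> f s <= H s * kap s" for c d f
  unfolding N_def by (rule integral_subinterval_le[OF Hkc Hk that])
 have mid: "kap s <= - (1/2)" if "s \<in> {-1/10..1/10}" for s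
 proof -
  have s2: "s^2 <= (1/10)^2" using that by (intro power2_le_iff_abs_le[THEN iffD2]) (auto simp: abs_le_iff)
  have "\<bar>a * s\<bar> <= 1 * (1/10)" unfolding abs_mult using that a by (intro mult_mono) (auto simp: abs_le_iff)
  hence 1: "- (4 * a * s + 1 * (5 * s^2 - 1)) >= 55/100" using s2 by (simp add: power2_eq_square abs_le_iff)
  have 2: "15/16 * (1 - s^2) >= 92/100" using s2 by (simp add: power2_eq_square)
  have "92/100 * (55/100) <= 15/16 * (1 - s^2) * - (4 * a * s + 1 * (5 * s^2 - 1))"
   by (rule mult_mono[OF 2 1]) (use 2 in auto)
  thus ?thesis unfolding kap_def bump_slope_def by linarith
 qed
 \<comment> \<open>In each case both factors of \<open>H\<close> and the weight are bounded away
   from 0 on average over some interval: right of 8/10, left of -8/10, or next to 0.\<close>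
 have Nb: "N >= 15/10000 * eta * (D + eta)"
 proof -
  consider (1) "X (8/10) - be >= eta/2" | (2) "al - X (- 8/10) >= eta/2"
   | (3) "be - X (1/10) >= eta/2" "X (- 1/10) - al >= eta/2" using R L by linarith
  thus ?thesis
  proof cases
   case 1
   have s2: "s2 <= 8/10" using 1 X[of "8/10" s2] eta s by (force simp: be_def)
   have "integral {8/10..1} (%s. ((D + eta/2) * (eta/2)) * kap s) <= N"
   proof (rule N_ge)
    fix s :: real assume s': "s \<in> {8/10..1}"
    have "X s - be >= eta/2" using 1 X[of "8/10" s] s' by auto
    hence "(D + eta/2) * (eta/2) <= H s" unfolding H_def using D0 eta by (intro mult_mono) (auto simp: D_def)
    thus "((D + eta/2) * (eta/2)) * kap s <= H s * kap s" using kp[of s] s' s2 by (intro mult_right_mono) auto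
   qed (auto intro!: continuous_intros kapc)
   moreover have "integral {8/10..1} kap >= 1/10 * (1215/10000)"
   proof -
    have "integral {8/10..1} kap = (a + 8/10) * bump (8/10)" unfolding kap_def by (simp add: integral_bump_slope)
    also have "... >= 1/10 * (1215/10000)" using as2 s2 by (intro mult_mono) (auto simp: bump_def power2_eq_square)
    finally show ?thesis .
   qed
   hence "((D + eta/2) * (eta/2)) * (1/10 * (1215/10000)) <= ((D + eta/2) * (eta/2)) * integral {8/10..1} kap"
    using D0 eta by (intro mult_left_mono) auto
   moreover have "15/10000 * eta * (D + eta) <= ((D + eta/2) * (eta/2)) * (1/10 * (1215/10000))"
   proof -
    have "15/10000 * (eta * D) <= 1215/200000 * (eta * D)" using D0 eta by (intro mult_right_mono) auto
    moreover have "15/10000 * (eta * eta) <= 1215/400000 * (eta * eta)" using eta by (intro mult_right_mono) auto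
    ultimately show ?thesis by (simp add: algebra_simps)
   qed
   ultimately show ?thesis by simp
  next
   case 2
   have s1': "s1 >= - 8/10" using 2 X[of s1 "- 8/10"] eta s by (force simp: al_def)
   have "integral {-1..-8/10} (%s. ((D + eta/2) * (eta/2)) * kap s) <= N"
   proof (rule N_ge)
    fix s :: real assume s': "s \<in> {-1..-8/10}"
    have "al - X s >= eta/2" using 2 X[of s "- 8/10"] s' by auto
    hence "(D + eta/2) * (eta/2) <= (be - X s) * (al - X s)" using D0 eta by (intro mult_mono) (auto simp: D_def)
    hence "(D + eta/2) * (eta/2) <= H s" unfolding H_def by (simp add: algebra_simps)
    thus "((D + eta/2) * (eta/2)) * kap s <= H s * kap s" using kp[of s] s' s1' by (intro mult_right_mono) auto
   qed (auto intro!: continuous_intros kapc)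
   moreover have "integral {-1..-8/10} kap >= 1/10 * (1215/10000)"
   proof -
    have "integral {-1..-8/10} kap = (8/10 - a) * bump (8/10)" unfolding kap_def by (simp add: integral_bump_slope bump_def power2_eq_square field_simps)
    also have "... >= 1/10 * (1215/10000)" using as1 s1' by (intro mult_mono) (auto simp: bump_def power2_eq_square)
    finally show ?thesis .
   qed
   hence "((D + eta/2) * (eta/2)) * (1/10 * (1215/10000)) <= ((D + eta/2) * (eta/2)) * integral {-1..-8/10} kap"
    using D0 eta by (intro mult_left_mono) auto
   moreover have "15/10000 * eta * (D + eta) <= ((D + eta/2) * (eta/2)) * (1/10 * (1215/10000))"
   proof -
    have "15/10000 * (eta * D) <= 1215/200000 * (eta * D)" using D0 eta by (intro mult_right_mono) auto
    moreover have "15/10000 * (eta * eta) <= 1215/400000 * (eta * eta)" using eta by (intro mult_right_mono) auto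
    ultimately show ?thesis by (simp add: algebra_simps)
   qed
   ultimately show ?thesis by simp
  next
   case 3
   have Deta: "D >= eta" using 3 X[of "- 1/10" "1/10"] by (simp add: D_def)
   have "(D/2) * (eta/2) * (1/2) * (1/10) <= N"
   proof (cases "X 0 - al >= D/2")
    case True
    have "integral {0..1/10} (%s::real. (D/2) * (eta/2) * (1/2)) <= N"
    proof (rule N_ge)
     fix s :: real assume s': "s \<in> {0..1/10}"
     have "D/2 <= X s - al" "eta/2 <= be - X s" using True X[of 0 s] X[of s "1/10"] 3 s' by auto
     hence h: "(D/2) * (eta/2) <= (X s - al) * (be - X s)" using D0 eta by (intro mult_mono) auto
     have "0 <= (D/2) * (eta/2)" using D0 eta by simp
     hence "(D/2) * (eta/2) * (1/2) <= ((X s - al) * (be - X s)) * (- kap s)"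
      using mid[of s] s' h by (intro mult_mono[OF h]) auto
     thus "(D/2) * (eta/2) * (1/2) <= H s * kap s" by (simp add: H_def algebra_simps)
    qed auto
    thus ?thesis by simp
   next
    case False
    hence F: "be - X 0 >= D/2" by (simp add: D_def field_simps)
    have "integral {-1/10..0} (%s::real. (D/2) * (eta/2) * (1/2)) <= N"
    proof (rule N_ge)
     fix s :: real assume s': "s \<in> {-1/10..0}"
     have "eta/2 <= X s - al" "D/2 <= be - X s" using F X[of s 0] X[of "- 1/10" s] 3 s' by auto
     hence h: "(eta/2) * (D/2) <= (X s - al) * (be - X s)" using D0 eta by (intro mult_mono) auto
     have "0 <= (eta/2) * (D/2)" using D0 eta by simp
     hence "(eta/2) * (D/2) * (1/2) <= ((X s - al) * (be - X s)) * (- kap s)"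
      using mid[of s] s' h by (intro mult_mono[OF h]) auto
     thus "(D/2) * (eta/2) * (1/2) <= H s * kap s" by (simp add: H_def algebra_simps)
    qed auto
    thus ?thesis by simp
   qed
   moreover have "eta * eta <= eta * D" using Deta eta by (intro mult_left_mono) auto
   moreover have "0 <= eta * D" using D0 eta by simp
   ultimately show ?thesis by (simp add: algebra_simps)
  qed
 qed
 have I0: "integral {-1..1} kap = 0" unfolding kap_def by (simp add: integral_bump_slope)
 have NP: "N = P2 + t * P1"
 proof -
  have "N = integral {-1..1} (%s. ((X s)^2 + (- (al + be)) * X s + al * be) * kap s)"
   unfolding N_def H_def by (rule arg_cong[where f = "integral {-1..1}"]) (auto simp: fun_eq_iff algebra_simps power2_eq_square)
  also have "... = integral {-1..1} (%s. (X s)^2 * kap s) - (al + be) * P1"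
   by (subst integral_quadratic[OF kapc]) (simp add: I0 P1_def algebra_simps)
  finally show ?thesis unfolding P2_def t_def by (subst smean_lin[OF kapc]) (simp add: I0 P1_def algebra_simps)
 qed
 have tV: "t^2 + 4 * svar = D^2 + 4 * integral {-1..1} (%s. H s * bump s)"
 proof -
  have "integral {-1..1} (%s. H s * bump s) = integral {-1..1} (%s. ((X s)^2 + (- (al + be)) * X s + al * be) * bump s)"
   unfolding H_def by (rule arg_cong[where f = "integral {-1..1}"]) (auto simp: fun_eq_iff algebra_simps power2_eq_square)
  also have "... = integral {-1..1} (%s. (X s)^2 * bump s) - (al + be) * smean + al * be"
   by (subst integral_quadratic) (simp_all add: bump_moments smean_def continuous_on_bump algebra_simps)
  finally show ?thesis unfolding svar_eq t_def D_def by (simp add: power2_eq_square algebra_simps)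
 qed
 \<comment> \<open>The integral of H G is nonnegative piece by piece. On the outer pieces the second
   mean value theorem reduces this to tails of \<open>kap\<close> and \<open>bump\<close>, compared
   by the bounds \<open>as1\<close> and \<open>as2\<close>; in the middle \<open>H\<close> and
   \<open>G\<close> are both nonpositive.\<close>
 define G where "G s = 2 * kap s - bump s" for s
 have Gc: "continuous_on A G" for A unfolding G_def[abs_def] by (intro continuous_intros kapc)
 have Gi: "G integrable_on {c..d}" for c d by (rule integrable_continuous_real[OF Gc])
 have IG: "integral {c..d} G = 2 * integral {c..d} kap - integral {c..d} bump" for c d
  unfolding G_def by (subst integral_diff) (auto intro!: integrable_continuous_real continuous_intros kapc)
 have HGi: "(%s. H s * G s) integrable_on {c..d}" if "{c..d} \<subseteq> {-1..1}" for c d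
  by (intro integrable_continuous_real continuous_intros Gc continuous_on_subset[OF Hc that])
 have right: "integral {s2..1} (%s. H s * G s) >= 0"
 proof -
  have m: "H x <= H y" if "s2 <= x" "x <= y" "y <= 1" for x y
   unfolding H_def al_def be_def using X[of x y] X[of s2 x] X[of s1 x] that s by (intro mult_mono) auto
  obtain c where c: "c \<in> {s2..1}" "integral {s2..1} (%s. H s * G s) = H s2 * integral {s2..c} G + H 1 * integral {c..1} G"
   by (rule second_mean_value_theorem[OF Gi, of s2 1 H]) (use m s in auto)
  have "(1 - c) / 2 <= a + c" using as2 c(1) by simp
  hence "bump c * ((1 - c) / 2) <= bump c * (a + c)" by (rule mult_left_mono) simp
  hence "integral {c..1} G >= 0" unfolding IG kap_def using integral_bump_tail(1)[of c] c(1) s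
   by (simp add: integral_bump_slope algebra_simps)
  moreover have "H s2 = 0" by (simp add: H_def be_def)
  moreover have "H 1 >= 0" using Hp[of 1] s by simp
  ultimately show ?thesis using c(2) by simp
 qed
 have left: "integral {-1..s1} (%s. H s * G s) >= 0"
 proof -
  have m: "- H x <= - H y" if "- 1 <= x" "x <= y" "y <= s1" for x y
  proof -
   have "(al - X y) * (be - X y) <= (al - X x) * (be - X x)"
    unfolding al_def be_def using X[of x y] X[of y s1] X[of y s2] that s by (intro mult_mono) auto
   thus ?thesis by (simp add: H_def algebra_simps)
  qed
  obtain c where c: "c \<in> {-1..s1}" "integral {-1..s1} (%s. - H s * G s) = - H (- 1) * integral {-1..c} G + - H s1 * integral {c..s1} G"
   by (rule second_mean_value_theorem[OF Gi, of "- 1" s1 "%s. - H s"]) (use m s in auto)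
  have "(1 + c) / 2 <= - (a + c)" using as1 c(1) by simp
  hence "bump c * ((1 + c) / 2) <= bump c * - (a + c)" by (rule mult_left_mono) simp
  moreover have "integral {-1..c} kap = bump c * - (a + c)"
   using c(1) unfolding kap_def by (simp add: integral_bump_slope algebra_simps)
  moreover have "integral {-1..c} bump <= bump c * (1 + c)" by (rule integral_bump_tail(2)) (use c(1) s in auto)
  moreover have "2 * (bump c * ((1 + c) / 2)) = bump c * (1 + c)" by simp
  ultimately have "integral {-1..c} G >= 0" unfolding IG by linarith
  moreover have "H s1 = 0" by (simp add: H_def al_def)
  moreover have "H (- 1) >= 0" using Hp[of "- 1"] s by simp
  moreover have "integral {-1..s1} (%s. - H s * G s) = - integral {-1..s1} (%s. H s * G s)" by simp
  ultimately show ?thesis using c(2) by simp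
 qed
 have middle: "integral {s1..s2} (%s. H s * G s) >= 0"
 proof (rule integral_nonneg[OF HGi])
  fix x assume x: "x \<in> {s1..s2}"
  have "G x <= 0" unfolding G_def using kn[of x] x bump_nonneg[of x] unfolding atLeastAtMost_iff by linarith
  thus "0 <= H x * G x" using Hn[of x] x by (simp add: mult_nonpos_nonpos)
 qed (use s in auto)
 have "integral {-1..1} (%s. H s * G s) >= 0"
  using Henstock_Kurzweil_Integration.integral_combine[of "-1" s1 1 "%s. H s * G s", OF _ _ HGi]
   Henstock_Kurzweil_Integration.integral_combine[of s1 s2 1 "%s. H s * G s", OF _ _ HGi] left right middle s by simp
 moreover have "integral {-1..1} (%s. H s * G s) = 2 * N - integral {-1..1} (%s. H s * bump s)"
 proof -
  have "(%s. H s * G s) = (%s. 2 * (H s * kap s) - H s * bump s)" by (simp add: G_def algebra_simps)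
  thus ?thesis unfolding N_def
   by (simp only:) (subst integral_diff, auto intro!: integrable_continuous_real continuous_intros Hc kapc)
 qed
 ultimately have E: "t^2 + 4 * svar <= D^2 + 8 * N" using tV by simp
 have V: "svar > 0" by (rule svar_pos[OF R eta])
 define S where "S = P1^2 + 7 * P2^2 / (4 * svar)"
 have S0: "S >= 0" using V by (simp add: S_def)
 have "N^2 <= S * (t^2 + 4 * svar / 7)"
 proof -
  \<comment> \<open>Lagrange's identity for the Cauchy-Schwarz inequality with weights 1 and 7 / (4
    svar).\<close>
  have "S * (t^2 + 4 * svar / 7) - N^2 = 7 / (4 * svar) * (P2 * t - 4 * svar / 7 * P1)^2"
   using V unfolding NP S_def by (simp add: field_simps power2_eq_square)
  also have "... >= 0" using V by simp
  finally show ?thesis by simp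
 qed
 also have "... <= S * (D^2 + 8 * N)" using E V S0 by (intro mult_left_mono) auto
 finally have NS: "N^2 <= S * (D^2 + 8 * N)" .
 have "11/10^7 * eta^2 <= S"
 proof (cases "D^2 >= 8 * N")
  case True
  have Npos: "N > 0" using Nb D0 eta by (smt (verit) mult_pos_pos divide_pos_pos)
  hence D: "D^2 > 0" using True by linarith
  have "15/10000 * eta * D <= 15/10000 * eta * (D + eta)" using eta by (intro mult_left_mono) auto
  hence "15/10000 * eta * D <= N" using Nb by linarith
  hence "(15/10000 * eta * D)^2 <= N^2" using D0 eta by (intro power_mono) auto
  also have "... <= S * (2 * D^2)" using NS mult_left_mono[OF _ S0, of "D^2 + 8 * N" "2 * D^2"] True by linarith
  finally have "(15/10000)^2 * eta^2 * D^2 <= 2 * S * D^2" by (simp only: power_mult_distrib mult_ac)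
  hence "(15/10000)^2 * eta^2 <= 2 * S" using D by (rule mult_right_le_imp_le)
  hence A: "9 * (eta * eta) <= 8000000 * S" by (simp add: power2_eq_square)
  have B: "0 <= eta * eta" by simp
  show ?thesis by (simp add: power2_eq_square) (use A B in linarith)
 next
  case False
  have Npos: "N > 0" using Nb D0 eta by (smt (verit) mult_pos_pos divide_pos_pos)
  have "N^2 <= S * (16 * N)" using NS mult_left_mono[OF _ S0, of "D^2 + 8 * N" "16 * N"] False by linarith
  hence "N * N <= (16 * S) * N" by (simp add: power2_eq_square)
  hence "N <= 16 * S" using Npos by (rule mult_right_le_imp_le)
  moreover have "15/10000 * eta * eta <= 15/10000 * eta * (D + eta)" using D0 eta by (intro mult_left_mono) auto
  ultimately have A: "15/10000 * eta * eta <= 16 * S" using Nb by linarith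
  have B: "0 <= eta * eta" by simp
  show ?thesis by (simp add: power2_eq_square) (use A B in linarith)
 qed
 thus ?thesis by (simp add: S_def P1_def P2_def kap_def)
qed

text \<open>By homogeneity there are two cases: for |b| <= |a| the mean alone suffices, and for |a|
  < |b| one may take b = 1, where the variance is needed. The loss from a^2 + b^2 <= 2 b^2 halves
  11/10^7.\<close>

lemma slope_norm_ge:
 assumes eta: "eta > 0" and R: "X (8/10) - X (1/10) >= eta" and L: "X (- 1/10) - X (- 8/10) >= eta"
 shows "54/10^8 * eta^2 * (a^2 + b^2) <= slope_norm a b"
proof (cases "\<bar>b\<bar> <= \<bar>a\<bar>")
 case True
 have V: "svar > 0" by (rule svar_pos[OF R eta])
 have *: "54/10^8 * eta^2 * (a^2 + b^2) <= slope_norm a b" if ab: "\<bar>b\<bar> <= a" for a b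
 proof -
  have "24/1000 * a * eta <= integral {-1..1} (%s. X s * bump_slope a b s)"
   by (rule bump_slope_pairing_ge[OF ab R])
  hence "(24/1000 * a * eta)^2 <= (integral {-1..1} (%s. X s * bump_slope a b s))^2"
   using ab eta by (intro power_mono) auto
  also have "... <= slope_norm a b" using V by (simp add: slope_norm_def)
  finally have 1: "(24/1000)^2 * (eta^2 * a^2) <= slope_norm a b" by (simp only: power_mult_distrib mult_ac)
  have "b^2 <= a^2" using ab by (intro power2_le_iff_abs_le[THEN iffD2]) auto
  hence "eta^2 * (a^2 + b^2) <= eta^2 * (2 * a^2)" by (intro mult_left_mono) auto
  moreover have "(24/1000)^2 * (eta^2 * a^2) = 576/1000000 * (eta^2 * a^2)" by (simp add: power2_eq_square)
  moreover have "0 <= eta^2 * a^2" by simp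
  ultimately have "54/100000000 * (eta^2 * (a^2 + b^2)) <= slope_norm a b" using 1 by linarith
  thus ?thesis by (simp add: mult.assoc)
 qed
 show ?thesis
 proof (cases "a >= 0")
  case False
  hence "54/10^8 * eta^2 * ((- a)^2 + (- b)^2) <= slope_norm (- a) (- b)" using True by (intro *) auto
  thus ?thesis using slope_norm_scale[of "- 1" a b] by simp
 qed (use True * in auto)
next
 case False
 have "11/10^7 * eta^2 <= slope_norm (a / b) 1"
  unfolding slope_norm_def by (rule variance_slope_ge[OF _ eta R L]) (use False in \<open>auto simp: field_simps\<close>)
 hence "b^2 * (11/10^7 * eta^2) <= b^2 * slope_norm (a / b) 1" by (rule mult_left_mono) simp
 also have "... = slope_norm a b" using slope_norm_scale[of b "a / b" 1] False by (cases "b = 0") auto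
 finally have 1: "11/10^7 * (eta^2 * b^2) <= slope_norm a b" by (simp add: mult_ac)
 have "a^2 <= b^2" using False by (metis abs_le_square_iff linear)
 hence "eta^2 * (a^2 + b^2) <= eta^2 * (2 * b^2)" by (intro mult_left_mono) auto
 moreover have "0 <= eta^2 * b^2" by simp
 moreover have "11/10000000 * (eta^2 * b^2) <= slope_norm a b" using 1 by simp
 ultimately have "54/100000000 * (eta^2 * (a^2 + b^2)) <= slope_norm a b" by linarith
 thus ?thesis by (simp add: mult.assoc)
qed

lemma smean_bounds: "X (- 1) <= smean" "smean <= X 1"
proof -
 have i: "(%s. X s * bump s) integrable_on {-1..1}" by (rule sampled_integrable(1)[OF continuous_on_bump])
 have "integral {-1..1} (%s. X (- 1) * bump s) <= smean" unfolding smean_def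
  by (rule integral_le[OF _ i]) (auto intro!: integrable_continuous_real continuous_intros mult_right_mono monotone_onD[OF Xm])
 thus "X (- 1) <= smean" by (simp add: bump_moments)
 have "smean <= integral {-1..1} (%s. X 1 * bump s)" unfolding smean_def
  by (rule integral_le[OF i]) (auto intro!: integrable_continuous_real continuous_intros mult_right_mono monotone_onD[OF Xm])
 thus "smean <= X 1" by (simp add: bump_moments)
qed

text \<open>\<open>weighted_slope_le\<close> is applied to sqrt (X - X (-1)) for the mean, as the
  weight annihilates constants, and to X - \<open>smean\<close> for the variance. 84 exceeds 5.5^2
  (1 + 7/4).\<close>

lemma slope_norm_le:
 assumes Lam: "X 1 - X (- 1) = Lam" "Lam > 0" and V: "svar > 0"
 shows "slope_norm a b <= 84 * Lam^2 * (a^2 + b^2)"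
proof -
 have X: "X (- 1) <= X s" "X s <= X 1" if "s \<in> {-1..1}" for s
  using monotone_onD[OF Xm, of "- 1" s] monotone_onD[OF Xm, of s 1] that by auto
 have *: "slope_norm a b <= 84 * Lam^2" if ab: "a^2 + b^2 = 1" for a b
 proof -
  have "\<bar>integral {-1..1} (%s. (sqrt (X s - X (- 1)))^2 * bump_slope a b s)\<bar> <= 55/10 * sqrt Lam * sqrt Lam"
  proof (rule weighted_slope_le[OF _ _ ab])
   have "integral {-1..1} (%s. (sqrt (X s - X (- 1)))^2 * bump s) = integral {-1..1} (%s. X s * bump s - X (- 1) * bump s)"
    by (rule integral_cong) (use X in \<open>auto simp: algebra_simps\<close>)
   also have "... = smean - X (- 1)"
    by (subst integral_diff) (auto simp: smean_def bump_moments intro!: integrable_continuous_real continuous_intros Xc)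
   also have "... <= (sqrt Lam)^2" using Lam smean_bounds by simp
   finally show "integral {-1..1} (%s. (sqrt (X s - X (- 1)))^2 * bump s) <= (sqrt Lam)^2" .
   fix s :: real assume "s \<in> {-1..1}"
   thus "\<bar>sqrt (X s - X (- 1))\<bar> <= sqrt Lam" using X[of s] Lam by auto
  qed (use Lam in \<open>auto intro!: continuous_intros Xc\<close>)
  also have "... = 55/10 * Lam" using Lam by simp
  also have "integral {-1..1} (%s. (sqrt (X s - X (- 1)))^2 * bump_slope a b s)
    = integral {-1..1} (%s. X s * bump_slope a b s - X (- 1) * bump_slope a b s)"
   by (rule integral_cong) (use X in \<open>auto simp: algebra_simps\<close>)
  also have "... = integral {-1..1} (%s. X s * bump_slope a b s)"
   by (subst integral_diff) (auto simp: integral_bump_slope intro!: integrable_continuous_real continuous_intros Xc)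
  finally have 1: "(integral {-1..1} (%s. X s * bump_slope a b s))^2 <= (55/10 * Lam)^2" by (intro power2_le_iff_abs_le[THEN iffD2]) (use Lam in auto)
  have "\<bar>integral {-1..1} (%s. (X s - smean)^2 * bump_slope a b s)\<bar> <= 55/10 * Lam * sqrt svar"
  proof (rule weighted_slope_le[OF _ _ ab])
   show "integral {-1..1} (%s. (X s - smean)^2 * bump s) <= (sqrt svar)^2" using V by (simp add: svar_def)
   fix s :: real assume "s \<in> {-1..1}"
   thus "\<bar>X s - smean\<bar> <= Lam" using X[of s] Lam smean_bounds by (auto simp: abs_le_iff)
  qed (use Lam V in \<open>auto intro!: continuous_intros Xc\<close>)
  hence "(integral {-1..1} (%s. (X s - smean)^2 * bump_slope a b s))^2 <= (55/10 * Lam * sqrt svar)^2"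
   by (intro power2_le_iff_abs_le[THEN iffD2]) (use Lam V in auto)
  also have "... = 3025/100 * Lam^2 * svar" using V by (simp add: power_mult_distrib power2_eq_square)
  finally have q2: "(integral {-1..1} (%s. (X s - smean)^2 * bump_slope a b s))^2 <= 3025/100 * Lam^2 * svar" .
  have "7 * (integral {-1..1} (%s. (X s - smean)^2 * bump_slope a b s))^2 / (4 * svar) <= 7 * (3025/100 * Lam^2 * svar) / (4 * svar)"
   by (intro divide_right_mono mult_left_mono q2) (use V in auto)
  also have "7 * (3025/100 * Lam^2 * svar) / (4 * svar) = 7 * (3025/400) * Lam^2" using V by (simp add: field_simps)
  finally have "slope_norm a b <= (55/10 * Lam)^2 + 7 * (3025/400) * Lam^2" unfolding slope_norm_def using 1 by linarith
  also have "... <= 84 * Lam^2" by (simp add: power2_eq_square)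
  finally show ?thesis .
 qed
 define r where "r = sqrt (a^2 + b^2)"
 have r2: "r^2 = a^2 + b^2" by (simp add: r_def)
 show ?thesis
 proof (cases "r = 0")
  case True
  hence "a = 0" "b = 0" using r2 by (auto simp: sum_power2_eq_zero_iff)
  thus ?thesis using slope_norm_scale[of 0 a b] by simp
 next
  case False
  have "(a / r)^2 + (b / r)^2 = 1"
   using False by (simp add: power_divide r2[symmetric] add_divide_distrib[symmetric])
  hence "r^2 * slope_norm (a / r) (b / r) <= r^2 * (84 * Lam^2)" by (intro mult_left_mono *) auto
  thus ?thesis using slope_norm_scale[of r "a / r" "b / r"] False r2 by (simp add: mult_ac)
 qed
qed

end

end

end

section \<open>Differentiation of window averages of a continuous function\<close>

lemma integral_scaled_window:
 fixes F :: "real => real"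
 assumes F: "continuous_on UNIV F" "!!xi. \<bar>xi - u\<bar> >= v ==> F xi = 0" and v: "v > 0" and I: "c <= u - v" "u + v <= d"
 shows "integral {c..d} F = v * integral {-1..1} (%s. F (u + v * s))"
proof -
 have Fi: "F integrable_on {x..y}" for x y
  by (rule integrable_continuous_real[OF continuous_on_subset[OF F(1)]]) simp
 have "integral {c..u - v} F = integral {c..u - v} (%_. 0)" by (rule integral_cong) (use F(2) in auto)
 moreover have "integral {u + v..d} F = integral {u + v..d} (%_. 0)" by (rule integral_cong) (use F(2) in auto)
 ultimately have "integral {c..d} F = integral {u - v..u + v} F"
  using Henstock_Kurzweil_Integration.integral_combine[of c "u - v" d F, OF _ _ Fi]
   Henstock_Kurzweil_Integration.integral_combine[of "u - v" "u + v" d F, OF _ _ Fi] I v by simp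
 also have "... = integral {-1..1} (%s. v *\<^sub>R F (u + v * s))"
 proof (rule sym, rule integral_unique)
  have "((%s. v *\<^sub>R F (u + v * s)) has_integral (integral {u + v * (- 1)..u + v * 1} F)) {-1..1}"
  proof (rule has_integral_substitution)
   show "(%s. u + v * s) ` {- 1..1} \<subseteq> {u - v..u + v}"
   proof (rule image_subsetI)
    fix s :: real assume "s \<in> {-1..1}"
    hence "\<bar>v * s\<bar> <= v" using mult_left_le[of "\<bar>s\<bar>" v] v by (auto simp: abs_mult)
    thus "u + v * s \<in> {u - v..u + v}" by (auto simp: abs_le_iff)
   qed
   show "((%s. u + v * s) has_field_derivative v) (at x within {- 1..1})" for x
    by (auto intro!: derivative_eq_intros)
  qed (use v in \<open>auto intro: continuous_on_subset[OF F(1)]\<close>)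
  thus "((%s. v *\<^sub>R F (u + v * s)) has_integral integral {u - v..u + v} F) {- 1..1}" by simp
 qed
 finally show ?thesis by simp
qed

text \<open>The square of the positive part is continuously differentiable with Lipschitz
  derivative; this is its first-order Taylor estimate.\<close>

lemma pos_square_diff_le:
 fixes x y :: real
 shows "\<bar>(max 0 y)^2 - (max 0 x)^2 - 2 * max 0 x * (y - x)\<bar> <= (y - x)^2"
proof (cases "0 <= x")
 case True
 show ?thesis
 proof (cases "0 <= y")
  case True
  hence "(max 0 y)^2 - (max 0 x)^2 - 2 * max 0 x * (y - x) = (y - x)^2"
   using \<open>0 <= x\<close> by (simp add: power2_eq_square algebra_simps)
  thus ?thesis by simp
 next
  case False
  have "(max 0 y)^2 - (max 0 x)^2 - 2 * max 0 x * (y - x) = x^2 - 2 * (x * y)"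
   using True False by (simp add: power2_eq_square algebra_simps)
  moreover have "x * y <= 0" using True False by (simp add: mult_nonneg_nonpos)
  moreover have "(y - x)^2 = y^2 - 2 * (x * y) + x^2" by (simp add: power2_diff)
  moreover have "x^2 >= 0" "y^2 >= 0" by simp_all
  ultimately show ?thesis by linarith
 qed
next
 case False
 show ?thesis
 proof (cases "0 <= y")
  case True
  have "y^2 <= (y - x)^2" using True False by (intro power_mono) auto
  thus ?thesis using True False by simp
 qed (use False in simp)
qed

text \<open>\<open>h\<close> is only continuous, so the dependence on \<open>w\<close> is moved to
  the kernel by the substitution xi = Re w + Im w s. The average becomes 15/16 (Im w)^(-5) times the
  integral of \<open>h\<close> against the square of the positive part of (Im w)^2 - (xi - Re w)^2,
  which is continuously differentiable in \<open>w\<close>.\<close>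

lemma window_integral_has_derivative:
 fixes h :: "real => real"
 assumes h: "continuous_on UNIV h" and v: "Im w > 0"
 shows "((%w. integral {-1..1} (%s. h (Re w + Im w * s) * bump s)) has_derivative
  (%de. integral {-1..1} (%s. h (Re w + Im w * s) * bump_slope (Re de) (Im de) s) / Im w)) (at w)"
proof -
 define u v where "u = Re w" and "v = Im w"
 have v0: "v > 0" using v by (simp add: v_def)
 \<comment> \<open>A fixed interval containing the windows of all z within v/2 of w: their centres
   are off by at most v/2 and their half-widths are at most 3/2 v.\<close>
 define I where "I = {u - 2 * v..u + 2 * v}"
 define T where "T z xi = (Im z)^2 - (xi - Re z)^2" for z xi
 define P where "P z xi = max 0 (T z xi)" for z xi
 define N where "N z = integral I (%xi. h xi * (P z xi)^2)" for z
 define A where "A = integral I (%xi. h xi * (4 * P w xi * (xi - u)))"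
 define B where "B = integral I (%xi. h xi * (4 * P w xi * v))"
 define M where "M = integral I (%xi. \<bar>h xi\<bar>)"
 have hs: "continuous_on S h" for S using h by (rule continuous_on_subset) simp
 have Pc: "continuous_on S (P z)" for S z unfolding P_def[abs_def] T_def by (intro continuous_intros)
 have int: "f integrable_on I" if "continuous_on UNIV f" for f :: "real => real"
  unfolding I_def by (rule integrable_continuous_real[OF continuous_on_subset[OF that]]) simp
 have hN: "integral {-1..1} (%s. h (Re z + Im z * s) * bump s) = 15/16 * N z / (Im z) ^ 5"
  if z: "dist z w < v/2" for z
 proof -
  have d: "\<bar>Re z - u\<bar> < v/2" "\<bar>Im z - v\<bar> < v/2"
   using z abs_Re_le_cmod[of "z - w"] abs_Im_le_cmod[of "z - w"] by (auto simp: dist_norm u_def v_def)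
  hence y: "Im z > 0" "Im z < 3/2 * v" by linarith+
  have "N z = Im z * integral {-1..1} (%s. h (Re z + Im z * s) * (P z (Re z + Im z * s))^2)"
   unfolding N_def I_def
  proof (rule integral_scaled_window)
   show "continuous_on UNIV (%xi. h xi * (P z xi)^2)" by (intro continuous_intros h Pc)
   fix xi assume "Im z <= \<bar>xi - Re z\<bar>"
   hence "(Im z)^2 <= (xi - Re z)^2" using y by (metis abs_le_square_iff abs_of_pos)
   thus "h xi * (P z xi)^2 = 0" by (simp add: P_def T_def)
  qed (use d y in linarith)+
  also have "integral {-1..1} (%s. h (Re z + Im z * s) * (P z (Re z + Im z * s))^2)
    = integral {-1..1} (%s. (16/15 * Im z ^ 4) * (h (Re z + Im z * s) * bump s))"
  proof (rule integral_cong)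
   fix s :: real assume "s \<in> {-1..1}"
   hence "s^2 <= 1" by (simp add: abs_square_le_1 abs_le_iff)
   hence "P z (Re z + Im z * s) = (Im z)^2 * (1 - s^2)"
    using y by (simp add: P_def T_def power_mult_distrib algebra_simps max_absorb2 mult_left_le)
   thus "h (Re z + Im z * s) * (P z (Re z + Im z * s))^2 = (16/15 * Im z ^ 4) * (h (Re z + Im z * s) * bump s)"
    by (simp add: bump_def power_mult_distrib)
  qed
  also have "... = (16/15 * Im z ^ 4) * integral {-1..1} (%s. h (Re z + Im z * s) * bump s)" by simp
  finally show ?thesis using y by (simp add: field_simps eval_nat_numeral)
 qed
 have eqA: "integral I (%xi. h xi * (4 * P w xi * k ((xi - u) / v))) = v ^ 3 * integral {-1..1} (%s. h (u + v * s) * (4 * (1 - s^2) * k s))"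
  if k: "continuous_on UNIV k" for k
 proof -
  have "integral I (%xi. h xi * (4 * P w xi * k ((xi - u) / v)))
    = v * integral {-1..1} (%s. h (u + v * s) * (4 * P w (u + v * s) * k ((u + v * s - u) / v)))"
   unfolding I_def
  proof (rule integral_scaled_window)
   show "continuous_on UNIV (%xi. h xi * (4 * P w xi * k ((xi - u) / v)))"
    using v0 by (intro continuous_intros h Pc continuous_on_compose2[OF k]) auto
   fix xi assume "v <= \<bar>xi - u\<bar>"
   hence "v^2 <= (xi - u)^2" using v0 by (metis abs_le_square_iff abs_of_pos)
   thus "h xi * (4 * P w xi * k ((xi - u) / v)) = 0" by (simp add: P_def T_def u_def v_def)
  qed (use v0 in auto)
  also have "integral {-1..1} (%s. h (u + v * s) * (4 * P w (u + v * s) * k ((u + v * s - u) / v)))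
    = integral {-1..1} (%s. v^2 * (h (u + v * s) * (4 * (1 - s^2) * k s)))"
  proof (rule integral_cong)
   fix s :: real assume "s \<in> {-1..1}"
   hence "s^2 <= 1" by (simp add: abs_square_le_1 abs_le_iff)
   hence "P w (u + v * s) = v^2 * (1 - s^2)"
    using v0 unfolding P_def T_def u_def[symmetric] v_def[symmetric] by (simp add: power_mult_distrib algebra_simps max_absorb2 mult_left_le)
   thus "h (u + v * s) * (4 * P w (u + v * s) * k ((u + v * s - u) / v)) = v^2 * (h (u + v * s) * (4 * (1 - s^2) * k s))"
    using v0 by simp
  qed
  finally show ?thesis by (simp add: eval_nat_numeral)
 qed
 have A: "A = v ^ 4 * integral {-1..1} (%s. h (u + v * s) * (4 * (1 - s^2) * s))"
 proof -
  have "A = integral I (%xi. v * (h xi * (4 * P w xi * ((xi - u) / v))))" using v0 by (simp add: A_def)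
  also have "... = v * integral I (%xi. h xi * (4 * P w xi * ((xi - u) / v)))" by (rule integral_mult_right)
  also have "... = v * (v ^ 3 * integral {-1..1} (%s. h (u + v * s) * (4 * (1 - s^2) * s)))"
   by (subst eqA[of "%s. s"]) (auto intro: continuous_intros)
  finally show ?thesis by (simp add: eval_nat_numeral)
 qed
 have B: "B = v ^ 4 * integral {-1..1} (%s. h (u + v * s) * (4 * (1 - s^2)))"
 proof -
  have "B = integral I (%xi. v * (h xi * (4 * P w xi * 1)))" by (simp add: B_def mult_ac)
  also have "... = v * integral I (%xi. h xi * (4 * P w xi * 1))" by (rule integral_mult_right)
  also have "... = v * (v ^ 3 * integral {-1..1} (%s. h (u + v * s) * (4 * (1 - s^2) * 1)))"
   by (subst eqA[of "%s. 1"]) (auto intro: continuous_intros)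
  finally show ?thesis by (simp add: eval_nat_numeral)
 qed
 \<comment> \<open>In the remainder bound 60 exceeds 49 + 2: \<open>T\<close> changes by at most 7 v
   r, and the second-order part of this change, multiplied by 2 \<open>P w xi\<close>, contributes
   at most 2 v^2 r^2.\<close>
 have Nd: "(N has_derivative (%de. Re de * A + Im de * B)) (at w)"
 proof (rule has_derivativeI_sandwich[where e = "v/2" and H = "%z. 60 * v^2 * M * norm (z - w)"])
  show "bounded_linear (%de. Re de * A + Im de * B)"
   by (intro bounded_linear_add bounded_linear_mult_const bounded_linear_Re bounded_linear_Im)
  have "((%z. 60 * v^2 * M * norm (z - w)) \<longlongrightarrow> 60 * v^2 * M * norm (w - w)) (at w)" by (intro tendsto_intros)
  thus "((%z. 60 * v^2 * M * norm (z - w)) \<longlongrightarrow> 0) (at w)" by simp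
  fix z assume z: "z ~= w" "dist z w < v/2"
  define a b where "a = Re (z - w)" and "b = Im (z - w)"
  define r where "r = norm (z - w)"
  have r: "r > 0" "r < v/2" "\<bar>a\<bar> <= r" "\<bar>b\<bar> <= r"
   using z abs_Re_le_cmod[of "z - w"] abs_Im_le_cmod[of "z - w"] by (auto simp: dist_norm r_def a_def b_def)
  have pw: "norm (h xi * (P z xi)^2 - h xi * (P w xi)^2 - (a * (h xi * (4 * P w xi * (xi - u))) + b * (h xi * (4 * P w xi * v))))
    <= 60 * v^2 * r^2 * \<bar>h xi\<bar>" if xi: "xi \<in> I" for xi
  proof -
   have x: "\<bar>xi - u\<bar> <= 2 * v" using xi by (auto simp: I_def abs_le_iff)
   have T: "T z xi - T w xi = 2 * v * b + 2 * (xi - u) * a + (b^2 - a^2)"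
    by (simp add: T_def a_def b_def u_def v_def power2_eq_square algebra_simps)
   have sq: "b^2 <= r^2" "a^2 <= r^2" using r by (auto intro!: power2_le_iff_abs_le[THEN iffD2])
   hence ba: "\<bar>b^2 - a^2\<bar> <= r^2" using zero_le_power2[of a] zero_le_power2[of b] by linarith
   have P: "0 <= P w xi" "P w xi <= v^2" by (auto simp: P_def T_def v_def)
   have "\<bar>v * b\<bar> <= v * r" "\<bar>(xi - u) * a\<bar> <= 2 * v * r" "r^2 <= v * r" unfolding abs_mult power2_eq_square
    using x r v0 by (auto intro!: mult_mono)
   hence "\<bar>T z xi - T w xi\<bar> <= 7 * (v * r)" unfolding T using ba by (simp only: mult.assoc)
   hence "(T z xi - T w xi)^2 <= (7 * (v * r))^2" using v0 r by (intro power2_le_iff_abs_le[THEN iffD2]) auto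
   hence 1: "(T z xi - T w xi)^2 <= 49 * (v^2 * r^2)" by (simp add: power_mult_distrib)
   have 2: "\<bar>2 * P w xi * (b^2 - a^2)\<bar> <= 2 * (v^2 * r^2)"
    using mult_mono[OF P(2) ba] P(1) by (simp add: abs_mult)
   have 3: "0 <= v^2 * r^2" by simp
   have "(P z xi)^2 - (P w xi)^2 - (a * (4 * P w xi * (xi - u)) + b * (4 * P w xi * v))
     = ((P z xi)^2 - (P w xi)^2 - 2 * P w xi * (T z xi - T w xi)) + 2 * P w xi * (b^2 - a^2)"
    unfolding T by (simp add: algebra_simps)
   hence "\<bar>(P z xi)^2 - (P w xi)^2 - (a * (4 * P w xi * (xi - u)) + b * (4 * P w xi * v))\<bar> <= 60 * (v^2 * r^2)"
    using pos_square_diff_le[of "T z xi" "T w xi"] 1 2 3 unfolding P_def by linarith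
   hence "\<bar>h xi\<bar> * \<bar>(P z xi)^2 - (P w xi)^2 - (a * (4 * P w xi * (xi - u)) + b * (4 * P w xi * v))\<bar> <= \<bar>h xi\<bar> * (60 * (v^2 * r^2))"
    by (rule mult_left_mono) simp
   thus ?thesis unfolding real_norm_def abs_mult[symmetric] by (simp add: algebra_simps)
  qed
  define E where "E xi = h xi * (P z xi)^2 - h xi * (P w xi)^2 - (a * (h xi * (4 * P w xi * (xi - u))) + b * (h xi * (4 * P w xi * v)))" for xi
  have ic: "(%xi. h xi * (P z xi)^2) integrable_on I" "(%xi. h xi * (P w xi)^2) integrable_on I"
   "(%xi. h xi * (4 * P w xi * (xi - u))) integrable_on I" "(%xi. h xi * (4 * P w xi * v)) integrable_on I"
   "(%xi. 60 * v^2 * r^2 * \<bar>h xi\<bar>) integrable_on I"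
   by (intro int continuous_intros h Pc)+
  have ih: "(%xi. \<bar>h xi\<bar>) integrable_on I" by (intro int continuous_intros h)
  have "(E has_integral (N z - N w - (a * A + b * B))) I"
   unfolding E_def[abs_def] N_def A_def B_def
   by (intro has_integral_diff has_integral_add has_integral_mult_right integrable_integral ic)
  hence E: "E integrable_on I" "integral I E = N z - N w - (a * A + b * B)" by (auto simp: integral_unique)
  have "((%xi. 60 * v^2 * r^2 * \<bar>h xi\<bar>) has_integral (60 * v^2 * r^2 * M)) I"
   unfolding M_def by (intro has_integral_mult_right integrable_integral ih)
  hence "integral I (%xi. 60 * v^2 * r^2 * \<bar>h xi\<bar>) = 60 * v^2 * r^2 * M" by (rule integral_unique)
  moreover have "norm (integral I E) <= integral I (%xi. 60 * v^2 * r^2 * \<bar>h xi\<bar>)"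
   by (rule integral_norm_bound_integral[OF E(1) ic(5)]) (use pw in \<open>simp add: E_def\<close>)
  ultimately have "norm (N z - N w - (a * A + b * B)) <= 60 * v^2 * r^2 * M" using E(2) by metis
  hence "norm (N z - N w - (a * A + b * B)) / r <= 60 * v^2 * M * r"
   using r by (simp add: divide_le_eq power2_eq_square mult_ac)
  thus "norm (N z - N w - (Re (z - w) * A + Im (z - w) * B)) / norm (z - w) <= 60 * v^2 * M * norm (z - w)"
   unfolding a_def b_def r_def .
 qed (use v0 in auto)
 have ImN: "((%z. 15/16 * N z / (Im z) ^ 5) has_derivative
   (%de. 15/16 * ((Re de * A + Im de * B) / v ^ 5 - 5 * Im de * N w / v ^ 6))) (at w)"
  using v0 by (auto intro!: derivative_eq_intros Nd simp: v_def[symmetric] field_simps eval_nat_numeral)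
 have "((%z. integral {-1..1} (%s. h (Re z + Im z * s) * bump s)) has_derivative
   (%de. 15/16 * ((Re de * A + Im de * B) / v ^ 5 - 5 * Im de * N w / v ^ 6))) (at w)"
  by (rule has_derivative_transform_within[OF ImN, of "v/2"]) (use v0 hN in auto)
 moreover have "15/16 * ((Re de * A + Im de * B) / v ^ 5 - 5 * Im de * N w / v ^ 6)
   = integral {-1..1} (%s. h (Re w + Im w * s) * bump_slope (Re de) (Im de) s) / Im w" for de
 proof -
  define A0 where "A0 = integral {-1..1} (%s. h (u + v * s) * (4 * (1 - s^2) * s))"
  define B0 where "B0 = integral {-1..1} (%s. h (u + v * s) * (4 * (1 - s^2)))"
  define M0 where "M0 = integral {-1..1} (%s. h (u + v * s) * bump s)"
  have hc: "continuous_on {-1..1} (%s. h (u + v * s))" by (intro continuous_on_compose2[OF h] continuous_intros) auto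
  have N: "15/16 * N w = v ^ 5 * integral {-1..1} (%s. h (u + v * s) * bump s)"
   using hN[of w] v0 by (simp add: u_def[symmetric] v_def[symmetric] field_simps)
  have i1: "(%s. h (u + v * s) * (4 * (1 - s^2) * s)) integrable_on {-1..1}" "(%s. h (u + v * s) * (4 * (1 - s^2))) integrable_on {-1..1}"
   "(%s. h (u + v * s) * bump s) integrable_on {-1..1}"
   by (intro integrable_continuous_real continuous_intros hc)+
  have eq: "h (u + v * s) * bump_slope (Re de) (Im de) s = 15/16 * (Re de * (h (u + v * s) * (4 * (1 - s^2) * s)))
    + (15/16 * (Im de * (h (u + v * s) * (4 * (1 - s^2)))) - 5 * Im de * (h (u + v * s) * bump s))" for s
  proof -
   have "h (u + v * s) * (15/16 * (1 - s^2) * (4 * Re de * s + Im de * (4 - 5 * (1 - s^2)))) = 15/16 * (Re de * (h (u + v * s) * (4 * (1 - s^2) * s)))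
    + (15/16 * (Im de * (h (u + v * s) * (4 * (1 - s^2)))) - 5 * Im de * (h (u + v * s) * (15/16 * ((1 - s^2) * (1 - s^2)))))"
    by (simp only: distrib_left distrib_right right_diff_distrib left_diff_distrib mult_ac)
   moreover have "4 - 5 * (1 - s^2) = 5 * s^2 - 1" by simp
   ultimately show ?thesis unfolding bump_slope_def bump_def power2_eq_square[of "1 - s^2"] by simp
  qed
  have "((%s. h (u + v * s) * bump_slope (Re de) (Im de) s) has_integral
    15/16 * (Re de * integral {-1..1} (%s. h (u + v * s) * (4 * (1 - s^2) * s)))
    + (15/16 * (Im de * integral {-1..1} (%s. h (u + v * s) * (4 * (1 - s^2)))) - 5 * Im de * integral {-1..1} (%s. h (u + v * s) * bump s))) {-1..1}"
   unfolding eq by (intro has_integral_diff has_integral_add has_integral_mult_right integrable_integral i1)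
  from integral_unique[OF this]
  have "integral {-1..1} (%s. h (u + v * s) * bump_slope (Re de) (Im de) s)
    = 15/16 * (Re de * integral {-1..1} (%s. h (u + v * s) * (4 * (1 - s^2) * s)))
    + (15/16 * (Im de * integral {-1..1} (%s. h (u + v * s) * (4 * (1 - s^2)))) - 5 * Im de * integral {-1..1} (%s. h (u + v * s) * bump s))" .
  hence R: "integral {-1..1} (%s. h (Re w + Im w * s) * bump_slope (Re de) (Im de) s) / Im w
    = (15/16 * (Re de * A0) + (15/16 * (Im de * B0) - 5 * Im de * M0)) / v"
   unfolding A0_def B0_def M0_def u_def v_def by simp
  have "N w = 16/15 * v ^ 5 * M0" using N by (simp add: M0_def)
  thus ?thesis unfolding R A B A0_def[symmetric] B0_def[symmetric] using v0
   by (simp add: field_simps eval_nat_numeral)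
 qed
 ultimately show ?thesis by simp
qed

section \<open>Extension of circle homeomorphisms to the disc\<close>

lemma eventually_le_of_has_derivative:
 fixes f :: "'a::real_normed_vector => 'b::real_normed_vector"
 assumes D: "(f has_derivative D) (at x)" and le: "!!de. norm (D de) <= M0 * norm de" and M: "M0 < M"
 shows "\<forall>\<^sub>F y in at x. norm (f y - f x) <= M * norm (y - x)"
proof -
 obtain d where d: "d > 0" "!!y. norm (y - x) < d ==> norm (f y - f x - D (y - x)) <= (M - M0) * norm (y - x)"
  using D[unfolded has_derivative_at_alt] M by (meson diff_gt_0_iff_gt)
 have "norm (f y - f x) <= M * norm (y - x)" if "dist y x < d" for y
 proof -
  have "norm (f y - f x) <= norm (f y - f x - D (y - x)) + norm (D (y - x))"
   using norm_triangle_sub[of "f y - f x" "D (y - x)"] by (simp add: add.commute)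
  also have "... <= (M - M0) * norm (y - x) + M0 * norm (y - x)" using d(2) le that by (intro add_mono) (auto simp: dist_norm)
  finally show ?thesis by (simp add: algebra_simps)
 qed
 thus ?thesis using d(1) unfolding eventually_at by blast
qed

lemma eventually_ge_of_has_derivative:
 fixes f :: "'a::real_normed_vector => 'b::real_normed_vector"
 assumes D: "(f has_derivative D) (at x)" and le: "!!de. norm (D de) >= M0 * norm de" and M: "M < M0"
 shows "\<forall>\<^sub>F y in at x. norm (f y - f x) >= M * norm (y - x)"
proof -
 obtain d where d: "d > 0" "!!y. norm (y - x) < d ==> norm (f y - f x - D (y - x)) <= (M0 - M) * norm (y - x)"
  using D[unfolded has_derivative_at_alt] M by (meson diff_gt_0_iff_gt)
 have "norm (f y - f x) >= M * norm (y - x)" if "dist y x < d" for y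
 proof -
  have "norm (D (y - x)) <= norm (f y - f x) + norm (f y - f x - D (y - x))"
   using norm_triangle_sub[of "D (y - x)" "f y - f x"] by (simp add: norm_minus_commute)
  moreover have "norm (f y - f x - D (y - x)) <= (M0 - M) * norm (y - x)" using d(2) that by (simp add: dist_norm)
  moreover have "M0 * norm (y - x) <= norm (D (y - x))" by (rule le)
  moreover have "M0 * norm (y - x) - (M0 - M) * norm (y - x) = M * norm (y - x)" by (simp add: algebra_simps)
  ultimately show ?thesis by linarith
 qed
 thus ?thesis using d(1) unfolding eventually_at by blast
qed

text \<open>7 is the reciprocal of the variance of \<open>bump\<close>; with this factor
  \<open>Gmap\<close> is the identity on the closed upper half-plane when \<open>g\<close> is the
  identity.\<close>

definition Gmap :: "(real => real) => complex => complex" where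
 "Gmap g w = Complex (smean (%s. g (Re w + Im w * s))) (sqrt (7 * svar (%s. g (Re w + Im w * s))))"

context
 fixes g :: "real => real"
 assumes gc: "continuous_on UNIV g" and gm: "strict_mono g" and geq: "!!x. g (x + 2 * pi) = g x + 2 * pi"
begin

abbreviation win :: "complex => real => real" where "win w \<equiv> %s. g (Re w + Im w * s)"

lemma win_cont: "continuous_on A (win w)"
 by (intro continuous_on_compose2[OF gc] continuous_intros) auto

lemma win_mono: "Im w >= 0 ==> mono_on A (win w)"
 using strict_mono_mono[OF gm] by (auto simp: mono_on_def mono_def mult_left_mono)

lemma win_strict: "Im w > 0 ==> s < t ==> win w s < win w t"
 using gm by (auto simp: strict_mono_def)

lemma svar_win_pos: "Im w > 0 ==> svar (win w) > 0"
 using svar_pos[OF win_cont win_mono, of w "win w (8/10) - win w (1/10)"] win_strict[of w "1/10" "8/10"] by simp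

lemma Gmap_Im_pos: "Im w > 0 ==> Im (Gmap g w) > 0" using svar_win_pos by (simp add: Gmap_def)

lemma Gmap_has_derivative:
 assumes v: "Im w > 0"
 obtains D where "(Gmap g has_derivative D) (at w)"
  "!!de. (norm (D de))^2 = slope_norm (win w) (Re de) (Im de) / (Im w)^2"
proof -
 define X where "X = win w"
 define m where "m = smean X"
 define P1 where "P1 de = integral {-1..1} (%s. X s * bump_slope (Re de) (Im de) s)" for de
 define Q where "Q de = integral {-1..1} (%s. (X s)^2 * bump_slope (Re de) (Im de) s)" for de
 define P2 where "P2 de = integral {-1..1} (%s. (X s - m)^2 * bump_slope (Re de) (Im de) s)" for de
 have Xc: "continuous_on {-1..1} X" unfolding X_def by (rule win_cont)
 have V: "svar X > 0" unfolding X_def by (rule svar_win_pos[OF v])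
 have P2: "P2 de = Q de - 2 * m * P1 de" for de
  unfolding P2_def Q_def P1_def by (subst smean_lin[OF Xc continuous_on_bump_slope]) (simp add: integral_bump_slope)
 have d1: "((%z. smean (win z)) has_derivative (%de. P1 de / Im w)) (at w)"
  unfolding smean_def P1_def X_def by (rule window_integral_has_derivative[OF gc v])
 have "continuous_on UNIV (%x. (g x)^2)" by (intro continuous_intros gc)
 from window_integral_has_derivative[OF this v]
 have d2: "((%z. integral {-1..1} (%s. (win z s)^2 * bump s)) has_derivative (%de. Q de / Im w)) (at w)"
  unfolding Q_def X_def .
 have sv: "(%z. svar (win z)) = (%z. integral {-1..1} (%s. (win z s)^2 * bump s) - (smean (win z))^2)"
  by (rule ext, rule svar_eq[OF win_cont])
 have d3: "((%z. svar (win z)) has_derivative (%de. P2 de / Im w)) (at w)"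
  unfolding sv P2
  by (rule has_derivative_eq_rhs, rule has_derivative_diff[OF d2 has_derivative_power[OF d1]])
    (simp add: m_def X_def diff_divide_distrib fun_eq_iff)
 have d4: "((%z. sqrt (7 * svar (win z))) has_derivative (%de. 7 * P2 de / (2 * sqrt (7 * svar X) * Im w))) (at w)"
  by (rule has_derivative_eq_rhs, rule has_derivative_real_sqrt[OF _ has_derivative_mult_right[OF d3]])
    (use V in \<open>simp_all add: X_def field_simps fun_eq_iff\<close>)
 define D where "D de = of_real (P1 de / Im w) + \<i> * of_real (7 * P2 de / (2 * sqrt (7 * svar X) * Im w))" for de
 have "((%z. of_real (smean (win z)) + \<i> * of_real (sqrt (7 * svar (win z)))) has_derivative D) (at w)"
  unfolding D_def by (intro has_derivative_add has_derivative_mult_right has_derivative_of_real d1 d4)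
 moreover have "(%z. of_real (smean (win z)) + \<i> * of_real (sqrt (7 * svar (win z)))) = Gmap g"
  by (simp add: Gmap_def fun_eq_iff Complex_eq)
 ultimately have "(Gmap g has_derivative D) (at w)" by simp
 moreover have "(norm (D de))^2 = slope_norm (win w) (Re de) (Im de) / (Im w)^2" for de
 proof -
  have "(norm (D de))^2 = (P1 de / Im w)^2 + (7 * P2 de / (2 * sqrt (7 * svar X) * Im w))^2"
   unfolding cmod_power2 by (simp add: D_def)
  also have "... = ((P1 de)^2 + 7 * (P2 de)^2 / (4 * svar X)) / (Im w)^2"
   using v V by (simp add: power_divide power_mult_distrib field_simps)
  finally show ?thesis by (simp add: slope_norm_def P1_def P2_def m_def X_def)
 qed
 ultimately show ?thesis using that by blast
qed

lemma Gmap_upper: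
 assumes v: "Im w > 0"
 shows "\<forall>\<^sub>F z in at w. norm (Gmap g z - Gmap g w) <= 10 * (g (Re w + Im w) - g (Re w - Im w)) / Im w * norm (z - w)"
proof -
 define Lam where "Lam = g (Re w + Im w) - g (Re w - Im w)"
 have Lam: "Lam > 0" using win_strict[OF v, of "-1" 1] by (simp add: Lam_def)
 obtain D where D: "(Gmap g has_derivative D) (at w)"
  "!!de. (norm (D de))^2 = slope_norm (win w) (Re de) (Im de) / (Im w)^2" using Gmap_has_derivative[OF v] by blast
 have "norm (D de) <= (95/10 * Lam / Im w) * norm de" for de
 proof (rule power2_le_imp_le)
  have "slope_norm (win w) (Re de) (Im de) <= 84 * Lam^2 * ((Re de)^2 + (Im de)^2)"
   by (rule slope_norm_le[OF win_cont win_mono _ Lam svar_win_pos[OF v]]) (use v in \<open>auto simp: Lam_def\<close>)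
  also have "... = 84 * (Lam^2 * (norm de)^2)" by (simp add: cmod_power2)
  also have "... <= (95/10)^2 * (Lam^2 * (norm de)^2)" by (intro mult_right_mono) (auto simp: power2_eq_square)
  finally have "slope_norm (win w) (Re de) (Im de) / (Im w)^2 <= (95/10)^2 * (Lam^2 * (norm de)^2) / (Im w)^2"
   by (rule divide_right_mono) simp
  thus "(norm (D de))^2 <= (95/10 * Lam / Im w * norm de)^2"
   unfolding D(2) power_mult_distrib power_divide by (simp only: mult.assoc times_divide_eq_left times_divide_eq_right)
 qed (use Lam v in auto)
 hence "\<forall>\<^sub>F z in at w. norm (Gmap g z - Gmap g w) <= (10 * Lam / Im w) * norm (z - w)"
  by (rule eventually_le_of_has_derivative[OF D(1)]) (rule divide_strict_right_mono, use Lam v in auto)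
 thus ?thesis by (simp add: Lam_def)
qed

lemma Gmap_lower:
 assumes v: "Im w > 0" and eta: "eta > 0"
  and R: "g (Re w + Im w * (8/10)) - g (Re w + Im w * (1/10)) >= eta"
  and L: "g (Re w + Im w * (- 1/10)) - g (Re w + Im w * (- 8/10)) >= eta"
 shows "\<forall>\<^sub>F z in at w. norm (Gmap g z - Gmap g w) >= 7/10000 * eta / Im w * norm (z - w)"
proof -
 obtain D where D: "(Gmap g has_derivative D) (at w)"
  "!!de. (norm (D de))^2 = slope_norm (win w) (Re de) (Im de) / (Im w)^2" using Gmap_has_derivative[OF v] by blast
 have "norm (D de) >= (73/100000 * eta / Im w) * norm de" for de
 proof (rule power2_le_imp_le)
  have "(73/100000)^2 * (eta^2 * (norm de)^2) <= 54/10^8 * (eta^2 * (norm de)^2)"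
   by (intro mult_right_mono) (auto simp: power2_eq_square)
  also have "... = 54/10^8 * eta^2 * ((Re de)^2 + (Im de)^2)" by (simp add: cmod_power2)
  also have "... <= slope_norm (win w) (Re de) (Im de)"
   by (rule slope_norm_ge[OF win_cont win_mono eta]) (use v R L in auto)
  finally have "(73/100000)^2 * (eta^2 * (norm de)^2) / (Im w)^2 <= slope_norm (win w) (Re de) (Im de) / (Im w)^2"
   by (rule divide_right_mono) simp
  thus "(73/100000 * eta / Im w * norm de)^2 <= (norm (D de))^2"
   unfolding D(2) power_mult_distrib power_divide by (simp only: mult.assoc times_divide_eq_left times_divide_eq_right)
 qed simp
 thus ?thesis
  by (rule eventually_ge_of_has_derivative[OF D(1)]) (rule divide_strict_right_mono, use eta v in auto)
qed

lemma Gmap_real: "Gmap g (of_real x) = of_real (g x)"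
 unfolding Gmap_def by (simp add: smean_def svar_def bump_moments complex_eq_iff)

lemma Gmap_shift: "Gmap g (w + of_real (2 * pi)) = Gmap g w + of_real (2 * pi)"
proof -
 have w: "win (w + of_real (2 * pi)) = (%s. win w s + 2 * pi)"
  using geq[of "Re w + Im w * s" for s] by (simp add: fun_eq_iff algebra_simps)
 have w': "g (Re (w + of_real (2 * pi)) + Im (w + of_real (2 * pi)) * s) = win w s + 2 * pi" for s
  using w by meson
 have i: "(%s. win w s * bump s) integrable_on {-1..1}"
  by (intro integrable_continuous_real continuous_intros win_cont)
 have "((%s. win w s * bump s + 2 * pi * bump s) has_integral (smean (win w) + 2 * pi * integral {-1..1} bump)) {-1..1}"
  unfolding smean_def
  by (intro has_integral_add has_integral_mult_right integrable_integral i integrable_continuous_real continuous_intros)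
 hence m: "smean (win (w + of_real (2 * pi))) = smean (win w) + 2 * pi"
  unfolding smean_def w by (simp add: integral_unique bump_moments distrib_right smean_def)
 have "svar (win (w + of_real (2 * pi))) = svar (win w)"
  unfolding svar_def w' m[unfolded w'] by simp
 thus ?thesis using m by (simp add: Gmap_def complex_eq_iff)
qed

lemma Gmap_cont: "continuous_on UNIV (Gmap g)"
proof -
 have c: "continuous_on UNIV (%z. integral {-1..1} (%s. h (Re z + Im z * s) * bump s))" if h: "continuous_on UNIV h" for h :: "real => real"
 proof -
  have "continuous_on (UNIV \<times> cbox (-1) 1) (%(z::complex, s). h (Re z + Im z * s) * bump s)"
   unfolding case_prod_beta
   by (intro continuous_intros continuous_on_compose2[OF h] continuous_on_compose2[OF continuous_on_bump[of UNIV]]) auto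
  from integral_continuous_on_param[OF this] show ?thesis by simp
 qed
 have sv: "(%z. svar (win z)) = (%z. integral {-1..1} (%s. (win z s)^2 * bump s) - (smean (win z))^2)"
  by (rule ext, rule svar_eq[OF win_cont])
 have "continuous_on UNIV (%z. smean (win z))" unfolding smean_def by (rule c[OF gc])
 moreover have "continuous_on UNIV (%z. svar (win z))"
  unfolding sv by (intro continuous_intros c[of "%x. (g x)^2"] gc calculation)
 ultimately show ?thesis unfolding Gmap_def[abs_def] by (intro continuous_intros)
qed

text \<open>A shift by full periods puts y into [x, x + 2 pi); there both \<open>g\<close> and the
  identity increase by something between 0 and 2 pi.\<close>

lemma drift_le: "\<bar>(g x - x) - (g y - y)\<bar> <= 2 * pi"
proof -
 define n where "n = \<lfloor>(y - x) / (2 * pi)\<rfloor>"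
 have "of_int n <= (y - x) / (2 * pi)" "(y - x) / (2 * pi) < of_int n + 1" unfolding n_def by linarith+
 hence n: "x + 2 * pi * of_int n <= y" "y < x + 2 * pi * of_int n + 2 * pi" by (simp_all add: field_simps)
 have "g (x + 2 * pi * of_int n) = g x + 2 * pi * of_int n" by (rule shift_2pi_iterate) (rule geq)
 moreover have "g (x + 2 * pi * of_int n) <= g y" using n(1) gm by (simp add: strict_mono_less_eq)
 moreover have "g y <= g (x + 2 * pi * of_int n) + 2 * pi"
  using n(2) gm geq[of "x + 2 * pi * of_int n"] by (metis less_imp_le strict_mono_less)
 ultimately show ?thesis using n by linarith
qed

text \<open>Triangle inequality for the standard deviation: the window function is v s plus a
  constant plus a function \<open>Y\<close> with |Y| <= pi, and sqrt 7 times the standard deviation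
  of v s is v.\<close>

lemma Gmap_Im_bounds:
 assumes v: "Im w >= 0"
 shows "\<bar>Im (Gmap g w) - Im w\<bar> <= sqrt 7 * pi"
proof -
 define u where "u = Re w"
 define v where "v = Im w"
 define th where "th s = g (u + v * s) - (u + v * s)" for s
 have thc: "continuous_on A th" for A unfolding th_def
  by (intro continuous_intros continuous_on_compose2[OF gc]) auto
 obtain sM where sM: "sM \<in> {-1..1}" "!!s. s \<in> {-1..1} ==> th s <= th sM"
  using continuous_attains_sup[of "{-1..1::real}" th] thc by auto
 obtain sm where sm: "sm \<in> {-1..1}" "!!s. s \<in> {-1..1} ==> th sm <= th s"
  using continuous_attains_inf[of "{-1..1::real}" th] thc by auto
 define c where "c = (th sM + th sm) / 2"
 have range: "th sM - th sm <= 2 * pi" using drift_le[of "u + v * sM" "u + v * sm"] unfolding th_def by linarith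
 define Y where "Y s = th s - c" for s
 have Yc: "continuous_on A Y" for A unfolding Y_def[abs_def] by (intro continuous_intros thc)
 have Yb: "\<bar>Y s\<bar> <= pi" if "s \<in> {-1..1}" for s
  using sM(2)[OF that] sm(2)[OF that] range unfolding Y_def c_def abs_le_iff by (simp add: field_simps)
 define E where "E f = integral {-1..1} (%s. f s * bump s)" for f :: "real => real"
 have Elin: "E (%s. a * f s + h s) = a * E f + E h" if "continuous_on {-1..1} f" "continuous_on {-1..1} h" for a f h
 proof -
  have "((%s. a * (f s * bump s) + h s * bump s) has_integral (a * E f + E h)) {-1..1}" unfolding E_def
   by (intro has_integral_add has_integral_mult_right integrable_integral integrable_continuous_real continuous_intros that)
  moreover have "(%s. a * (f s * bump s) + h s * bump s) = (%s. (a * f s + h s) * bump s)" by (simp add: algebra_simps)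
  ultimately show ?thesis unfolding E_def by (simp add: integral_unique)
 qed
 have E1: "E (%s. 1) = 1" "E (%s. k) = k" "E (%s. s) = 0" "E (%s. s^2) = 1/7" for k
  by (simp_all add: E_def bump_moments)
 have Epos: "E f >= 0" if "continuous_on {-1..1} f" "!!s. s \<in> {-1..1} ==> f s >= 0" for f
  unfolding E_def using that by (intro integral_nonneg integrable_continuous_real continuous_intros) auto
 define e where "e = E Y"
 define q where "q = E (%s. (Y s)^2)"
 define r where "r = E (%s. s * Y s)"
 note cs = continuous_intros Yc
 have X: "win w = (%s. v * s + (1 * Y s + (u + c)))" by (simp add: fun_eq_iff Y_def th_def u_def v_def)
 have Xs: "g (Re w + Im w * s) = v * s + (1 * Y s + (u + c))" for s using X by meson
 have m: "smean (win w) = e + (u + c)"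
 proof -
  have "smean (win w) = E (%s. v * s + (1 * Y s + (u + c)))" unfolding smean_def X E_def ..
  also have "... = v * E (%s. s) + (1 * E Y + E (%s. u + c))" by (subst Elin, (intro cs)+, subst Elin, (intro cs)+, rule refl)
  finally show ?thesis by (simp add: E1 e_def)
 qed
 have sv: "7 * svar (win w) = v^2 + 2 * v * (7 * r) + 7 * (q - e^2)"
 proof -
  have "svar (win w) = E (%s. v^2 * s^2 + (2 * v * (s * Y s) + (- 2 * v * e * s + (1 * (Y s)^2 + (- 2 * e * Y s + e^2)))))"
   unfolding svar_def m E_def
   unfolding Xs by (rule integral_cong) (simp add: power2_eq_square algebra_simps)
  also have "... = v^2 * E (%s. s^2) + (2 * v * E (%s. s * Y s) + (- 2 * v * e * E (%s. s) + (1 * E (%s. (Y s)^2) + (- 2 * e * E Y + E (%s. e^2)))))"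
   by (subst Elin, (intro cs)+)+ (rule refl)
  finally show ?thesis by (simp add: E1 e_def[symmetric] q_def[symmetric] r_def[symmetric] power2_eq_square[of e] power2_eq_square[of r] algebra_simps)
 qed
 \<comment> \<open>Y - e - 7 r s is the residual of the linear regression of \<open>Y\<close> on s,
   which has variance 1/7. That its second moment is nonnegative is the Cauchy-Schwarz inequality
   for the covariance \<open>r\<close>.\<close>
 have B: "q - e^2 >= 7 * r^2"
 proof -
  have "0 <= E (%s. (Y s - e - 7 * r * s)^2)" by (rule Epos) (auto intro!: cs)
  also have "... = E (%s. 49 * r^2 * s^2 + (- 14 * r * (s * Y s) + (14 * r * e * s + (1 * (Y s)^2 + (- 2 * e * Y s + e^2)))))"
   unfolding E_def by (rule integral_cong) (simp add: power2_eq_square algebra_simps)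
  also have "... = 49 * r^2 * E (%s. s^2) + (- 14 * r * E (%s. s * Y s) + (14 * r * e * E (%s. s) + (1 * E (%s. (Y s)^2) + (- 2 * e * E Y + E (%s. e^2)))))"
   by (subst Elin, (intro cs)+)+ (rule refl)
  finally show ?thesis by (simp add: E1 e_def[symmetric] q_def[symmetric] r_def[symmetric] power2_eq_square[of e] power2_eq_square[of r] algebra_simps)
 qed
 have qb: "q <= pi^2"
 proof -
  have "0 <= E (%s. (- 1) * (Y s)^2 + pi^2)"
  proof (rule Epos)
   show "0 <= (- 1) * (Y s)^2 + pi^2" if "s \<in> {-1..1}" for s
    using Yb[OF that] by (simp add: power2_le_iff_abs_le)
  qed (intro cs)
  also have "... = (- 1) * E (%s. (Y s)^2) + E (%s. pi^2)" by (subst Elin, (intro cs)+) (rule refl)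
  finally show ?thesis by (simp add: E1 q_def)
 qed
 define b where "b = sqrt (7 * (q - e^2))"
 have B0: "q - e^2 >= 0" using B by (smt (verit) zero_le_power2)
 have b2: "b^2 = 7 * (q - e^2)" and b0: "b >= 0" using B0 by (simp_all add: b_def)
 have "q - e^2 <= pi^2" using qb by (rule order_trans[rotated]) simp
 hence "b^2 <= 7 * pi^2" unfolding b2 by simp
 hence "b <= sqrt (7 * pi^2)" by (rule real_le_rsqrt)
 hence bp: "b <= sqrt 7 * pi" by (simp add: real_sqrt_mult)
 have "(7 * r)^2 <= b^2" unfolding b2 using B by (simp add: power_mult_distrib)
 hence rb: "\<bar>7 * r\<bar> <= b" using b0 by (metis abs_le_square_iff abs_of_nonneg)
 have v0: "v >= 0" using assms by (simp add: v_def)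
 have "\<bar>v * (7 * r)\<bar> <= v * b" using rb v0 by (simp add: abs_mult mult_left_mono)
 hence "(v - b)^2 <= 7 * svar (win w)" "7 * svar (win w) <= (v + b)^2"
  unfolding sv power2_diff power2_sum b2[symmetric] by (simp_all add: abs_le_iff algebra_simps)
 hence "sqrt ((v - b)^2) <= sqrt (7 * svar (win w))" "sqrt (7 * svar (win w)) <= sqrt ((v + b)^2)"
  by (simp_all only: real_sqrt_le_iff)
 hence "\<bar>sqrt (7 * svar (win w)) - v\<bar> <= b" using v0 b0 by (auto simp: abs_le_iff abs_if split: if_splits)
 thus ?thesis using bp by (simp add: Gmap_def v_def)
qed

text \<open>Equal values of \<open>Gmap\<close> mean that 1, g and g^2 have equal integrals against
  the kernels \<open>K w\<close> and \<open>K w'\<close>. The kernels are squares of positive parts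
  of quadratic polynomials whose difference \<open>Q\<close> changes sign at most twice. A
  combination p of 1, g, g^2 with the sign pattern of \<open>Q\<close> makes p (K w' - K w)
  nonnegative with integral 0; so the kernels agree, and so do their supports, which determine w and
  w'.\<close>

lemma Gmap_inj_aux:
 assumes w: "Im w > 0" "Im w' > 0" "Im w <= Im w'" and eq: "Gmap g w = Gmap g w'"
 shows "w = w'"
proof (rule ccontr)
 assume ne: "w ~= w'"
 \<comment> \<open>With this normalisation the integral of \<open>K z\<close> is 16/15 for both
   points, so that the constant 1 is available as a test function too.\<close>
 define c where "c z = 1 / sqrt (Im z ^ 5)" for z
 define k where "k z xi = c z * ((Im z)^2 - (xi - Re z)^2)" for z xi
 define K where "K z xi = (max 0 (k z xi))^2" for z xi
 define lo where "lo = min (Re w - Im w) (Re w' - Im w')"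
 define hi where "hi = max (Re w + Im w) (Re w' + Im w')"
 define Q where "Q xi = k w' xi - k w xi" for xi
 have c: "c w > 0" "c w' > 0" "c w' <= c w"
  using w by (auto simp: c_def intro!: divide_left_mono power_mono mult_pos_pos)
 have Kc: "continuous_on S (K z)" for S z unfolding K_def[abs_def] k_def by (intro continuous_intros)
 have K0: "K z xi = 0 \<longleftrightarrow> Im z <= \<bar>xi - Re z\<bar>" if "z = w | z = w'" for z xi
 proof -
  have z: "c z > 0" "Im z > 0" using that c w by auto
  have "K z xi = 0 \<longleftrightarrow> k z xi <= 0" unfolding K_def by (auto simp: max_def)
  also have "... \<longleftrightarrow> (Im z)^2 <= (xi - Re z)^2" unfolding k_def using z by (simp add: mult_le_0_iff)
  also have "... \<longleftrightarrow> Im z <= \<bar>xi - Re z\<bar>" using z abs_le_square_iff[of "Im z" "xi - Re z"] by simp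
  finally show ?thesis .
 qed
 have mom: "integral {lo..hi} (%xi. h xi * K z xi) = 16/15 * integral {-1..1} (%s. h (Re z + Im z * s) * bump s)"
  if z: "z = w | z = w'" and h: "continuous_on UNIV h" for z h
 proof -
  have z0: "Im z > 0" using z w by auto
  have "integral {lo..hi} (%xi. h xi * K z xi) = Im z * integral {-1..1} (%s. h (Re z + Im z * s) * K z (Re z + Im z * s))"
  proof (rule integral_scaled_window)
   show "continuous_on UNIV (%xi. h xi * K z xi)" by (intro continuous_intros h Kc)
   show "h xi * K z xi = 0" if "Im z <= \<bar>xi - Re z\<bar>" for xi using K0[OF z] that by simp
  qed (use z z0 in \<open>auto simp: lo_def hi_def\<close>)
  also have "integral {-1..1} (%s. h (Re z + Im z * s) * K z (Re z + Im z * s))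
    = integral {-1..1} (%s. 16/15 / Im z * (h (Re z + Im z * s) * bump s))"
  proof (rule integral_cong)
   fix s :: real assume "s \<in> {-1..1}"
   hence "s^2 <= 1" by (simp add: abs_square_le_1 abs_le_iff)
   moreover have "k z (Re z + Im z * s) = c z * (Im z)^2 * (1 - s^2)" by (simp add: k_def power_mult_distrib algebra_simps)
   moreover have "0 <= c z * (Im z)^2 * (1 - s^2)"
    using z0 \<open>s^2 <= 1\<close> by (intro mult_nonneg_nonneg) (auto simp: c_def)
   ultimately have "max 0 (k z (Re z + Im z * s)) = c z * (Im z)^2 * (1 - s^2)" by simp
   hence "K z (Re z + Im z * s) = (c z)^2 * (Im z) ^ 4 * (1 - s^2)^2" by (simp add: K_def power_mult_distrib)
   also have "(c z)^2 * (Im z) ^ 4 = 1 / Im z" using z0 by (simp add: c_def power_divide eval_nat_numeral)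
   finally show "h (Re z + Im z * s) * K z (Re z + Im z * s) = 16/15 / Im z * (h (Re z + Im z * s) * bump s)"
    by (simp add: bump_def)
  qed
  finally show ?thesis using z0 by simp
 qed
 have moms: "integral {lo..hi} (%xi. h xi * K w' xi) = integral {lo..hi} (%xi. h xi * K w xi)"
  if "h = (%xi. 1) | h = g | h = (%xi. (g xi)^2)" for h
 proof -
  have m: "smean (win w) = smean (win w')" "svar (win w) = svar (win w')" using eq by (auto simp: Gmap_def)
  hence "integral {-1..1} (%s. (win w s)^2 * bump s) = integral {-1..1} (%s. (win w' s)^2 * bump s)"
   unfolding svar_eq[OF win_cont] by simp
  thus ?thesis using that m(1) mom[of w h] mom[of w' h] by (auto simp: smean_def continuous_intros gc)
 qed
 have zero: "integral {lo..hi} (%xi. (a * (g xi)^2 + b * g xi + d) * (K w' xi - K w xi)) = 0" for a b d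
 proof -
  have J: "((%xi. h xi * K w' xi - h xi * K w xi) has_integral 0) {lo..hi}" if "h = (%xi. 1) | h = g | h = (%xi. (g xi)^2)" for h
  proof -
   have "continuous_on {lo..hi} h" using that gc by (auto intro!: continuous_intros intro: continuous_on_subset)
   hence "(%xi. h xi * K z xi) integrable_on {lo..hi}" for z
    by (intro integrable_continuous_real continuous_intros Kc)
   hence "((%xi. h xi * K w' xi - h xi * K w xi) has_integral (integral {lo..hi} (%xi. h xi * K w' xi) - integral {lo..hi} (%xi. h xi * K w xi))) {lo..hi}"
    by (intro has_integral_diff integrable_integral)
   thus ?thesis using moms[OF that] by simp
  qed
  have "((%xi. a * ((g xi)^2 * K w' xi - (g xi)^2 * K w xi) + (b * (g xi * K w' xi - g xi * K w xi) + d * (1 * K w' xi - 1 * K w xi))) has_integral (a * 0 + (b * 0 + d * 0))) {lo..hi}"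
   by (intro has_integral_add has_integral_mult_right J) auto
  moreover have "(%xi. a * ((g xi)^2 * K w' xi - (g xi)^2 * K w xi) + (b * (g xi * K w' xi - g xi * K w xi) + d * (1 * K w' xi - 1 * K w xi)))
    = (%xi. (a * (g xi)^2 + b * g xi + d) * (K w' xi - K w xi))" by (simp add: fun_eq_iff algebra_simps)
  ultimately show ?thesis by (simp add: integral_unique)
 qed
 have gg: "(g x - g y) * (x - y) >= 0" "g x = g y \<longleftrightarrow> x = y" for x y
 proof -
  show "(g x - g y) * (x - y) >= 0"
   using strict_mono_less_eq[OF gm, of x y] strict_mono_less_eq[OF gm, of y x] by (auto simp: zero_le_mult_iff)
  show "g x = g y \<longleftrightarrow> x = y" using gm strict_mono_eq by blast
 qed
 \<comment> \<open>The combination follows the sign changes of \<open>Q\<close>: one if the heights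
   agree, otherwise none or two. Since Im w <= Im w', the leading coefficient of \<open>Q\<close> is
   nonnegative. \<open>F\<close> contains the zeros of the combination.\<close>
 obtain a b d F where F: "finite F" "!!xi. (a * (g xi)^2 + b * g xi + d) * Q xi >= 0"
  "!!xi. xi \<notin> F ==> a * (g xi)^2 + b * g xi + d ~= 0"
 proof (cases "Im w = Im w'")
  case True
  define m where "m = (Re w + Re w') / 2"
  define e where "e = Re w' - Re w"
  have e: "e ~= 0" using ne True by (auto simp: e_def complex_eq_iff)
  have "c w' = c w" using True by (simp add: c_def)
  hence "Q xi = c w * ((xi - Re w)^2 - (xi - Re w')^2)" for xi
   using True by (simp add: Q_def k_def algebra_simps)
  moreover have "(xi - Re w)^2 - (xi - Re w')^2 = 2 * e * (xi - m)" for xi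
   by (simp add: e_def m_def power2_eq_square field_simps)
  ultimately have Qe: "Q xi = 2 * c w * e * (xi - m)" for xi by simp
  have "(0 * (g xi)^2 + e * g xi + - e * g m) * Q xi = 2 * c w * e^2 * ((g xi - g m) * (xi - m))" for xi
   unfolding Qe by (simp add: power2_eq_square algebra_simps)
  hence "(0 * (g xi)^2 + e * g xi + - e * g m) * Q xi >= 0" for xi using gg(1)[of xi m] c by simp
  moreover have "0 * (g xi)^2 + e * g xi + - e * g m ~= 0" if "xi \<notin> {m}" for xi
   using e gg(2)[of xi m] that by (auto simp: algebra_simps)
  ultimately show ?thesis using that[of "{m}" 0 e "- e * g m"] by blast
 next
  case False
  hence "Im w ^ 5 < Im w' ^ 5" using w by (intro power_strict_mono) auto
  hence cc: "c w - c w' > 0" using w by (auto simp: c_def intro!: divide_strict_left_mono mult_pos_pos)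
  define m where "m = (c w * Re w - c w' * Re w') / (c w - c w')"
  have m: "(c w - c w') * m = c w * Re w - c w' * Re w'" using cc by (simp add: m_def)
  have Q: "Q xi = (c w - c w') * (xi - m)^2 + Q m" for xi
  proof -
   have "Q xi - ((c w - c w') * (xi - m)^2 + Q m) = 2 * (xi - m) * ((c w - c w') * m - (c w * Re w - c w' * Re w'))"
    by (simp add: Q_def k_def power2_eq_square algebra_simps)
   thus ?thesis using m by simp
  qed
  show ?thesis
  proof (cases "Q m >= 0")
   case True
   have "Q xi >= 0" for xi unfolding Q[of xi] using True cc by simp
   thus ?thesis using that[of "{}" 0 0 1] by simp
  next
   case neg: False
   define rho where "rho = sqrt (- Q m / (c w - c w'))"
   have "rho^2 = - Q m / (c w - c w')" using neg cc by (simp add: rho_def divide_nonpos_pos)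
   hence r: "Q m = - (c w - c w') * rho^2" using cc by (simp add: field_simps)
   define x y where "x = m - rho" and "y = m + rho"
   have Q': "Q xi = (c w - c w') * ((xi - x) * (xi - y))" for xi
    unfolding Q[of xi] r x_def y_def by (simp add: power2_eq_square algebra_simps)
   have p: "1 * (g xi)^2 + - (g x + g y) * g xi + g x * g y = (g xi - g x) * (g xi - g y)" for xi
    by (simp add: power2_eq_square algebra_simps)
   have "(1 * (g xi)^2 + - (g x + g y) * g xi + g x * g y) * Q xi >= 0" for xi
   proof -
    have "(g xi - g x) * (g xi - g y) * Q xi = (c w - c w') * (((g xi - g x) * (xi - x)) * ((g xi - g y) * (xi - y)))"
     by (simp add: Q' mult_ac)
    also have "... >= 0" using cc by (intro mult_nonneg_nonneg[OF _ mult_nonneg_nonneg] gg(1)) auto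
    finally show ?thesis unfolding p .
   qed
   moreover have "1 * (g xi)^2 + - (g x + g y) * g xi + g x * g y ~= 0" if "xi \<notin> {x, y}" for xi
    unfolding p using that gg(2)[of xi x] gg(2)[of xi y] by simp
   ultimately show ?thesis using that[of "{x, y}" 1 "- (g x + g y)" "g x * g y"] by blast
  qed
 qed
 define p where "p xi = a * (g xi)^2 + b * g xi + d" for xi
 have lohi: "lo < hi" using w by (auto simp: lo_def hi_def)
 have nonneg: "p xi * (K w' xi - K w xi) >= 0" for xi
 proof -
  consider "Q xi = 0" | "Q xi > 0" | "Q xi < 0" by linarith
  thus ?thesis
  proof cases
   case 1 thus ?thesis by (simp add: Q_def K_def)
  next
   case 2
   hence "p xi >= 0" using F(2)[of xi] by (simp add: p_def zero_le_mult_iff)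
   moreover have "K w xi <= K w' xi" unfolding K_def using 2 by (intro power_mono) (auto simp: Q_def)
   ultimately show ?thesis by simp
  next
   case 3
   hence "p xi <= 0" using F(2)[of xi] by (simp add: p_def zero_le_mult_iff)
   moreover have "K w' xi <= K w xi" unfolding K_def using 3 by (intro power_mono) (auto simp: Q_def)
   ultimately show ?thesis by (simp add: mult_nonpos_nonpos)
  qed
 qed
 have "\<forall>xi\<in>{lo..hi}. p xi * (K w' xi - K w xi) = 0"
 proof (rule integral_eq_0_iff[THEN iffD1])
  show "continuous_on {lo..hi} (%xi. p xi * (K w' xi - K w xi))" unfolding p_def
   by (intro continuous_intros Kc continuous_on_subset[OF gc]) auto
  show "integral {lo..hi} (%xi. p xi * (K w' xi - K w xi)) = 0" unfolding p_def by (rule zero)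
 qed (use lohi nonneg in auto)
 hence KF: "K w' xi = K w xi" if "xi \<in> {lo..hi}" "xi \<notin> F" for xi using that F(3)[of xi] by (auto simp: p_def)
 have Kout: "K w' xi = K w xi" if "xi \<notin> {lo..hi}" for xi
 proof -
  have "Im w <= \<bar>xi - Re w\<bar>" "Im w' <= \<bar>xi - Re w'\<bar>" using that by (auto simp: lo_def hi_def)
  thus ?thesis using K0[of w xi] K0[of w' xi] by simp
 qed
 have "open {xi. K w' xi ~= K w xi}" by (intro open_Collect_neq Kc)
 moreover have "{xi. K w' xi ~= K w xi} \<subseteq> F" using KF Kout by blast
 hence "finite {xi. K w' xi ~= K w xi}" using F(1) finite_subset by blast
 ultimately have "{xi. K w' xi ~= K w xi} = {}" using finite_imp_not_open by blast
 hence "K w' xi = K w xi" for xi by blast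
 hence "ball (Re w) (Im w) = ball (Re w') (Im w')"
  using K0[of w] K0[of w'] by (auto simp: set_eq_iff dist_real_def abs_minus_commute not_le[symmetric])
 thus False using ne w by (auto simp: ball_eq_ball_iff complex_eq_iff)
qed

lemma Gmap_inj: "inj_on (Gmap g) {w. Im w >= 0}"
proof (rule inj_onI)
 fix w w' assume w: "w \<in> {w. 0 <= Im w}" "w' \<in> {w. 0 <= Im w}" and eq: "Gmap g w = Gmap g w'"
 have r: "Im (Gmap g z) = 0 \<longleftrightarrow> Im z = 0" if "Im z >= 0" for z
 proof (cases "Im z = 0")
  case True
  thus ?thesis using Gmap_real[of "Re z"] by (metis Im_complex_of_real complex_is_Real_iff of_real_Re)
 qed (use that Gmap_Im_pos[of z] in auto)
 show "w = w'"
 proof (cases "Im w = 0")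
  case True
  hence "Im w' = 0" using r[of w] r[of w'] w eq by auto
  hence "w = of_real (Re w)" "w' = of_real (Re w')" using True by (simp_all add: complex_eq_iff)
  hence "g (Re w) = g (Re w')" using eq Gmap_real by (metis of_real_eq_iff)
  hence "Re w = Re w'" using gm strict_mono_eq by blast
  thus ?thesis using True \<open>Im w' = 0\<close> by (simp add: complex_eq_iff)
 next
  case False
  hence "Im w > 0" "Im w' > 0" using r[of w] r[of w'] w eq by auto
  thus ?thesis using Gmap_inj_aux[of w w'] Gmap_inj_aux[of w' w] eq by (cases "Im w <= Im w'") auto
 qed
qed

end

section \<open>Transfer from the half-plane to the disc\<close>

definition Psi :: "(real => real) => complex => complex" where
 "Psi g z = (if z = 0 then 0 else exp (\<i> * Gmap g (- \<i> * Ln z)))"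

text \<open>The image of the open disc is open by invariance of domain and relatively closed by
  compactness, so connectedness makes it everything.\<close>

lemma disc_homeomorphism_of_inj:
 fixes psi :: "complex => complex"
 assumes c: "continuous_on (cball 0 1) psi" and i: "inj_on psi (cball 0 1)"
  and b: "psi ` ball 0 1 \<subseteq> ball 0 1" and s: "psi ` sphere 0 1 \<subseteq> sphere 0 1"
 shows "psi ` ball 0 1 = ball 0 1"
proof -
 have o: "open (psi ` ball 0 1)"
  by (rule invariance_of_domain) (use c i in \<open>auto intro: continuous_on_subset inj_on_subset simp: ball_subset_cball\<close>)
 have "psi ` ball 0 1 = psi ` cball 0 1 \<inter> ball 0 1"
 proof
  show "psi ` ball 0 1 \<subseteq> psi ` cball 0 1 \<inter> ball 0 1" using b ball_subset_cball[of 0 1] by blast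
  show "psi ` cball 0 1 \<inter> ball 0 1 \<subseteq> psi ` ball 0 1"
  proof
   fix y assume "y \<in> psi ` cball 0 1 \<inter> ball 0 1"
   then obtain x where x: "x \<in> cball 0 1" "y = psi x" "y \<in> ball 0 1" by auto
   have "x \<notin> sphere 0 1" using x s by force
   thus "y \<in> psi ` ball 0 1" using x by auto
  qed
 qed
 moreover have "closed (psi ` cball 0 1)" using c by (simp add: compact_continuous_image compact_imp_closed)
 ultimately have "openin (top_of_set (ball 0 1)) (psi ` ball 0 1)" "closedin (top_of_set (ball 0 1)) (psi ` ball 0 1)"
  using o b by (auto simp: openin_open closedin_closed Int_commute)
 hence "psi ` ball 0 1 = {} | psi ` ball 0 1 = ball 0 1"
  using connected_clopen[of "ball (0::complex) 1"] connected_ball by metis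
 thus ?thesis by auto
qed

lemma exp_preimage:
 assumes "z ~= 0" "norm z <= 1"
 obtains w where "z = exp (\<i> * w)" "Im w >= 0"
proof
 show "z = exp (\<i> * (- \<i> * Ln z))" using assms by simp
 show "Im (- \<i> * Ln z) >= 0" using assms by (simp add: ln_le_zero_iff)
qed

context
 fixes g :: "real => real"
 assumes gc: "continuous_on UNIV g" and gm: "strict_mono g" and geq: "!!x. g (x + 2 * pi) = g x + 2 * pi"
begin

lemma Gmap_shift_int: "Gmap g (w + of_real (2 * pi * of_int n)) = Gmap g w + of_real (2 * pi * of_int n)"
proof -
 note S = Gmap_shift[OF gc gm geq]
 have *: "Gmap g (w + of_real (2 * pi * real m)) = Gmap g w + of_real (2 * pi * real m)" for w and m :: nat
 proof (induction m)
  case (Suc m)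
  have "w + of_real (2 * pi * real (Suc m)) = (w + of_real (2 * pi * real m)) + of_real (2 * pi)" by (simp add: algebra_simps)
  thus ?case using S[of "w + of_real (2 * pi * real m)"] Suc by (simp add: algebra_simps)
 qed simp
 show ?thesis
 proof (cases "n >= 0")
  case True
  thus ?thesis using *[of w "nat n"] by simp
 next
  case False
  have "w + of_real (2 * pi * of_int n) + of_real (2 * pi * real (nat (- n))) = w" using False by (simp add: algebra_simps)
  thus ?thesis using *[of "w + of_real (2 * pi * of_int n)" "nat (- n)"] False by (simp add: algebra_simps)
 qed
qed

lemma Psi_exp: "Psi g (exp (\<i> * w)) = exp (\<i> * Gmap g w)"
proof -
 have "exp (Ln (exp (\<i> * w))) = exp (\<i> * w)" by simp
 then obtain n :: int where n: "Ln (exp (\<i> * w)) = \<i> * w + (of_int (2 * n) * pi) * \<i>" using exp_eq by blast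
 have "- \<i> * Ln (exp (\<i> * w)) = w + of_real (2 * pi * of_int n)" unfolding n by (simp add: algebra_simps)
 hence "Psi g (exp (\<i> * w)) = exp (\<i> * (Gmap g w + of_real (2 * pi * of_int n)))"
  unfolding Psi_def using Gmap_shift_int[of w n] by simp
 also have "... = exp (\<i> * Gmap g w + (of_int (2 * n) * pi) * \<i>)" by (rule arg_cong[where f = exp]) (simp add: algebra_simps)
 also have "... = exp (\<i> * Gmap g w)" unfolding exp_eq by blast
 finally show ?thesis .
qed

lemma Psi_cis: "Psi g (cis x) = cis (g x)"
 using Psi_exp[of "of_real x"] Gmap_real[OF gc gm geq, of x] by (simp add: cis_conv_exp)

text \<open>Gives continuity at 0: \<open>Gmap\<close> changes heights by a bounded amount, so
  \<open>Psi g\<close> changes moduli by a bounded factor.\<close>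

lemma norm_Psi_le: "norm z <= 1 ==> norm (Psi g z) <= exp (sqrt 7 * pi) * norm z"
proof (cases "z = 0")
 case False
 assume "norm z <= 1"
 then obtain w where w: "z = exp (\<i> * w)" "Im w >= 0" using exp_preimage False by blast
 have "- Im (Gmap g w) <= sqrt 7 * pi - Im w" using Gmap_Im_bounds[OF gc gm geq w(2)] by linarith
 hence "exp (- Im (Gmap g w)) <= exp (sqrt 7 * pi) * exp (- Im w)" unfolding exp_add[symmetric] by simp
 thus ?thesis unfolding w(1) Psi_exp by simp
qed (simp add: Psi_def)

lemma Psi_ball: "z \<in> ball 0 1 ==> Psi g z \<in> ball 0 1"
proof (cases "z = 0")
 case False
 assume z: "z \<in> ball 0 1"
 then obtain w where w: "z = exp (\<i> * w)" "Im w >= 0" using exp_preimage[of z] False by auto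
 hence "Im w > 0" using z by auto
 thus ?thesis unfolding w(1) Psi_exp using Gmap_Im_pos[OF gc gm geq, of w] by simp
qed (simp add: Psi_def)

lemma Psi_sphere: "z \<in> sphere 0 1 ==> Psi g z \<in> sphere 0 1"
 using cis_image_UNIV(1) Psi_cis by (metis imageE mem_sphere_0 norm_cis)

lemma Psi_inj: "inj_on (Psi g) (cball 0 1)"
proof (rule inj_onI)
 fix z z' assume z: "z \<in> cball 0 1" "z' \<in> cball 0 1" and eq: "Psi g z = Psi g z'"
 have "z = 0 \<longleftrightarrow> z' = 0" using eq by (metis Psi_def exp_not_eq_zero)
 show "z = z'"
 proof (cases "z = 0")
  case False
  hence "z' ~= 0" using \<open>z = 0 \<longleftrightarrow> z' = 0\<close> by simp
  obtain w where w: "z = exp (\<i> * w)" "Im w >= 0" using exp_preimage[of z] False z by auto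
  obtain w' where w': "z' = exp (\<i> * w')" "Im w' >= 0" using exp_preimage[of z'] \<open>z' ~= 0\<close> z by auto
  have "exp (\<i> * Gmap g w) = exp (\<i> * Gmap g w')" using eq unfolding w(1) w'(1) Psi_exp .
  then obtain n :: int where "\<i> * Gmap g w = \<i> * Gmap g w' + (of_int (2 * n) * pi) * \<i>" unfolding exp_eq by blast
  hence "\<i> * Gmap g w = \<i> * (Gmap g w' + of_real (2 * pi * of_int n))" by (simp add: algebra_simps)
  hence "Gmap g w = Gmap g (w' + of_real (2 * pi * of_int n))" using Gmap_shift_int[of w' n] by simp
  hence "w = w' + of_real (2 * pi * of_int n)"
   using inj_onD[OF Gmap_inj[OF gc gm geq]] w(2) w'(2) by simp
  hence "exp (\<i> * w) = exp (\<i> * w' + (of_int (2 * n) * pi) * \<i>)" by (intro arg_cong[where f = exp]) (simp add: algebra_simps)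
  also have "... = exp (\<i> * w')" unfolding exp_eq by blast
  finally show ?thesis unfolding w w' .
 qed (use \<open>z = 0 \<longleftrightarrow> z' = 0\<close> in simp)
qed

lemma Psi_cont: "continuous_on (cball 0 1) (Psi g)"
 unfolding continuous_on_eq_continuous_within
proof
 fix z0 assume z0: "z0 \<in> cball (0::complex) 1"
 show "continuous (at z0 within cball 0 1) (Psi g)"
 proof (cases "z0 = 0")
  case True
  have "(Psi g \<longlongrightarrow> 0) (at 0 within cball 0 1)"
  proof (rule Lim_null_comparison)
   show "\<forall>\<^sub>F x in at 0 within cball 0 1. norm (Psi g x) <= exp (sqrt 7 * pi) * norm x"
    using norm_Psi_le by (auto simp: eventually_at_filter)
   have "((%x::complex. exp (sqrt 7 * pi) * norm x) \<longlongrightarrow> exp (sqrt 7 * pi) * norm (0::complex)) (at 0 within cball 0 1)"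
    by (intro tendsto_intros)
   thus "((%x::complex. exp (sqrt 7 * pi) * norm x) \<longlongrightarrow> 0) (at 0 within cball 0 1)" by simp
  qed
  thus ?thesis unfolding continuous_within True by (simp add: Psi_def)
 next
  case False
  obtain w0 where w0: "z0 = exp (\<i> * w0)" using exp_preimage[of z0] False z0 by auto
  \<comment> \<open>Local formula near \<open>z0\<close>: the logarithm is taken of z / z0, which is
    near 1 and thus away from the branch cut.\<close>
  have P: "Psi g z = exp (\<i> * Gmap g (w0 - \<i> * Ln (z / z0)))" if "z ~= 0" for z
  proof -
   have "exp (\<i> * (w0 - \<i> * Ln (z / z0))) = z0 * exp (Ln (z / z0))" by (simp add: w0 exp_add[symmetric] algebra_simps)
   also have "... = z" using that False by simp
   finally show ?thesis using Psi_exp by metis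
  qed
  have "isCont (%z. exp (\<i> * Gmap g (w0 - \<i> * Ln (z / z0)))) z0"
  proof -
   have L: "isCont (%z. w0 - \<i> * Ln (z / z0)) z0" using False by (intro continuous_intros) auto
   have "isCont (Gmap g) (w0 - \<i> * Ln (z0 / z0))" using Gmap_cont[OF gc gm geq] by (simp add: continuous_on_eq_continuous_at)
   from isCont_o2[OF L this] show ?thesis by (intro continuous_intros)
  qed
  hence C: "continuous (at z0 within cball 0 1) (%z. exp (\<i> * Gmap g (w0 - \<i> * Ln (z / z0))))"
   by (rule continuous_at_imp_continuous_within)
  have E: "exp (\<i> * Gmap g (w0 - \<i> * Ln (x / z0))) = Psi g x" if "dist x z0 < norm z0" for x
  proof -
   have "x ~= 0" using that by (auto simp: dist_norm)
   thus ?thesis using P by simp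
  qed
  show ?thesis
   by (rule continuous_transform_within[OF C, of "norm z0"]) (use False z0 E in auto)
 qed
qed

lemma Psi_image: "Psi g ` ball 0 1 = ball 0 1" "Psi g ` cball 0 1 = cball 0 1" "Psi g ` sphere 0 1 = sphere 0 1"
proof -
 show b: "Psi g ` ball 0 1 = ball 0 1"
  by (rule disc_homeomorphism_of_inj[OF Psi_cont Psi_inj]) (use Psi_ball Psi_sphere in auto)
 have sg: "\<exists>x. g x = y" for y
 proof -
  obtain N :: nat where "2 * pi * real N > \<bar>y - g 0\<bar>" using reals_Archimedean3[of "2 * pi"] by (auto simp: mult.commute)
  hence "g (0 + 2 * pi * of_int (- int N)) <= y" "y <= g (0 + 2 * pi * of_int (int N))"
   unfolding shift_2pi_iterate[of g, OF geq] by auto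
  thus ?thesis
   using IVT'[of g "0 + 2 * pi * of_int (- int N)" y "0 + 2 * pi * of_int (int N)"] gc by (auto intro: continuous_on_subset)
 qed
 show s: "Psi g ` sphere 0 1 = sphere 0 1"
 proof
  show "sphere 0 1 \<subseteq> Psi g ` sphere 0 1"
  proof
   fix z :: complex assume "z \<in> sphere 0 1"
   then obtain t where "z = cis t" using cis_image_UNIV(1) by (metis imageE)
   thus "z \<in> Psi g ` sphere 0 1" using sg[of t] Psi_cis by (metis imageI mem_sphere_0 norm_cis)
  qed
 qed (use Psi_sphere in blast)
 have "cball (0::complex) 1 = ball 0 1 \<union> sphere 0 1" by auto
 thus "Psi g ` cball 0 1 = cball 0 1" using b s by (simp add: image_Un)
qed

end

section \<open>Comparison with the distance to the curve\<close>

text \<open>The subwindows in the lower bound for \<open>Gmap\<close> are seen under an angle of at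
  least pi / 6, so the chart estimates apply with n = 6. The point is tan (pi / 6) = 0.577... < 0.7
  / 1.08.\<close>

lemma arctan_view_inner: "arctan (8/10) - arctan (1/10) >= pi / real 6"
proof -
 have "arctan (8/10) + arctan (- 1/10) = arctan ((8/10 + (- 1/10)) / (1 - 8/10 * (- 1/10)))"
  by (rule arctan_add) auto
 moreover have "arctan (1 / sqrt 3) <= arctan ((8/10 + (- 1/10)) / (1 - 8/10 * (- 1/10)))"
  unfolding arctan_le_iff using real_le_rsqrt[of "108/70" 3] by (simp add: field_simps power2_eq_square)
 moreover have "arctan (1 / sqrt 3) = pi / 6"
  by (rule arctan_unique) (use pi_gt_zero in \<open>auto simp: tan_30\<close>)
 moreover have "arctan (- 1/10) = - arctan (1/10)" using arctan_minus[of "1/10"] by simp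
 ultimately show ?thesis by simp
qed

text \<open>At heights up to 4/10 the interval from the edge of the window to a quarter period away
  is seen under pi / 6, because pi / 4 - 8/31 >= pi / 6.\<close>

lemma arctan_view_outer:
 assumes v: "0 < v" "v <= 4/10"
 shows "arctan (pi / (2 * v)) - arctan 1 >= pi / real 6"
proof -
 define x where "x = pi / (2 * v)"
 have x: "x > 0" using v by (simp add: x_def)
 have "1 / x = 2 * v / pi" using v by (simp add: x_def)
 also have "... <= (8/10) / (31/10)" using v pi_approx by (intro frac_le) auto
 finally have "1 / x <= 8/31" by simp
 moreover have "arctan (1 / x) <= 1 / x"
 proof -
  have "0 - arctan 0 <= 1 / x - arctan (1 / x)"
  proof (rule DERIV_nonneg_imp_nondecreasing[of 0 "1 / x" "%y. y - arctan y"])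
   fix y :: real
   have "inverse (1 + y^2) <= 1" by (simp add: inverse_le_1_iff)
   thus "\<exists>D. ((%y. y - arctan y) has_real_derivative D) (at y) & 0 <= D"
    by (intro exI[of _ "1 - inverse (1 + y^2)"]) (auto intro!: derivative_eq_intros)
  qed (use x in simp)
  thus ?thesis by simp
 qed
 moreover have "arctan (1 / x) = pi / 2 - arctan x" using arctan_inverse[of x] x by (simp add: inverse_eq_divide)
 ultimately show ?thesis using pi_approx by (simp add: x_def arctan_one)
qed

lemma exp_ii_pointwise:
 fixes si :: real
 assumes "si = 1 | si = - 1"
 shows "\<forall>\<^sub>F c in at c0. norm (exp (of_real si * \<i> * c) - exp (of_real si * \<i> * c0)) >= exp (- si * Im c0) / 2 * norm (c - c0)"
  "\<forall>\<^sub>F c in at c0. norm (exp (of_real si * \<i> * c) - exp (of_real si * \<i> * c0)) <= 2 * exp (- si * Im c0) * norm (c - c0)"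
proof -
 have D: "((%c. exp (of_real si * \<i> * c)) has_derivative (%de. exp (of_real si * \<i> * c0) * (of_real si * \<i> * de))) (at c0)"
  by (auto intro!: derivative_eq_intros)
 have n: "norm (exp (of_real si * \<i> * c0) * (of_real si * \<i> * de)) = exp (- si * Im c0) * norm de" for de
  using assms by (auto simp: norm_mult)
 show "\<forall>\<^sub>F c in at c0. norm (exp (of_real si * \<i> * c) - exp (of_real si * \<i> * c0)) >= exp (- si * Im c0) / 2 * norm (c - c0)"
  by (rule eventually_ge_of_has_derivative[OF D, of "exp (- si * Im c0)"]) (use n in auto)
 show "\<forall>\<^sub>F c in at c0. norm (exp (of_real si * \<i> * c) - exp (of_real si * \<i> * c0)) <= 2 * exp (- si * Im c0) * norm (c - c0)"
  by (rule eventually_le_of_has_derivative[OF D, of "exp (- si * Im c0)"]) (use n in auto)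
qed

text \<open>Common setting of the two sides. Inside, \<open>J\<close> is the identity and
  \<open>th\<close> is 1; outside, J x = q0 + 1 / x and th a = 1 / |phi a|. The rule for |J (phi a)
  - J (phi b)| makes the factors \<open>th\<close> cancel in cross-ratios, so the estimates for
  \<open>phi\<close> pass to the map with \<open>J\<close>. The point 0 is left out because outside
  it stands for infinity. \<open>M0\<close> measures the size of the curve; both interpretations
  take half the diameter.\<close>

locale curve_side =
 fixes phi J h :: "complex => complex" and th :: "complex => real" and g :: "real => real" and kap M0 :: real
 assumes ch: "disc_chart phi"
  and gc: "continuous_on UNIV g" and gm: "strict_mono g" and geq: "!!x. g (x + 2 * pi) = g x + 2 * pi"
  and bdry: "!!x. J (phi (cis x)) = h (cis (g x))"
  and bl: "!!a b. a \<in> sphere 0 1 ==> b \<in> sphere 0 1 ==> norm (a - b) <= norm (h a - h b)"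
   "!!a b. a \<in> sphere 0 1 ==> b \<in> sphere 0 1 ==> norm (h a - h b) <= kap * norm (a - b)"
  and J: "!!a b. a \<in> cball 0 1 - {0} ==> b \<in> cball 0 1 - {0} ==> norm (J (phi a) - J (phi b)) = th a * th b * norm (phi a - phi b)"
  and th: "!!a. a \<in> cball 0 1 - {0} ==> th a > 0"
  and J': "!!a. a \<in> ball 0 1 - {0} ==> \<exists>D. ((%z. J (phi z)) has_field_derivative D) (at a) & norm D = (th a)^2 * norm (deriv phi a)"
  and M0: "M0 > 0" "!!q. q \<in> h ` sphere 0 1 ==> \<exists>b\<in>h ` sphere 0 1. norm (q - b) >= M0"
begin

definition Phi :: "complex => complex" where "Phi w = J (phi (exp (\<i> * w)))"
abbreviation Gam :: "complex set" where "Gam \<equiv> h ` sphere 0 1"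
definition d :: "complex => real" where "d w = infdist (Phi w) Gam"
abbreviation gam :: "real => complex" where "gam x \<equiv> h (cis (g x))"

lemma kap_nonneg: "kap >= 0"
proof -
 have "norm (h 1 - h (- 1)) <= kap * norm ((1::complex) - (- 1))" by (rule bl(2)) auto
 from order_trans[OF norm_ge_zero this] show ?thesis by simp
qed

lemma h_cont: "continuous_on (sphere 0 1) h"
proof -
 have "kap-lipschitz_on (sphere 0 1) h"
  by (rule lipschitz_onI) (use bl(2) kap_nonneg in \<open>auto simp: dist_norm\<close>)
 thus ?thesis by (rule lipschitz_on_continuous_on)
qed

lemma Gam_compact: "compact Gam" by (intro compact_continuous_image h_cont compact_sphere)

lemma g_surj: "\<exists>x. g x = y"
proof -
 obtain N :: nat where "2 * pi * real N > \<bar>y - g 0\<bar>" using reals_Archimedean3[of "2 * pi"] by (auto simp: mult.commute)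
 hence "g (0 + 2 * pi * of_int (- int N)) <= y" "y <= g (0 + 2 * pi * of_int (int N))"
  unfolding shift_2pi_iterate[of g, OF geq] by auto
 thus ?thesis
  using IVT'[of g "0 + 2 * pi * of_int (- int N)" y "0 + 2 * pi * of_int (int N)"] gc by (auto intro: continuous_on_subset)
qed

lemma Gam_point: "q \<in> Gam ==> \<exists>x. q = gam x"
proof -
 assume "q \<in> Gam"
 then obtain z where z: "z \<in> sphere 0 1" "q = h z" by auto
 then obtain t where "z = cis t" using cis_image_UNIV(1) by (metis imageE)
 thus ?thesis using g_surj[of t] z by auto
qed

lemma gam_in [simp]: "gam x \<in> Gam" by simp

lemma exp_in: "Im w > 0 ==> exp (\<i> * w) \<in> ball 0 1 - {0}" "Im w > 0 ==> exp (\<i> * w) \<in> cball 0 1 - {0}" by auto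

lemma cis_in [simp]: "cis x \<in> cball 0 1 - {0}" by simp

lemma Phi_not_Gam: "Im w > 0 ==> Phi w ~= gam x"
proof
 assume w: "Im w > 0" and "Phi w = gam x"
 hence "norm (J (phi (exp (\<i> * w))) - J (phi (cis x))) = 0" by (simp add: Phi_def bdry)
 hence "phi (exp (\<i> * w)) = phi (cis x)"
  using J[OF exp_in(2)[OF w] cis_in] th[OF exp_in(2)[OF w]] th[OF cis_in, of x] by auto
 moreover have "exp (\<i> * w) \<in> cball 0 1" "cis x \<in> cball 0 1" using w by auto
 ultimately have "exp (\<i> * w) = cis x" using ch unfolding disc_chart_def inj_on_def by blast
 hence "norm (exp (\<i> * w)) = 1" by simp
 thus False using w by simp
qed

lemma nearest: obtains q where "q \<in> Gam" "d w = norm (Phi w - q)"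
 using infdist_attains_inf[OF compact_imp_closed[OF Gam_compact], of "Phi w"] by (auto simp: d_def dist_norm)

lemma d_le: "q \<in> Gam ==> d w <= norm (Phi w - q)" unfolding d_def dist_norm[symmetric] by (rule infdist_le)

lemma d_pos: "Im w > 0 ==> d w > 0"
proof -
 assume w: "Im w > 0"
 obtain q where q: "q \<in> Gam" "d w = norm (Phi w - q)" using nearest by blast
 then obtain x where "q = gam x" using Gam_point by blast
 thus ?thesis using Phi_not_Gam[OF w] q by simp
qed

lemma arc_far:
 assumes w: "Im w > 0" and st: "arctan t - arctan s >= pi / real 6"
  and xb: "xb \<in> {Re w + Im w * s..Re w + Im w * t}" and q: "q \<in> Gam" "q ~= gam xb"
 shows "\<exists>x\<in>{Re w + Im w * s..Re w + Im w * t}. norm (gam x - Phi w) * norm (q - gam xb)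
   < ((3 + 5 ^ 6) / 2)^2 * norm (gam x - gam xb) * norm (Phi w - q)"
proof -
 define a where "a = exp (\<i> * w)"
 have a: "a \<in> cball 0 1 - {0}" using exp_in[OF w] by (simp add: a_def)
 obtain y where y: "q = gam y" using Gam_point[OF q(1)] by blast
 have "phi (cis y) ~= phi (cis xb)" using q(2) y by (metis bdry)
 then obtain x where x: "x \<in> {Re w + Im w * s..Re w + Im w * t}"
  "norm (phi (cis x) - phi a) * norm (phi (cis y) - phi (cis xb)) < ((3 + 5 ^ 6) / 2)^2 * norm (phi (cis x) - phi (cis xb)) * norm (phi a - phi (cis y))"
  using disc_chart_arc_far_at[OF ch w _ st xb, of "phi (cis y)"] by (auto simp: a_def)
 \<comment> \<open>Each of the four points occurs once on either side of the inequality, so one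
   factor turns distances before \<open>J\<close> into distances after \<open>J\<close>.\<close>
 define T where "T = (th (cis x) * th a) * (th (cis y) * th (cis xb))"
 have "T > 0" unfolding T_def by (intro mult_pos_pos th a cis_in)
 from mult_strict_left_mono[OF x(2) this]
 have "norm (J (phi (cis x)) - J (phi a)) * norm (J (phi (cis y)) - J (phi (cis xb)))
   < ((3 + 5 ^ 6) / 2)^2 * norm (J (phi (cis x)) - J (phi (cis xb))) * norm (J (phi a) - J (phi (cis y)))"
  unfolding J[OF cis_in a] J[OF cis_in cis_in] J[OF a cis_in] T_def by (simp only: mult_ac)
 thus ?thesis using x(1) y by (auto simp: bdry Phi_def a_def)
qed

lemma arc_spread:
 assumes w: "Im w > 0" and st: "arctan t - arctan s >= pi / real 6"
  and b: "b \<in> Gam" and q: "q \<in> Gam" "q ~= b"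
 shows "\<exists>x\<in>{Re w + Im w * s..Re w + Im w * t}. norm (gam x - q) * norm (Phi w - b)
   > (3 / 100 ^ 6) * norm (gam x - b) * norm (q - Phi w)"
proof -
 define a where "a = exp (\<i> * w)"
 have a: "a \<in> cball 0 1 - {0}" using exp_in[OF w] by (simp add: a_def)
 obtain y where y: "q = gam y" using Gam_point[OF q(1)] by blast
 obtain z where z: "b = gam z" using Gam_point[OF b] by blast
 have "phi (cis y) ~= phi (cis z)" using q(2) y z by (metis bdry)
 then obtain x where x: "x \<in> {Re w + Im w * s..Re w + Im w * t}"
  "(3 / 100 ^ 6) * norm (phi (cis x) - phi (cis z)) * norm (phi (cis y) - phi a) < norm (phi (cis x) - phi (cis y)) * norm (phi a - phi (cis z))"
  using disc_chart_arc_spread_at[OF ch w _ st, of "phi (cis z)" "phi (cis y)"] by (auto simp: a_def)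
 define T where "T = (th (cis x) * th a) * (th (cis y) * th (cis z))"
 have "T > 0" unfolding T_def by (intro mult_pos_pos th a cis_in)
 from mult_strict_left_mono[OF x(2) this]
 have "(3 / 100 ^ 6) * norm (J (phi (cis x)) - J (phi (cis z))) * norm (J (phi (cis y)) - J (phi a))
   < norm (J (phi (cis x)) - J (phi (cis y))) * norm (J (phi a) - J (phi (cis z)))"
  unfolding J[OF cis_in a] J[OF cis_in cis_in] J[OF a cis_in] T_def by (simp only: mult_ac)
 thus ?thesis using x(1) y z by (auto simp: bdry Phi_def a_def)
qed

lemma Phi_deriv:
 assumes w: "Im w > 0"
 obtains D where "(Phi has_field_derivative D) (at w)"
  "!!q b. q \<in> Gam ==> b \<in> Gam ==> norm D * (2 * sinh (Im w)) * norm (q - b) <= 38 * norm (Phi w - b) * norm (Phi w - q)"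
  "norm D = exp (- Im w) * (th (exp (\<i> * w)))^2 * norm (deriv phi (exp (\<i> * w)))"
proof -
 define a where "a = exp (\<i> * w)"
 have a: "a \<in> ball 0 1 - {0}" "a \<in> cball 0 1 - {0}" using exp_in[OF w] by (simp_all add: a_def)
 obtain E where E: "((%z. J (phi z)) has_field_derivative E) (at a)" "norm E = (th a)^2 * norm (deriv phi a)" using J'[OF a(1)] by blast
 have e: "((%w. exp (\<i> * w)) has_field_derivative (\<i> * a)) (at w)"
  by (auto intro!: derivative_eq_intros simp: a_def)
 have D: "(Phi has_field_derivative (E * (\<i> * a))) (at w)"
  unfolding Phi_def[abs_def] using DERIV_chain2[OF E(1)[unfolded a_def] e] by (simp add: a_def)
 have na: "norm a = exp (- Im w)" by (simp add: a_def)
 have nD: "norm (E * (\<i> * a)) = exp (- Im w) * (th a)^2 * norm (deriv phi a)" by (simp add: norm_mult E(2) na)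
 have s: "exp (- Im w) * (2 * sinh (Im w)) = 1 - (norm a)^2"
 proof -
  have "2 * sinh (Im w) = exp (Im w) - exp (- Im w)" by (simp add: sinh_field_def)
  thus ?thesis unfolding na by (simp add: right_diff_distrib power2_eq_square mult_exp_exp)
 qed
 have "norm (E * (\<i> * a)) * (2 * sinh (Im w)) * norm (q - b) <= 38 * norm (Phi w - b) * norm (Phi w - q)"
  if qb: "q \<in> Gam" "b \<in> Gam" for q b
 proof -
  obtain y z where yz: "q = gam y" "b = gam z" using Gam_point qb by metis
  define T where "T = (th a)^2 * (th (cis y) * th (cis z))"
  have T: "T >= 0" unfolding T_def using th[OF cis_in] by (intro mult_nonneg_nonneg) (auto intro: less_imp_le)
  have "norm (deriv phi a) * (1 - (norm a)^2) * norm (phi (cis y) - phi (cis z)) <= 38 * norm (phi a - phi (cis z)) * norm (phi a - phi (cis y))"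
   by (rule disc_chart_deriv_le_at[OF ch]) (use a in auto)
  from mult_left_mono[OF this T]
  have "((th a)^2 * norm (deriv phi a)) * (1 - (norm a)^2) * norm (J (phi (cis y)) - J (phi (cis z)))
    <= 38 * norm (J (phi a) - J (phi (cis z))) * norm (J (phi a) - J (phi (cis y)))"
   unfolding J[OF cis_in cis_in] J[OF a(2) cis_in] T_def power2_eq_square[of "th a"] by (simp only: mult_ac)
  thus ?thesis unfolding nD s[symmetric] by (simp add: bdry yz Phi_def a_def[symmetric] mult_ac)
 qed
 thus ?thesis using that[OF D] nD by (simp add: a_def)
qed

text \<open>Here \<open>q\<close> is a nearest point of the curve and \<open>b\<close> a point at
  distance at least \<open>M0\<close> from \<open>q\<close>. The factor 2 sinh (Im w) is (1 - |a|^2)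
  / |a| for a = exp (i w).\<close>

lemma deriv_upper:
 assumes w: "Im w > 0" and D: "(Phi has_field_derivative D) (at w)"
 shows "norm D * (2 * sinh (Im w)) <= 38 * d w * (1 + d w / M0)"
proof -
 obtain D' where D': "(Phi has_field_derivative D') (at w)"
  "!!q b. q \<in> Gam ==> b \<in> Gam ==> norm D' * (2 * sinh (Im w)) * norm (q - b) <= 38 * norm (Phi w - b) * norm (Phi w - q)"
  using Phi_deriv[OF w] by metis
 have DD: "D' = D" using D D'(1) DERIV_unique by blast
 obtain q where q: "q \<in> Gam" "d w = norm (Phi w - q)" using nearest by blast
 obtain b where b: "b \<in> Gam" "norm (q - b) >= M0" using M0(2)[OF q(1)] by blast
 define r where "r = norm (q - b)"
 have r: "r >= M0" "r > 0" using b M0 by (auto simp: r_def)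
 have d0: "d w > 0" by (rule d_pos[OF w])
 have "norm (Phi w - b) <= d w + r" unfolding q(2) r_def using norm_triangle_ineq[of "Phi w - q" "q - b"] by simp
 hence "38 * norm (Phi w - b) * norm (Phi w - q) <= 38 * (d w + r) * d w"
  unfolding q(2)[symmetric] using d0 by (intro mult_right_mono mult_left_mono) auto
 hence "norm D * (2 * sinh (Im w)) * r <= 38 * (d w + r) * d w"
  using D'(2)[OF q(1) b(1)] unfolding DD r_def by linarith
 hence "norm D * (2 * sinh (Im w)) <= 38 * d w * (1 + d w / r)" using r by (simp add: field_simps)
 also have "... <= 38 * d w * (1 + d w / M0)" using r M0 d0 by (intro mult_left_mono add_left_mono divide_left_mono) auto
 finally show ?thesis .
qed

text \<open>The spread estimate is applied with \<open>q\<close> the image of the left end of the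
  interval and \<open>b\<close> far from \<open>q\<close>. It yields a point of the arc at distance
  of order min (d w) M0 from \<open>q\<close>, and distances on the curve are at most
  \<open>kap\<close> times increments of \<open>g\<close>.\<close>

lemma arc_length_lower:
 assumes w: "Im w > 0" and st: "arctan t - arctan s >= pi / real 6"
 shows "kap * (g (Re w + Im w * t) - g (Re w + Im w * s)) >= 3 / (4 * 100 ^ 6) * min (d w) M0"
proof -
 define u v where "u = Re w" and "v = Im w"
 define q where "q = gam (u + v * s)"
 have q: "q \<in> Gam" by (simp add: q_def)
 obtain b where b: "b \<in> Gam" "norm (q - b) >= M0" using M0(2)[OF q] by blast
 have ne: "q ~= b" using b M0 by auto
 obtain x where x: "x \<in> {u + v * s..u + v * t}"
  "norm (gam x - q) * norm (Phi w - b) > (3 / 100 ^ 6) * norm (gam x - b) * norm (q - Phi w)"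
  using arc_spread[OF w st b(1) q ne] by (auto simp: u_def v_def)
 define ta where "ta = norm (gam x - q)"
 define r where "r = norm (q - b)"
 define e where "e = norm (q - Phi w)"
 define m where "m = min (d w) M0"
 have d0: "d w > 0" by (rule d_pos[OF w])
 have m: "m > 0" "m <= e" "m <= r" using d0 M0 b(2) d_le[OF q, of w] by (auto simp: m_def e_def r_def norm_minus_commute)
 define A where "A = norm (gam x - b)"
 define B where "B = norm (Phi w - b)"
 define c :: real where "c = 3 / 100 ^ 6"
 have "A >= r - ta" unfolding A_def r_def ta_def using norm_triangle_ineq[of "q - gam x" "gam x - b"] by (simp add: norm_minus_commute)
 hence "c * (r - ta) * e <= c * A * e" by (intro mult_right_mono mult_left_mono) (auto simp: c_def e_def)
 also have "... < ta * B" using x(2) by (simp add: A_def B_def c_def e_def ta_def)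
 also have "B <= e + r" unfolding B_def e_def r_def using norm_triangle_ineq[of "Phi w - q" "q - b"] by (simp add: norm_minus_commute)
 hence "ta * B <= ta * (e + r)" by (intro mult_left_mono) (auto simp: ta_def)
 finally have sp: "3 / 100 ^ 6 * (r - ta) * e < ta * (e + r)" unfolding c_def .
 have ta: "ta >= 3 / (4 * 100 ^ 6) * m"
 proof (cases "ta <= r / 2")
  case True
  have "3 / 100 ^ 6 * (r / 2) * e <= 3 / 100 ^ 6 * (r - ta) * e" using True by (intro mult_right_mono mult_left_mono) (auto simp: e_def)
  hence A: "3 / 100 ^ 6 * (r / 2) * e <= ta * (e + r)" using sp by linarith
  have er: "m * (e + r) <= 2 * (r * e)"
  proof -
   have "m * e <= r * e" "m * r <= e * r" using m by (auto intro!: mult_right_mono)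
   thus ?thesis by (simp add: algebra_simps)
  qed
  have "3 / (4 * 100 ^ 6) * m * (e + r) <= 3 / (4 * 100 ^ 6) * (2 * (r * e))"
   unfolding mult.assoc by (rule mult_left_mono[OF er]) simp
  also have "3 / (4 * 100 ^ 6) * (2 * (r * e)) = 3 / 100 ^ 6 * (r / 2) * e" by simp
  finally have "3 / (4 * 100 ^ 6) * m * (e + r) <= ta * (e + r)" using A by linarith
  moreover have "e + r > 0" using m by linarith
  ultimately show ?thesis by (rule mult_right_le_imp_le)
 next
  case False
  have "3 / (4 * 100 ^ 6) * m <= 1/2 * m" using m by (intro mult_right_mono) auto
  thus ?thesis using False m by simp
 qed
 have "ta <= kap * norm (cis (g x) - cis (g (u + v * s)))" unfolding ta_def q_def by (rule bl(2)) auto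
 also have "... <= kap * \<bar>g x - g (u + v * s)\<bar>" by (intro mult_left_mono norm_cis_diff_le kap_nonneg)
 also have "... <= kap * (g (u + v * t) - g (u + v * s))"
  using x(1) gm by (intro mult_left_mono kap_nonneg) (auto simp: strict_mono_less_eq)
 finally show ?thesis using ta by (simp add: u_def v_def m_def)
qed

text \<open>Main link between the view from \<open>w\<close> and the parameter \<open>g\<close>: an
  interval seen under pi / 6 contains a parameter close to that of a nearest point, on the scale of
  d w. Otherwise, by the lower bi-Lipschitz bound, the left end and the point found by
  \<open>arc_far\<close> are both far from \<open>h tq\<close>, and the triangle inequality
  contradicts the cross-ratio bound. No \<open>kap\<close> enters.\<close>

lemma no_far_interval:
 assumes w: "Im w > 0" and st: "arctan t - arctan s >= pi / real 6" "s <= t"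
  and tq: "tq \<in> sphere 0 1" "d w = norm (Phi w - h tq)"
  and far: "!!x. x \<in> {Re w + Im w * s..Re w + Im w * t} ==> norm (cis (g x) - tq) >= 3 * ((3 + 5 ^ 6) / 2)^2 * d w"
 shows False
proof -
 define R where "R = ((3 + 5 ^ 6) / 2 :: real)^2"
 have R: "R >= 1" by (simp add: R_def power2_eq_square)
 have d0: "d w > 0" by (rule d_pos[OF w])
 define xb where "xb = Re w + Im w * s"
 have xb: "xb \<in> {Re w + Im w * s..Re w + Im w * t}" using w st by (auto simp: xb_def)
 have ge: "norm (gam x - h tq) >= 3 * R * d w" if "x \<in> {Re w + Im w * s..Re w + Im w * t}" for x
  using far[OF that] bl(1)[of "cis (g x)" tq] tq by (simp add: R_def)
 have "h tq ~= gam xb" using ge[OF xb] R d0 by (auto simp: mult_le_0_iff)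
 then obtain x where x: "x \<in> {Re w + Im w * s..Re w + Im w * t}"
  "norm (gam x - Phi w) * norm (h tq - gam xb) < R * norm (gam x - gam xb) * norm (Phi w - h tq)"
  using arc_far[OF w st(1) xb, of "h tq"] tq by (auto simp: R_def)
 define r where "r = norm (gam x - h tq)"
 define e where "e = norm (gam xb - h tq)"
 define de where "de = d w"
 have r: "r >= 3 * (R * de)" "e >= 3 * (R * de)" using ge[OF x(1)] ge[OF xb] by (auto simp: r_def e_def de_def)
 have dR: "de <= R * de" "de > 0" using R d0 by (auto simp: de_def)
 have "norm (gam x - Phi w) >= r - de" unfolding r_def de_def tq(2) using norm_triangle_ineq[of "gam x - Phi w" "Phi w - h tq"] by simp
 moreover have "norm (gam x - gam xb) <= r + e" unfolding r_def e_def using norm_triangle_ineq4[of "gam x - h tq" "gam xb - h tq"] by simp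
 ultimately have 1: "(r - de) * e <= norm (gam x - Phi w) * e" "R * norm (gam x - gam xb) * de <= R * (r + e) * de"
  using R dR by (auto intro!: mult_right_mono mult_left_mono simp: e_def)
 have "norm (gam x - Phi w) * e < R * norm (gam x - gam xb) * de"
  using x(2) unfolding e_def de_def tq(2) norm_minus_commute[of "h tq" "gam xb"] .
 hence "(r - de) * e < R * (r + e) * de" using 1 by linarith
 moreover have "3 * (R * de) * r <= e * r" "3 * (R * de) * e <= r * e" using r dR R by (auto intro!: mult_right_mono simp: r_def e_def)
 moreover have "de * e <= (R * de) * e" using dR by (intro mult_right_mono) (auto simp: e_def)
 ultimately show False by (simp add: algebra_simps)
qed

text \<open>If the window carries more than 4 rho of parameter, the points \<open>c1\<close> and
  \<open>c2\<close> bounding the parameters far from the nearest point lie within pi / 2 of u, by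
  \<open>no_far_interval\<close>. Then the interval from c2 to c1 + 2 pi is longer than half a
  period but carries parameter length at most 2 nu, whereas the curve moves by \<open>de\<close> on
  every half period. So \<open>rho\<close> is at least de / (4 kap), and a trivial bound for the
  window suffices.\<close>

lemma window_length_upper:
 assumes w: "Im w > 0" "Im w <= 4/10" and de: "de > 0"
  and half: "!!al. \<exists>x\<in>{al..al + pi}. norm (gam x - gam al) >= de"
 shows "g (Re w + Im w) - g (Re w - Im w) <= (8 + 29 * kap / de) * (3 * ((3 + 5 ^ 6) / 2)^2 * d w)"
proof -
 define u v where "u = Re w" and "v = Im w"
 define rho where "rho = 3 * ((3 + 5 ^ 6) / 2)^2 * d w"
 define nu where "nu = 2 * rho"
 have v: "0 < v" "v <= 4/10" using w by (simp_all add: v_def)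
 have rho: "rho > 0" using d_pos[OF w(1)] by (simp add: rho_def)
 have k0: "0 <= 29 * kap / de * rho" using kap_nonneg de rho by simp
 have mono: "g x <= g y \<longleftrightarrow> x <= y" for x y using gm by (rule strict_mono_less_eq)
 \<comment> \<open>71/10 bounds 2 v + 2 pi for v <= 4/10.\<close>
 have "pi <= 315/100" using pi_approx by simp
 hence L7: "g (u + v) - g (u - v) <= 71/10"
  using drift_le[OF gc gm geq, of "u + v" "u - v"] v by linarith
 have "g (u + v) - g (u - v) <= (8 + 29 * kap / de) * rho"
 proof (cases "rho < 1")
  case False
  thus ?thesis using L7 k0 by (simp add: algebra_simps)
 next
  case True
  obtain q where q: "q \<in> Gam" "d w = norm (Phi w - q)" using nearest by blast
  then obtain tq where tq: "tq \<in> sphere 0 1" "q = h tq" by blast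
  then obtain ta0 where ta0: "tq = cis ta0" using cis_image_UNIV(1) by (metis imageE)
  \<comment> \<open>Selects the representative \<open>ta\<close> of the angle \<open>ta0\<close> for
    which g (u - v) lies in the period starting at ta - nu.\<close>
  define j where "j = \<lfloor>(g (u - v) - (ta0 - nu)) / (2 * pi)\<rfloor>"
  define ta where "ta = ta0 + 2 * pi * of_int j"
  have tau: "tq = cis ta" unfolding ta0 cis_eq_iff_int ta_def by (intro exI[of _ "- j"]) simp
  have tau2: "cis (ta + 2 * pi) = tq" unfolding tau cis_eq_iff_int by (intro exI[of _ 1]) simp
  have "of_int j <= (g (u - v) - (ta0 - nu)) / (2 * pi)" "(g (u - v) - (ta0 - nu)) / (2 * pi) < of_int j + 1"
   unfolding j_def by linarith+
  hence base: "ta - nu <= g (u - v)" "g (u - v) < ta - nu + 2 * pi" by (simp_all add: ta_def field_simps)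
  have far: "norm (cis (g x) - tq) >= rho" if x: "ta + nu <= g x" "g x <= ta + 2 * pi - nu" for x
  proof (cases "g x - ta <= pi")
   case True
   hence "\<bar>g x - ta\<bar> <= pi" using x rho by (simp add: nu_def)
   from norm_cis_diff_ge[OF this] show ?thesis using x rho by (simp add: nu_def tau)
  next
   case False
   have le: "g x <= ta + 2 * pi" using x rho by (simp add: nu_def)
   hence "\<bar>g x - (ta + 2 * pi)\<bar> <= pi" using False by (simp add: abs_if)
   from norm_cis_diff_ge[OF this] show ?thesis using x le rho unfolding tau2 by (simp add: nu_def abs_if split: if_splits)
  qed
  show ?thesis
  proof (cases "g (u + v) <= ta + nu")
   case True
   hence "g (u + v) - g (u - v) <= 4 * rho" using base by (simp add: nu_def)
   thus ?thesis using k0 rho by (simp add: algebra_simps)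
  next
   case False
   have nu2: "nu <= 2" using True by (simp add: nu_def)
   obtain x0 where x0: "u - v <= x0" "x0 <= u + v" "ta + nu <= g x0" "g x0 <= ta + 2 * pi - nu"
   proof (cases "ta + nu <= g (u - v)")
    case True
    thus ?thesis using that[of "u - v"] base v by simp
   next
    case F: False
    have "\<exists>x\<ge>u - v. x <= u + v & g x = ta + nu"
     by (rule IVT') (use F False v gc in \<open>auto intro: continuous_on_subset\<close>)
    then obtain x where x: "u - v <= x" "x <= u + v" "g x = ta + nu" by blast
    have "2 * nu <= 2 * pi" using nu2 pi_gt3 by linarith
    thus ?thesis using that[OF x(1,2)] x(3) by simp
   qed
   obtain c1 where c1: "g c1 = ta + nu" using g_surj by blast
   obtain c2 where c2: "g c2 = ta + 2 * pi - nu" using g_surj by blast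
   have cx: "c1 <= x0" "x0 <= c2" using mono[of c1 x0] mono[of x0 c2] c1 c2 x0 by auto
   have pv: "1 <= pi / (2 * v)" using v pi_gt3 by (simp add: field_simps)
   have c2u: "c2 < u + pi/2"
   proof (rule ccontr)
    assume "\<not> c2 < u + pi/2"
    hence c: "u + pi/2 <= c2" by simp
    show False
    proof (rule no_far_interval[OF w(1) arctan_view_outer[OF v] pv tq(1)])
     show "d w = norm (Phi w - h tq)" using q tq by simp
     fix x assume "x \<in> {Re w + Im w * 1..Re w + Im w * (pi / (2 * v))}"
     hence "u + v <= x" "x <= u + pi/2" using v by (auto simp: u_def v_def)
     hence "x0 <= x" "x <= c2" using x0 c by auto
     hence "g x0 <= g x" "g x <= g c2" using mono by auto
     thus "3 * ((3 + 5 ^ 6) / 2)^2 * d w <= norm (cis (g x) - tq)"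
      using far[of x] x0 c2 by (simp add: rho_def)
    qed
   qed
   have c1u: "u - pi/2 < c1"
   proof (rule ccontr)
    assume "\<not> u - pi/2 < c1"
    hence c: "c1 <= u - pi/2" by simp
    have view: "arctan (- 1) - arctan (- (pi / (2 * v))) >= pi / real 6"
     using arctan_view_outer[OF v] arctan_minus[of 1] arctan_minus[of "pi / (2 * v)"] by simp
    show False
    proof (rule no_far_interval[OF w(1) view _ tq(1)])
     show "d w = norm (Phi w - h tq)" using q tq by simp
     show "- (pi / (2 * v)) <= - 1" using pv by simp
     fix x assume "x \<in> {Re w + Im w * (- (pi / (2 * v)))..Re w + Im w * (- 1)}"
     hence "x <= u - v" "u - pi/2 <= x" using v by (auto simp: u_def v_def)
     hence "x <= x0" "c1 <= x" using x0 c by auto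
     hence "g c1 <= g x" "g x <= g x0" using mono by auto
     thus "3 * ((3 + 5 ^ 6) / 2)^2 * d w <= norm (cis (g x) - tq)"
      using far[of x] x0 c1 by (simp add: rho_def)
    qed
   qed
   obtain x where x: "x \<in> {c2..c2 + pi}" "norm (gam x - gam c2) >= de" using half by blast
   have "x <= c1 + 2 * pi" using x(1) c1u c2u by simp
   hence "g x <= ta + nu + 2 * pi" using mono[of x "c1 + 2 * pi"] geq[of c1] c1 by simp
   moreover have "g c2 <= g x" using x(1) mono by simp
   ultimately have gx: "\<bar>g x - g c2\<bar> <= 2 * nu" using c2 by simp
   have "de <= kap * norm (cis (g x) - cis (g c2))" using x(2) bl(2)[of "cis (g x)" "cis (g c2)"] by simp
   also have "... <= kap * (2 * nu)" using norm_cis_diff_le[of "g x" "g c2"] gx by (intro mult_left_mono kap_nonneg) auto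
   finally have "de <= 4 * kap * rho" by (simp add: nu_def)
   \<comment> \<open>29 is chosen above 4 * 71/10, so the trivial bound is now enough.\<close>
   hence "1 <= 4 * (kap * rho / de)" using de by simp
   hence "71/10 <= 29 * (kap * rho / de)" by linarith
   also have "... = 29 * kap / de * rho" by simp
   finally show ?thesis using L7 rho unfolding distrib_right by linarith
  qed
 qed
 thus ?thesis by (simp add: u_def v_def rho_def)
qed

section \<open>From conformal estimates to local Lipschitz bounds\<close>

lemma Gmap_filterlim:
 assumes w: "Im w > 0"
 shows "filterlim (Gmap g) (at (Gmap g w)) (at w)"
proof (rule filterlim_atI)
 show "(Gmap g \<longlongrightarrow> Gmap g w) (at w)"
  using Gmap_cont[OF gc gm geq] by (simp add: continuous_on_def)
 have "\<forall>\<^sub>F z in at w. z \<in> {z. Im z > 0} - {w}"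
  using w open_halfspace_Im_gt[of 0] eventually_at_in_open[of "{z. Im z > 0}" w] by simp
 thus "\<forall>\<^sub>F z in at w. Gmap g z ~= Gmap g w"
  by eventually_elim (use inj_onD[OF Gmap_inj[OF gc gm geq]] w in force)
qed

text \<open>Target coordinate: \<open>Z 1 w\<close> is \<open>Psi g\<close> at exp (i w);
  \<open>Z (- 1) w\<close> is its reciprocal, which after conjugation is the coordinate outside the
  disc.\<close>

definition Z :: "real => complex => complex" where "Z si w = exp (of_real si * \<i> * Gmap g w)"

text \<open>Chain rule without an inverse derivative: \<open>Phi\<close> is locally Lipschitz in w
  with constant \<open>K\<close>, while \<open>Z si\<close> expands locally by exp (- si y) / 2
  times the expansion of \<open>Gmap\<close>. The halved exponential makes 7/10000 into
  35/100000.\<close>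

lemma pointwise_upper:
 assumes w: "Im w > 0" and si: "si = 1 | si = - 1" and eta: "eta > 0"
  and R: "g (Re w + Im w * (8/10)) - g (Re w + Im w * (1/10)) >= eta"
  and L: "g (Re w + Im w * (- 1/10)) - g (Re w + Im w * (- 8/10)) >= eta"
  and D: "(Phi has_field_derivative D) (at w)" "norm D < K"
  and M: "K * exp (si * Im (Gmap g w)) * Im w <= M * (35/100000 * eta)"
 shows "\<forall>\<^sub>F z in at w. norm (Phi z - Phi w) <= M * norm (Z si z - Z si w)"
proof -
 define y where "y = Im (Gmap g w)"
 have 1: "\<forall>\<^sub>F z in at w. norm (Phi z - Phi w) <= K * norm (z - w)"
  by (rule eventually_le_of_has_derivative[OF D(1)[unfolded has_field_derivative_def], of "norm D"]) (use D(2) in \<open>auto simp: norm_mult\<close>)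
 have 2: "\<forall>\<^sub>F z in at w. norm (Gmap g z - Gmap g w) >= 7/10000 * eta / Im w * norm (z - w)"
  by (rule Gmap_lower[OF gc gm geq w eta R L])
 have 3: "\<forall>\<^sub>F z in at w. norm (Z si z - Z si w) >= exp (- si * y) / 2 * norm (Gmap g z - Gmap g w)"
  using filterlim_iff[THEN iffD1, OF Gmap_filterlim[OF w], rule_format, OF exp_ii_pointwise(1)[OF si]] by (simp add: Z_def y_def)
 have K: "K > 0" using D(2) norm_ge_zero[of D] by linarith
 have "K * norm (z - w) <= M * (exp (- si * y) / 2 * (7/10000 * eta / Im w * norm (z - w)))" for z
 proof -
  have "K * exp (si * y) * Im w * (exp (- si * y) / Im w) <= M * (35/100000 * eta) * (exp (- si * y) / Im w)"
   using M w by (intro mult_right_mono) (auto simp: y_def)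
  hence "K <= M * (exp (- si * y) / 2 * (7/10000 * eta / Im w))" using w by (simp add: exp_minus field_simps)
  from mult_right_mono[OF this norm_ge_zero[of "z - w"]] show ?thesis by (simp only: mult.assoc)
 qed
 note X = this
 have "0 < K * exp (si * y) * Im w" using K w by simp
 hence "0 < M * (35/100000 * eta)" using M by (simp add: y_def)
 hence M0: "M > 0" using eta by (simp add: zero_less_mult_iff)
 show ?thesis using 1 2 3
 proof eventually_elim
  case (elim z)
  have "exp (- si * y) / 2 * (7/10000 * eta / Im w * norm (z - w)) <= exp (- si * y) / 2 * norm (Gmap g z - Gmap g w)"
   using elim(2) by (rule mult_left_mono) simp
  also have "... <= norm (Z si z - Z si w)" by (rule elim(3))
  finally have "M * (exp (- si * y) / 2 * (7/10000 * eta / Im w * norm (z - w))) <= M * norm (Z si z - Z si w)"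
   using M0 by (intro mult_left_mono) auto
  thus ?case using elim(1) X[of z] by linarith
 qed
qed

lemma pointwise_lower:
 assumes w: "Im w > 0" and si: "si = 1 | si = - 1"
  and D: "(Phi has_field_derivative D) (at w)" "K < norm D" "K > 0"
  and M: "exp (- si * Im (Gmap g w)) * (20 * (g (Re w + Im w) - g (Re w - Im w))) <= M * (K * Im w)"
 shows "\<forall>\<^sub>F z in at w. norm (Z si z - Z si w) <= M * norm (Phi z - Phi w)"
proof -
 define y where "y = Im (Gmap g w)"
 define Lam where "Lam = g (Re w + Im w) - g (Re w - Im w)"
 have 1: "\<forall>\<^sub>F z in at w. norm (Phi z - Phi w) >= K * norm (z - w)"
  by (rule eventually_ge_of_has_derivative[OF D(1)[unfolded has_field_derivative_def], of "norm D"]) (use D(2) in \<open>auto simp: norm_mult\<close>)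
 have 2: "\<forall>\<^sub>F z in at w. norm (Gmap g z - Gmap g w) <= 10 * Lam / Im w * norm (z - w)"
  unfolding Lam_def by (rule Gmap_upper[OF gc gm geq w])
 have 3: "\<forall>\<^sub>F z in at w. norm (Z si z - Z si w) <= 2 * exp (- si * y) * norm (Gmap g z - Gmap g w)"
  using filterlim_iff[THEN iffD1, OF Gmap_filterlim[OF w], rule_format, OF exp_ii_pointwise(2)[OF si]] by (simp add: Z_def y_def)
 have Lam: "Lam > 0" unfolding Lam_def using gm w by (simp add: strict_mono_less)
 have X: "2 * exp (- si * y) * (10 * Lam / Im w) <= M * K"
  using M w by (simp add: y_def Lam_def field_simps)
 moreover have "0 < 2 * exp (- si * y) * (10 * Lam / Im w)" using Lam w by simp
 ultimately have M0: "M > 0" using D(3) by (smt (verit) mult_nonpos_nonneg)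
 show ?thesis using 1 2 3
 proof eventually_elim
  case (elim z)
  have "norm (Z si z - Z si w) <= 2 * exp (- si * y) * (10 * Lam / Im w * norm (z - w))"
   using elim(3) mult_left_mono[OF elim(2), of "2 * exp (- si * y)"] by simp
  also have "... <= (M * K) * norm (z - w)" using mult_right_mono[OF X norm_ge_zero[of "z - w"]] by (simp only: mult.assoc)
  also have "... <= M * norm (Phi z - Phi w)" using mult_left_mono[OF elim(1), of M] M0 by (simp add: mult.assoc)
  finally show ?case .
 qed
qed

end

text \<open>Schwarz-Pick inequality: the Schwarz lemma for \<open>psi\<close> followed by the
  automorphism that moves \<open>psi p\<close> to 0.\<close>

lemma schwarz_pick_ball:
 assumes hol: "psi holomorphic_on ball p r" and im: "psi ` ball p r \<subseteq> ball 0 1" and r: "r > 0"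
 shows "norm (deriv psi p) * r <= 1 - (norm (psi p))^2"
proof -
 define a where "a = psi p"
 have p: "p \<in> ball p r" using r by simp
 have "psi p \<in> ball 0 1" using im p by blast
 hence a: "norm a < 1" by (simp add: a_def)
 have aa: "cnj a * a = of_real ((norm a)^2)" by (simp add: complex_norm_square mult.commute del: of_real_power)
 have a2: "(norm a)^2 < 1" using a by (simp add: abs_square_less_1)
 define F where "F s = disc_shift (- a) (psi (p + of_real r * s))" for s
 have map: "p + of_real r * s \<in> ball p r" if "norm s < 1" for s
  using that r by (simp add: dist_norm norm_mult)
 have h1: "(%s. psi (p + of_real r * s)) holomorphic_on ball 0 1"
  by (rule holomorphic_on_compose_gen[OF _ hol, unfolded o_def]) (use map in \<open>auto intro!: holomorphic_intros\<close>)
 have na: "norm (- a) < 1" using a by simp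
 have Fh: "F holomorphic_on ball 0 1" unfolding F_def[abs_def]
  by (rule holomorphic_on_compose_gen[OF h1 disc_shift_holomorphic(1)[OF na], unfolded o_def]) (use map im in auto)
 have F0: "F 0 = 0" by (simp add: F_def disc_shift_def a_def)
 have F1: "norm (F s) < 1" if "norm s < 1" for s
 proof -
  have "psi (p + of_real r * s) \<in> ball 0 1" using map[OF that] im by blast
  hence "F s \<in> disc_shift (- a) ` ball 0 1" unfolding F_def by blast
  thus ?thesis using disc_shift_bij(1)[OF na] by simp
 qed
 have "norm (deriv F 0) <= 1" by (rule Schwarz_Lemma(2)[OF Fh F0 F1, of 0]) auto
 moreover have "deriv F 0 = deriv psi p * of_real r / of_real (1 - (norm a)^2)"
 proof (rule DERIV_imp_deriv)
  have d1: "(psi has_field_derivative deriv psi p) (at (p + of_real r * 0))"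
   using holomorphic_derivI[OF hol open_ball p] by simp
  have d2: "((%s. psi (p + of_real r * s)) has_field_derivative deriv psi p * of_real r) (at 0)"
   by (rule DERIV_chain2[where f = psi and g = "%s. p + of_real r * s" and x = 0, OF d1])
    (auto intro!: derivative_eq_intros)
  have nz: "1 + cnj (- a) * psi (p + of_real r * 0) ~= 0"
   using aa a2 unfolding a_def[symmetric] by (simp add: a_def[symmetric] complex_eq_iff del: of_real_power)
  have "((%s. (psi (p + of_real r * s) + - a) / (1 + cnj (- a) * psi (p + of_real r * s))) has_field_derivative
    ((deriv psi p * of_real r + 0) * (1 + cnj (- a) * psi (p + of_real r * 0)) - (psi (p + of_real r * 0) + - a) * (0 + cnj (- a) * (deriv psi p * of_real r)))
     / ((1 + cnj (- a) * psi (p + of_real r * 0)) * (1 + cnj (- a) * psi (p + of_real r * 0)))) (at 0)"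
   by (intro DERIV_divide DERIV_add DERIV_const DERIV_cmult d2 nz)
  moreover have "((deriv psi p * of_real r + 0) * (1 + cnj (- a) * psi (p + of_real r * 0)) - (psi (p + of_real r * 0) + - a) * (0 + cnj (- a) * (deriv psi p * of_real r)))
     / ((1 + cnj (- a) * psi (p + of_real r * 0)) * (1 + cnj (- a) * psi (p + of_real r * 0))) = deriv psi p * of_real r / (1 + cnj (- a) * a)"
   using nz by (simp add: a_def)
  moreover have "1 + cnj (- a) * a = of_real (1 - (norm a)^2)" using aa by simp
  ultimately show "(F has_field_derivative deriv psi p * of_real r / of_real (1 - (norm a)^2)) (at 0)"
   unfolding F_def[abs_def] disc_shift_def by simp
 qed
 ultimately have "norm (deriv psi p) * r / \<bar>1 - (norm a)^2\<bar> <= 1"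
  using r by (simp add: norm_mult norm_divide del: of_real_diff of_real_power)
 thus ?thesis using a2 by (simp add: a_def divide_le_eq)
qed

lemma two_sin_ge_one:
 assumes "pi/3 <= x" "x <= 5 * pi/3"
 shows "2 * \<bar>sin (x / 2)\<bar> >= 1"
proof (cases "x / 2 <= pi/2")
 case True
 have "sin (pi/6) <= sin (x/2)" using assms True by (intro sin_monotone_2pi_le) auto
 thus ?thesis by (simp add: sin_30)
next
 case False
 have "sin (pi/6) <= sin (pi - x/2)" using assms False by (intro sin_monotone_2pi_le) auto
 thus ?thesis by (simp add: sin_30)
qed

context curve_side
begin

text \<open>Schwarz-Pick for the inverse conformal map \<open>psi\<close> on the largest disc around
  \<open>Phi w\<close> that avoids the curve; its derivative is the reciprocal of that of
  \<open>Phi\<close> up to the factor exp (- Im w).\<close>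

lemma deriv_lower:
 assumes w: "Im w > 0" and D: "(Phi has_field_derivative D) (at w)"
  and psi: "psi holomorphic_on ball (Phi w) (d w)" "psi ` ball (Phi w) (d w) \<subseteq> ball 0 1"
  and inv: "!!z. Im z > 0 ==> Phi z \<in> ball (Phi w) (d w) ==> psi (Phi z) = exp (\<i> * z)"
 shows "norm D * (2 * sinh (Im w)) >= d w"
proof -
 have d0: "d w > 0" by (rule d_pos[OF w])
 have cw: "Phi w \<in> ball (Phi w) (d w)" using d0 by simp
 have 1: "norm (deriv psi (Phi w)) * d w <= 1 - (norm (psi (Phi w)))^2" by (rule schwarz_pick_ball[OF psi d0])
 have "((%z. psi (Phi z)) has_field_derivative deriv psi (Phi w) * D) (at w)"
  by (rule DERIV_chain2[OF holomorphic_derivI[OF psi(1) open_ball cw] D])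
 moreover have "\<forall>\<^sub>F z in nhds w. psi (Phi z) = exp (\<i> * z)"
 proof -
  have "isCont Phi w" using D DERIV_isCont by blast
  hence "(Phi \<longlongrightarrow> Phi w) (nhds w)" by (simp add: isCont_def tendsto_at_iff_tendsto_nhds)
  hence "\<forall>\<^sub>F z in nhds w. Phi z \<in> ball (Phi w) (d w)" using open_ball cw by (rule topological_tendstoD)
  moreover have "\<forall>\<^sub>F z in nhds w. z \<in> {z. Im z > 0}" using w open_halfspace_Im_gt[of 0] by (intro eventually_nhds_in_open) auto
  ultimately show ?thesis by eventually_elim (use inv in auto)
 qed
 ultimately have "((%z. exp (\<i> * z)) has_field_derivative deriv psi (Phi w) * D) (at w)"
  using DERIV_cong_ev[of w w "%z. psi (Phi z)" "%z. exp (\<i> * z)"] by blast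
 moreover have "((%z. exp (\<i> * z)) has_field_derivative exp (\<i> * w) * \<i>) (at w)" by (auto intro!: derivative_eq_intros)
 ultimately have "deriv psi (Phi w) * D = exp (\<i> * w) * \<i>" by (rule DERIV_unique)
 hence nD: "norm (deriv psi (Phi w)) * norm D = exp (- Im w)" by (simp flip: norm_mult) (simp add: norm_mult)
 have s: "1 - (norm (psi (Phi w)))^2 = exp (- Im w) * (2 * sinh (Im w))"
 proof -
  have "2 * sinh (Im w) = exp (Im w) - exp (- Im w)" by (simp add: sinh_field_def)
  thus ?thesis using inv[OF w cw] by (simp add: right_diff_distrib power2_eq_square mult_exp_exp)
 qed
 have "norm (deriv psi (Phi w)) * d w <= norm (deriv psi (Phi w)) * (norm D * (2 * sinh (Im w)))"
  using 1 unfolding s nD[symmetric] by simp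
 moreover have "norm (deriv psi (Phi w)) ~= 0" using nD by auto
 ultimately show ?thesis by simp
qed

text \<open>The parameter circle is cut into three arcs of length 2 pi / 3 with preimages
  [T j, T (j + 1)]. From height sqrt 3 H over the middle of the shortest preimage, of half-length H,
  this interval and part of each neighbour are seen under at least pi / 6. One of the three arcs has
  chord distance at least 1 from the parameter of the nearest point, so
  \<open>no_far_interval\<close> excludes a small \<open>d w\<close>.\<close>

lemma good_center: "\<exists>w. Im w > 0 & d w >= 1 / (3 * ((3 + 5 ^ 6) / 2)^2)"
proof -
 have "\<forall>j::int. \<exists>x. g x = 2 * pi * of_int j / 3" using g_surj by blast
 from choice[OF this] obtain T :: "int => real" where T: "!!j. g (T j) = 2 * pi * of_int j / 3" by blast
 have mono: "g x <= g y \<longleftrightarrow> x <= y" for x y using gm by (rule strict_mono_less_eq)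
 have T3: "T (j + 3) = T j + 2 * pi" for j
 proof -
  have "g (T (j + 3)) = g (T j + 2 * pi)" unfolding geq T by (simp add: field_simps)
  thus ?thesis using strict_mono_eq[OF gm] by blast
 qed
 define len where "len j = T (j + 1) - T j" for j
 have lenq: "len (j + 3) = len j" for j using T3[of j] T3[of "j + 1"] by (simp add: len_def algebra_simps)
 have lenp: "len j > 0" for j
 proof -
  have "g (T j) < g (T (j + 1))" unfolding T by (simp add: divide_strict_right_mono)
  thus ?thesis using strict_mono_less[OF gm] by (simp add: len_def)
 qed
 obtain j0 where j0: "len j0 <= len (j0 - 1)" "len j0 <= len (j0 + 1)"
 proof -
  consider "len 0 <= len 1" "len 0 <= len 2" | "len 1 <= len 0" "len 1 <= len 2" | "len 2 <= len 0" "len 2 <= len 1" by linarith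
  thus ?thesis
  proof cases
   case 1 thus ?thesis using that[of 0] lenq[of "- 1"] by simp
  next
   case 2 thus ?thesis using that[of 1] by simp
  next
   case 3 thus ?thesis using that[of 2] lenq[of 0] by simp
  qed
 qed
 define u where "u = (T j0 + T (j0 + 1)) / 2"
 define H where "H = len j0 / 2"
 define w where "w = Complex u (sqrt 3 * H)"
 have H: "H > 0" using lenp[of j0] by (simp add: H_def)
 have w: "Im w > 0" using H by (simp add: w_def)
 have Tu: "T j0 = u - H" "T (j0 + 1) = u + H" by (simp_all add: u_def H_def len_def field_simps)
 have "len j0 = 2 * H" "len (j0 + 1) = T (j0 + 2) - T (j0 + 1)" "len (j0 - 1) = T j0 - T (j0 - 1)"
  by (simp_all add: len_def H_def add.assoc)
 hence T2: "T (j0 + 2) >= u + 3 * H" and T0: "T (j0 - 1) <= u - 3 * H" using j0 Tu by linarith+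
 have at: "arctan (1 / sqrt 3) = pi / 6" "arctan (sqrt 3) = pi / 3"
  by (rule arctan_unique, use pi_gt_zero in linarith, use pi_gt_zero in linarith, simp add: tan_30 tan_60)+
 have "d w >= 1 / (3 * ((3 + 5 ^ 6) / 2)^2)"
 proof (rule ccontr)
  assume "\<not> d w >= 1 / (3 * ((3 + 5 ^ 6) / 2)^2)"
  hence small: "3 * ((3 + 5 ^ 6) / 2)^2 * d w < 1" by (simp add: field_simps power2_eq_square)
  obtain q where q: "q \<in> Gam" "d w = norm (Phi w - q)" using nearest by blast
  then obtain tq where tq: "tq \<in> sphere 0 1" "q = h tq" by blast
  then obtain ta0 where ta0: "tq = cis ta0" using cis_image_UNIV(1) by (metis imageE)
  \<comment> \<open>Arc \<open>j\<close> starts more than pi / 3 and ends at most 5 pi / 3 after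
    \<open>ta0\<close>; \<open>m\<close> full turns move it to one of the three arcs around
    \<open>j0\<close>.\<close>
  define j where "j = \<lfloor>(ta0 + pi/3) / (2 * pi/3)\<rfloor> + 1"
  define m where "m = - ((j - (j0 - 1)) div 3)"
  define k where "k = j + 3 * m"
  define ta where "ta = ta0 + 2 * pi * of_int m"
  have tau: "tq = cis ta" unfolding ta0 cis_eq_iff_int ta_def by (intro exI[of _ "- m"]) simp
  have k: "k = j0 - 1 | k = j0 | k = j0 + 1"
   unfolding k_def m_def using div_mult_mod_eq[of "j - (j0 - 1)" 3] pos_mod_sign[of 3 "j - (j0 - 1)"] pos_mod_bound[of 3 "j - (j0 - 1)"] by presburger
  have "of_int (j - 1) <= (ta0 + pi/3) / (2 * pi/3)" "(ta0 + pi/3) / (2 * pi/3) < of_int j" unfolding j_def by linarith+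
  hence "2 * pi * of_int (j - 1) / 3 <= ta0 + pi/3" "ta0 + pi/3 < 2 * pi * of_int j / 3" by (simp_all add: field_simps)
  hence kr: "2 * pi * of_int (k - 1) / 3 <= ta + pi/3" "ta + pi/3 < 2 * pi * of_int k / 3"
   by (simp_all add: k_def ta_def field_simps)
  have far: "norm (cis (g x) - tq) >= 3 * ((3 + 5 ^ 6) / 2)^2 * d w" if x: "x \<in> {T k..T (k + 1)}" for x
  proof -
   have "g (T k) <= g x" "g x <= g (T (k + 1))" using x mono by auto
   hence "2 * pi * of_int k / 3 <= g x" "g x <= 2 * pi * of_int (k + 1) / 3" unfolding T .
   hence "pi/3 <= g x - ta" "g x - ta <= 5 * pi/3" using kr by (simp_all add: field_simps)
   from two_sin_ge_one[OF this] show ?thesis using small unfolding tau norm_cis_diff by linarith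
  qed
  note nf = no_far_interval[OF w _ _ tq(1) q(2)[unfolded tq(2)] far]
  have w': "Re w = u" "Im w * (1 / sqrt 3) = H" "Im w * sqrt 3 = 3 * H" by (simp_all add: w_def)
  have s13: "1 / sqrt 3 <= sqrt 3" by (simp add: field_simps)
  consider "k = j0 - 1" | "k = j0" | "k = j0 + 1" using k by blast
  thus False
  proof cases
   case 1
   show False
   proof (rule nf[of "- (1 / sqrt 3)" "- sqrt 3"])
    show "x \<in> {T k..T (k + 1)}" if "x \<in> {Re w + Im w * - sqrt 3..Re w + Im w * - (1 / sqrt 3)}" for x
     using that w' T0 Tu 1 by (simp only: mult_minus_right) simp
   qed (use at s13 arctan_minus[of "sqrt 3"] arctan_minus[of "1 / sqrt 3"] in \<open>simp_all del: arctan_minus\<close>)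
  next
   case 2
   show False
   proof (rule nf[of "1 / sqrt 3" "- (1 / sqrt 3)"])
    show "x \<in> {T k..T (k + 1)}" if "x \<in> {Re w + Im w * - (1 / sqrt 3)..Re w + Im w * (1 / sqrt 3)}" for x
     using that w' Tu 2 by (simp only: mult_minus_right) simp
    show "pi / real 6 <= arctan (1 / sqrt 3) - arctan (- (1 / sqrt 3))"
     unfolding arctan_minus at by simp
   qed simp
  next
   case 3
   show False
   proof (rule nf[of "sqrt 3" "1 / sqrt 3"])
    show "x \<in> {T k..T (k + 1)}" if "x \<in> {Re w + Im w * (1 / sqrt 3)..Re w + Im w * sqrt 3}" for x
     using that w' Tu T2 3 by (simp only: add.assoc) simp
   qed (use at s13 in simp_all)
  qed
 qed
 thus ?thesis using w by blast
qed

end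

section \<open>Jordan curve facts and numerical bounds\<close>

lemma inside_subset_cball:
 fixes Gam :: "complex set"
 assumes "Gam \<subseteq> cball q r"
 shows "inside Gam \<subseteq> cball q r"
 using outside_subset_convex[OF convex_cball assms] by (auto simp: inside_outside)

lemma inside_curve_facts:
 fixes h :: "complex => complex"
 assumes h: "continuous_on (sphere 0 1) h" "inj_on h (sphere 0 1)"
 shows "inside (h ` sphere 0 1) ~= {}" "open (inside (h ` sphere 0 1))" "open (outside (h ` sphere 0 1))"
  "frontier (inside (h ` sphere 0 1)) = h ` sphere 0 1" "frontier (outside (h ` sphere 0 1)) = h ` sphere 0 1"
  "connected (outside (h ` sphere 0 1))"
proof -
 define c where "c = h \<circ> circlepath 0 1"
 have img: "path_image c = h ` sphere 0 1"
  unfolding c_def path_image_compose by (simp add: path_image_circlepath)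
 have sp: "simple_path c" unfolding c_def
  by (rule simple_path_continuous_image) (use h in \<open>simp_all add: path_image_circlepath simple_path_circlepath\<close>)
 have cl: "pathfinish c = pathstart c" by (simp add: c_def pathfinish_compose pathstart_compose)
 show "inside (h ` sphere 0 1) ~= {}" "open (inside (h ` sphere 0 1))" "open (outside (h ` sphere 0 1))"
  "frontier (inside (h ` sphere 0 1)) = h ` sphere 0 1" "frontier (outside (h ` sphere 0 1)) = h ` sphere 0 1"
  "connected (outside (h ` sphere 0 1))"
  using Jordan_inside_outside[OF sp cl] by (simp_all add: img)
qed

lemma mult_exp_le_sinh: "v >= 0 ==> v * exp v <= (1 + 2 * v) * sinh v" for v :: real
proof -
 assume v: "v >= 0"
 have "(1 + 2 * v) * exp (- v) <= exp (2 * v) * exp (- v)" using exp_ge_add_one_self[of "2 * v"] by (intro mult_right_mono) auto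
 also have "... = exp v" by (simp add: mult_exp_exp)
 finally show ?thesis by (simp add: sinh_field_def algebra_simps)
qed

lemma sinh_le_mult_exp: "v >= 0 ==> sinh v <= v * exp v" for v :: real
proof -
 assume v: "v >= 0"
 have "(1 - 2 * v) * exp v <= exp (- 2 * v) * exp v" using exp_ge_add_one_self[of "- 2 * v"] by (intro mult_right_mono) auto
 also have "... = exp (- v)" by (simp add: mult_exp_exp)
 finally show ?thesis by (simp add: sinh_field_def algebra_simps)
qed

lemma exp_nat_le: "exp (real n) <= 3 ^ n"
proof -
 have "exp (real n) = exp 1 ^ n" by (simp flip: exp_of_nat_mult)
 also have "... <= 3 ^ n" by (intro power_mono exp_le) auto
 finally show ?thesis .
qed

lemma exp_sqrt7_pi: "exp (sqrt 7 * pi) <= 20000"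
proof -
 have "sqrt 7 <= 27/10" by (rule real_le_lsqrt) (auto simp: power2_eq_square)
 hence "sqrt 7 * pi <= 27/10 * (32/10)" using pi_approx by (intro mult_mono) auto
 hence "sqrt 7 * pi <= real 9" by simp
 hence "exp (sqrt 7 * pi) <= exp (real 9)" by (simp only: exp_le_cancel_iff)
 also have "... <= 3 ^ 9" by (rule exp_nat_le)
 finally show ?thesis by simp
qed

lemma exp_minus_two_fifths: "exp (- (4/10)) <= (6704/10000 :: real)"
proof -
 have "(10253125/10000000 :: real) ^ 16 <= exp (1/40) ^ 16"
  using exp_lower_Taylor_quadratic[of "1/40"] by (intro power_mono) (auto simp: power2_eq_square)
 also have "... = exp (4/10)" by (simp flip: exp_of_nat_mult)
 finally have "10000/6704 <= (exp (4/10) :: real)" by (rule order_trans[rotated]) (simp add: power_divide)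
 thus ?thesis by (simp add: exp_minus field_simps)
qed

context curve_side
begin

lemma exp_Im_bounds:
 assumes "Im w > 0"
 shows "exp (Im (Gmap g w)) <= 20000 * exp (Im w)" "exp (- Im (Gmap g w)) <= 20000 * exp (- Im w)" "exp (- Im (Gmap g w)) <= 1"
proof -
 have b: "\<bar>Im (Gmap g w) - Im w\<bar> <= sqrt 7 * pi" by (rule Gmap_Im_bounds[OF gc gm geq]) (use assms in simp)
 have "exp (Im (Gmap g w)) <= exp (sqrt 7 * pi) * exp (Im w)" unfolding mult_exp_exp exp_le_cancel_iff using b by linarith
 also have "... <= 20000 * exp (Im w)" by (intro mult_right_mono exp_sqrt7_pi) auto
 finally show "exp (Im (Gmap g w)) <= 20000 * exp (Im w)" .
 have "exp (- Im (Gmap g w)) <= exp (sqrt 7 * pi) * exp (- Im w)" unfolding mult_exp_exp exp_le_cancel_iff using b by linarith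
 also have "... <= 20000 * exp (- Im w)" by (intro mult_right_mono exp_sqrt7_pi) auto
 finally show "exp (- Im (Gmap g w)) <= 20000 * exp (- Im w)" .
 show "exp (- Im (Gmap g w)) <= 1" using Gmap_Im_pos[OF gc gm geq assms] by simp
qed

lemma g_increment_ge: "2 * pi <= t ==> g (x + t) - g x >= t / 2"
proof -
 assume t: "2 * pi <= t"
 define n where "n = \<lfloor>t / (2 * pi)\<rfloor>"
 have n: "of_int n <= t / (2 * pi)" "t / (2 * pi) < of_int n + 1" unfolding n_def by linarith+
 have "1 <= t / (2 * pi)" using t by simp
 hence "n >= 1" unfolding n_def by linarith
 hence "2 * real_of_int n >= of_int n + 1" by simp
 hence "t / (2 * pi) <= 2 * of_int n" using n by linarith
 hence "t <= 4 * pi * of_int n" by (simp add: field_simps)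
 moreover have "x + 2 * pi * of_int n <= x + t" using n(1) by (simp add: field_simps)
 hence "g (x + 2 * pi * of_int n) <= g (x + t)" using gm by (simp add: strict_mono_less_eq)
 moreover have "g (x + 2 * pi * of_int n) = g x + 2 * pi * of_int n" by (rule shift_2pi_iterate) (rule geq)
 ultimately show ?thesis by simp
qed

lemma g_window_le: "v > 0 ==> g (u + v) - g (u - v) <= 2 * v + 2 * pi"
 using drift_le[OF gc gm geq, of "u + v" "u - v"] by linarith

definition Psi_inv :: "complex => complex" where "Psi_inv = inv_into (cball 0 1) (Psi g)"

lemma Psi_inv_left: "z \<in> cball 0 1 ==> Psi_inv (Psi g z) = z"
 unfolding Psi_inv_def using Psi_inj[OF gc gm geq] by simp

lemma Psi_inv_right: "z \<in> cball 0 1 ==> Psi g (Psi_inv z) = z" "z \<in> cball 0 1 ==> Psi_inv z \<in> cball 0 1"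
 unfolding Psi_inv_def using Psi_image(2)[OF gc gm geq] by (metis f_inv_into_f, metis inv_into_into)

lemma Psi_inv_cont: "continuous_on (cball 0 1) Psi_inv"
proof -
 have "continuous_on (Psi g ` cball 0 1) Psi_inv"
  by (rule continuous_on_inv[OF Psi_cont[OF gc gm geq] compact_cball]) (use Psi_inv_left in auto)
 thus ?thesis by (simp add: Psi_image(2)[OF gc gm geq])
qed

lemma Psi_inv_image: "Psi_inv ` cball 0 1 = cball 0 1" "Psi_inv ` ball 0 1 = ball 0 1" "inj_on Psi_inv (cball 0 1)"
proof -
 show "inj_on Psi_inv (cball 0 1)" by (metis Psi_inv_right(1) inj_onI)
 show "Psi_inv ` cball 0 1 = cball 0 1"
 proof
  show "cball 0 1 \<subseteq> Psi_inv ` cball 0 1"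
  proof
   fix x :: complex assume x: "x \<in> cball 0 1"
   hence "Psi g x \<in> cball 0 1" using Psi_image(2)[OF gc gm geq] by blast
   thus "x \<in> Psi_inv ` cball 0 1" using Psi_inv_left[OF x] by (metis imageI)
  qed
 qed (use Psi_inv_right(2) in blast)
 have e: "Psi_inv ` ball 0 1 = Psi_inv ` (Psi g ` ball 0 1)" by (simp add: Psi_image(1)[OF gc gm geq])
 also have "... = ball 0 1"
  unfolding image_image using Psi_inv_left by (simp add: image_cong[of "ball 0 1" "ball 0 1" "%x. Psi_inv (Psi g x)" "%x. x"] ball_subset_cball[THEN subsetD])
 finally show "Psi_inv ` ball 0 1 = ball 0 1" .
qed

lemma Psi_inv_cis: "Psi_inv (cis (g x)) = cis x"
 using Psi_inv_left[of "cis x"] by (simp add: Psi_cis[OF gc gm geq])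

text \<open>Carries local statements from \<open>w\<close> to the disc: \<open>k\<close> is a branch
  of the logarithm of \<open>Psi_inv\<close> near the given point, and it takes punctured
  neighbourhoods to punctured neighbourhoods.\<close>

lemma Psi_inv_transfer:
 assumes w0: "Im w0 > 0" and Q: "\<forall>\<^sub>F w in at w0. Q w"
 shows "\<forall>\<^sub>F z in at (exp (\<i> * Gmap g w0)). \<exists>w. Q w & z = exp (\<i> * Gmap g w) & Psi_inv z = exp (\<i> * w)"
proof -
 define z0 where "z0 = exp (\<i> * Gmap g w0)"
 define a where "a = exp (\<i> * w0)"
 define k where "k z = w0 - \<i> * Ln (Psi_inv z / a)" for z
 have z0: "z0 \<in> ball 0 1" using Gmap_Im_pos[OF gc gm geq w0] by (simp add: z0_def)
 have a: "a \<in> cball 0 1" "a ~= 0" using w0 by (auto simp: a_def)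
 have Pa: "Psi g a = z0" by (simp add: a_def z0_def Psi_exp[OF gc gm geq])
 have ia: "Psi_inv z0 = a" using Psi_inv_left[OF a(1)] Pa by simp
 have c: "isCont Psi_inv z0"
  using Psi_inv_cont z0 by (intro continuous_on_interior[of "cball 0 1"]) auto
 have "isCont k z0" unfolding k_def using a ia by (intro continuous_intros c) auto
 moreover have "k z0 = w0" using a by (simp add: k_def ia)
 ultimately have lim: "(k \<longlongrightarrow> w0) (at z0)" unfolding isCont_def by simp
 have "\<forall>\<^sub>F z in at z0. z \<in> ball 0 1 - {z0}" using z0 by (intro eventually_at_in_open) auto
 moreover have "\<forall>\<^sub>F z in at z0. Psi_inv z ~= 0"
 proof -
  have "(Psi_inv \<longlongrightarrow> a) (at z0)" using c ia unfolding isCont_def by simp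
  thus ?thesis using a(2) by (rule tendsto_imp_eventually_ne)
 qed
 ultimately have ev: "\<forall>\<^sub>F z in at z0. z \<in> ball 0 1 - {z0} & Psi_inv z ~= 0" by eventually_elim auto
 have ek: "exp (\<i> * k z) = Psi_inv z" if "Psi_inv z ~= 0" for z
 proof -
  have "exp (\<i> * k z) = a * exp (Ln (Psi_inv z / a))" by (simp add: k_def a_def exp_add[symmetric] algebra_simps)
  thus ?thesis using that a(2) by simp
 qed
 have "\<forall>\<^sub>F z in at z0. k z ~= w0" using ev
 proof eventually_elim
  case (elim z)
  show ?case
  proof
   assume "k z = w0"
   hence "Psi_inv z = a" using ek[of z] elim by (simp add: a_def)
   moreover have "Psi g (Psi_inv z) = z" using elim by (intro Psi_inv_right(1)) auto
   ultimately show False using Pa elim by simp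
  qed
 qed
 hence "filterlim k (at w0) (at z0)" using lim by (rule filterlim_atI[rotated])
 hence "\<forall>\<^sub>F z in at z0. Q (k z)" using Q unfolding filterlim_iff by blast
 with ev have "\<forall>\<^sub>F z in at z0. \<exists>w. Q w & z = exp (\<i> * Gmap g w) & Psi_inv z = exp (\<i> * w)"
 proof eventually_elim
  case (elim z)
  have "exp (\<i> * Gmap g (k z)) = Psi g (Psi_inv z)" using ek[of z] elim by (simp flip: Psi_exp[OF gc gm geq])
  also have "... = z" using elim by (intro Psi_inv_right(1)) auto
  finally show ?case using elim ek[of z] by metis
 qed
 thus ?thesis by (simp add: z0_def)
qed

end

section \<open>Normalised curves and the pointwise estimate for the inside\<close>

definition unit_bilip :: "real => (complex => complex) => bool" where
 "unit_bilip kap f \<longleftrightarrow> (\<forall>a\<in>sphere 0 1. \<forall>b\<in>sphere 0 1. norm (a - b) <= norm (f a - f b) & norm (f a - f b) <= kap * norm (a - b))"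

text \<open>\<open>M0\<close> is half the diameter of the curve, which is at least 2 by the images
  of 1 and -1 and at most 2 \<open>kap\<close>.\<close>

lemma unit_bilip_facts:
 assumes f: "unit_bilip kap f"
 shows "kap >= 1" "continuous_on (sphere 0 1) f" "inj_on f (sphere 0 1)"
  "\<exists>M0. 1 <= M0 & M0 <= kap & (\<forall>q\<in>f ` sphere 0 1. f ` sphere 0 1 \<subseteq> cball q (2 * M0) & (\<exists>b\<in>f ` sphere 0 1. norm (q - b) >= M0))"
proof -
 have bl: "norm (a - b) <= norm (f a - f b)" "norm (f a - f b) <= kap * norm (a - b)" if "a \<in> sphere 0 1" "b \<in> sphere 0 1" for a b
  using f that by (auto simp: unit_bilip_def)
 have "norm ((1::complex) - (- 1)) <= norm (f 1 - f (- 1))" "norm (f 1 - f (- 1)) <= kap * norm ((1::complex) - (- 1))"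
  by (rule bl; simp)+
 hence two: "2 <= norm (f 1 - f (- 1))" "norm (f 1 - f (- 1)) <= kap * 2" by simp_all
 thus k: "kap >= 1" by linarith
 have "kap-lipschitz_on (sphere 0 1) f"
  by (rule lipschitz_onI) (use bl(2) k in \<open>auto simp: dist_norm\<close>)
 thus c: "continuous_on (sphere 0 1) f" by (rule lipschitz_on_continuous_on)
 show "inj_on f (sphere 0 1)"
 proof (rule inj_onI)
  fix x y assume "x \<in> sphere 0 1" "y \<in> sphere 0 1" "f x = f y"
  thus "x = y" using bl(1)[of x y] by simp
 qed
 define Gam where "Gam = f ` sphere 0 1"
 have comp: "compact Gam" unfolding Gam_def by (intro compact_continuous_image c compact_sphere)
 define Del where "Del = diameter Gam"
 have dist: "norm (x - y) <= Del" if "x \<in> Gam" "y \<in> Gam" for x y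
  using diameter_bounded_bound[OF compact_imp_bounded[OF comp] that] by (simp add: Del_def dist_norm)
 have "f 1 \<in> Gam" "f (- 1) \<in> Gam" by (auto simp: Gam_def)
 hence Del2: "Del >= 2" using dist two(1) by fastforce
 have ne: "Gam ~= {}" using \<open>f 1 \<in> Gam\<close> by blast
 obtain x y where xy: "x \<in> Gam" "y \<in> Gam" "norm (x - y) = Del"
  using diameter_compact_attained[OF comp ne] by (auto simp: Del_def dist_norm)
 obtain s t where st: "s \<in> sphere 0 1" "t \<in> sphere 0 1" "x = f s" "y = f t" using xy by (auto simp: Gam_def)
 have "norm (s - t) <= 2" using norm_triangle_ineq4[of s t] st by simp
 hence "kap * norm (s - t) <= kap * 2" using k by (intro mult_left_mono) auto
 hence Delk: "Del <= kap * 2" using bl(2)[OF st(1,2)] xy(3) st by simp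
 have far: "\<exists>b\<in>Gam. norm (q - b) >= Del / 2" for q
 proof (rule ccontr)
  assume "\<not> ?thesis"
  hence "norm (q - x) < Del / 2" "norm (q - y) < Del / 2" using xy by (auto simp: not_le)
  moreover have "norm (x - y) <= norm (q - x) + norm (q - y)" using norm_triangle_ineq4[of "q - y" "q - x"] by simp
  ultimately show False using xy(3) by simp
 qed
 have "f ` sphere 0 1 \<subseteq> cball q (2 * (Del / 2))" if "q \<in> f ` sphere 0 1" for q
  using dist[of q] that by (auto simp: Gam_def dist_norm)
 thus "\<exists>M0. 1 <= M0 & M0 <= kap & (\<forall>q\<in>f ` sphere 0 1. f ` sphere 0 1 \<subseteq> cball q (2 * M0) & (\<exists>b\<in>f ` sphere 0 1. norm (q - b) >= M0))"
  using Del2 Delk far unfolding Gam_def by (intro exI[of _ "Del / 2"]) auto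
qed

lemma arctan_view_inner': "arctan (- 1/10) - arctan (- 8/10) >= pi / real 6"
 using arctan_view_inner arctan_minus[of "1/10"] arctan_minus[of "8/10"] by simp

context curve_side
begin

lemma increments_long:
 assumes v: "Im w >= 9"
 shows "g (Re w + Im w * (8/10)) - g (Re w + Im w * (1/10)) >= 35/100 * Im w"
  "g (Re w + Im w * (- 1/10)) - g (Re w + Im w * (- 8/10)) >= 35/100 * Im w"
proof -
 have t: "2 * pi <= 7/10 * Im w" using v pi_approx by simp
 have e: "Re w + Im w * (1/10) + 7/10 * Im w = Re w + Im w * (8/10)"
  "Re w + Im w * (- 8/10) + 7/10 * Im w = Re w + Im w * (- 1/10)" by simp_all
 show "g (Re w + Im w * (8/10)) - g (Re w + Im w * (1/10)) >= 35/100 * Im w"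
  using g_increment_ge[OF t, of "Re w + Im w * (1/10)"] unfolding e by simp
 show "g (Re w + Im w * (- 1/10)) - g (Re w + Im w * (- 8/10)) >= 35/100 * Im w"
  using g_increment_ge[OF t, of "Re w + Im w * (- 8/10)"] unfolding e by simp
qed

lemma increments_short:
 assumes w: "Im w > 0" and k: "kap > 0"
 shows "g (Re w + Im w * (8/10)) - g (Re w + Im w * (1/10)) >= 3 / (4 * 10 ^ 12) * min (d w) M0 / kap"
  "g (Re w + Im w * (- 1/10)) - g (Re w + Im w * (- 8/10)) >= 3 / (4 * 10 ^ 12) * min (d w) M0 / kap"
 using arc_length_lower[OF w arctan_view_inner] arc_length_lower[OF w arctan_view_inner'] k
 by (simp_all add: field_simps)

text \<open>|Phi'| sinh v is comparable to d w by \<open>deriv_upper\<close> and \<open>Dl\<close>.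
  The remaining factors are the increments of \<open>g\<close> and the change of modulus under
  \<open>Psi\<close>, which is at most 20000. Large heights are treated apart: there
  \<open>g\<close> increases like the identity, and \<open>dmin\<close> bounds d w from
  below.\<close>

lemma interior_pointwise:
 assumes k: "kap >= 1" and M: "M0 <= kap" and w: "Im w > 0" and dM: "d w <= 2 * M0"
  and D: "(Phi has_field_derivative D) (at w)" and Dl: "norm D * (2 * sinh (Im w)) >= d w"
  and half: "!!al. \<exists>x\<in>{al..al + pi}. norm (gam x - gam al) >= 4 / 10 ^ 13"
  and dmin: "Im w >= 4/10 ==> d w >= 1 / 10 ^ 16"
 shows "\<forall>\<^sub>F z in at w. norm (Phi z - Phi w) <= 9 * 10 ^ 27 * kap * norm (Z 1 z - Z 1 w)"
  "\<forall>\<^sub>F z in at w. norm (Z 1 z - Z 1 w) <= 9 * 10 ^ 24 * kap * norm (Phi z - Phi w)"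
proof -
 define v where "v = Im w"
 define S where "S = sinh v"
 have v: "v > 0" using w by (simp add: v_def)
 have S: "S > 0" using v by (simp add: S_def)
 have d0: "d w > 0" by (rule d_pos[OF w])
 have Du: "norm D * (2 * S) <= 114 * d w"
 proof -
  have "norm D * (2 * S) <= 38 * d w * (1 + d w / M0)" using deriv_upper[OF w D] by (simp add: S_def v_def)
  also have "... <= 38 * d w * 3" using dM M0 d0 by (intro mult_left_mono) (auto simp: divide_le_eq)
  finally show ?thesis by simp
 qed
 hence "norm D * S < 60 * d w" using d0 by linarith
 hence DK: "norm D < 60 * d w / S" using S by (simp add: less_divide_eq)
 have "v * exp v <= (1 + 2 * v) * S" unfolding S_def by (rule mult_exp_le_sinh) (use v in simp)
 hence "v * exp v / S <= 1 + 2 * v" using S by (simp add: divide_le_eq)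
 hence ve: "60 * d w * 20000 * (v * exp v / S) <= 60 * d w * 20000 * (1 + 2 * v)" using d0 by (intro mult_left_mono) auto
 have "60 * d w / S * exp (Im (Gmap g w)) * v <= 60 * d w / S * (20000 * exp v) * v"
  using exp_Im_bounds(1)[OF w] d0 S v by (intro mult_right_mono mult_left_mono) (auto simp: v_def)
 hence lhs: "60 * d w / S * exp (1 * Im (Gmap g w)) * v <= 1200000 * d w * (1 + 2 * v)" using ve by (simp add: field_simps)
 show "\<forall>\<^sub>F z in at w. norm (Phi z - Phi w) <= 9 * 10 ^ 27 * kap * norm (Z 1 z - Z 1 w)"
 \<comment> \<open>From height 9 on a subwindow covers a full period, since 7/10 * 9 > 2 pi; its
   increment is then comparable to v.\<close>
 proof (cases "v >= 9")
  case True
  show ?thesis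
  proof (rule pointwise_upper[OF w _ _ increments_long D DK, of 1])
   have "d w <= 2 * kap" using dM M by linarith
   hence "1200000 * d w * (1 + 2 * v) <= 1200000 * (2 * kap) * (3 * v)" using d0 True by (intro mult_mono) auto
   also have "... <= 9 * 10 ^ 27 * kap * (35/100000 * (35/100 * v))" using k v by simp
   finally show "60 * d w / S * exp (1 * Im (Gmap g w)) * Im w <= 9 * 10 ^ 27 * kap * (35/100000 * (35/100 * Im w))"
    using lhs by (simp add: v_def)
  qed (use True v in \<open>auto simp: v_def\<close>)
 next
  case False
  define eta where "eta = 3 / (8 * 10 ^ 12) * d w / kap"
  define m where "m = min (d w) M0"
  have "d w / 2 <= m" using dM d0 by (simp add: m_def)
  hence "3 / (8 * 10 ^ 12) * d w <= 3 / (4 * 10 ^ 12) * m" by simp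
  hence "eta <= 3 / (4 * 10 ^ 12) * min (d w) M0 / kap" unfolding eta_def m_def using k by (intro divide_right_mono) auto
  hence inc: "g (Re w + Im w * (8/10)) - g (Re w + Im w * (1/10)) >= eta"
   "g (Re w + Im w * (- 1/10)) - g (Re w + Im w * (- 8/10)) >= eta" using increments_short[OF w] k by force+
  show ?thesis
  proof (rule pointwise_upper[OF w _ _ inc D DK, of 1])
   have "1200000 * d w * (1 + 2 * v) <= 1200000 * d w * 19" using d0 False by (intro mult_left_mono) auto
   also have "... <= 9 * 10 ^ 27 * (35/100000 * (3 / (8 * 10 ^ 12) * d w))" using d0 by simp
   also have "... = 9 * 10 ^ 27 * kap * (35/100000 * eta)" using k by (simp add: eta_def)
   finally show "60 * d w / S * exp (1 * Im (Gmap g w)) * Im w <= 9 * 10 ^ 27 * kap * (35/100000 * eta)"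
    using lhs by (simp add: v_def)
  qed (use d0 k in \<open>auto simp: eta_def\<close>)
 qed
 have K: "d w / (4 * S) < norm D"
 proof -
  have "d w <= norm D * (2 * S)" using Dl by (simp add: S_def v_def)
  hence "d w < norm D * (4 * S)" using d0 by linarith
  thus ?thesis using S by (simp add: divide_less_eq)
 qed
 show "\<forall>\<^sub>F z in at w. norm (Z 1 z - Z 1 w) <= 9 * 10 ^ 24 * kap * norm (Phi z - Phi w)"
 proof (rule pointwise_lower[OF w _ D K])
  define Lam where "Lam = g (Re w + Im w) - g (Re w - Im w)"
  have Lam: "Lam > 0" unfolding Lam_def using gm w by (simp add: strict_mono_less)
  show "exp (- 1 * Im (Gmap g w)) * (20 * (g (Re w + Im w) - g (Re w - Im w))) <= 9 * 10 ^ 24 * kap * (d w / (4 * S) * Im w)"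
  \<comment> \<open>The first case decides the constant of the inverse: 12 * 20 * 13432 * 10^18 is
    about 3.2 * 10^24.\<close>
  proof (cases "v <= 4/10")
   case True
   have "Lam <= (8 + 29 * kap / (4 / 10 ^ 13)) * (3 * ((3 + 5 ^ 6) / 2)^2 * d w)"
    unfolding Lam_def by (rule window_length_upper[OF w _ _ half]) (use True in \<open>auto simp: v_def\<close>)
   also have "... <= (73 * 10 ^ 12 * kap) * (184 * 10 ^ 6 * d w)"
   proof (rule mult_mono)
    show "8 + 29 * kap / (4 / 10 ^ 13) <= 73 * 10 ^ 12 * kap" using k by simp
    show "3 * ((3 + 5 ^ 6) / 2)^2 * d w <= 184 * 10 ^ 6 * d w"
     using d0 by (intro mult_right_mono) (auto simp: power2_eq_square)
   qed (use k d0 in auto)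
   finally have 1: "Lam <= 13432 * 10 ^ 18 * kap * d w" by simp
   have "exp v <= exp (real 1)" using True by simp
   also have "... <= 3 ^ 1" by (rule exp_nat_le)
   finally have "exp v <= 3" by simp
   hence "v * exp v <= v * 3" using v by (intro mult_left_mono) auto
   moreover have "S <= v * exp v" unfolding S_def by (rule sinh_le_mult_exp) (use v in simp)
   ultimately have "S <= 3 * v" by simp
   hence "d w * S <= d w * (3 * v)" using d0 by (intro mult_left_mono) auto
   hence "d w / 12 * (4 * S) <= d w * v" by (simp add: mult_ac)
   moreover have "4 * S > 0" using S by simp
   ultimately have "d w / 12 <= d w * v / (4 * S)" by (simp only: pos_le_divide_eq)
   hence "d w / 12 <= d w / (4 * S) * v" by (simp only: times_divide_eq_left)
   hence 2: "9 * 10 ^ 24 * kap * (d w / 12) <= 9 * 10 ^ 24 * kap * (d w / (4 * S) * v)" using k by (intro mult_left_mono) auto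
   have "exp (- 1 * Im (Gmap g w)) * (20 * Lam) <= 1 * (20 * Lam)"
    using exp_Im_bounds(3)[OF w] Lam by (intro mult_right_mono) auto
   also have "... <= 20 * (13432 * 10 ^ 18 * kap * d w)" using 1 by simp
   also have "... <= 9 * 10 ^ 24 * kap * (d w / 12)" using k d0 by simp
   finally show ?thesis using 2 by (simp add: Lam_def v_def)
  next
   case False
   have L: "Lam <= 18 * v" unfolding Lam_def using g_window_le[OF w, of "Re w"] False pi_approx by (simp add: v_def)
   have dm: "d w >= 1 / 10 ^ 16" using dmin False by (simp add: v_def)
   have "2 * S <= exp v" by (simp add: S_def sinh_field_def)
   hence "exp (- v) * (2 * S) <= exp (- v) * exp v" by (intro mult_left_mono) auto
   hence "exp (- v) * (2 * S) <= 1" by (simp add: mult_exp_exp)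
   hence "exp (- v) / 2 <= 1 / (4 * S)" using S by (simp add: field_simps)
   hence "(1 / 10 ^ 16) * (exp (- v) / 2) <= d w * (1 / (4 * S))"
    using d0 by (intro mult_mono[OF dm]) auto
   hence 3: "(1 / 10 ^ 16) * (exp (- v) / 2) * v <= d w * (1 / (4 * S)) * v"
    by (rule mult_right_mono) (use v in simp)
   have "9 * 10 ^ 24 * 1 <= 9 * 10 ^ 24 * kap" using k by simp
   hence 2: "9 * 10 ^ 24 * 1 * ((1 / 10 ^ 16) * (exp (- v) / 2) * v) <= 9 * 10 ^ 24 * kap * (d w * (1 / (4 * S)) * v)"
    by (rule mult_mono[OF _ 3]) (use k v in simp_all)
   have "exp (- 1 * Im (Gmap g w)) * (20 * Lam) <= (20000 * exp (- v)) * (20 * (18 * v))"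
    using exp_Im_bounds(2)[OF w] L Lam by (intro mult_mono) (auto simp: v_def)
   also have "... <= 9 * 10 ^ 24 * 1 * ((1 / 10 ^ 16) * (exp (- v) / 2) * v)" using v by simp
   finally show ?thesis using 2 by (simp add: Lam_def v_def)
  qed
 qed (use d0 S in auto)
qed

end

lemma conformal_inverse_on:
 assumes ch: "disc_chart phi"
 obtains psi where "psi holomorphic_on phi ` ball 0 1" "!!z. z \<in> ball 0 1 ==> psi (phi z) = z"
proof -
 have "phi holomorphic_on ball 0 1" "inj_on phi (ball 0 1)"
  using ch by (auto simp: disc_chart_def intro: inj_on_subset ball_subset_cball)
 from holomorphic_has_inverse[OF this(1) open_ball this(2)] show ?thesis using that by metis
qed

section \<open>The two sides of the curve\<close>

text \<open>A bound between the single point \<open>z\<close> and its neighbours; the global bounds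
  arise later by following segments.\<close>

definition locally_bilip :: "real => (complex => complex) => complex => bool" where
 "locally_bilip kap H z \<longleftrightarrow> (\<forall>\<^sub>F z' in at z. norm (H z' - H z) <= 9 * 10 ^ 27 * kap * norm (z' - z)) &
   (\<forall>\<^sub>F z' in at z. norm (z' - z) <= 9 * 10 ^ 24 * kap * norm (H z' - H z))"

text \<open>\<open>A\<close> is a closed side of the circle, \<open>B\<close> its interior and
  \<open>U\<close> the side of the curve onto which \<open>B\<close> is mapped. The local bounds
  leave out 0, where the logarithmic coordinate is not defined.\<close>

definition side_map :: "real => (complex => complex) => complex set => complex set => complex set => (complex => complex) => bool" where
 "side_map kap f A B U H \<longleftrightarrow> continuous_on A H & inj_on H A & H ` B = U & (\<forall>z\<in>sphere 0 1. H z = f z) &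
   (\<forall>z\<in>B - {0}. locally_bilip kap H z)"

text \<open>The hypothesis \<open>center\<close> keeps the centre of the chart at a definite
  distance from the curve; this is what yields the two quantitative inputs \<open>half\<close> and
  \<open>dmin\<close> of \<open>interior_pointwise\<close>.\<close>

lemma interior_side_core:
 assumes f: "unit_bilip kap f" and ch: "disc_chart phi"
  and im: "phi ` ball 0 1 = inside (f ` sphere 0 1)"
  and g: "continuous_on UNIV g" "strict_mono g" "!!x. g (x + 2 * pi) = g x + 2 * pi"
  and bdry: "!!x. phi (cis x) = f (cis (g x))"
  and center: "!!q. q \<in> f ` sphere 0 1 ==> norm (phi 0 - q) >= 1 / (3 * ((3 + 5 ^ 6) / 2)^2)"
 shows "\<exists>H. side_map kap f (cball 0 1) (ball 0 1) (inside (f ` sphere 0 1)) H & H 0 = phi 0"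
proof -
 note F = unit_bilip_facts[OF f]
 have bl: "norm (a - b) <= norm (f a - f b)" "norm (f a - f b) <= kap * norm (a - b)" if "a \<in> sphere 0 1" "b \<in> sphere 0 1" for a b
  using f that by (auto simp: unit_bilip_def)
 obtain M0 where MM: "1 <= M0" "M0 <= kap" "!!q. q \<in> f ` sphere 0 1 ==> f ` sphere 0 1 \<subseteq> cball q (2 * M0)"
  "!!q. q \<in> f ` sphere 0 1 ==> \<exists>b\<in>f ` sphere 0 1. norm (q - b) >= M0" using F(4) by metis
 interpret curve_side phi "%x. x" f "%_. 1" g kap M0
 proof
  show "\<exists>D. (phi has_field_derivative D) (at a) & norm D = 1^2 * norm (deriv phi a)" if "a \<in> ball 0 1 - {0}" for a
   using ch that by (intro exI[of _ "deriv phi a"]) (auto simp: disc_chart_def intro!: holomorphic_derivI[OF _ open_ball])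
 qed (use ch g bdry bl MM in auto)
 have Gams: "phi ` sphere 0 1 = f ` sphere 0 1"
 proof
  show "phi ` sphere 0 1 \<subseteq> f ` sphere 0 1"
  proof
   fix x assume "x \<in> phi ` sphere 0 1"
   then obtain t where "x = phi (cis t)" using cis_image_UNIV(1) by (metis imageE)
   thus "x \<in> f ` sphere 0 1" using bdry[of t] gam_in[of t] by simp
  qed
  show "f ` sphere 0 1 \<subseteq> phi ` sphere 0 1" using Gam_point bdry by (metis (no_types, opaque_lifting) imageI mem_sphere_0 norm_cis subsetI)
 qed
 have fr: "frontier (phi ` ball 0 1) \<subseteq> Gam" using inside_curve_facts(4)[OF F(2,3)] im by simp
 obtain psi where psi: "psi holomorphic_on phi ` ball 0 1" "!!z. z \<in> ball 0 1 ==> psi (phi z) = z" using conformal_inverse_on[OF ch] by metis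
 have Phiin: "Phi w \<in> phi ` ball 0 1" if "Im w > 0" for w using exp_in(1)[OF that] by (auto simp: Phi_def)
 have dball: "ball (Phi w) (d w) \<subseteq> phi ` ball 0 1" if w: "Im w > 0" for w
 proof (rule connected_avoiding_frontier_subset[OF connected_ball _ fr])
  show "ball (Phi w) (d w) \<inter> Gam = {}" using d_le[of _ w] by (force simp: dist_norm)
  show "ball (Phi w) (d w) \<inter> phi ` ball 0 1 ~= {}" using Phiin[OF w] d_pos[OF w] by (metis IntI centre_in_ball empty_iff)
 qed
 have d2: "d w <= 2 * M0" if w: "Im w > 0" for w
 proof -
  obtain q where q: "q \<in> Gam" "d w = norm (Phi w - q)" using nearest by blast
  have "Phi w \<in> cball q (2 * M0)" using inside_subset_cball[OF MM(3)[OF q(1)]] Phiin[OF w] im by auto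
  thus ?thesis using q(2) by (simp add: dist_norm norm_minus_commute)
 qed
 \<comment> \<open>Spread estimate at the centre for a half-circle, n = 2. With e >= 5 / 10^9 and r
   >= 1, a value below 4 / 10^13 contradicts it.\<close>
 have half: "\<exists>x\<in>{al..al + pi}. norm (gam x - gam al) >= 4 / 10 ^ 13" for al
 proof -
  define q where "q = gam al"
  have q: "q \<in> Gam" by (simp add: q_def)
  obtain b where b: "b \<in> Gam" "norm (q - b) >= M0" using MM(4)[OF q] by blast
  have ne: "q ~= b" using b MM(1) by auto
  have "\<exists>x\<in>{al..al + pi}. norm (phi (cis x) - q) * norm (phi 0 - b) > (3 / 100 ^ 2) * norm (phi (cis x) - b) * norm (q - phi 0)"
   by (rule disc_chart_arc_spread[OF ch]) (use b q ne Gams in auto)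
  then obtain x where x: "x \<in> {al..al + pi}"
   "norm (gam x - q) * norm (phi 0 - b) > (3 / 100 ^ 2) * norm (gam x - b) * norm (q - phi 0)" by (auto simp: bdry)
  define ta r e where "ta = norm (gam x - q)" and "r = norm (q - b)" and "e = norm (q - phi 0)"
  have e: "e >= 5 / 10 ^ 9" using center[OF q] by (simp add: e_def norm_minus_commute power2_eq_square)
  have r: "r >= 1" using b MM by (simp add: r_def)
  have rt: "norm (gam x - b) >= r - ta" unfolding r_def ta_def using norm_triangle_ineq[of "q - gam x" "gam x - b"] by (simp add: norm_minus_commute)
  have pe: "norm (phi 0 - b) <= e + r" unfolding e_def r_def using norm_triangle_ineq[of "phi 0 - q" "q - b"] by (simp add: norm_minus_commute)
  have "ta >= 4 / 10 ^ 13"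
  proof (rule ccontr)
   assume "\<not> ?thesis"
   hence ta: "ta < 4 / 10 ^ 13" by simp
   have "r - ta >= 99/100 * r" using ta r by simp
   hence "3 / 100 ^ 2 * (99/100 * r) * e <= 3 / 100 ^ 2 * norm (gam x - b) * e"
    using rt e by (intro mult_right_mono mult_left_mono) auto
   also have "... < ta * norm (phi 0 - b)" using x(2) by (simp add: ta_def e_def)
   also have "... <= ta * (e + r)" using pe by (intro mult_left_mono) (auto simp: ta_def)
   also have "... <= 4 / 10 ^ 13 * (e + r)" using ta e r by (intro mult_right_mono) auto
   finally have A: "3 / 100 ^ 2 * (99/100 * r) * e < 4 / 10 ^ 13 * (e + r)" .
   have "e * 1 <= e * r" using r e by (intro mult_left_mono) auto
   moreover have "r * (5 / 10 ^ 9) <= r * e" using r e by (intro mult_left_mono) auto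
   moreover have "0 < r * e" using r e by simp
   ultimately show False using A by (simp add: field_simps)
  qed
  thus ?thesis using x(1) by (auto simp: ta_def q_def)
 qed
 \<comment> \<open>By the growth estimate |phi 0 - Phi w| <= 21 * 10^6 d w; as the centre is at
   least 5 / 10^9 away from the curve, d w cannot be below 10^(-16).\<close>
 have dmin: "d w >= 1 / 10 ^ 16" if w: "Im w >= 4/10" for w
 proof -
  have w0: "Im w > 0" using w by simp
  define a where "a = exp (\<i> * w)"
  obtain q where q: "q \<in> Gam" "d w = norm (Phi w - q)" using nearest by blast
  obtain b where b: "b \<in> Gam" "norm (q - b) >= M0" using MM(4)[OF q(1)] by blast
  define r D0 where "r = norm (q - b)" and "D0 = norm (phi 0 - phi a)"
  have r: "r >= M0" "r >= 1" using b MM by (auto simp: r_def)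
  have dq: "norm (phi 0 - q) <= D0 + d w"
   using norm_triangle_ineq[of "phi 0 - phi a" "phi a - q"] by (simp add: D0_def q(2) Phi_def a_def)
  have "norm a = exp (- Im w)" by (simp add: a_def)
  also have "... <= exp (- (4/10))" using w by simp
  also have "... <= 6704/10000" by (rule exp_minus_two_fifths)
  finally have "D0 * r <= 3 * 10 ^ 6 * norm (phi 0 - b) * d w"
   using disc_chart_growth_large_at[OF ch, of a b q] b q Gams by (simp add: D0_def r_def Phi_def a_def)
  moreover have "norm (phi 0 - b) <= D0 + d w + r"
  proof -
   have "phi 0 - b = (phi 0 - phi a) + (phi a - q) + (q - b)" by simp
   thus ?thesis unfolding D0_def r_def q(2) using norm_triangle_ineq[of "(phi 0 - phi a) + (phi a - q)" "q - b"] norm_triangle_ineq[of "phi 0 - phi a" "phi a - q"]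
    by (simp add: Phi_def a_def)
  qed
  moreover have "D0 <= 4 * M0"
  proof -
   have "phi 0 \<in> inside Gam" using im by (metis centre_in_ball imageI zero_less_one)
   hence "phi 0 \<in> cball q (2 * M0)" using inside_subset_cball[OF MM(3)[OF q(1)]] by blast
   hence "norm (phi 0 - q) <= 2 * M0" by (simp add: dist_norm norm_minus_commute)
   moreover have "D0 <= norm (phi 0 - q) + d w"
    using norm_triangle_ineq4[of "phi 0 - q" "phi a - q"] by (simp add: D0_def q(2) Phi_def a_def)
   ultimately show ?thesis using d2[OF w0] by simp
  qed
  ultimately have n: "norm (phi 0 - b) <= 7 * r" "D0 * r <= 3 * 10 ^ 6 * norm (phi 0 - b) * d w"
   using d2[OF w0] r by linarith+
  have "3 * 10 ^ 6 * norm (phi 0 - b) * d w <= 3 * 10 ^ 6 * (7 * r) * d w"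
   using d_pos[OF w0] by (intro mult_right_mono mult_left_mono n(1)) auto
  hence "D0 * r <= 3 * 10 ^ 6 * (7 * r) * d w" using n(2) by linarith
  hence "D0 * r <= (21 * 10 ^ 6 * d w) * r" by (simp add: mult_ac)
  moreover have "r > 0" using r by linarith
  ultimately have "D0 <= 21 * 10 ^ 6 * d w" by (rule mult_right_le_imp_le)
  moreover have "5 / 10 ^ 9 <= norm (phi 0 - q)"
   using center[OF q(1)] by (rule order_trans[rotated]) (simp add: power2_eq_square)
  ultimately show ?thesis using dq d_pos[OF w0] by simp
 qed
 define H where "H z = phi (Psi_inv z)" for z
 have phic: "continuous_on (cball 0 1) phi" "inj_on phi (cball 0 1)" using ch by (auto simp: disc_chart_def)
 have Hc: "continuous_on (cball 0 1) H" unfolding H_def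
  by (rule continuous_on_compose2[OF phic(1) Psi_inv_cont]) (simp add: Psi_inv_image)
 have Hi: "inj_on H (cball 0 1)" unfolding H_def
  using comp_inj_on[of Psi_inv "cball 0 1" phi] phic(2) Psi_inv_image by (simp add: comp_def)
 have "H ` ball 0 1 = phi ` (Psi_inv ` ball 0 1)" unfolding H_def by blast
 hence Hb: "H ` ball 0 1 = inside Gam" by (simp only: Psi_inv_image(2) im)
 have Hs: "H z = f z" if z: "z \<in> sphere 0 1" for z
 proof -
  have "z \<in> range cis" using z cis_image_UNIV(1) by simp
  then obtain t where t: "z = cis t" by blast
  obtain x where x: "g x = t" using g_surj by blast
  have "H z = phi (cis x)" unfolding H_def t x[symmetric] Psi_inv_cis ..
  thus ?thesis unfolding bdry t x .
 qed
 have H0: "H 0 = phi 0" using Psi_inv_left[of 0] by (simp add: H_def Psi_def)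
 have pt: "locally_bilip kap H z" if z: "z \<in> ball 0 1 - {0}" for z
 proof -
  have "Psi_inv z \<in> ball 0 1" using Psi_inv_image(2) z by blast
  moreover have "Psi_inv z ~= 0" using Psi_inv_right(1)[of z] z by (auto simp: Psi_def)
  ultimately obtain w where w: "Psi_inv z = exp (\<i> * w)" "Im w >= 0" using exp_preimage[of "Psi_inv z"] by auto
  have wp: "Im w > 0" using w \<open>Psi_inv z \<in> ball 0 1\<close> by auto
  have zw: "z = exp (\<i> * Gmap g w)" using Psi_inv_right(1)[of z] z w by (simp flip: Psi_exp[OF g])
  have Pw: "Psi_inv (exp (\<i> * Gmap g w)) = exp (\<i> * w)" using w(1) zw by simp
  have HZ: "H z = Phi w" "z = Z 1 w" using w zw by (auto simp: H_def Phi_def Z_def)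
  obtain D where D: "(Phi has_field_derivative D) (at w)" using Phi_deriv[OF wp] by metis
  have Dl: "norm D * (2 * sinh (Im w)) >= d w"
  proof (rule deriv_lower[OF wp D])
   show "psi holomorphic_on ball (Phi w) (d w)" using psi(1) dball[OF wp] by (rule holomorphic_on_subset)
   show "psi ` ball (Phi w) (d w) \<subseteq> ball 0 1" using dball[OF wp] psi(2) by force
   show "psi (Phi z) = exp (\<i> * z)" if "Im z > 0" for z using psi(2)[of "exp (\<i> * z)"] that by (simp add: Phi_def)
  qed
  have P1: "\<forall>\<^sub>F z in at w. norm (Phi z - Phi w) <= 9 * 10 ^ 27 * kap * norm (Z 1 z - Z 1 w)"
   by (rule interior_pointwise(1)[OF F(1) MM(2) wp d2[OF wp] D Dl half]) (rule dmin)
  have P2: "\<forall>\<^sub>F z in at w. norm (Z 1 z - Z 1 w) <= 9 * 10 ^ 24 * kap * norm (Phi z - Phi w)"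
   by (rule interior_pointwise(2)[OF F(1) MM(2) wp d2[OF wp] D Dl half]) (rule dmin)
  have "\<forall>\<^sub>F z' in at z. norm (H z' - H z) <= 9 * 10 ^ 27 * kap * norm (z' - z)"
   using Psi_inv_transfer[OF wp P1] unfolding zw[symmetric]
   by eventually_elim (auto simp: H_def Phi_def Z_def zw Pw)
  moreover have "\<forall>\<^sub>F z' in at z. norm (z' - z) <= 9 * 10 ^ 24 * kap * norm (H z' - H z)"
   using Psi_inv_transfer[OF wp P2] unfolding zw[symmetric]
   by eventually_elim (auto simp: H_def Phi_def Z_def zw Pw)
  ultimately show ?thesis unfolding locally_bilip_def by blast
 qed
 show ?thesis unfolding side_map_def using Hc Hi Hb Hs H0 pt by (intro exI[of _ H]) blast
qed

lemma sphere_cnj: "cnj ` sphere 0 1 = sphere 0 1"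
proof
 show "sphere 0 1 \<subseteq> cnj ` sphere 0 1"
 proof
  fix z :: complex assume "z \<in> sphere 0 1"
  thus "z \<in> cnj ` sphere 0 1" by (intro image_eqI[of _ _ "cnj z"]) auto
 qed
qed auto

lemma unit_bilip_cnj:
 assumes "unit_bilip kap f"
 shows "unit_bilip kap (%z. f (cnj z))" "(%z. f (cnj z)) ` sphere 0 1 = f ` sphere 0 1"
proof -
 have n: "norm (cnj a - cnj b) = norm (a - b)" for a b by (metis complex_cnj_diff complex_mod_cnj)
 show "unit_bilip kap (%z. f (cnj z))"
  unfolding unit_bilip_def
 proof (intro ballI)
  fix a b :: complex assume "a \<in> sphere 0 1" "b \<in> sphere 0 1"
  hence "cnj a \<in> sphere 0 1" "cnj b \<in> sphere 0 1" by auto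
  thus "norm (a - b) <= norm (f (cnj a) - f (cnj b)) & norm (f (cnj a) - f (cnj b)) <= kap * norm (a - b)"
   using assms n[of a b] unfolding unit_bilip_def by metis
 qed
 show "(%z. f (cnj z)) ` sphere 0 1 = f ` sphere 0 1" by (metis image_image sphere_cnj)
qed

text \<open>A reversed orientation is absorbed by composing \<open>f\<close> with conjugation, so
  that only increasing lifts occur in the side estimates.\<close>

lemma lifted_chart:
 assumes f: "unit_bilip kap f" and p: "p \<in> inside (f ` sphere 0 1)"
 obtains phi g f' where "f' = f | f' = (%z. f (cnj z))" "disc_chart phi" "phi ` ball 0 1 = inside (f ` sphere 0 1)" "phi 0 = p"
  "continuous_on UNIV g" "strict_mono g" "!!x. g (x + 2 * pi) = g x + 2 * pi" "!!x. phi (cis x) = f' (cis (g x))"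
proof -
 note F = unit_bilip_facts[OF f]
 obtain phi where phi: "disc_chart phi" "phi ` ball 0 1 = inside (f ` sphere 0 1)" "phi ` sphere 0 1 = f ` sphere 0 1" "phi 0 = p"
  using jordan_disc_chart[OF F(2,3) p] by metis
 obtain si g where g: "si = 1 | si = - 1" "continuous_on UNIV g" "strict_mono g"
  "!!x. g (x + 2 * pi) = g x + 2 * pi" "!!x. phi (cis x) = f (cis (si * g x))"
  using disc_chart_lift[OF F(2,3) phi(1,3)] by metis
 define f' where "f' = (if si = 1 then f else (%z. f (cnj z)))"
 have "phi (cis x) = f' (cis (g x))" for x using g(1,5) by (auto simp: f'_def cis_cnj)
 thus ?thesis using that[of f' phi g] phi g by (auto simp: f'_def)
qed

text \<open>A chart with arbitrary centre is used to find a point far from the curve; this point is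
  the centre of the chart taken afterwards.\<close>

lemma central_point:
 assumes f: "unit_bilip kap f"
 obtains p where "p \<in> inside (f ` sphere 0 1)" "!!q. q \<in> f ` sphere 0 1 ==> norm (p - q) >= 1 / (3 * ((3 + 5 ^ 6) / 2)^2)"
proof -
 obtain p0 where p0: "p0 \<in> inside (f ` sphere 0 1)" using inside_curve_facts(1)[OF unit_bilip_facts(2,3)[OF f]] by blast
 obtain f' phi g where L: "f' = f | f' = (%z. f (cnj z))" "disc_chart phi" "phi ` ball 0 1 = inside (f ` sphere 0 1)" "phi 0 = p0"
  "continuous_on UNIV g" "strict_mono g" "!!x. g (x + 2 * pi) = g x + 2 * pi" "!!x. phi (cis x) = f' (cis (g x))"
  by (rule lifted_chart[OF f p0]) (rule that)
 have f': "unit_bilip kap f'" "f' ` sphere 0 1 = f ` sphere 0 1" using L(1) f unit_bilip_cnj[OF f] by (elim disjE; simp)+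
 have bl: "norm (a - b) <= norm (f' a - f' b)" "norm (f' a - f' b) <= kap * norm (a - b)" if "a \<in> sphere 0 1" "b \<in> sphere 0 1" for a b
  using f'(1) that by (auto simp: unit_bilip_def)
 obtain M0 where MM: "1 <= M0" "!!q. q \<in> f' ` sphere 0 1 ==> \<exists>b\<in>f' ` sphere 0 1. norm (q - b) >= M0"
  using unit_bilip_facts(4)[OF f'(1)] by metis
 interpret curve_side phi "%x. x" f' "%_. 1" g kap M0
 proof
  show "\<exists>D. (phi has_field_derivative D) (at a) & norm D = 1^2 * norm (deriv phi a)" if "a \<in> ball 0 1 - {0}" for a
   using L(2) that by (intro exI[of _ "deriv phi a"]) (auto simp: disc_chart_def intro!: holomorphic_derivI[OF _ open_ball])
 qed (use L bl MM in auto)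
 obtain w where w: "Im w > 0" "d w >= 1 / (3 * ((3 + 5 ^ 6) / 2)^2)" using good_center by blast
 have "Phi w \<in> phi ` ball 0 1" using exp_in(1)[OF w(1)] by (auto simp: Phi_def)
 moreover have "norm (Phi w - q) >= 1 / (3 * ((3 + 5 ^ 6) / 2)^2)" if "q \<in> f ` sphere 0 1" for q
  using d_le[of q w] w(2) that f'(2) by simp
 ultimately show ?thesis using that[of "Phi w"] L(3) by simp
qed

lemma eventually_at_cnj:
 assumes "\<forall>\<^sub>F z' in at (cnj z). P z'"
 shows "\<forall>\<^sub>F z' in at z. P (cnj z')"
proof -
 have "filterlim cnj (at (cnj z)) (at z)"
  by (rule filterlim_atI) (auto intro!: tendsto_intros simp: eventually_at_filter)
 thus ?thesis using assms unfolding filterlim_iff by blast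
qed

text \<open>Undoes the change of orientation by composing the side map with conjugation, which is an
  isometry.\<close>

lemma side_map_of_cnj:
 assumes f': "f' = f | f' = (%z. f (cnj z))" and H: "side_map kap f' A B U H"
  and A: "!!z. cnj z \<in> A \<longleftrightarrow> z \<in> A" and B: "!!z. cnj z \<in> B \<longleftrightarrow> z \<in> B"
 obtains H' where "side_map kap f A B U H'" "H' 0 = H 0"
proof (cases "f' = f")
 case True
 thus ?thesis using that[of H] H by simp
next
 case False
 hence e: "f' = (%z. f (cnj z))" using f' by blast
 have n: "norm (cnj a - cnj b) = norm (a - b)" for a b by (metis complex_cnj_diff complex_mod_cnj)
 have "cnj ` B = B"
 proof
  show "B \<subseteq> cnj ` B"
  proof
   fix z assume "z \<in> B"
   thus "z \<in> cnj ` B" using B[of z] by (intro image_eqI[of _ _ "cnj z"]) simp_all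
  qed
 qed (use B in blast)
 hence im: "(%z. H (cnj z)) ` B = U" using H unfolding image_image[symmetric, of H cnj] side_map_def by simp
 have c: "continuous_on A (%z. H (cnj z))"
  by (rule continuous_on_compose2[of A H]) (use H A in \<open>auto intro!: continuous_intros simp: side_map_def\<close>)
 have i: "inj_on (%z. H (cnj z)) A"
 proof (rule inj_onI)
  fix x y assume "x \<in> A" "y \<in> A" "H (cnj x) = H (cnj y)"
  hence "cnj x = cnj y" using inj_onD[of H A "cnj x" "cnj y"] H A unfolding side_map_def by simp
  thus "x = y" by simp
 qed
 have v: "H (cnj z) = f z" if "z \<in> sphere 0 1" for z
 proof -
  have "H (cnj z) = f' (cnj z)" using H that unfolding side_map_def by simp
  thus ?thesis by (simp add: e)
 qed
 have l: "locally_bilip kap (%z. H (cnj z)) z" if "z \<in> B - {0}" for z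
 proof -
  have "locally_bilip kap H (cnj z)" using H B[of z] that unfolding side_map_def by simp
  hence "\<forall>\<^sub>F z' in at (cnj z). norm (H z' - H (cnj z)) <= 9 * 10 ^ 27 * kap * norm (z' - cnj z)"
   "\<forall>\<^sub>F z' in at (cnj z). norm (z' - cnj z) <= 9 * 10 ^ 24 * kap * norm (H z' - H (cnj z))" unfolding locally_bilip_def by blast+
  thus ?thesis unfolding locally_bilip_def by (intro conjI) (drule eventually_at_cnj, simp only: n)+
 qed
 show ?thesis by (rule that[of "%z. H (cnj z)"]) (use c i im v l in \<open>auto simp: side_map_def\<close>)
qed

lemma interior_side:
 assumes f: "unit_bilip kap f" and p: "p \<in> inside (f ` sphere 0 1)"
  "!!q. q \<in> f ` sphere 0 1 ==> norm (p - q) >= 1 / (3 * ((3 + 5 ^ 6) / 2)^2)"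
 obtains H where "side_map kap f (cball 0 1) (ball 0 1) (inside (f ` sphere 0 1)) H" "H 0 = p"
proof -
 obtain f' phi g where L: "f' = f | f' = (%z. f (cnj z))" "disc_chart phi" "phi ` ball 0 1 = inside (f ` sphere 0 1)" "phi 0 = p"
  "continuous_on UNIV g" "strict_mono g" "!!x. g (x + 2 * pi) = g x + 2 * pi" "!!x. phi (cis x) = f' (cis (g x))"
  by (rule lifted_chart[OF f p(1)]) (rule that)
 have f': "unit_bilip kap f'" "f' ` sphere 0 1 = f ` sphere 0 1" using L(1) f unit_bilip_cnj[OF f] by (elim disjE; simp)+
 have im: "phi ` ball 0 1 = inside (f' ` sphere 0 1)" using L(3) f'(2) by simp
 have ce: "norm (phi 0 - q) >= 1 / (3 * ((3 + 5 ^ 6) / 2)^2)" if "q \<in> f' ` sphere 0 1" for q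
  using p(2)[of q] that f'(2) L(4) by simp
 obtain H where H: "side_map kap f' (cball 0 1) (ball 0 1) (inside (f ` sphere 0 1)) H" "H 0 = p"
  using interior_side_core[OF f'(1) L(2) im L(5-8) ce] unfolding f'(2) L(4) by blast
 obtain H' where "side_map kap f (cball 0 1) (ball 0 1) (inside (f ` sphere 0 1)) H'" "H' 0 = H 0"
  by (rule side_map_of_cnj[OF L(1) H(1)]) simp_all
 thus ?thesis using that[of H'] H(2) by simp
qed

section \<open>The outside: pointwise estimate and inverted chart\<close>

lemma exp_five_le: "exp (- 5) <= (1 / 128 :: real)" "exp (5 :: real) <= 243"
proof -
 have "(13/8 :: real) ^ 10 <= exp (1/2) ^ 10"
  using exp_lower_Taylor_quadratic[of "1/2"] by (intro power_mono) (auto simp: power2_eq_square)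
 also have "... = exp 5" by (simp flip: exp_of_nat_mult)
 finally have "128 <= (exp 5 :: real)" by (simp add: power_divide)
 thus "exp (- 5) <= (1 / 128 :: real)" by (simp add: exp_minus field_simps)
 show "exp (5 :: real) <= 243" using exp_nat_le[of 5] by simp
qed

context curve_side
begin

text \<open>As inside, with two changes near infinity. The distance d w may grow like exp (Im w),
  which is offset in the upper bound by the stretching exp (Im (Gmap g w)) of
  \<open>Z (- 1)\<close>. For the inverse bound this stretching must be matched by growth of |Phi'|,
  which is the hypothesis \<open>Dbig\<close>.\<close>

lemma exterior_pointwise:
 assumes k: "kap >= 1" and M: "M0 <= kap" and w: "Im w > 0" and dM: "d w <= 4 * M0 * exp (Im w)"
  and D: "(Phi has_field_derivative D) (at w)" and Dl: "norm D * (2 * sinh (Im w)) >= d w"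
  and half: "!!al. \<exists>x\<in>{al..al + pi}. norm (gam x - gam al) >= 1 / 10 ^ 4"
  and dmin: "Im w >= 4/10 ==> d w >= 1 / (3 * 10 ^ 6)"
  and Dbig: "Im w >= 5 ==> norm D > 6 / 10 ^ 6 * exp (Im w)"
 shows "\<forall>\<^sub>F z in at w. norm (Phi z - Phi w) <= 9 * 10 ^ 27 * kap * norm (Z (- 1) z - Z (- 1) w)"
  "\<forall>\<^sub>F z in at w. norm (Z (- 1) z - Z (- 1) w) <= 9 * 10 ^ 24 * kap * norm (Phi z - Phi w)"
proof -
 define v where "v = Im w"
 define S where "S = sinh v"
 define m where "m = min (d w) M0"
 have v: "v > 0" using w by (simp add: v_def)
 have S: "S > 0" using v by (simp add: S_def)
 have d0: "d w > 0" by (rule d_pos[OF w])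
 have m0: "m > 0" using d0 M0(1) by (simp add: m_def)
 define B where "B = d w * (1 + d w / M0)"
 \<comment> \<open>Compares d (1 + d / M0) with min d M0. For d > M0 the ratio t = d / M0 is at most
   4 exp v, so t (1 + t) <= 32 exp (2 v).\<close>
 have B: "B <= 32 * exp (2 * v) * m"
 proof (cases "d w <= M0")
  case True
  have "1 <= exp (2 * v)" using v by simp
  have "B <= d w * 2" unfolding B_def using True M0(1) d0 by (intro mult_left_mono) (auto simp: divide_le_eq)
  also have "... <= d w * (32 * exp (2 * v))" using \<open>1 <= exp (2 * v)\<close> d0 by (intro mult_left_mono) linarith+
  finally show ?thesis using True by (simp add: m_def mult_ac)
 next
  case False
  define t where "t = d w / M0"
  have t: "1 <= t" "t <= 4 * exp v" using False dM M0(1) by (auto simp: t_def v_def divide_le_eq le_divide_eq mult_ac)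
  have "t * (1 + t) <= (4 * exp v) * (8 * exp v)" using t by (intro mult_mono) auto
  also have "... = 32 * exp (2 * v)" by (simp add: mult_exp_exp)
  finally have "M0 * (t * (1 + t)) <= M0 * (32 * exp (2 * v))" using M0(1) by (intro mult_left_mono) auto
  thus ?thesis using False M0(1) by (simp add: B_def t_def m_def mult_ac)
 qed
 have B0: "B > 0" unfolding B_def using d0 M0(1) by (intro mult_pos_pos add_pos_pos) auto
 have "norm D * (2 * S) <= 38 * B" using deriv_upper[OF w D] by (simp add: S_def v_def B_def mult_ac)
 hence "norm D * S < 20 * B" using B0 by linarith
 hence DK: "norm D < 20 * B / S" using S by (simp add: less_divide_eq)
 have "v * exp v <= (1 + 2 * v) * S" unfolding S_def by (rule mult_exp_le_sinh) (use v in simp)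
 hence vS: "v * exp v / S <= 1 + 2 * v" using S by (simp add: divide_le_eq)
 have lhs: "20 * B / S * exp (- 1 * Im (Gmap g w)) * v <= 12800000 * m * (1 + 2 * v)"
 proof -
  have "20 * B / S * exp (- 1 * Im (Gmap g w)) * v <= 20 * (32 * exp (2 * v) * m) / S * (20000 * exp (- v)) * v"
   using exp_Im_bounds(2)[OF w] B B0 S v m0
   by (intro mult_right_mono mult_mono divide_right_mono mult_left_mono) (auto simp: v_def)
  also have "... = 12800000 * m * (v * (exp (2 * v) * exp (- v)) / S)" by simp
  also have "exp (2 * v) * exp (- v) = exp v" by (simp add: mult_exp_exp)
  also have "12800000 * m * (v * exp v / S) <= 12800000 * m * (1 + 2 * v)" using vS m0 by (intro mult_left_mono) auto
  finally show ?thesis .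
 qed
 show "\<forall>\<^sub>F z in at w. norm (Phi z - Phi w) <= 9 * 10 ^ 27 * kap * norm (Z (- 1) z - Z (- 1) w)"
 proof (cases "v >= 9")
  case True
  show ?thesis
  proof (rule pointwise_upper[OF w _ _ increments_long D DK, of "- 1"])
   have "m <= kap" using M by (simp add: m_def)
   hence "12800000 * m * (1 + 2 * v) <= 12800000 * kap * (3 * v)" using m0 True by (intro mult_mono) auto
   also have "... <= 9 * 10 ^ 27 * kap * (35/100000 * (35/100 * v))" using k v by simp
   finally show "20 * B / S * exp (- 1 * Im (Gmap g w)) * Im w <= 9 * 10 ^ 27 * kap * (35/100000 * (35/100 * Im w))"
    using lhs by (simp add: v_def)
  qed (use True v in \<open>auto simp: v_def\<close>)
 next
  case False
  show ?thesis
  proof (rule pointwise_upper[OF w _ _ increments_short[OF w] D DK, of "- 1"])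
   have "12800000 * m * (1 + 2 * v) <= 12800000 * m * 19" using m0 False by (intro mult_left_mono) auto
   also have "... <= 9 * 10 ^ 27 * (35/100000 * (3 / (4 * 10 ^ 12) * m))" using m0 by simp
   also have "... = 9 * 10 ^ 27 * kap * (35/100000 * (3 / (4 * 10 ^ 12) * m / kap))" using k by simp
   finally show "20 * B / S * exp (- 1 * Im (Gmap g w)) * Im w <= 9 * 10 ^ 27 * kap * (35/100000 * (3 / (4 * 10 ^ 12) * min (d w) M0 / kap))"
    using lhs by (simp only: v_def m_def)
  qed (use m0 k in \<open>auto simp: m_def\<close>)
 qed
 define Lam where "Lam = g (Re w + Im w) - g (Re w - Im w)"
 have Lam: "Lam > 0" unfolding Lam_def using gm w by (simp add: strict_mono_less)
 have K: "d w / (4 * S) < norm D"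
 proof -
  have "d w <= norm D * (2 * S)" using Dl by (simp add: S_def v_def)
  hence "d w < norm D * (4 * S)" using d0 by linarith
  thus ?thesis using S by (simp add: divide_less_eq)
 qed
 show "\<forall>\<^sub>F z in at w. norm (Z (- 1) z - Z (- 1) w) <= 9 * 10 ^ 24 * kap * norm (Phi z - Phi w)"
 proof (cases "v < 5")
  case v5: True
  show ?thesis
  proof (rule pointwise_lower[OF w _ D K])
   show "exp (- (- 1) * Im (Gmap g w)) * (20 * (g (Re w + Im w) - g (Re w - Im w))) <= 9 * 10 ^ 24 * kap * (d w / (4 * S) * Im w)"
   proof (cases "v <= 4/10")
    case True
    have "Lam <= (8 + 29 * kap / (1 / 10 ^ 4)) * (3 * ((3 + 5 ^ 6) / 2)^2 * d w)"
     unfolding Lam_def by (rule window_length_upper[OF w _ _ half]) (use True in \<open>auto simp: v_def\<close>)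
    also have "... <= (3 * 10 ^ 5 * kap) * (184 * 10 ^ 6 * d w)"
    proof (rule mult_mono)
     show "8 + 29 * kap / (1 / 10 ^ 4) <= 3 * 10 ^ 5 * kap" using k by simp
     show "3 * ((3 + 5 ^ 6) / 2)^2 * d w <= 184 * 10 ^ 6 * d w"
      using d0 by (intro mult_right_mono) (auto simp: power2_eq_square)
    qed (use k d0 in auto)
    finally have 1: "Lam <= 552 * 10 ^ 11 * kap * d w" by simp
    have "exp v <= exp (real 1)" using True by simp
    also have "... <= 3 ^ 1" by (rule exp_nat_le)
    finally have e3: "exp v <= 3" by simp
    hence "v * exp v <= v * 3" using v by (intro mult_left_mono) auto
    moreover have "S <= v * exp v" unfolding S_def by (rule sinh_le_mult_exp) (use v in simp)
    ultimately have "S <= 3 * v" by simp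
    hence "d w * S <= d w * (3 * v)" using d0 by (intro mult_left_mono) auto
    hence "d w / 12 * (4 * S) <= d w * v" by (simp add: mult_ac)
    moreover have "4 * S > 0" using S by simp
    ultimately have "d w / 12 <= d w * v / (4 * S)" by (simp only: pos_le_divide_eq)
    hence "d w / 12 <= d w / (4 * S) * v" by (simp only: times_divide_eq_left)
    hence 2: "9 * 10 ^ 24 * kap * (d w / 12) <= 9 * 10 ^ 24 * kap * (d w / (4 * S) * v)" using k by (intro mult_left_mono) auto
    have "exp (Im (Gmap g w)) <= 60000" using exp_Im_bounds(1)[OF w] e3 by (simp add: v_def)
    hence "exp (- (- 1) * Im (Gmap g w)) * (20 * Lam) <= 60000 * (20 * Lam)"
     using Lam by (intro mult_right_mono) auto
    also have "... <= 60000 * (20 * (552 * 10 ^ 11 * kap * d w))" using 1 by simp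
    also have "... <= 9 * 10 ^ 24 * kap * (d w / 12)" using k d0 by simp
    finally show ?thesis using 2 by (simp add: Lam_def v_def)
   next
    case False
    have L: "Lam <= 18 * v" unfolding Lam_def using g_window_le[OF w, of "Re w"] False pi_approx by (simp add: v_def)
    have dm: "d w >= 1 / (3 * 10 ^ 6)" using dmin False by (simp add: v_def)
    have "exp v <= exp 5" using v5 by simp
    hence e5: "exp v <= 243" using exp_five_le(2) by linarith
    have "2 * S <= exp v" by (simp add: S_def sinh_field_def)
    hence S5: "4 * S <= 486" using e5 by linarith
    have "(1 / (3 * 10 ^ 6)) / 486 <= d w / (4 * S)" using S5 dm d0 S by (intro frac_le) auto
    hence 3: "(1 / (3 * 10 ^ 6)) / 486 * v <= d w / (4 * S) * v" by (rule mult_right_mono) (use v in simp)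
    have "9 * 10 ^ 24 * 1 <= 9 * 10 ^ 24 * kap" using k by simp
    hence 2: "9 * 10 ^ 24 * 1 * ((1 / (3 * 10 ^ 6)) / 486 * v) <= 9 * 10 ^ 24 * kap * (d w / (4 * S) * v)"
     by (rule mult_mono[OF _ 3]) (use k v in simp_all)
    have "exp (Im (Gmap g w)) <= 20000 * 243" using exp_Im_bounds(1)[OF w] e5 by (simp add: v_def)
    hence "exp (- (- 1) * Im (Gmap g w)) * (20 * Lam) <= (20000 * 243) * (20 * (18 * v))"
     using L Lam by (intro mult_mono) auto
    also have "... <= 9 * 10 ^ 24 * 1 * ((1 / (3 * 10 ^ 6)) / 486 * v)" using v by simp
    finally show ?thesis using 2 by (simp add: Lam_def v_def)
   qed
  qed (use d0 S in auto)
 next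
  case False
  show ?thesis
  proof (rule pointwise_lower[OF w _ D, of _ "6 / 10 ^ 6 * exp (Im w)"])
   show "6 / 10 ^ 6 * exp (Im w) < norm D" using Dbig False by (simp add: v_def)
   have L: "Lam <= 4 * v" unfolding Lam_def using g_window_le[OF w, of "Re w"] False pi_approx by (simp add: v_def)
   have "exp (- (- 1) * Im (Gmap g w)) * (20 * Lam) <= (20000 * exp v) * (20 * (4 * v))"
    using exp_Im_bounds(1)[OF w] L Lam by (intro mult_mono) (auto simp: v_def)
   also have "... = 1600000 * (exp v * v)" by simp
   also have "... <= 9 * 10 ^ 24 * 6 / 10 ^ 6 * (exp v * v)" using v by (intro mult_right_mono) auto
   also have "... <= kap * (9 * 10 ^ 24 * 6 / 10 ^ 6 * (exp v * v))" using mult_right_mono[OF k, of "9 * 10 ^ 24 * 6 / 10 ^ 6 * (exp v * v)"] v by simp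
   also have "... = 9 * 10 ^ 24 * kap * (6 / 10 ^ 6 * exp v * v)" by simp
   finally show "exp (- (- 1) * Im (Gmap g w)) * (20 * (g (Re w + Im w) - g (Re w - Im w))) <= 9 * 10 ^ 24 * kap * (6 / 10 ^ 6 * exp (Im w) * Im w)"
    by (simp only: Lam_def v_def)
  qed auto
 qed
qed

end

lemma norm_inverse_diff:
 fixes x y :: complex
 assumes "x ~= 0" "y ~= 0"
 shows "norm (1 / x - 1 / y) = norm (x - y) / (norm x * norm y)"
proof -
 have "1 / x - 1 / y = (y - x) / (x * y)" using assms by (simp add: field_simps)
 thus ?thesis by (simp add: norm_divide norm_mult norm_minus_commute)
qed

text \<open>\<open>V\<close> in the proof is the outside in the coordinate 1 / (y - q0), with
  infinity added at 0. It is open and bounded, misses the inverted curve and has its frontier on it;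
  hence it is the inside of the inverted curve, and the chart of a Jordan domain applies.\<close>

lemma exterior_chart:
 fixes h :: "complex => complex"
 assumes h: "continuous_on (sphere 0 1) h" "inj_on h (sphere 0 1)" and q0: "q0 \<in> inside (h ` sphere 0 1)"
 obtains phi and si :: real and g where "disc_chart phi" "phi 0 = 0"
  "!!x. x \<in> phi ` ball 0 1 \<longleftrightarrow> x = 0 | q0 + 1 / x \<in> outside (h ` sphere 0 1)"
  "si = 1 | si = - 1" "continuous_on UNIV g" "strict_mono g"
  "!!x. g (x + 2 * pi) = g x + 2 * pi" "!!x. phi (cis x) = 1 / (h (cis (si * g x)) - q0)"
proof -
 define Gam where "Gam = h ` sphere 0 1"
 define k where "k z = 1 / (h z - q0)" for z
 define Gam' where "Gam' = k ` sphere 0 1"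
 define V where "V = {x. x = 0 | q0 + 1 / x \<in> outside Gam}"
 have q0': "q0 \<notin> Gam" using q0 inside_no_overlap[of Gam] unfolding Gam_def by blast
 have ne: "h z - q0 ~= 0" if "z \<in> sphere 0 1" for z using q0' that by (auto simp: Gam_def)
 have kc: "continuous_on (sphere 0 1) k" unfolding k_def using ne by (intro continuous_intros h) auto
 have ki: "inj_on k (sphere 0 1)"
 proof (rule inj_onI)
  fix x y :: complex assume xy: "x \<in> sphere 0 1" "y \<in> sphere 0 1" "k x = k y"
  hence "h x = h y" using ne by (simp add: k_def)
  thus "x = y" using h(2) xy by (meson inj_onD)
 qed
 have Gamc: "compact Gam" unfolding Gam_def by (intro compact_continuous_image h compact_sphere)
 have oo: "open (outside Gam)" "open (inside Gam)" unfolding Gam_def using inside_curve_facts[OF h] by auto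
 have jc: "isCont (%x. q0 + 1 / x) x" if "x ~= 0" for x :: complex using that by (intro continuous_intros)
 have far: "\<exists>R>0. \<forall>y. norm (y - q0) > R --> y \<in> outside Gam"
 proof -
  have "bounded Gam" using Gamc by (rule compact_imp_bounded)
  then obtain R where R: "R > 0" "Gam \<subseteq> ball q0 R" using bounded_subset_ballD by blast
  hence "Gam \<subseteq> cball q0 R" by auto
  hence "- cball q0 R \<subseteq> outside Gam" by (rule outside_subset_convex[OF convex_cball])
  thus ?thesis using R(1) by (intro exI[of _ R]) (auto simp: dist_norm norm_minus_commute subset_iff)
 qed
 have oV: "open V"
 proof (subst open_subopen, intro ballI)
  fix x assume x: "x \<in> V"
  show "\<exists>T. open T & x \<in> T & T \<subseteq> V"
  proof (cases "x = 0")
   case True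
   obtain R where R: "R > 0" "!!y. norm (y - q0) > R ==> y \<in> outside Gam" using far by blast
   have "ball 0 (1 / R) \<subseteq> V"
   proof
    fix y :: complex assume "y \<in> ball 0 (1 / R)"
    hence "y ~= 0 ==> R < norm (q0 + 1 / y - q0)" using R(1) by (simp add: norm_divide field_simps)
    thus "y \<in> V" using R(2)[of "q0 + 1 / y"] by (auto simp: V_def)
   qed
   thus ?thesis using True R(1) by (intro exI[of _ "ball 0 (1 / R)"]) auto
  next
   case False
   hence "q0 + 1 / x \<in> outside Gam" using x by (simp add: V_def)
   then obtain T where "open T" "x \<in> T" "!!y. y \<in> T ==> q0 + 1 / y \<in> outside Gam"
    using jc[OF False] oo(1) unfolding continuous_at_open by metis
   thus ?thesis by (intro exI[of _ T]) (auto simp: V_def)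
  qed
 qed
 have bV: "bounded V"
 proof -
  obtain e where e: "e > 0" "ball q0 e \<subseteq> inside Gam" using oo(2) q0 by (auto simp: open_contains_ball Gam_def)
  have "norm x <= 1 / e" if "x \<in> V" for x
  proof (cases "x = 0")
   case False
   hence "q0 + 1 / x \<in> outside Gam" using that by (simp add: V_def)
   hence "q0 + 1 / x \<notin> ball q0 e" using e(2) inside_Int_outside[of Gam] by blast
   hence "e <= norm (1 / x)" by (simp add: dist_norm)
   thus ?thesis using False e(1) by (simp add: norm_divide field_simps)
  qed (use e in simp)
  thus ?thesis unfolding bounded_iff by blast
 qed
 have fV: "frontier V \<subseteq> Gam'"
 proof
  fix x assume x: "x \<in> frontier V"
  have xV: "x \<notin> V" "x \<in> closure V" using x oV by (auto simp: frontier_def interior_open)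
  hence x0: "x ~= 0" and xo: "q0 + 1 / x \<notin> outside Gam" by (auto simp: V_def)
  have "q0 + 1 / x \<notin> inside Gam"
  proof
   assume "q0 + 1 / x \<in> inside Gam"
   then obtain T where T: "open T" "x \<in> T" "!!y. y \<in> T ==> q0 + 1 / y \<in> inside Gam"
    using jc[OF x0] oo(2) unfolding continuous_at_open by metis
   have "open (T - {0})" "x \<in> T - {0}" using T x0 by auto
   then obtain y where "y \<in> V" "y \<in> T - {0}" using xV(2) by (meson closure_iff_nhds_not_empty disjoint_iff order_refl)
   hence "q0 + 1 / y \<in> outside Gam" "q0 + 1 / y \<in> inside Gam" using T(3)[of y] by (auto simp: V_def)
   thus False using inside_Int_outside[of Gam] by blast
  qed
  hence "q0 + 1 / x \<in> Gam" using xo by (metis ComplD UnCI inside_Un_outside ComplI UnE)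
  then obtain z where z: "z \<in> sphere 0 1" "q0 + 1 / x = h z" by (auto simp: Gam_def)
  hence "k z = x" using x0 by (simp add: k_def flip: z(2))
  thus "x \<in> Gam'" using z(1) by (auto simp: Gam'_def)
 qed
 have dV: "V \<inter> Gam' = {}"
 proof -
  have "k z \<notin> V" if z: "z \<in> sphere 0 1" for z
  proof -
   have "q0 + 1 / k z = h z" "k z ~= 0" using ne[OF z] by (auto simp: k_def)
   moreover have "h z \<notin> outside Gam" using z outside_no_overlap[of Gam] unfolding Gam_def by blast
   ultimately show ?thesis by (auto simp: V_def)
  qed
  thus ?thesis by (auto simp: Gam'_def)
 qed
 have Vi: "V \<subseteq> inside Gam'"
 proof
  fix x assume x: "x \<in> V"
  hence xn: "x \<notin> Gam'" using dV by auto
  have "connected_component_set (- Gam') x \<subseteq> V"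
  proof (rule connected_avoiding_frontier_subset[OF connected_connected_component _ fV])
   show "connected_component_set (- Gam') x \<inter> Gam' = {}" using connected_component_subset[of "- Gam'" x] by auto
   show "connected_component_set (- Gam') x \<inter> V ~= {}" using x xn connected_component_refl[of x "- Gam'"] by blast
  qed
  thus "x \<in> inside Gam'" using xn bV bounded_subset by (auto simp: inside_def)
 qed
 have "0 \<in> inside (k ` sphere 0 1)" using Vi by (auto simp: V_def Gam'_def)
 from jordan_disc_chart[OF kc ki this]
 obtain phi where phi: "disc_chart phi" "phi ` ball 0 1 = inside Gam'" "phi ` sphere 0 1 = k ` sphere 0 1" "phi 0 = 0"
  unfolding Gam'_def by metis
 have "connected (inside Gam')" unfolding phi(2)[symmetric]
  using phi(1) by (intro connected_continuous_image) (auto simp: disc_chart_def intro: continuous_on_subset)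
 hence "inside Gam' \<subseteq> V"
 proof (rule connected_avoiding_frontier_subset[OF _ _ fV])
  show "inside Gam' \<inter> Gam' = {}" by simp
  show "inside Gam' \<inter> V ~= {}" using Vi by (auto simp: V_def)
 qed
 hence im: "x \<in> phi ` ball 0 1 \<longleftrightarrow> x = 0 | q0 + 1 / x \<in> outside (h ` sphere 0 1)" for x
  using Vi phi(2) by (auto simp: V_def Gam_def)
 obtain si :: real and g where g: "si = 1 | si = - 1" "continuous_on UNIV g" "strict_mono g"
  "!!x. g (x + 2 * pi) = g x + 2 * pi" "!!x. phi (cis x) = k (cis (si * g x))"
  by (rule disc_chart_lift[OF kc ki phi(1,3)]) (rule that)
 show ?thesis by (rule that[OF phi(1,4) im g(1-4)]) (simp add: g(5) k_def)
qed

lemma eventually_at_reflection: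
 fixes z :: complex
 assumes "z ~= 0" "\<forall>\<^sub>F z' in at (1 / cnj z). P z'"
 shows "\<forall>\<^sub>F z' in at z. P (1 / cnj z')"
proof -
 have "filterlim (%z. 1 / cnj z) (at (1 / cnj z)) (at z)"
  by (rule filterlim_atI) (use assms(1) in \<open>auto intro!: tendsto_intros simp: eventually_at_filter\<close>)
 thus ?thesis using assms(2) unfolding filterlim_iff by blast
qed

text \<open>\<open>H\<close> is conjugated by the reflection \<open>z \<mapsto> 1 / cnj z\<close>, which fixes the circle pointwise.\<close>

lemma exterior_side_core:
 assumes f: "unit_bilip kap f" and q0: "q0 \<in> inside (f ` sphere 0 1)" and ch: "disc_chart phi" and phi0: "phi 0 = 0"
  and im: "!!x. x \<in> phi ` ball 0 1 \<longleftrightarrow> x = 0 | q0 + 1 / x \<in> outside (f ` sphere 0 1)"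
  and g: "continuous_on UNIV g" "strict_mono g" "!!x. g (x + 2 * pi) = g x + 2 * pi"
  and bdry: "!!x. phi (cis x) = 1 / (f (cis (g x)) - q0)"
 shows "\<exists>H. side_map kap f (- ball 0 1) (- cball 0 1) (outside (f ` sphere 0 1)) H"
proof -
 note F = unit_bilip_facts[OF f]
 have bl: "norm (a - b) <= norm (f a - f b)" "norm (f a - f b) <= kap * norm (a - b)" if "a \<in> sphere 0 1" "b \<in> sphere 0 1" for a b
  using f that by (auto simp: unit_bilip_def)
 obtain M0 where MM: "1 <= M0" "M0 <= kap" "!!q. q \<in> f ` sphere 0 1 ==> f ` sphere 0 1 \<subseteq> cball q (2 * M0)"
  "!!q. q \<in> f ` sphere 0 1 ==> \<exists>b\<in>f ` sphere 0 1. norm (q - b) >= M0" using F(4) by metis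
 have phic: "continuous_on (cball 0 1) phi" "inj_on phi (cball 0 1)" "phi holomorphic_on ball 0 1" using ch by (auto simp: disc_chart_def)
 have nz: "phi a ~= 0" if "a \<in> cball 0 1 - {0}" for a
  using inj_onD[OF phic(2), of a 0] that phi0 by auto
 have q0n: "q - q0 ~= 0" if "q \<in> f ` sphere 0 1" for q
  using q0 that inside_no_overlap[of "f ` sphere 0 1"] by (metis disjoint_iff eq_iff_diff_eq_0)
 define J where "J x = q0 + 1 / x" for x
 note bdry0 = bdry
 interpret curve_side phi J f "%a. 1 / norm (phi a)" g kap M0
 proof
  show "J (phi (cis x)) = f (cis (g x))" for x by (simp add: J_def bdry)
  show "norm (J (phi a) - J (phi b)) = 1 / norm (phi a) * (1 / norm (phi b)) * norm (phi a - phi b)"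
   if "a \<in> cball 0 1 - {0}" "b \<in> cball 0 1 - {0}" for a b
   using norm_inverse_diff[OF nz[OF that(1)] nz[OF that(2)]] by (simp add: J_def)
  show "\<exists>D. ((%z. J (phi z)) has_field_derivative D) (at a) & norm D = (1 / norm (phi a))^2 * norm (deriv phi a)"
   if a: "a \<in> ball 0 1 - {0}" for a
  proof (intro exI conjI)
   have "(phi has_field_derivative deriv phi a) (at a)" using a by (intro holomorphic_derivI[OF phic(3) open_ball]) auto
   thus "((%z. J (phi z)) has_field_derivative - (deriv phi a / (phi a)^2)) (at a)"
    unfolding J_def using nz[of a] a by (auto intro!: derivative_eq_intros simp: power2_eq_square)
   show "norm (- (deriv phi a / (phi a)^2)) = (1 / norm (phi a))^2 * norm (deriv phi a)"
    by (simp add: norm_divide norm_power power_divide)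
  qed
 qed (use ch g bl MM nz in auto)
 have phiq: "1 / (q - q0) \<in> phi ` sphere 0 1" if q: "q \<in> Gam" for q
 proof -
  obtain x where "q = gam x" using Gam_point[OF q] by blast
  thus ?thesis using bdry0[of x] by (intro image_eqI[of _ _ "cis x"]) auto
 qed
 obtain psi where psi: "psi holomorphic_on phi ` ball 0 1" "!!z. z \<in> ball 0 1 ==> psi (phi z) = z" using conformal_inverse_on[OF ch] by metis
 \<comment> \<open>\<open>qm\<close> is a point of the curve farthest from \<open>q0\<close>.
   Everything beyond its distance \<open>Rm\<close> is outside, so the disc of radius 1 / Rm around
   0 lies in the image of the chart.\<close>
 have "\<exists>qm\<in>Gam. \<forall>q\<in>Gam. norm (q - q0) <= norm (qm - q0)"
  by (rule continuous_attains_sup[OF Gam_compact]) (auto intro!: continuous_intros)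
 then obtain qm where qm: "qm \<in> Gam" "!!q. q \<in> Gam ==> norm (q - q0) <= norm (qm - q0)" by blast
 define Rm where "Rm = norm (qm - q0)"
 have Rm: "Rm <= 2 * M0" "1 / 2 <= Rm"
 proof -
  have "q0 \<in> cball qm (2 * M0)" using inside_subset_cball[OF MM(3)[OF qm(1)]] q0 by blast
  thus "Rm <= 2 * M0" by (simp add: Rm_def dist_norm)
  obtain b where b: "b \<in> Gam" "norm (qm - b) >= M0" using MM(4)[OF qm(1)] by blast
  have "norm (qm - b) <= norm (qm - q0) + norm (b - q0)" using norm_triangle_ineq4[of "qm - q0" "b - q0"] by simp
  thus "1 / 2 <= Rm" using qm(2)[OF b(1)] b(2) MM(1) by (simp add: Rm_def)
 qed
 have out: "y \<in> outside Gam" if "Rm < norm (y - q0)" for y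
 proof -
  have "Gam \<subseteq> cball q0 Rm"
  proof
   fix q assume "q \<in> Gam"
   from qm(2)[OF this] show "q \<in> cball q0 Rm" by (simp add: Rm_def dist_norm norm_minus_commute)
  qed
  hence "- cball q0 Rm \<subseteq> outside Gam" by (rule outside_subset_convex[OF convex_cball])
  thus ?thesis using that by (auto simp: dist_norm norm_minus_commute)
 qed
 have small: "ball 0 (1 / Rm) \<subseteq> phi ` ball 0 1"
 proof
  fix x :: complex assume x: "x \<in> ball 0 (1 / Rm)"
  show "x \<in> phi ` ball 0 1"
  proof (cases "x = 0")
   case False
   hence "Rm < norm (q0 + 1 / x - q0)" using x Rm(2) by (simp add: norm_divide field_simps)
   thus ?thesis using out im by blast
  qed (use im in blast)
 qed
 have psib: "psi ` (phi ` ball 0 1) \<subseteq> ball 0 1" using psi(2) by auto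
 \<comment> \<open>Schwarz lemma for the inverse chart on the disc of radius 1 / Rm; it limits the
   growth of |Phi w - q0| to Rm exp (Im w).\<close>
 have sz: "norm s <= Rm * norm (phi s)" if s: "s \<in> ball 0 1" for s
 proof (cases "norm (phi s) < 1 / Rm")
  case True
  define y where "y = of_real Rm * phi s"
  have R0: "Rm > 0" using Rm by simp
  have sub: "(%z. z / of_real Rm) ` ball 0 1 \<subseteq> ball (0::complex) (1 / Rm)"
   using R0 by (auto simp: norm_divide divide_strict_right_mono)
  have "norm (psi (y / of_real Rm)) <= norm y"
  proof (rule Schwarz_Lemma(1))
   have "psi \<circ> (%z. z / of_real Rm) holomorphic_on ball 0 1"
    by (rule holomorphic_on_compose_gen[OF _ holomorphic_on_subset[OF psi(1) small] sub]) (use R0 in \<open>auto intro!: holomorphic_intros\<close>)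
   thus "(%z. psi (z / of_real Rm)) holomorphic_on ball 0 1" by (simp add: comp_def)
   show "norm (psi (z / of_real Rm)) < 1" if "norm z < 1" for z
   proof -
    have "z / of_real Rm \<in> ball 0 (1 / Rm)" using sub that by force
    hence "psi (z / of_real Rm) \<in> ball 0 1" using small psib by blast
    thus ?thesis by simp
   qed
   show "psi (0 / of_real Rm) = 0" using psi(2)[of 0] phi0 by simp
   show "norm y < 1" using True R0 by (simp add: y_def norm_mult field_simps)
  qed
  thus ?thesis using R0 psi(2)[OF s] by (simp add: y_def norm_mult)
 next
  case False
  hence "1 <= Rm * norm (phi s)" using Rm by (simp add: field_simps)
  thus ?thesis using s by simp
 qed
 have Pq: "Phi w - q0 = 1 / phi (exp (\<i> * w))" for w by (simp add: Phi_def J_def)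
 have Pnz: "phi (exp (\<i> * w)) ~= 0" if "Im w > 0" for w using nz[OF exp_in(2)[OF that]] .
 have phiP: "phi (exp (\<i> * w)) = 1 / (Phi w - q0)" for w by (simp add: Pq)
 have Phiout: "Phi w \<in> outside Gam" if "Im w > 0" for w
  using im[of "phi (exp (\<i> * w))"] exp_in(1)[OF that] Pnz[OF that] by (auto simp: Phi_def J_def)
 have dM: "d w <= 4 * M0 * exp (Im w)" if w: "Im w > 0" for w
 proof -
  have "exp (- Im w) <= Rm * norm (phi (exp (\<i> * w)))" using sz[of "exp (\<i> * w)"] exp_in(1)[OF w] by simp
  hence "norm (Phi w - q0) <= Rm * exp (Im w)"
   using Pnz[OF w] by (simp add: Pq norm_divide exp_minus field_simps)
  moreover have "d w <= norm (Phi w - q0) + Rm"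
   using d_le[OF qm(1), of w] norm_triangle_ineq4[of "Phi w - q0" "qm - q0"] by (simp add: Rm_def)
  moreover have "Rm * 1 <= Rm * exp (Im w)" using Rm w by (intro mult_left_mono) auto
  moreover have "Rm * exp (Im w) <= 2 * M0 * exp (Im w)" using Rm by (intro mult_right_mono) auto
  ultimately show ?thesis by linarith
 qed
 have dball: "ball (Phi w) (d w) \<subseteq> outside Gam" if w: "Im w > 0" for w
 proof (rule connected_avoiding_frontier_subset[OF connected_ball])
  show "frontier (outside Gam) \<subseteq> Gam" using inside_curve_facts(5)[OF F(2,3)] by simp
  show "ball (Phi w) (d w) \<inter> Gam = {}" using d_le[of _ w] by (force simp: dist_norm)
  show "ball (Phi w) (d w) \<inter> outside Gam ~= {}" using Phiout[OF w] d_pos[OF w] by (metis IntI centre_in_ball empty_iff)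
 qed
 \<comment> \<open>Spread estimate with n = 2 and the centre at infinity: after the inversion all
   distances to \<open>q0\<close> cancel, and only distances between points of the curve
   remain.\<close>
 have half: "\<exists>x\<in>{al..al + pi}. norm (gam x - gam al) >= 1 / 10 ^ 4" for al
 proof -
  define q where "q = gam al"
  have q: "q \<in> Gam" by (simp add: q_def)
  obtain b where b: "b \<in> Gam" "norm (q - b) >= M0" using MM(4)[OF q] by blast
  have ne: "1 / (q - q0) ~= 1 / (b - q0)" using b(2) MM(1) by auto
  have "\<exists>x\<in>{al..al + pi}. norm (phi (cis x) - 1 / (q - q0)) * norm (phi 0 - 1 / (b - q0))
    > (3 / 100 ^ 2) * norm (phi (cis x) - 1 / (b - q0)) * norm (1 / (q - q0) - phi 0)"
   by (rule disc_chart_arc_spread[OF ch]) (use b q ne phiq in auto)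
  then obtain x where x: "x \<in> {al..al + pi}" "norm (1 / (gam x - q0) - 1 / (q - q0)) * norm (1 / (b - q0))
    > (3 / 100 ^ 2) * norm (1 / (gam x - q0) - 1 / (b - q0)) * norm (1 / (q - q0))"
   by (auto simp: bdry0 phi0)
  define X Q B where "X = norm (gam x - q0)" and "Q = norm (q - q0)" and "B = norm (b - q0)"
  have pos: "X > 0" "Q > 0" "B > 0" unfolding X_def Q_def B_def using q0n[OF gam_in] q0n[OF q] q0n[OF b(1)] by auto
  have "norm (gam x - q) / (X * Q) * (1 / B) > (3 / 100 ^ 2) * (norm (gam x - b) / (X * B)) * (1 / Q)"
   using x(2) norm_inverse_diff[OF q0n[OF gam_in[of x]] q0n[OF q]] norm_inverse_diff[OF q0n[OF gam_in[of x]] q0n[OF b(1)]]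
   by (simp add: X_def Q_def B_def norm_divide)
  hence "(3 / 100 ^ 2 * norm (gam x - b)) / (X * Q * B) < norm (gam x - q) / (X * Q * B)" by (simp add: mult_ac)
  hence "3 / 100 ^ 2 * norm (gam x - b) < norm (gam x - q)" using pos unfolding divide_less_cancel by (auto simp: zero_less_mult_iff)
  moreover have "norm (q - b) <= norm (gam x - q) + norm (gam x - b)"
   using norm_triangle_ineq4[of "gam x - b" "gam x - q"] by simp
  ultimately have "norm (gam x - q) >= 1 / 10 ^ 4" using b(2) MM(1) by simp
  thus ?thesis using x(1) by (auto simp: q_def)
 qed
 have dmin: "d w >= 1 / (3 * 10 ^ 6)" if w: "Im w >= 4/10" for w
 proof -
  have w0: "Im w > 0" using w by simp
  obtain q where q: "q \<in> Gam" "d w = norm (Phi w - q)" using nearest by blast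
  obtain b where b: "b \<in> Gam" "norm (q - b) >= M0" using MM(4)[OF q(1)] by blast
  have "norm (exp (\<i> * w)) = exp (- Im w)" by simp
  also have "... <= exp (- (4/10))" using w by simp
  also have "... <= 6704/10000" by (rule exp_minus_two_fifths)
  finally have "norm (phi 0 - phi (exp (\<i> * w))) * norm (1 / (q - q0) - 1 / (b - q0))
    <= 3 * 10 ^ 6 * norm (phi 0 - 1 / (b - q0)) * norm (phi (exp (\<i> * w)) - 1 / (q - q0))"
   by (rule disc_chart_growth_large_at[OF ch _ phiq[OF b(1)] phiq[OF q(1)]])
  moreover define X Q B where "X = norm (Phi w - q0)" and "Q = norm (q - q0)" and "B = norm (b - q0)"
  moreover have P0: "Phi w - q0 ~= 0" using Pnz[OF w0] by (simp add: Pq)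
  ultimately have "1 / X * (norm (q - b) / (Q * B)) <= 3 * 10 ^ 6 * (1 / B) * (d w / (X * Q))"
   using norm_inverse_diff[OF q0n[OF q(1)] q0n[OF b(1)]] norm_inverse_diff[OF P0 q0n[OF q(1)]]
   by (simp add: phiP phi0 norm_divide q(2))
  hence "norm (q - b) / (X * Q * B) <= (3 * 10 ^ 6 * d w) / (X * Q * B)" by (simp add: mult_ac)
  moreover have "X > 0" "Q > 0" "B > 0" unfolding X_def Q_def B_def using P0 q0n[OF q(1)] q0n[OF b(1)] by auto
  ultimately have "norm (q - b) <= 3 * 10 ^ 6 * d w" unfolding divide_le_cancel by (auto simp: zero_less_mult_iff)
  thus ?thesis using b(2) MM(1) by simp
 qed
 \<comment> \<open>With s = exp (i w) and e = 1 / Rm: the growth estimate gives |phi s| <= 109 |s|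
   e, Schwarz-Pick for the inverse chart gives |phi' s| >= 155/1000 e, and |Phi' w| = |s| |phi' s| /
   |phi s|^2.\<close>
 have Dbig: "norm D > 6 / 10 ^ 6 * exp (Im w)" if w: "Im w >= 5" and D: "(Phi has_field_derivative D) (at w)" for w D
 proof -
  have w0: "Im w > 0" using w by simp
  define s where "s = exp (\<i> * w)"
  have s: "s \<in> ball 0 1" "s ~= 0" using exp_in(1)[OF w0] by (auto simp: s_def)
  define u where "u = norm s"
  have u_eq: "u = exp (- Im w)" by (simp add: u_def s_def)
  have "u <= exp (- 5)" using w by (simp add: u_eq)
  hence u: "u <= 1 / 128" "u > 0" using exp_five_le(1) s by (auto simp: u_def)
  define e where "e = 1 / Rm"
  have e: "e > 0" "e <= 2" using Rm by (auto simp: e_def divide_le_eq)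
  define qt where "qt = 1 / (qm - q0)"
  have qt: "qt \<in> phi ` sphere 0 1" "norm qt = e" using phiq[OF qm(1)] by (auto simp: qt_def e_def Rm_def norm_divide)
  \<comment> \<open>Otherwise the inverted curve would lie in the disc of radius e around
    \<open>qt\<close>; the complement of that disc is connected, contains 0 and avoids the curve, so
    the bounded inside would contain an unbounded set.\<close>
  have "\<exists>b\<in>phi ` sphere 0 1. norm (qt - b) >= e"
  proof (rule ccontr)
   assume "\<not> ?thesis"
   hence sub: "phi ` sphere 0 1 \<subseteq> ball qt e" by (auto simp: dist_norm not_le)
   have fr: "frontier (phi ` ball 0 1) \<subseteq> phi ` sphere 0 1" using disc_chart_facts(4)[OF ch] by simp
   have "- ball qt e \<subseteq> phi ` ball 0 1"
   proof (rule connected_avoiding_frontier_subset[OF _ _ fr])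
    show "connected (- ball qt e)" by (rule connected_complement_bounded_convex) auto
    show "- ball qt e \<inter> phi ` sphere 0 1 = {}" using sub by blast
    have "0 \<in> - ball qt e" using qt(2) by (simp add: dist_norm)
    moreover have "0 \<in> phi ` ball 0 1" using phi0 by (metis centre_in_ball imageI zero_less_one)
    ultimately show "- ball qt e \<inter> phi ` ball 0 1 ~= {}" by blast
   qed
   moreover have "bounded (phi ` ball 0 1)" by (rule disc_chart_facts(6)[OF ch])
   ultimately have "bounded (- ball qt e)" using bounded_subset by blast
   thus False using cobounded_imp_unbounded bounded_ball by blast
  qed
  then obtain b where b: "b \<in> phi ` sphere 0 1" "norm (qt - b) >= e" by blast
  define x y where "x = norm (phi s)" and "y = norm (qt - b)"
  have y: "y >= e" "y > 0" using b(2) e by (auto simp: y_def)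
  have x0: "x > 0" using Pnz[OF w0] by (simp add: x_def s_def)
  have gr: "x * y <= 38 * u * norm (phi s - b) * e"
   using disc_chart_growth_small[OF ch b(1) qt(1), of s] u phi0 qt(2) by (simp add: x_def y_def u_def)
  have "norm (phi s - b) <= x + e + y"
  proof -
   have "phi s - b = phi s - qt + (qt - b)" by simp
   thus ?thesis using norm_triangle_ineq[of "phi s - qt" "qt - b"] norm_triangle_ineq4[of "phi s" qt] by (simp add: x_def y_def qt(2))
  qed
  hence "38 * u * norm (phi s - b) * e <= 38 * u * (x + e + y) * e" using u e by (intro mult_right_mono mult_left_mono) auto
  hence gr2: "x * y <= 38 * u * (x + e + y) * e" using gr by linarith
  have ey: "e * e <= e * y" "x * e <= x * y" using y e x0 by (auto intro!: mult_left_mono)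
  \<comment> \<open>Two rounds: u <= 1/128 first gives x < e, and with this the same inequality
    gives a bound of \<open>x\<close> that is linear in \<open>u\<close>.\<close>
  have "38 * u * (x + e + y) * e <= 38 * (1 / 128) * (x + e + y) * e" using u e x0 y by (intro mult_right_mono) auto
  hence "x * y <= 38 / 128 * (x * e + e * e + e * y)" using gr2 by (simp add: algebra_simps)
  hence "(1 - 38 / 128) * (x * y) <= 76 / 128 * (e * y)" using ey by (simp add: field_simps)
  hence "x * y <= (845 / 1000 * e) * y" using e y by (simp add: field_simps)
  hence x1: "x <= 845 / 1000 * e" using y(2) by (rule mult_right_le_imp_le)
  have "38 * u * (x + e + y) * e <= 38 * u * (2845 / 1000 * y) * e" using u e x1 y by (intro mult_right_mono mult_left_mono) auto
  moreover have "38 * u * (2845 / 1000 * y) * e = 38 * 2845 / 1000 * (u * e * y)" "(109 * u * e) * y = 109 * (u * e * y)" by simp_all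
  moreover have "0 < u * e * y" using u e y by simp
  ultimately have "x * y <= (109 * u * e) * y" using gr2 by linarith
  hence x2: "x <= 109 * u * e" using y(2) by (rule mult_right_le_imp_le)
  have bs: "ball (phi s) (e - x) \<subseteq> phi ` ball 0 1"
  proof
   fix z assume "z \<in> ball (phi s) (e - x)"
   hence "norm z < e" using norm_triangle_ineq2[of z "phi s"] by (simp add: x_def dist_norm norm_minus_commute)
   thus "z \<in> phi ` ball 0 1" using small by (auto simp: e_def)
  qed
  have "norm (deriv psi (phi s)) * (e - x) <= 1 - (norm (psi (phi s)))^2"
   by (rule schwarz_pick_ball[OF holomorphic_on_subset[OF psi(1) bs]]) (use bs psib x1 e in auto)
  hence sp: "norm (deriv psi (phi s)) * (e - x) <= 1" using zero_le_power2[of "norm (psi (phi s))"] by linarith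
  have "((%z. psi (phi z)) has_field_derivative deriv psi (phi s) * deriv phi s) (at s)"
   by (rule DERIV_chain2[OF holomorphic_derivI[OF psi(1) disc_chart_open[OF ch]] holomorphic_derivI[OF phic(3) open_ball s(1)]]) (use s in auto)
  moreover have "((%z. psi (phi z)) has_field_derivative 1) (at s)"
   by (rule has_field_derivative_transform_within_open[OF DERIV_ident open_ball s(1)]) (simp add: psi(2))
  ultimately have "deriv psi (phi s) * deriv phi s = 1" by (rule DERIV_unique)
  hence "norm (deriv psi (phi s)) * norm (deriv phi s) = 1" by (metis norm_mult norm_one)
  define p where "p = norm (deriv phi s)"
  have p: "norm (deriv psi (phi s)) * p = 1" "p > 0"
   using \<open>norm (deriv psi (phi s)) * norm (deriv phi s) = 1\<close> by (auto simp: p_def intro!: zero_less_norm_iff[THEN iffD2])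
  have "p * (norm (deriv psi (phi s)) * (e - x)) <= p * 1" using sp p(2) by (intro mult_left_mono) auto
  also have "p * (norm (deriv psi (phi s)) * (e - x)) = (norm (deriv psi (phi s)) * p) * (e - x)" by (simp only: mult_ac)
  finally have "155 / 1000 * e <= p" using x1 p(1) by simp
  obtain D' where D': "(Phi has_field_derivative D') (at w)" "norm D' = exp (- Im w) * ((1 / norm (phi (exp (\<i> * w))))^2 * norm (deriv phi (exp (\<i> * w))))"
   using Phi_deriv[OF w0] by (metis mult.assoc)
  have DD: "norm D * x^2 = u * p" using DERIV_unique[OF D D'(1)] D'(2) x0
   by (simp add: u_eq x_def s_def p_def power_divide)
  have "x^2 <= (109 * u * e)^2" using x2 x0 by (intro power_mono) auto
  hence "norm D * x^2 <= norm D * (109 * u * e)^2" by (intro mult_left_mono) auto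
  moreover have "u * (155 / 1000 * e) <= u * p" using \<open>155 / 1000 * e <= p\<close> u by (intro mult_left_mono) auto
  ultimately have "(155 / 1000) * (u * e) <= (11881 * norm D * u * e) * (u * e)" using DD by (simp add: power2_eq_square mult_ac)
  moreover have "u * e > 0" using u e by simp
  ultimately have "155 / 1000 <= 11881 * norm D * u * e" by (rule mult_right_le_imp_le)
  also have "... <= 11881 * norm D * u * 2" using e u by (intro mult_left_mono) auto
  finally have "6 / 10 ^ 6 < norm D * u" by simp
  hence "6 / 10 ^ 6 * exp (Im w) < norm D * u * exp (Im w)" by (rule mult_strict_right_mono) simp
  thus ?thesis by (simp add: u_eq mult_exp_exp mult.assoc)
 qed
 define H where "H z = J (phi (Psi_inv (1 / cnj z)))" for z
 have R: "1 / cnj z \<in> cball 0 1 - {0}" if "z \<in> - ball 0 1" for z using that by (auto simp: norm_divide divide_le_eq not_less)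
 have Rb: "1 / cnj z \<in> ball 0 1 - {0}" if "z \<in> - cball 0 1" for z using that by (auto simp: norm_divide divide_less_eq)
 have RR: "1 / cnj (1 / cnj z) = z" for z by simp
 have Pnz': "Psi_inv z \<in> cball 0 1 - {0}" if "z \<in> cball 0 1 - {0}" for z
  using Psi_inv_right[of z] that by (auto simp: Psi_def)
 have Hc: "continuous_on (- ball 0 1) H"
 proof -
  have 1: "continuous_on (- ball 0 1) (%z. 1 / cnj z)" by (intro continuous_intros) auto
  have 2: "continuous_on (- ball 0 1) (%z. Psi_inv (1 / cnj z))"
   by (rule continuous_on_compose2[OF Psi_inv_cont 1]) (use R in blast)
  have 3: "continuous_on (- ball 0 1) (%z. phi (Psi_inv (1 / cnj z)))"
   by (rule continuous_on_compose2[OF phic(1) 2]) (use R Pnz' in blast)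
  show ?thesis unfolding H_def J_def
   by (intro continuous_intros 3) (use nz R Pnz' in blast)
 qed
 have Hi: "inj_on H (- ball 0 1)"
 proof (rule inj_onI)
  fix x y assume xy: "x \<in> - ball 0 1" "y \<in> - ball 0 1" "H x = H y"
  have "phi (Psi_inv (1 / cnj x)) = phi (Psi_inv (1 / cnj y))" using xy(3) by (simp add: H_def J_def)
  hence "Psi_inv (1 / cnj x) = Psi_inv (1 / cnj y)"
   using inj_onD[OF phic(2), of "Psi_inv (1 / cnj x)" "Psi_inv (1 / cnj y)"] Pnz'[OF R[OF xy(1)]] Pnz'[OF R[OF xy(2)]] by blast
  hence "1 / cnj x = 1 / cnj y"
   using inj_onD[OF Psi_inv_image(3), of "1 / cnj x" "1 / cnj y"] R[OF xy(1)] R[OF xy(2)] by blast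
  thus "x = y" using RR by metis
 qed
 have Hb: "H ` (- cball 0 1) = outside Gam"
 proof
  show "H ` (- cball 0 1) \<subseteq> outside Gam"
  proof
   fix y assume "y \<in> H ` (- cball 0 1)"
   then obtain z where z: "z \<in> - cball 0 1" "y = H z" by blast
   have "Psi_inv (1 / cnj z) \<in> ball 0 1" using Rb[OF z(1)] Psi_inv_image(2) by blast
   moreover have "phi (Psi_inv (1 / cnj z)) ~= 0" by (intro nz Pnz') (use Rb[OF z(1)] in auto)
   ultimately show "y \<in> outside Gam" using im[of "phi (Psi_inv (1 / cnj z))"] z(2) by (auto simp: H_def J_def)
  qed
  show "outside Gam \<subseteq> H ` (- cball 0 1)"
  proof
   fix y assume y: "y \<in> outside Gam"
   hence yq: "y ~= q0" using q0 inside_Int_outside[of Gam] by blast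
   have "1 / (y - q0) \<in> phi ` ball 0 1" using y im[of "1 / (y - q0)"] by simp
   then obtain s where s: "s \<in> ball 0 1" "phi s = 1 / (y - q0)" by auto
   hence s0: "s ~= 0" using yq phi0 by auto
   obtain z where z: "z \<in> ball 0 1" "s = Psi_inv z" using s(1) Psi_inv_image(2) by blast
   have z0: "z ~= 0" using Psi_inv_left[of 0] s0 z(2) by (auto simp: Psi_def)
   have "H (1 / cnj z) = y" using s(2) by (simp add: H_def J_def z(2) flip: z(2))
   moreover have "1 / cnj z \<in> - cball 0 1" using z(1) z0 by (simp add: norm_divide less_divide_eq)
   ultimately show "y \<in> H ` (- cball 0 1)" by blast
  qed
 qed
 have Hs: "H z = f z" if z: "z \<in> sphere 0 1" for z
 proof -
  have "z \<in> range cis" using z cis_image_UNIV(1) by simp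
  then obtain t where t: "z = cis t" by blast
  obtain x where x: "g x = t" using g_surj by blast
  have "1 / cnj (cis t) = cis t" by (simp add: cis_cnj flip: cis_inverse inverse_eq_divide)
  hence "H z = J (phi (cis x))" unfolding H_def t x[symmetric] by (simp add: Psi_inv_cis)
  thus ?thesis unfolding bdry t x .
 qed
 have pt: "locally_bilip kap H z" if z: "z \<in> - cball 0 1" for z
 proof -
  have z0: "z ~= 0" using z by auto
  have sb: "Psi_inv (1 / cnj z) \<in> ball 0 1" using Psi_inv_image(2) Rb[OF z] by blast
  have s0: "Psi_inv (1 / cnj z) ~= 0" using Pnz'[of "1 / cnj z"] Rb[OF z] by auto
  obtain w where w: "Psi_inv (1 / cnj z) = exp (\<i> * w)" "Im w >= 0" using exp_preimage[of "Psi_inv (1 / cnj z)"] sb s0 by auto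
  have wp: "Im w > 0" using w sb by auto
  have zw: "1 / cnj z = exp (\<i> * Gmap g w)" using Psi_inv_right(1)[of "1 / cnj z"] Rb[OF z] w by (simp flip: Psi_exp[OF g])
  have Zw: "x = cnj (Z (- 1) v)" if "1 / cnj x = exp (\<i> * Gmap g v)" for x v
  proof -
   have "cnj x = exp (- (\<i> * Gmap g v))" using that by (metis exp_minus inverse_eq_divide inverse_inverse_eq)
   hence "cnj x = Z (- 1) v" by (simp add: Z_def)
   thus ?thesis by (metis complex_cnj_cnj)
  qed
  have n: "norm (cnj a - cnj b) = norm (a - b)" for a b by (metis complex_cnj_diff complex_mod_cnj)
  obtain D where D: "(Phi has_field_derivative D) (at w)" using Phi_deriv[OF wp] by metis
  have Dl: "norm D * (2 * sinh (Im w)) >= d w"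
  proof (rule deriv_lower[OF wp D])
   have sub: "(%ze. 1 / (ze - q0)) ` ball (Phi w) (d w) \<subseteq> phi ` ball 0 1"
    using dball[OF wp] im by auto
   have ne: "ze - q0 ~= 0" if "ze \<in> ball (Phi w) (d w)" for ze
    unfolding right_minus_eq using dball[OF wp] that q0 inside_Int_outside[of Gam] by blast
   have "psi \<circ> (%ze. 1 / (ze - q0)) holomorphic_on ball (Phi w) (d w)"
    by (rule holomorphic_on_compose_gen[OF _ psi(1) sub]) (use ne in \<open>auto intro!: holomorphic_intros\<close>)
   thus "(%ze. psi (1 / (ze - q0))) holomorphic_on ball (Phi w) (d w)" by (simp add: comp_def)
   show "(%ze. psi (1 / (ze - q0))) ` ball (Phi w) (d w) \<subseteq> ball 0 1" using sub psib by blast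
   show "psi (1 / (Phi v - q0)) = exp (\<i> * v)" if "Im v > 0" for v
    using psi(2)[of "exp (\<i> * v)"] that by (simp add: phiP[symmetric])
  qed
  have P1: "\<forall>\<^sub>F v in at w. norm (Phi v - Phi w) <= 9 * 10 ^ 27 * kap * norm (Z (- 1) v - Z (- 1) w)"
   by (rule exterior_pointwise(1)[OF F(1) MM(2) wp dM[OF wp] D Dl half]) (rule dmin, assumption, rule Dbig[OF _ D], assumption)
  have P2: "\<forall>\<^sub>F v in at w. norm (Z (- 1) v - Z (- 1) w) <= 9 * 10 ^ 24 * kap * norm (Phi v - Phi w)"
   by (rule exterior_pointwise(2)[OF F(1) MM(2) wp dM[OF wp] D Dl half]) (rule dmin, assumption, rule Dbig[OF _ D], assumption)
  have tr: "\<forall>\<^sub>F z' in at z. \<exists>v. Q v & z' = cnj (Z (- 1) v) & H z' = Phi v" if "\<forall>\<^sub>F v in at w. Q v" for Q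
   using eventually_at_reflection[OF z0 Psi_inv_transfer[OF wp that, folded zw]]
  proof eventually_elim
   case (elim z')
   then obtain v where v: "Q v" "1 / cnj z' = exp (\<i> * Gmap g v)" "Psi_inv (1 / cnj z') = exp (\<i> * v)" by blast
   thus ?case using Zw[OF v(2)] by (intro exI[of _ v]) (simp add: H_def Phi_def)
  qed
  have HZ: "H z = Phi w" "z = cnj (Z (- 1) w)" using w(1) Zw[OF zw] by (simp_all add: H_def Phi_def)
  have nz': "norm (cnj (Z (- 1) v) - z) = norm (Z (- 1) v - Z (- 1) w)" for v unfolding HZ(2) by (rule n)
  have "\<forall>\<^sub>F z' in at z. norm (H z' - H z) <= 9 * 10 ^ 27 * kap * norm (z' - z)"
   using tr[OF P1] by eventually_elim (auto simp: HZ(1) nz')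
  moreover have "\<forall>\<^sub>F z' in at z. norm (z' - z) <= 9 * 10 ^ 24 * kap * norm (H z' - H z)"
   using tr[OF P2] by eventually_elim (auto simp: HZ(1) nz')
  ultimately show ?thesis unfolding locally_bilip_def by blast
 qed
 show ?thesis unfolding side_map_def using Hc Hi Hb Hs pt by (intro exI[of _ H]) blast
qed

section \<open>Gluing\<close>

lemma exterior_side:
 assumes f: "unit_bilip kap f" and q0: "q0 \<in> inside (f ` sphere 0 1)"
 obtains H where "side_map kap f (- ball 0 1) (- cball 0 1) (outside (f ` sphere 0 1)) H"
proof -
 note F = unit_bilip_facts[OF f]
 obtain phi si g where L: "disc_chart phi" "phi 0 = 0"
  "!!x. x \<in> phi ` ball 0 1 \<longleftrightarrow> x = 0 | q0 + 1 / x \<in> outside (f ` sphere 0 1)"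
  "si = 1 | si = - 1" "continuous_on UNIV g" "strict_mono g"
  "!!x. g (x + 2 * pi) = g x + 2 * pi" "!!x. phi (cis x) = 1 / (f (cis (si * g x)) - q0)"
  by (rule exterior_chart[OF F(2,3) q0]) (rule that)
 define f' where "f' = (if si = 1 then f else (%z. f (cnj z)))"
 have f': "unit_bilip kap f'" "f' ` sphere 0 1 = f ` sphere 0 1" using f unit_bilip_cnj[OF f] by (auto simp: f'_def)
 have b: "phi (cis x) = 1 / (f' (cis (g x)) - q0)" for x using L(4,8) by (auto simp: f'_def cis_cnj)
 have q0': "q0 \<in> inside (f' ` sphere 0 1)" using q0 f'(2) by simp
 have im: "x \<in> phi ` ball 0 1 \<longleftrightarrow> x = 0 | q0 + 1 / x \<in> outside (f' ` sphere 0 1)" for x using L(3) f'(2) by simp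
 have f'c: "f' = f | f' = (%z. f (cnj z))" by (auto simp: f'_def)
 obtain H where H: "side_map kap f' (- ball 0 1) (- cball 0 1) (outside (f ` sphere 0 1)) H"
  using exterior_side_core[OF f'(1) q0' L(1,2) im L(5-7) b] unfolding f'(2) by blast
 obtain H' where "side_map kap f (- ball 0 1) (- cball 0 1) (outside (f ` sphere 0 1)) H'"
  by (rule side_map_of_cnj[OF f'c H]) simp_all
 thus ?thesis by (rule that)
qed

text \<open>Continuous induction: the times at which the bound from \<open>a\<close> holds form a
  compact set, and the one-sided local bound moves its last element further unless that is
  \<open>b\<close>.\<close>

lemma pointwise_lipschitz_right:
 fixes g :: "real => 'a::real_normed_vector"
 assumes ab: "a <= b" and c: "continuous_on {a..b} g"
  and lip: "!!t. t \<in> {a..<b} ==> \<forall>\<^sub>F t' in at_right t. norm (g t' - g t) <= M * (t' - t)"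
 shows "norm (g b - g a) <= M * (b - a)"
proof -
 define A where "A = {t \<in> {a..b}. norm (g t - g a) - M * (t - a) \<in> {..0}}"
 have "closed A" unfolding A_def
  by (intro continuous_closed_preimage[unfolded vimage_def Int_def, simplified]) (auto intro!: continuous_intros c)
 hence "compact A" by (rule compact_eq_bounded_closed[THEN iffD2, OF conjI, rotated]) (auto simp: A_def intro: bounded_subset[of "{a..b}"])
 moreover have "a \<in> A" using ab by (simp add: A_def)
 ultimately obtain t where t: "t \<in> A" "!!s. s \<in> A ==> s <= t" using compact_attains_sup[of A] by blast
 have "t = b"
 proof (rule ccontr)
  assume "t ~= b"
  hence tb: "t \<in> {a..<b}" using t(1) by (auto simp: A_def)
  have "\<forall>\<^sub>F s in at_right t. s \<in> {t<..<b}" using tb by (intro eventually_at_right_real) auto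
  hence "\<forall>\<^sub>F s in at_right t. norm (g s - g t) <= M * (s - t) & s \<in> {t<..<b}"
   using lip[OF tb] by eventually_elim auto
  then obtain s where s: "norm (g s - g t) <= M * (s - t)" "t < s" "s < b"
   using eventually_happens[of _ "at_right t"] by (auto simp: trivial_limit_at_right_real)
  have "norm (g s - g a) <= norm (g s - g t) + norm (g t - g a)" using norm_triangle_ineq[of "g s - g t" "g t - g a"] by simp
  also have "... <= M * (s - t) + M * (t - a)" using s(1) t(1) by (auto simp: A_def)
  also have "... = M * (s - a)" by (simp add: algebra_simps)
  finally have "s \<in> A" using s tb by (simp add: A_def)
  thus False using t(2) s(2) by force
 qed
 thus ?thesis using t(1) by (simp add: A_def)
qed

text \<open>The interval is cut at the exceptional points. On each piece the local bound may fail at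
  the left end, which is recovered by continuity.\<close>

lemma pointwise_lipschitz_interval:
 fixes g :: "real => 'a::real_normed_vector"
 assumes "finite S" "a <= b" "continuous_on {a..b} g"
  "!!t. t \<in> {a<..<b} - S ==> \<forall>\<^sub>F t' in at_right t. norm (g t' - g t) <= M * (t' - t)"
 shows "norm (g b - g a) <= M * (b - a)"
 using assms
proof (induction S arbitrary: a b rule: finite_induct)
 case empty
 show ?case
 proof (cases "a = b")
  case False
  hence ab: "a < b" using empty by simp
  have "((%x. norm (g b - g x) - M * (b - x)) \<longlongrightarrow> norm (g b - g a) - M * (b - a)) (at a within {a..b})"
   using empty(2) ab by (intro tendsto_intros) (auto simp: continuous_on_def)
  hence lim: "((%x. norm (g b - g x) - M * (b - x)) \<longlongrightarrow> norm (g b - g a) - M * (b - a)) (at_right a)"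
   using at_within_Icc_at_right[OF ab] by simp
  have "\<forall>\<^sub>F x in at_right a. x \<in> {a<..<b}" using ab by (rule eventually_at_right_real)
  hence "\<forall>\<^sub>F x in at_right a. norm (g b - g x) - M * (b - x) <= 0"
  proof eventually_elim
   case (elim x)
   hence "norm (g b - g x) <= M * (b - x)"
    by (intro pointwise_lipschitz_right empty(3) continuous_on_subset[OF empty(2)]) auto
   thus ?case by simp
  qed
  hence "norm (g b - g a) - M * (b - a) <= 0"
   by (rule tendsto_upperbound[OF lim]) (simp add: trivial_limit_at_right_real)
  thus ?thesis by simp
 qed simp
next
 case (insert s S)
 show ?case
 proof (cases "s \<in> {a<..<b}")
  case True
  have "norm (g s - g a) <= M * (s - a)"
   by (rule insert.IH) (use True insert.prems(3) in \<open>auto intro: continuous_on_subset[OF insert.prems(2)]\<close>)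
  moreover have "norm (g b - g s) <= M * (b - s)"
   by (rule insert.IH) (use True insert.prems(3) in \<open>auto intro: continuous_on_subset[OF insert.prems(2)]\<close>)
  moreover have "norm (g b - g a) <= norm (g b - g s) + norm (g s - g a)" using norm_triangle_ineq[of "g b - g s" "g s - g a"] by simp
  ultimately show ?thesis by (simp add: algebra_simps)
 next
  case False
  thus ?thesis by (intro insert.IH insert.prems) auto
 qed
qed

lemma pointwise_lipschitz_segment:
 fixes G :: "complex => complex"
 assumes c: "continuous_on UNIV G" and st: "s <= t" "M >= 0" and xy: "x ~= y"
  and fin: "finite {r \<in> {s<..<t}. x + of_real r * (y - x) \<in> E}"
  and lip: "!!z. z \<notin> E ==> \<forall>\<^sub>F z' in at z. norm (G z' - G z) <= M * norm (z' - z)"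
 shows "norm (G (x + of_real t * (y - x)) - G (x + of_real s * (y - x))) <= M * norm (y - x) * (t - s)"
proof (rule pointwise_lipschitz_interval[OF fin st(1), where g = "%r. G (x + of_real r * (y - x))"])
 show "continuous_on {s..t} (%r. G (x + of_real r * (y - x)))"
  by (rule continuous_on_compose2[OF c]) (auto intro!: continuous_intros)
 fix r assume "r \<in> {s<..<t} - {r \<in> {s<..<t}. x + of_real r * (y - x) \<in> E}"
 hence r: "x + of_real r * (y - x) \<notin> E" by auto
 have "filterlim (%r. x + of_real r * (y - x)) (at (x + of_real r * (y - x))) (at_right r)"
  by (rule filterlim_atI) (use xy in \<open>auto intro!: tendsto_eq_intros simp: eventually_at_filter\<close>)
 hence "\<forall>\<^sub>F r' in at_right r. norm (G (x + of_real r' * (y - x)) - G (x + of_real r * (y - x)))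
   <= M * norm (x + of_real r' * (y - x) - (x + of_real r * (y - x)))"
  using lip[OF r] unfolding filterlim_iff by blast
 moreover have "\<forall>\<^sub>F r' in at_right r. r' > r" by (simp add: eventually_at_filter)
 ultimately show "\<forall>\<^sub>F r' in at_right r. norm (G (x + of_real r' * (y - x)) - G (x + of_real r * (y - x))) <= M * norm (y - x) * (r' - r)"
 proof eventually_elim
  case (elim r')
  have "x + of_real r' * (y - x) - (x + of_real r * (y - x)) = of_real (r' - r) * (y - x)" by (simp add: algebra_simps)
  hence "norm (x + of_real r' * (y - x) - (x + of_real r * (y - x))) = (r' - r) * norm (y - x)"
   using elim(2) by (simp add: norm_mult del: of_real_diff)
  thus ?case using elim(1) by (simp add: mult_ac)
 qed
qed

lemma finite_line_point:
 fixes x y :: complex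
 assumes "x ~= y"
 shows "finite {r :: real. x + of_real r * (y - x) = p}"
proof -
 have "inj (%r::real. x + of_real r * (y - x))" using assms by (auto intro!: injI)
 from finite_vimageI[OF _ this, of "{p}"] show ?thesis by (simp add: vimage_def)
qed

text \<open>The squared modulus along the line is a quadratic polynomial with leading coefficient |y
  - x|^2 > 0.\<close>

lemma finite_line_circle:
 fixes x y :: complex
 assumes "x ~= y"
 shows "finite {r :: real. x + of_real r * (y - x) \<in> sphere 0 1}"
proof -
 define P where "P = [: (Re x)^2 + (Im x)^2 - 1, 2 * (Re x * Re (y - x) + Im x * Im (y - x)), (norm (y - x))^2 :]"
 have "P ~= 0" using assms by (simp add: P_def)
 hence "finite {r. poly P r = 0}" by (rule poly_roots_finite)
 moreover have "poly P r = (norm (x + of_real r * (y - x)))^2 - 1" for r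
  by (simp add: P_def cmod_power2) (simp add: algebra_simps power2_eq_square)
 hence "{r :: real. x + of_real r * (y - x) \<in> sphere 0 1} \<subseteq> {r. poly P r = 0}" by auto
 ultimately show ?thesis using finite_subset by blast
qed

theorem unit_bilip_extends:
 assumes f: "unit_bilip kap f"
 obtains F where "bij F" "!!z. z \<in> sphere 0 1 ==> F z = f z"
  "!!a b. norm (F a - F b) <= 9 * 10 ^ 27 * kap * norm (a - b)"
  "!!a b. norm (a - b) <= 9 * 10 ^ 24 * kap * norm (F a - F b)"
proof -
 define Gam where "Gam = f ` sphere 0 1"
 note fc = unit_bilip_facts[OF f]
 obtain p where p: "p \<in> inside (f ` sphere 0 1)" "!!q. q \<in> f ` sphere 0 1 ==> norm (p - q) >= 1 / (3 * ((3 + 5 ^ 6) / 2)^2)"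
  by (rule central_point[OF f]) (rule that)
 obtain H where H0: "side_map kap f (cball 0 1) (ball 0 1) (inside (f ` sphere 0 1)) H" "H 0 = p"
  by (rule interior_side[OF f p]) (assumption, rule that)
 obtain E where E0: "side_map kap f (- ball 0 1) (- cball 0 1) (outside (f ` sphere 0 1)) E"
  by (rule exterior_side[OF f p(1)]) (rule that)
 have H: "continuous_on (cball 0 1) H" "inj_on H (cball 0 1)" "H ` ball 0 1 = inside (f ` sphere 0 1)"
  "!!z. z \<in> sphere 0 1 ==> H z = f z" "!!z. z \<in> ball 0 1 - {0} ==> locally_bilip kap H z"
  using H0(1) unfolding side_map_def by blast+
 have E: "continuous_on (- ball 0 1) E" "inj_on E (- ball 0 1)" "E ` (- cball 0 1) = outside (f ` sphere 0 1)"
  "!!z. z \<in> sphere 0 1 ==> E z = f z" "!!z. z \<in> - cball 0 1 - {0} ==> locally_bilip kap E z"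
  using E0 unfolding side_map_def by blast+
 define F where "F z = (if norm z <= 1 then H z else E z)" for z
 have Fi: "F z = H z" if "z \<in> cball 0 1" for z using that by (simp add: F_def)
 have Fe: "F z = E z" if "z \<in> - cball 0 1" for z using that by (simp add: F_def)
 have Fs: "F z = f z" if "z \<in> sphere 0 1" for z using that H(4) by (simp add: F_def)
 have img: "z \<in> ball 0 1 ==> F z \<in> inside Gam" "z \<in> sphere 0 1 ==> F z \<in> Gam" "z \<in> - cball 0 1 ==> F z \<in> outside Gam" for z
 proof -
  show "F z \<in> inside Gam" if "z \<in> ball 0 1"
   using Fi[of z] that H(3) unfolding Gam_def by (metis ball_subset_cball imageI subsetD)
  show "F z \<in> Gam" if "z \<in> sphere 0 1" using Fs[OF that] that by (simp add: Gam_def)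
  show "F z \<in> outside Gam" if "z \<in> - cball 0 1" using Fe[OF that] that E(3) unfolding Gam_def by (metis imageI)
 qed
 have cont: "continuous_on UNIV F"
 proof -
  have "continuous_on (cball 0 1 \<union> - ball 0 1) (%z. if norm z <= 1 then H z else E z)"
   by (rule continuous_on_cases) (use H(1,4) E(1,4) in \<open>auto simp: not_less\<close>)
  moreover have "cball 0 1 \<union> - ball 0 1 = (UNIV :: complex set)" by auto
  ultimately show ?thesis by (simp add: F_def[abs_def])
 qed
 have inj: "inj F"
 proof (rule injI)
  fix x y assume xy: "F x = F y"
  have dis: False if "u \<in> cball 0 1" "v \<in> - cball 0 1" "F u = F v" for u v
  proof -
   have "F u \<in> inside Gam \<union> Gam" using img(1,2)[of u] that(1) by (cases "norm u = 1") auto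
   thus False unfolding that(3) using img(3)[OF that(2)] inside_Int_outside[of Gam] outside_no_overlap[of Gam] by blast
  qed
  consider "x \<in> cball 0 1" "y \<in> cball 0 1" | "x \<in> - cball 0 1" "y \<in> - cball 0 1"
   | "x \<in> cball 0 1" "y \<in> - cball 0 1" | "y \<in> cball 0 1" "x \<in> - cball 0 1" by blast
  thus "x = y"
  proof cases
   case 1 thus ?thesis using xy Fi inj_onD[OF H(2), of x y] by simp
  next
   case 2 thus ?thesis using xy Fe inj_onD[OF E(2), of x y] by auto
  next
   case 3 thus ?thesis using dis xy by blast
  next
   case 4 thus ?thesis using dis xy by metis
  qed
 qed
 have surj: "surj F"
 proof -
  have "y \<in> range F" for y
  proof -
   have "y \<in> inside Gam \<union> outside Gam \<union> Gam" using inside_Un_outside[of Gam] by blast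
   then consider "y \<in> H ` ball 0 1" | "y \<in> E ` (- cball 0 1)" | "y \<in> f ` sphere 0 1"
    unfolding H(3) E(3) Gam_def by blast
   thus ?thesis
   proof cases
    case 1
    then obtain z where "z \<in> ball 0 1" "y = H z" by blast
    thus ?thesis using Fi[of z] by (intro range_eqI[of _ F z]) simp
   next
    case 2
    then obtain z where "z \<in> - cball 0 1" "y = E z" by blast
    thus ?thesis using Fe[of z] by (intro range_eqI[of _ F z]) simp
   next
    case 3
    then obtain z where "z \<in> sphere 0 1" "y = f z" by blast
    thus ?thesis using Fs[of z] by (intro range_eqI[of _ F z]) simp
   qed
  qed
  thus ?thesis by blast
 qed
 have bij: "bij F" using inj surj by (rule bijI)
 \<comment> \<open>Exceptional set of the local bounds; every line meets it in finitely many
   points.\<close>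
 define S where "S = insert 0 (sphere (0::complex) 1)"
 have loc: "locally_bilip kap F z" if "\<forall>\<^sub>F z' in at z. F z' = X z'" "F z = X z" "locally_bilip kap X z" for X z
  unfolding locally_bilip_def that(2)
 proof
  show "\<forall>\<^sub>F z' in at z. norm (F z' - X z) <= 9 * 10 ^ 27 * kap * norm (z' - z)"
   using that(1) conjunct1[OF that(3)[unfolded locally_bilip_def]] by eventually_elim (simp only:)
  show "\<forall>\<^sub>F z' in at z. norm (z' - z) <= 9 * 10 ^ 24 * kap * norm (F z' - X z)"
   using that(1) conjunct2[OF that(3)[unfolded locally_bilip_def]] by eventually_elim (simp only:)
 qed
 have pt: "locally_bilip kap F z" if z: "z \<notin> S" for z
 proof (cases "norm z < 1")
  case True
  hence z: "z \<in> ball 0 1 - {0}" using z by (auto simp: S_def)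
  hence "\<forall>\<^sub>F z' in at z. z' \<in> ball 0 1" by (intro eventually_at_in_open') auto
  hence "\<forall>\<^sub>F z' in at z. F z' = H z'" by eventually_elim (auto intro: Fi)
  thus ?thesis by (rule loc) (use z Fi H(5) in auto)
 next
  case False
  hence z: "z \<in> - cball 0 1 - {0}" using z by (auto simp: S_def)
  hence "\<forall>\<^sub>F z' in at z. z' \<in> - cball 0 1" by (intro eventually_at_in_open') auto
  hence "\<forall>\<^sub>F z' in at z. F z' = E z'" by eventually_elim (auto intro: Fe)
  thus ?thesis by (rule loc) (use z Fe E(5) in auto)
 qed
 have k0: "kap >= 1" by (rule fc(1))
 have up: "norm (F b - F a) <= 9 * 10 ^ 27 * kap * norm (b - a)" for a b
 proof (cases "a = b")
  case False
  have "{r::real. a + of_real r * (b - a) \<in> S} = {r. a + of_real r * (b - a) = 0} \<union> {r. a + of_real r * (b - a) \<in> sphere 0 1}"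
   by (auto simp: S_def)
  hence "finite {r::real. a + of_real r * (b - a) \<in> S}"
   using finite_line_point[OF False] finite_line_circle[OF False] by simp
  hence "finite {r \<in> {0<..<1::real}. a + of_real r * (b - a) \<in> S}" by (rule rev_finite_subset) blast
  from pointwise_lipschitz_segment[OF cont _ _ False this, of "9 * 10 ^ 27 * kap"] show ?thesis using k0 pt unfolding locally_bilip_def by simp
 qed simp
 define K where "K = inv F"
 have KF: "K (F z) = z" and FK: "F (K y) = y" for z y
  using inj surj by (auto simp: K_def surj_f_inv_f)
 have Kc: "continuous_on UNIV K"
 proof -
  obtain G where G: "homeomorphism UNIV (range F) F G"
   using invariance_of_domain_homeomorphism[OF open_UNIV cont] inj by auto
  have "G = K" by (rule ext) (metis FK G UNIV_I homeomorphism_apply1)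
  thus ?thesis using homeomorphism_cont2[OF G] surj by simp
 qed
 have Kpt: "\<forall>\<^sub>F y' in at y. norm (K y' - K y) <= 9 * 10 ^ 24 * kap * norm (y' - y)" if y: "y \<notin> insert p Gam" for y
 proof -
  have "K y \<notin> S"
  proof
   assume "K y \<in> S"
   hence "y = p | y \<in> Gam" using img(2)[of "K y"] FK[of y] Fi[of 0] H0(2) by (auto simp: S_def)
   thus False using y by blast
  qed
  have "filterlim K (at (K y)) (at y)"
  proof (rule filterlim_atI)
   show "(K \<longlongrightarrow> K y) (at y)" using Kc by (simp add: continuous_on_def)
   show "\<forall>\<^sub>F x in at y. K x ~= K y" unfolding eventually_at_filter
    by (intro always_eventually allI impI notI) (metis FK)
  qed
  hence "\<forall>\<^sub>F y' in at y. norm (K y' - K y) <= 9 * 10 ^ 24 * kap * norm (F (K y') - F (K y))"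
   using pt[OF \<open>K y \<notin> S\<close>] unfolding locally_bilip_def filterlim_iff by blast
  thus ?thesis by (simp add: FK)
 qed
 define M where "M = 9 * 10 ^ 24 * kap"
 have M1: "M >= 1" using k0 by (simp add: M_def)
 \<comment> \<open>Unlike the circle, the curve may meet a line in infinitely many points, so
   \<open>pointwise_lipschitz_segment\<close> covers only the parts before the first and after the
   last meeting point. Between these two points of the curve the lower bound for \<open>f\<close>
   gives Lipschitz constant 1 <= M.\<close>
 have low: "norm (K y - K x) <= M * norm (y - x)" for x y
 proof (cases "x = y")
  case False
  define l where "l r = x + of_real r * (y - x)" for r :: real
  have piece: "norm (K (l t) - K (l s)) <= M * norm (y - x) * (t - s)" if "s <= t" "!!r. r \<in> {s<..<t} ==> l r \<notin> Gam" for s t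
   unfolding l_def
  proof (rule pointwise_lipschitz_segment[OF Kc that(1) _ False])
   have "{r \<in> {s<..<t}. x + of_real r * (y - x) \<in> insert p Gam} \<subseteq> {r. x + of_real r * (y - x) = p}"
    using that(2) by (auto simp: l_def)
   thus "finite {r \<in> {s<..<t}. x + of_real r * (y - x) \<in> insert p Gam}"
    using finite_line_point[OF False] by (rule finite_subset)
  qed (use M1 Kpt in \<open>auto simp: M_def\<close>)
  have l01: "l 0 = x" "l 1 = y" by (simp_all add: l_def)
  define A where "A = {0..1} \<inter> l -` Gam"
  have "compact Gam" unfolding Gam_def by (intro compact_continuous_image fc compact_sphere)
  hence "closed A" unfolding A_def l_def
   by (intro continuous_closed_preimage closed_atLeastAtMost) (auto intro!: continuous_intros compact_imp_closed)
  hence "compact A" using bounded_subset[of "{0..1::real}" A] by (auto simp: A_def compact_eq_bounded_closed)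
  have A_iff: "r \<in> A \<longleftrightarrow> 0 <= r & r <= 1 & l r \<in> Gam" for r by (auto simp: A_def)
  show ?thesis
  proof (cases "A = {}")
   case True
   hence "l r \<notin> Gam" if "r \<in> {0<..<1}" for r using that A_iff[of r] by simp
   from piece[OF zero_le_one this] show ?thesis by (simp add: l01)
  next
   case False
   obtain s where s: "s \<in> A" "!!r. r \<in> A ==> s <= r" using compact_attains_inf[OF \<open>compact A\<close> False] by blast
   obtain t where t: "t \<in> A" "!!r. r \<in> A ==> r <= t" using compact_attains_sup[OF \<open>compact A\<close> False] by blast
   have st: "0 <= s" "s <= t" "t <= 1" "l s \<in> Gam" "l t \<in> Gam" using s t by (auto simp: A_def)
   have 1: "norm (K (l s) - K (l 0)) <= M * norm (y - x) * (s - 0)"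
   proof (rule piece[OF st(1)])
    fix r assume "r \<in> {0<..<s}"
    thus "l r \<notin> Gam" using s(2)[of r] st by (auto simp: A_def)
   qed
   have 3: "norm (K (l 1) - K (l t)) <= M * norm (y - x) * (1 - t)"
   proof (rule piece[OF st(3)])
    fix r assume "r \<in> {t<..<1}"
    thus "l r \<notin> Gam" using t(2)[of r] st by (auto simp: A_def)
   qed
   obtain u v where uv: "u \<in> sphere 0 1" "l s = f u" "v \<in> sphere 0 1" "l t = f v" using st by (auto simp: Gam_def)
   have "norm (K (l t) - K (l s)) = norm (v - u)" using KF[of u] KF[of v] Fs uv by simp
   also have "... <= norm (l t - l s)" using f uv unfolding unit_bilip_def by simp
   also have "l t - l s = of_real (t - s) * (y - x)" by (simp add: l_def algebra_simps)
   also have "norm (of_real (t - s) * (y - x)) = (t - s) * norm (y - x)" using st by (simp add: norm_mult del: of_real_diff)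
   also have "... <= M * ((t - s) * norm (y - x))" using mult_right_mono[OF M1, of "(t - s) * norm (y - x)"] st by simp
   finally have 2: "norm (K (l t) - K (l s)) <= M * norm (y - x) * (t - s)" by (simp only: mult_ac)
   have "K y - K x = (K (l 1) - K (l t)) + (K (l t) - K (l s)) + (K (l s) - K (l 0))" by (simp add: l01)
   hence "norm (K y - K x) <= norm (K (l 1) - K (l t)) + norm (K (l t) - K (l s)) + norm (K (l s) - K (l 0))"
    by (metis norm_triangle_ineq norm_triangle_mono order_refl)
   also have "... <= M * norm (y - x) * (1 - t) + M * norm (y - x) * (t - s) + M * norm (y - x) * (s - 0)"
    using 1 2 3 by linarith
   also have "... = M * norm (y - x)" by (simp add: algebra_simps)
   finally show ?thesis .
  qed
 qed simp
 have "norm (a - b) <= 9 * 10 ^ 24 * kap * norm (F a - F b)" for a b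
  using low[of "F a" "F b"] by (simp add: KF M_def)
 thus ?thesis using that[of F] bij Fs up by blast
qed

theorem theorem1p1:
  fixes L l :: real and f :: "complex \<Rightarrow> complex"
  assumes "L > 0" and "l > 0"
    and "bilipschitz_embedding L l (sphere 0 1) f"
  shows "\<exists>F :: complex \<Rightarrow> complex.
           bilipschitz_automorphism (10 ^ 28 * L) (l\<^sup>2 / (10 ^ 25 * L)) F \<and>
           (\<forall>z\<in>sphere 0 1. F z = f z)"
proof -
 define f0 where "f0 z = f z / of_real l" for z
 have s: "norm (x / of_real l - y / of_real l) = norm (x - y) / l" for x y :: complex
  using assms(2) by (simp add: norm_divide flip: diff_divide_distrib)
 have "unit_bilip (L / l) f0"
  unfolding unit_bilip_def f0_def s
  using assms by (auto simp: bilipschitz_embedding_def field_simps)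
 then obtain F where F: "bij F" "!!z. z \<in> sphere 0 1 ==> F z = f0 z"
  "!!a b. norm (F a - F b) <= 9 * 10 ^ 27 * (L / l) * norm (a - b)"
  "!!a b. norm (a - b) <= 9 * 10 ^ 24 * (L / l) * norm (F a - F b)"
  by (rule unit_bilip_extends) (rule that)
 define G where "G z = of_real l * F z" for z
 have n: "norm (G a - G b) = l * norm (F a - F b)" for a b
  using assms(2) by (simp add: G_def norm_mult flip: right_diff_distrib)
 have b: "bij G"
 proof -
  have "bij (%z::complex. of_real l * z)"
   by (rule bij_betw_byWitness[of _ "%z. z / of_real l"]) (use assms(2) in auto)
  from bij_comp[OF F(1) this] show ?thesis by (simp add: G_def[abs_def] comp_def)
 qed
 have up: "norm (G a - G b) <= 10 ^ 28 * L * norm (a - b)" for a b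
 proof -
  have "l * norm (F a - F b) <= l * (9 * 10 ^ 27 * (L / l) * norm (a - b))"
   using F(3) assms(2) by (intro mult_left_mono) auto
  also have "... = 9 * 10 ^ 27 * (L * norm (a - b))" using assms(2) by simp
  also have "... <= 10 ^ 28 * (L * norm (a - b))" using assms(1) by (intro mult_right_mono) auto
  finally show ?thesis by (simp add: n)
 qed
 \<comment> \<open>The quotient l^2 / L arises as l / \<open>kap\<close> with \<open>kap\<close> = L
   / l: the factor l from scaling back and 1 / \<open>kap\<close> from the normalised inverse
   bound.\<close>
 have low: "l^2 / (10 ^ 25 * L) * norm (a - b) <= norm (G a - G b)" for a b
 proof -
  have "l^2 / (10 ^ 25 * L) * norm (a - b) <= l^2 / (10 ^ 25 * L) * (9 * 10 ^ 24 * (L / l) * norm (F a - F b))"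
   using F(4) assms(1) by (intro mult_left_mono) auto
  also have "... = 9 / 10 * (l * norm (F a - F b))" using assms(1,2) by (simp add: power2_eq_square)
  also have "... <= 1 * (l * norm (F a - F b))" using assms(2) by (intro mult_right_mono) auto
  finally show ?thesis by (simp add: n)
 qed
 have "bilipschitz_automorphism (10 ^ 28 * L) (l^2 / (10 ^ 25 * L)) G"
  using assms(1,2) b up low by (simp add: bilipschitz_automorphism_def bilipschitz_embedding_def)
 moreover have "\<forall>z\<in>sphere 0 1. G z = f z" using F(2) assms(2) by (simp add: G_def f0_def)
 ultimately show ?thesis by blast
qed

end
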